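(* Fix an integer $c\ge 2$. Let $\mathcal{E}$ be a 1-type uniform Steiner vector bundle on $\mathbb{P}^2$ of rank $r$, with no trivial summands (i.e. $\mathcal{O}_{\mathbb{P}^2}$ is not a direct summand of $\mathcal{E}$), defined by an exact sequence $$0 \rightarrow \mathcal{E} \rightarrow \mathcal{O}_{\mathbb{P}^2}^{r+c} \rightarrow \mathcal{O}_{\mathbb{P}^2}(1)^c \rightarrow 0.$$ Then $c+2\leq r \leq 2c$. Moreover, these bounds are sharp, and for every integer $r\in[c+2,2c]$ there exists a 1-type uniform Steiner vector bundle $\mathcal{E}$ on $\mathbb{P}^2$ with $c_1(\mathcal{E})=-c$ and $\operatorname{rk}(\mathcal{E})=r$.
   Context: The base field $\mathbb{K}$ is algebraically closed of characteristic $0$. A vector bundle $\mathcal{E}$ on $\mathbb{P}^n$ is a Steiner bundle if it is the kernel in a short exact sequence $0\to\mathcal{E}\to\mathcal{O}_{\mathbb{P}^n}^{x}\to\mathcal{O}_{\mathbb{P}^n}(1)^{c}\to 0$; then $c_1(\mathcal{E})=-c$ and $\operatorname{rk}\mathcal{E}=x-c$. A rank $r$ vector bundle $\mathcal{E}$ on $\mathbb{P}^n$ is uniform if its splitting type (the integers $a_1\le\dots\le a_r$ with $\mathcal{E}|_L\cong\bigoplus_{i=1}^r\mathcal{O}_L(a_i)$) is the same for every line $L\subset\mathbb{P}^n$. For an integer $k\ge1$, a uniform Steiner bundle is called $k$-type uniform if for every line $L$ one has $\mathcal{E}|_L\cong\bigoplus_{i=0}^{k}\mathcal{O}_L(-i)^{a_i}$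 with $a_i\ge 0$ independent of $L$ and $a_k>0$. *)

theory Defs
  imports "HOL-Analysis.Analysis" "HOL-Library.Function_Algebras"
    "HOL-Computational_Algebra.Polynomial"
begin

section \<open>Projective space as a classical variety\<close>

text \<open>
  Everything is done with classical varieties: over an algebraically closed field,
  projective space is its set of closed points with the Zariski topology and the sheaf of
  regular functions. The projective space of dimension \<open>n\<close> is the set of
  one-dimensional subspaces of \<open>'k ^ 'n\<close> with \<open>CARD('n) = n + 1\<close>; thus the plane is
  obtained from \<open>'k ^ 3\<close>. A point is the corresponding set of vectors.
\<close>

definition proj_space :: "('k::field ^ 'n::finite) set set" where
  "proj_space = {vec.span {v} | v. v \<noteq> 0}"

definition proj_lines :: "('k::field ^ 'n::finite) set set set" where
  "proj_lines = {{p \<in> proj_space. p \<subseteq> W} | W. vec.subspace W \<and> vec.dim W = 2}"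

text \<open>Polynomials are represented by polynomial functions, which loses nothing over an infinite field.\<close>

definition homogeneous :: "nat \<Rightarrow> ('k::field ^ 'n::finite \<Rightarrow> 'k) \<Rightarrow> bool" where
  "homogeneous d g \<longleftrightarrow>
     (\<exists>a. g = (\<lambda>v. \<Sum>e | (\<Sum>i\<in>UNIV. e i) = d. a e * (\<Prod>i\<in>UNIV. (v $ i) ^ e i)))"

definition basic_open :: "('k::field ^ 'n::finite \<Rightarrow> 'k) \<Rightarrow> ('k ^ 'n) set set" where
  "basic_open h = {p \<in> proj_space. \<forall>v\<in>p - {0}. h v \<noteq> 0}"

definition zariski_open_in :: "('k::field ^ 'n::finite) set set \<Rightarrow> ('k ^ 'n) set set \<Rightarrow> bool" where
  "zariski_open_in B U \<longleftrightarrow>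
     (\<exists>H. (\<forall>h\<in>H. \<exists>d. homogeneous d h) \<and> U = B \<inter> (\<Union>h\<in>H. basic_open h))"

text \<open>
  Regular functions on a locally closed set \<open>V\<close>: locally (for the topology induced on \<open>V\<close>)
  quotients of homogeneous polynomials of equal degree.
\<close>

definition regular_on :: "('k::field ^ 'n::finite) set set \<Rightarrow> (('k ^ 'n) set \<Rightarrow> 'k) \<Rightarrow> bool" where
  "regular_on V f \<longleftrightarrow>
     (\<forall>p\<in>V. \<exists>d g h. homogeneous d g \<and> homogeneous d h \<and> p \<in> basic_open h \<and>
        (\<forall>q\<in>V \<inter> basic_open h. \<forall>v\<in>q - {0}. f q = g v / h v))"


section \<open>Vector bundles\<close>

text \<open>Fibres are subspaces of the space \<open>'i \<Rightarrow> 'k\<close> of all functions on an index type.\<close>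

definition fscale :: "'k::field \<Rightarrow> ('i \<Rightarrow> 'k) \<Rightarrow> 'i \<Rightarrow> 'k" where
  "fscale a f = (\<lambda>i. a * f i)"

interpretation fvec: vector_space "fscale :: 'k::field \<Rightarrow> ('i \<Rightarrow> 'k) \<Rightarrow> 'i \<Rightarrow> 'k"
  by unfold_locales (auto simp: fscale_def algebra_simps fun_eq_iff)

definition is_basis :: "('i \<Rightarrow> 'k::field) set \<Rightarrow> ('i \<Rightarrow> 'k) list \<Rightarrow> bool" where
  "is_basis V bs \<longleftrightarrow> distinct bs \<and> fvec.independent (set bs) \<and> fvec.span (set bs) = V"

text \<open>
  A vector bundle consists of a base, a fibre over each point, and an atlas of local frames
  \<open>(U, [s\<^sub>1, \<dots>, s\<^sub>r])\<close>; a frame is the same as a local trivialisation over \<open>U\<close>. The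
  values of \<open>fibre\<close> and of the sections outside their domains carry no information.
\<close>

record ('k, 'n, 'i) vbundle =
  base :: "('k ^ 'n) set set"
  fibre :: "('k ^ 'n) set \<Rightarrow> ('i \<Rightarrow> 'k) set"
  frames :: "(('k ^ 'n) set set \<times> (('k ^ 'n) set \<Rightarrow> 'i \<Rightarrow> 'k) list) set"

definition regular_section ::
  "('k::field, 'n::finite, 'i) vbundle \<Rightarrow> ('k ^ 'n) set set \<Rightarrow> (('k ^ 'n) set \<Rightarrow> 'i \<Rightarrow> 'k) \<Rightarrow> bool" where
  "regular_section E V s \<longleftrightarrow>
     (\<forall>p\<in>V. s p \<in> fibre E p) \<and>
     (\<forall>(U, fs)\<in>frames E. \<exists>a.
        (\<forall>j<length fs. regular_on (U \<inter> V) (a j)) \<and>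
        (\<forall>p\<in>U \<inter> V. s p = (\<Sum>j<length fs. fscale (a j p) ((fs ! j) p))))"

text \<open>The last condition says that the transition matrices of the atlas are regular.\<close>

definition vector_bundle :: "nat \<Rightarrow> ('k::field, 'n::finite, 'i) vbundle \<Rightarrow> bool" where
  "vector_bundle r E \<longleftrightarrow>
     base E \<subseteq> proj_space \<and>
     (\<forall>(U, fs)\<in>frames E. zariski_open_in (base E) U \<and> length fs = r \<and>
        (\<forall>p\<in>U. is_basis (fibre E p) (map (\<lambda>s. s p) fs))) \<and>
     (\<Union>(U, fs)\<in>frames E. U) = base E \<and>
     (\<forall>(U, fs)\<in>frames E. \<forall>s\<in>set fs. regular_section E U s)"

definition bundle_hom ::
  "('k::field, 'n::finite, 'i) vbundle \<Rightarrow> ('k, 'n, 'j) vbundle \<Rightarrow>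
     (('k ^ 'n) set \<Rightarrow> ('i \<Rightarrow> 'k) \<Rightarrow> 'j \<Rightarrow> 'k) \<Rightarrow> bool" where
  "bundle_hom E F \<phi> \<longleftrightarrow>
     base E = base F \<and>
     (\<forall>p\<in>base E. \<phi> p ` fibre E p \<subseteq> fibre F p \<and>
        (\<forall>x\<in>fibre E p. \<forall>y\<in>fibre E p. \<phi> p (x + y) = \<phi> p x + \<phi> p y) \<and>
        (\<forall>x\<in>fibre E p. \<forall>a. \<phi> p (fscale a x) = fscale a (\<phi> p x))) \<and>
     (\<forall>(U, fs)\<in>frames E. \<forall>s\<in>set fs. regular_section F U (\<lambda>p. \<phi> p (s p)))"

definition bundle_iso ::
  "('k::field, 'n::finite, 'i) vbundle \<Rightarrow> ('k, 'n, 'j) vbundle \<Rightarrow> bool" where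
  "bundle_iso E F \<longleftrightarrow>
     (\<exists>\<phi> \<psi>. bundle_hom E F \<phi> \<and> bundle_hom F E \<psi> \<and>
        (\<forall>p\<in>base E. (\<forall>x\<in>fibre E p. \<psi> p (\<phi> p x) = x) \<and> (\<forall>y\<in>fibre F p. \<phi> p (\<psi> p y) = y)))"

text \<open>
  For vector bundles, exactness of \<open>0 \<rightarrow> E \<rightarrow> F \<rightarrow> G \<rightarrow> 0\<close> as a sequence of sheaves
  is the same as exactness on all fibres.
\<close>

definition short_exact ::
  "('k::field, 'n::finite, 'i) vbundle \<Rightarrow> ('k, 'n, 'j) vbundle \<Rightarrow> ('k, 'n, 'l) vbundle \<Rightarrow>
     (('k ^ 'n) set \<Rightarrow> ('i \<Rightarrow> 'k) \<Rightarrow> 'j \<Rightarrow> 'k) \<Rightarrow> (('k ^ 'n) set \<Rightarrow> ('j \<Rightarrow> 'k) \<Rightarrow> 'l \<Rightarrow> 'k) \<Rightarrow> bool" where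
  "short_exact E F G \<phi> \<psi> \<longleftrightarrow>
     bundle_hom E F \<phi> \<and> bundle_hom F G \<psi> \<and>
     (\<forall>p\<in>base E. inj_on (\<phi> p) (fibre E p) \<and>
        \<phi> p ` fibre E p = {y \<in> fibre F p. \<psi> p y = 0} \<and>
        \<psi> p ` fibre F p = fibre G p)"

definition restrict_bundle ::
  "('k::field, 'n::finite, 'i) vbundle \<Rightarrow> ('k ^ 'n) set set \<Rightarrow> ('k, 'n, 'i) vbundle" where
  "restrict_bundle E L =
     \<lparr>base = base E \<inter> L, fibre = fibre E, frames = (\<lambda>(U, fs). (U \<inter> L, fs)) ` frames E\<rparr>"

definition direct_sum ::
  "('k::field, 'n::finite, 'i) vbundle \<Rightarrow> ('k, 'n, 'j) vbundle \<Rightarrow> ('k, 'n, 'i + 'j) vbundle" where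
  "direct_sum E F =
     \<lparr>base = base E \<inter> base F,
      fibre = (\<lambda>p. {f. f \<circ> Inl \<in> fibre E p \<and> f \<circ> Inr \<in> fibre F p}),
      frames = {(U \<inter> V, map (\<lambda>s p. case_sum (s p) (\<lambda>_. 0)) fs @ map (\<lambda>s p. case_sum (\<lambda>_. 0) (s p)) gs)
                | U V fs gs. (U, fs) \<in> frames E \<and> (V, gs) \<in> frames F}\<rparr>"

text \<open>The base is an argument because the list may be empty (zero bundle).\<close>

definition direct_sum_list ::
  "('k::field ^ 'n::finite) set set \<Rightarrow> ('k, 'n, 'i) vbundle list \<Rightarrow> ('k, 'n, nat \<times> 'i) vbundle" where
  "direct_sum_list B Es =
     \<lparr>base = B,
      fibre = (\<lambda>p. {f. (\<forall>j<length Es. (\<lambda>i. f (j, i)) \<in> fibre (Es ! j) p) \<and>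
                       (\<forall>j\<ge>length Es. \<forall>i. f (j, i) = 0)}),
      frames = {(B \<inter> (\<Inter>j<length Es. fst (t j)),
                 concat (map (\<lambda>j. map (\<lambda>s p (j', i). if j' = j then s p i else 0) (snd (t j)))
                             [0..<length Es]))
                | t. \<forall>j<length Es. t j \<in> frames (Es ! j)}\<rparr>"

text \<open>
  The line bundle \<open>\<O>(d)\<close>: its fibre at \<open>p\<close> consists of the functions on \<open>p - {0}\<close> that are
  homogeneous of degree \<open>d\<close> (extended by zero to all vectors), so that \<open>\<O>(-1)\<close> is the
  tautological line bundle, and homogeneous polynomials of degree \<open>d\<close> are
  global sections of \<open>\<O>(d)\<close>. Frames are the \<open>d\<close>-th powers of the coordinates.
\<close>

definition twist :: "int \<Rightarrow> ('k::field, 'n::finite, 'k ^ 'n) vbundle" where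
  "twist d =
     \<lparr>base = proj_space,
      fibre = (\<lambda>p. {f. (\<forall>v. v \<notin> p - {0} \<longrightarrow> f v = 0) \<and>
                       (\<forall>v\<in>p - {0}. \<forall>a. a \<noteq> 0 \<longrightarrow> f (a *s v) = a powi d * f v)}),
      frames = range (\<lambda>i. (basic_open (\<lambda>v. v $ i),
                           [\<lambda>p v. if v \<in> p - {0} then (v $ i) powi d else 0]))\<rparr>"

definition has_trivial_summand :: "('k::field, 'n::finite, 'i) vbundle \<Rightarrow> bool" where
  "has_trivial_summand E \<longleftrightarrow>
     (\<exists>(F :: ('k, 'n, 'i) vbundle) r.
        vector_bundle r F \<and> base F = proj_space \<and> bundle_iso E (direct_sum (twist 0) F))"

text \<open>
  Taking the fibres of \<open>F\<close> in the same function space as those of \<open>E\<close> loses nothing, since a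
  direct summand of \<open>E\<close> is isomorphic to a subbundle of \<open>E\<close>.
\<close>


section \<open>First Chern class\<close>

definition alternating_on :: "nat \<Rightarrow> ('i \<Rightarrow> 'k::field) set \<Rightarrow> (('i \<Rightarrow> 'k) list \<Rightarrow> 'j \<Rightarrow> 'k) \<Rightarrow> bool" where
  "alternating_on r V \<omega> \<longleftrightarrow>
     (\<forall>xs. length xs = r \<and> set xs \<subseteq> V \<longrightarrow>
        (\<forall>j<r. \<forall>y\<in>V. \<omega> (xs[j := xs ! j + y]) = \<omega> xs + \<omega> (xs[j := y])) \<and>
        (\<forall>j<r. \<forall>a. \<omega> (xs[j := fscale a (xs ! j)]) = fscale a (\<omega> xs)) \<and>
        (\<forall>i j. i < j \<and> j < r \<and> xs ! i = xs ! j \<longrightarrow> \<omega> xs = 0))"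

text \<open>
  On projective space, \<open>c\<^sub>1(E) = d\<close> means that \<open>det E = \<Lambda>\<^sup>r E\<close> is isomorphic to \<open>\<O>(d)\<close>.
  By the universal property of the exterior power such an isomorphism is a regular family of
  alternating \<open>r\<close>-linear maps \<open>\<omega>\<close> to the fibres of \<open>\<O>(d)\<close> which do not vanish on frames.
\<close>

definition has_c1 :: "('k::field, 'n::finite, 'i) vbundle \<Rightarrow> int \<Rightarrow> bool" where
  "has_c1 E d \<longleftrightarrow>
     (\<exists>r \<omega>. vector_bundle r E \<and> base E = proj_space \<and>
        (\<forall>p\<in>proj_space. alternating_on r (fibre E p) (\<omega> p)) \<and>
        (\<forall>(U, fs)\<in>frames E.
           regular_section (twist d) U (\<lambda>p. \<omega> p (map (\<lambda>s. s p) fs)) \<and>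
           (\<forall>p\<in>U. \<omega> p (map (\<lambda>s. s p) fs) \<noteq> 0)))"


section \<open>Steiner bundles and uniformity\<close>

definition steiner_sequence :: "nat \<Rightarrow> nat \<Rightarrow> ('k::field, 'n::finite, 'i) vbundle \<Rightarrow> bool" where
  "steiner_sequence x c E \<longleftrightarrow>
     (\<exists>\<phi> \<psi>. short_exact E (direct_sum_list proj_space (replicate x (twist 0)))
                          (direct_sum_list proj_space (replicate c (twist 1))) \<phi> \<psi>)"

definition steiner_bundle :: "('k::field, 'n::finite, 'i) vbundle \<Rightarrow> bool" where
  "steiner_bundle E \<longleftrightarrow> (\<exists>r. vector_bundle r E) \<and> (\<exists>x c. steiner_sequence x c E)"

definition splits_on ::
  "('k::field, 'n::finite, 'i) vbundle \<Rightarrow> ('k ^ 'n) set set \<Rightarrow> int list \<Rightarrow> bool" where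
  "splits_on E L as \<longleftrightarrow>
     bundle_iso (restrict_bundle E L) (direct_sum_list L (map (\<lambda>a. restrict_bundle (twist a) L) as))"

text \<open>The splitting type is a multiset, so the order of the list is irrelevant.\<close>

definition uniform :: "('k::field, 'n::finite, 'i) vbundle \<Rightarrow> bool" where
  "uniform E \<longleftrightarrow> (\<exists>r. vector_bundle r E) \<and> base E = proj_space \<and>
     (\<exists>as. \<forall>L\<in>proj_lines. splits_on E L as)"

definition type_uniform_steiner :: "nat \<Rightarrow> ('k::field, 'n::finite, 'i) vbundle \<Rightarrow> bool" where
  "type_uniform_steiner k E \<longleftrightarrow>
     k \<ge> 1 \<and> steiner_bundle E \<and> uniform E \<and>
     (\<exists>a :: nat \<Rightarrow> nat. a k > 0 \<and>
        (\<forall>L\<in>proj_lines.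
           splits_on E L (concat (map (\<lambda>i. replicate (a i) (- int i)) [0..<Suc k]))))"

end

(* E is the kernel of a linear family of matrices M(v) : k^x -> k^c with x = r + c, because a locally
   rational function that is homogeneous of degree at most 1 restricts to a linear one on every line.
   On the line through u0, u1 the bundle has type 1 exactly when (M(u0), M(u1)) : k^x -> k^(2c) is
   surjective. So every nonzero element of the annihilator Z of the image of k^x in the space of
   triples of vectors of k^c has rank 3. If x < 2c + 2, then dim Z >= c - 1, and contracting c - 1
   independent elements with the coordinates gives c x (c - 1) matrices A, B, C all of whose
   nontrivial combinations are injective. Writing Q C^T = G2(Q) A^T + G1(Q) B^T for symmetric Q defines
   commuting operators G1, G2, and a common eigenvector makes some C - a B - b A singular.
   If x > 3c, a nonzero constant vector lies in the kernel of all M(v) and splits off a trivial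
   summand. In between, spaces Z of Toeplitz matrices give an example in every rank. *)
theory Submission
  imports Defs "Jordan_Normal_Form.Determinant"
begin

text \<open>With \<open>m = c - 1\<close>, matrices of size \<open>m + 1\<close> by \<open>m\<close>
  lose injectivity only in codimension two: no single determinant detects it, and a pencil of two of
  them may well be injective throughout. In the projective plane of combinations of A, B, C one
  expects m (m + 1) / 2 singular members, which is the dimension of the space of symmetric matrices
  of size m. The operators G1 and G2 make this count algebraic: a singular C - a B - b A with kernel
  vector y yields the common eigenvector y y^T with eigenvalues a and b. They exist and are unique
  because Q to A Q B^T - B Q A^T maps the symmetric matrices of size m bijectively onto the
  alternating ones of size m + 1. Its injectivity, like the passage from the splitting type on a
  line to surjectivity, reduces to an eigenvector of a pencil. So the lower bound rests on
  eigenvectors over an algebraically closed field in place of cohomology and intersection numbers.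
  In the examples the condition x \<ge> 2 c + 2 supplies the two initial zeros of a recurrence of
  order two.\<close>

no_notation vec_index (infixl "$" 100)

section \<open>Linear algebra\<close>

text \<open>Dependence in \<open>fvec\<close> speaks of sets, whereas the relations wanted here are
  indexed by numbers. A repetition in \<open>v\<close> is therefore a case of its own, with
  coefficients 1 and -1.\<close>

lemma nontrivial_relation:
  fixes v :: "nat \<Rightarrow> 'i \<Rightarrow> 'k::field"
  assumes "finite B" "\<And>i. i < n \<Longrightarrow> v i \<in> fvec.span B" "card B < n"
  shows "\<exists>c. (\<exists>i<n. c i \<noteq> 0) \<and> (\<Sum>i<n. fscale (c i) (v i)) = 0"
proof (cases "inj_on v {..<n}")
  case True
  have "fvec.dependent (v ` {..<n})"
  proof (rule ccontr)
    assume "\<not> fvec.dependent (v ` {..<n})"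
    moreover have "v ` {..<n} \<subseteq> fvec.span B" using assms(2) by auto
    ultimately have "card (v ` {..<n}) \<le> card B"
      using fvec.independent_span_bound[OF assms(1)] by blast
    thus False using assms(3) by (simp add: card_image[OF True])
  qed
  then obtain u where u: "\<exists>w\<in>v ` {..<n}. u w \<noteq> 0" "(\<Sum>w\<in>v ` {..<n}. fscale (u w) w) = 0"
    using fvec.dependent_finite[of "v ` {..<n}"] by auto
  show ?thesis
    by (rule exI[of _ "u \<circ> v"]) (use u in \<open>auto simp: sum.reindex[OF True]\<close>)
next
  case False
  then obtain i j where ij: "i < n" "j < n" "i \<noteq> j" "v i = v j" by (auto simp: inj_on_def)
  define c where "c k = (if k = i then 1 else if k = j then - 1 else (0::'k))" for k
  have "(\<Sum>k<n. fscale (c k) (v k)) = (\<Sum>k\<in>{i, j}. fscale (c k) (v k))"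
    by (rule sum.mono_neutral_right) (use ij in \<open>auto simp: c_def\<close>)
  also have "\<dots> = 0" using ij by (auto simp: c_def fscale_def fun_eq_iff)
  finally show ?thesis using ij by (intro exI[of _ c]) (auto simp: c_def)
qed

lemma sum_fun_apply: "(\<Sum>i\<in>A. f i) x = (\<Sum>i\<in>A. f i x)"
  for f :: "'a \<Rightarrow> 'b \<Rightarrow> 'c::comm_monoid_add"
  by (induction A rule: infinite_finite_induct) auto

lemma homogeneous_system:
  fixes M :: "nat \<Rightarrow> nat \<Rightarrow> 'k::field"
  assumes "m < n"
  shows "\<exists>w. (\<exists>l<n. w l \<noteq> 0) \<and> (\<forall>i<m. (\<Sum>l<n. M i l * w l) = 0)"
proof -
  define e where "e i = (\<lambda>j. if j = i then 1 else (0::'k))" for i :: nat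
  define col where "col l = (\<lambda>i. if i < m then M i l else 0)" for l
  have "col l \<in> fvec.span (e ` {..<m})" for l
  proof -
    have "col l = (\<Sum>i<m. fscale (M i l) (e i))"
      by (auto simp: fun_eq_iff col_def e_def fscale_def sum_fun_apply if_distrib cong: if_cong)
    also have "\<dots> \<in> fvec.span (e ` {..<m})"
      by (intro fvec.span_sum fvec.span_scale fvec.span_base) auto
    finally show ?thesis .
  qed
  moreover have "card (e ` {..<m}) < n"
    using card_image_le[of "{..<m}" e] assms by simp
  ultimately obtain c where c: "\<exists>i<n. c i \<noteq> 0" "(\<Sum>i<n. fscale (c i) (col i)) = 0"
    using nontrivial_relation[of "e ` {..<m}" n col] by blast
  have "(\<Sum>l<n. M i l * c l) = 0" if "i < m" for i
    using fun_cong[OF c(2), of i] that by (simp add: sum_fun_apply fscale_def col_def mult.commute)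
  thus ?thesis using c(1) by blast
qed

text \<open>The functionals \<open>g\<close> certify the independence of the \<open>z\<close> by
  equations: pairing a combination of the \<open>z\<close> with \<open>g i\<close> reads off its
  coefficient. They are built together with the \<open>z\<close>, one pair at a time.\<close>

lemma kernel_biorthogonal_system:
  fixes M :: "nat \<Rightarrow> nat \<Rightarrow> 'k::field"
  assumes "m + k \<le> n"
  shows "\<exists>z g. (\<forall>j<k. \<forall>i<m. (\<Sum>l<n. M i l * z j l) = 0) \<and>
            (\<forall>i<k. \<forall>j<k. (\<Sum>l<n. g i l * z j l) = (if i = j then 1 else 0))"
  using assms
proof (induction k)
  case (Suc k)
  hence "m + k \<le> n" by simp
  from Suc.IH[OF this] obtain z g where zg: "\<And>j i. j < k \<Longrightarrow> i < m \<Longrightarrow> (\<Sum>l<n. M i l * z j l) = 0"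
      "\<And>i j. i < k \<Longrightarrow> j < k \<Longrightarrow> (\<Sum>l<n. g i l * z j l) = (if i = j then 1 else 0)"
    by blast
  \<comment> \<open>Orthogonality to the earlier functionals is imposed as \<open>k\<close> further
    equations; a nonzero solution remains because \<open>m + k < n\<close>.\<close>
  define M' where "M' i = (if i < m then M i else g (i - m))" for i
  obtain w where w: "\<exists>l<n. w l \<noteq> 0" "\<And>i. i < m + k \<Longrightarrow> (\<Sum>l<n. M' i l * w l) = 0"
    using homogeneous_system[of "m + k" n M'] Suc.prems by auto
  have wM: "(\<Sum>l<n. M i l * w l) = 0" if "i < m" for i
    using w(2)[of i] that by (simp add: M'_def)
  have wg: "(\<Sum>l<n. g i l * w l) = 0" if "i < k" for i
    using w(2)[of "m + i"] that by (simp add: M'_def)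
  obtain l0 where l0: "l0 < n" "w l0 \<noteq> 0" using w(1) by auto
  \<comment> \<open>The coordinate at \<open>l0\<close>, scaled to take the value 1 on
    \<open>w\<close>, and corrected by the old functionals so as to vanish on the old
    vectors.\<close>
  define h where "h l = (if l = l0 then 1 / w l0 else 0) -
      (\<Sum>j<k. (z j l0 / w l0) * g j l)" for l
  have h_eq: "(\<Sum>l<n. h l * y l) = y l0 / w l0 - (\<Sum>j<k. (z j l0 / w l0) * (\<Sum>l<n. g j l * y l))" for y
  proof -
    have "(\<Sum>l<n. h l * y l) = (\<Sum>l<n. (if l = l0 then y l0 / w l0 else 0)) -
        (\<Sum>l<n. \<Sum>j<k. (z j l0 / w l0) * (g j l * y l))"
      unfolding sum_subtractf[symmetric]
      by (intro sum.cong) (auto simp: h_def algebra_simps sum_distrib_left sum_distrib_right)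
    also have "(\<Sum>l<n. \<Sum>j<k. (z j l0 / w l0) * (g j l * y l)) =
        (\<Sum>j<k. (z j l0 / w l0) * (\<Sum>l<n. g j l * y l))"
      by (subst sum.swap) (simp add: sum_distrib_left)
    finally show ?thesis using l0 by simp
  qed
  have hw: "(\<Sum>l<n. h l * w l) = 1" unfolding h_eq using l0 wg by simp
  have hz: "(\<Sum>l<n. h l * z j l) = 0" if "j < k" for j
  proof -
    have "(\<Sum>i<k. (z i l0 / w l0) * (\<Sum>l<n. g i l * z j l)) = (\<Sum>i<k. if i = j then z j l0 / w l0 else 0)"
      by (rule sum.cong) (use zg(2) that in auto)
    thus ?thesis unfolding h_eq using that by simp
  qed
  show ?case
    by (intro exI[of _ "z(k := w)"] exI[of _ "g(k := h)"])
      (use zg wM wg hw hz in \<open>auto simp: less_Suc_eq\<close>)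
qed auto

section \<open>Injective matrices, pivot columns and solvability\<close>

definition trivial_kernel :: "nat \<Rightarrow> nat \<Rightarrow> (nat \<Rightarrow> nat \<Rightarrow> 'k::field) \<Rightarrow> bool" where
  "trivial_kernel m n S \<longleftrightarrow> (\<forall>w. (\<forall>i<m. (\<Sum>j<n. S i j * w j) = 0) \<longrightarrow> (\<forall>j<n. w j = 0))"

lemma trivial_kernelI:
  assumes "\<And>w j. (\<And>i. i < m \<Longrightarrow> (\<Sum>j<n. S i j * w j) = 0) \<Longrightarrow> j < n \<Longrightarrow> w j = 0"
  shows "trivial_kernel m n S"
  unfolding trivial_kernel_def
proof (intro allI impI)
  fix w j assume "\<forall>i<m. (\<Sum>j<n. S i j * w j) = 0" "j < n"
  thus "w j = 0" by (intro assms[of w j]) auto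
qed

lemma trivial_kernelD:
  assumes "trivial_kernel m n S" "\<And>i. i < m \<Longrightarrow> (\<Sum>j<n. S i j * w j) = 0" "j < n"
  shows "w j = 0"
proof -
  have "(\<forall>i<m. (\<Sum>j<n. S i j * w j) = 0) \<longrightarrow> (\<forall>j<n. w j = 0)"
    using assms(1) unfolding trivial_kernel_def by (rule spec)
  thus ?thesis using assms(2,3) by simp
qed

text \<open>With \<open>- y\<close> as an extra column there are more unknowns than equations. By
  injectivity the last entry of a nontrivial solution cannot vanish, and dividing by it solves the
  system.\<close>

lemma square_solve:
  fixes S :: "nat \<Rightarrow> nat \<Rightarrow> 'k::field"
  assumes inj: "trivial_kernel n n S"
  shows "\<exists>w. (\<forall>k<n. (\<Sum>i<n. S k i * w i) = y k) \<and> (\<forall>i\<ge>n. w i = 0)"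
proof -
  define S' where "S' k l = (if l = n then - y k else S k l)" for k l
  obtain w where w: "\<exists>l<Suc n. w l \<noteq> 0" "\<forall>k<n. (\<Sum>l<Suc n. S' k l * w l) = 0"
    using homogeneous_system[OF lessI, of n S'] by blast
  have eq: "(\<Sum>l<n. S k l * w l) = y k * w n" if "k < n" for k
    using w(2)[rule_format, OF that] by (simp add: S'_def algebra_simps)
  have "w n \<noteq> 0"
  proof
    assume 0: "w n = 0"
    have "w i = 0" if "i < n" for i
      by (rule trivial_kernelD[OF inj _ that]) (use eq 0 in simp)
    thus False using w(1) 0 by (auto simp: less_Suc_eq)
  qed
  show ?thesis
  proof (intro exI[of _ "\<lambda>i. if i < n then w i / w n else 0"] conjI allI impI)
    fix k assume k: "k < n"
    have "(\<Sum>i<n. S k i * (if i < n then w i / w n else 0)) = (\<Sum>i<n. S k i * w i) / w n"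
      by (simp add: sum_divide_distrib)
    thus "(\<Sum>i<n. S k i * (if i < n then w i / w n else 0)) = y k"
      using eq[OF k] \<open>w n \<noteq> 0\<close> by simp
  qed auto
qed

text \<open>Full row rank is written as injectivity of the transpose. On the \<open>n\<close>
  columns found so far the first \<open>n + 1\<close> rows have a relation \<open>f\<close>; as it
  is no relation of the full rows, some column \<open>l\<close> breaks it and is added. Injectivity
  of the square block and of its transpose are carried along together, so that row and column rank
  never have to be compared.\<close>

lemma pivot_columns:
  fixes N :: "nat \<Rightarrow> nat \<Rightarrow> 'k::field"
  assumes "trivial_kernel x n (\<lambda>l i. N i l)"
  shows "\<exists>j. inj_on j {..<n} \<and> (\<forall>i<n. j i < x) \<and>
     trivial_kernel n n (\<lambda>k i. N k (j i)) \<and> trivial_kernel n n (\<lambda>i k. N k (j i))"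
  using assms
proof (induction n)
  case 0
  show ?case by (auto intro: trivial_kernelI)
next
  case (Suc n)
  have "trivial_kernel x n (\<lambda>l i. N i l)"
  proof (rule trivial_kernelI)
    fix f i assume f: "\<And>l. l < x \<Longrightarrow> (\<Sum>j<n. N j l * f j) = 0" and i: "i < n"
    have "(f(n := 0)) i = 0" by (rule trivial_kernelD[OF Suc.prems]) (use f i in auto)
    thus "f i = 0" using i by simp
  qed
  hence "\<exists>j. inj_on j {..<n} \<and> (\<forall>i<n. j i < x) \<and>
     trivial_kernel n n (\<lambda>k i. N k (j i)) \<and> trivial_kernel n n (\<lambda>i k. N k (j i))"
    by (rule Suc.IH)
  then obtain j where j: "inj_on j {..<n}" "\<forall>i<n. j i < x"
     "trivial_kernel n n (\<lambda>k i. N k (j i))" "trivial_kernel n n (\<lambda>i k. N k (j i))"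
    by blast
  have "\<exists>f. (\<exists>l<Suc n. f l \<noteq> 0) \<and> (\<forall>i<n. (\<Sum>l<Suc n. N l (j i) * f l) = 0)"
    by (rule homogeneous_system) simp
  then obtain f where f: "\<exists>l<Suc n. f l \<noteq> 0" "\<forall>i<n. (\<Sum>l<Suc n. N l (j i) * f l) = 0"
    by blast
  have fn: "f n \<noteq> 0"
  proof
    assume 0: "f n = 0"
    have "f i = 0" if "i < n" for i
      by (rule trivial_kernelD[OF j(4) _ that]) (use f(2) 0 in simp)
    thus False using f(1) 0 by (auto simp: less_Suc_eq)
  qed
  have "\<not> (\<forall>l<x. (\<Sum>i<Suc n. N i l * f i) = 0)"
    using trivial_kernelD[OF Suc.prems, of f n] fn by auto
  then obtain l where l: "l < x" "(\<Sum>i<Suc n. f i * N i l) \<noteq> 0" by (auto simp: mult.commute)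
  have fj: "(\<Sum>k<Suc n. f k * N k (j i)) = 0" if "i < n" for i
    using f(2)[rule_format, OF that] by (simp add: mult.commute)
  have lj: "l \<noteq> j i" if "i < n" for i using fj[OF that] l(2) by metis
  define j' where "j' = j(n := l)"
  have j'simp[simp]: "j' n = l" "i < n \<Longrightarrow> j' i = j i" for i by (auto simp: j'_def)
  have "inj_on j' {..<Suc n}"
    unfolding lessThan_Suc inj_on_insert using j(1) lj
    by (auto simp: inj_on_def)
  moreover have "\<forall>i<Suc n. j' i < x" using j(2) l(1) by (auto simp: less_Suc_eq)
  moreover have "trivial_kernel (Suc n) (Suc n) (\<lambda>k i. N k (j' i))"
  proof (rule trivial_kernelI)
    fix w i assume w: "\<And>k. k < Suc n \<Longrightarrow> (\<Sum>i<Suc n. N k (j' i) * w i) = 0" and i: "i < Suc n"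
    have "0 = (\<Sum>k<Suc n. f k * (\<Sum>i<Suc n. N k (j' i) * w i))" using w by simp
    also have "\<dots> = (\<Sum>k<Suc n. \<Sum>i<Suc n. f k * N k (j' i) * w i)"
      unfolding sum_distrib_left by (simp only: mult.assoc)
    also have "\<dots> = (\<Sum>i<Suc n. \<Sum>k<Suc n. f k * N k (j' i) * w i)" by (rule sum.swap)
    also have "\<dots> = (\<Sum>i<Suc n. (\<Sum>k<Suc n. f k * N k (j' i)) * w i)"
      by (simp only: sum_distrib_right)
    also have "\<dots> = (\<Sum>k<Suc n. f k * N k l) * w n"
      using fj by (subst sum.lessThan_Suc) simp
    finally have wn: "w n = 0" using l(2) by simp
    have "w i = 0" if "i < n" for i
      by (rule trivial_kernelD[OF j(3) _ that]) (use w wn in \<open>simp add: less_Suc_eq\<close>)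
    thus "w i = 0" using wn i by (auto simp: less_Suc_eq)
  qed
  moreover have "trivial_kernel (Suc n) (Suc n) (\<lambda>i k. N k (j' i))"
  proof (rule trivial_kernelI)
    fix g i assume "\<And>i. i < Suc n \<Longrightarrow> (\<Sum>k<Suc n. N k (j' i) * g k) = 0" and i: "i < Suc n"
    hence g: "\<And>i. i < Suc n \<Longrightarrow> (\<Sum>k<Suc n. g k * N k (j' i)) = 0" by (simp only: mult.commute)
    \<comment> \<open>Subtracting this multiple of \<open>f\<close> kills the last entry and brings
      \<open>h\<close> under the induction hypothesis; column \<open>l\<close> then forces the
      multiple to be 0.\<close>
    define h where "h k = g k - (g n / f n) * f k" for k
    have h_sum: "(\<Sum>k<Suc n. h k * N k p) = (\<Sum>k<Suc n. g k * N k p) - (g n / f n) * (\<Sum>k<Suc n. f k * N k p)" for p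
      unfolding sum_distrib_left sum_subtractf[symmetric] by (rule sum.cong) (auto simp: h_def algebra_simps)
    have hn: "h n = 0" using fn by (simp add: h_def)
    have "(\<Sum>k<n. h k * N k (j i)) = 0" if "i < n" for i
      using h_sum[of "j i"] fj[OF that] g[of i] that hn by simp
    hence "(\<Sum>k<n. N k (j i) * h k) = 0" if "i < n" for i
      using that by (simp add: mult.commute)
    hence h0: "h i = 0" if "i < n" for i
      by (rule trivial_kernelD[OF j(4) _ that]) simp
    hence "(\<Sum>k<Suc n. h k * N k l) = 0" using hn by simp
    moreover have "(\<Sum>k<Suc n. g k * N k l) = 0" using g[of n] by simp
    ultimately have "g n = 0" using h_sum[of l] l(2) fn by simp
    thus "g i = 0" using h0[of i] i by (auto simp: h_def less_Suc_eq)
  qed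
  ultimately show ?case by blast
qed

lemma full_row_rank_surj:
  fixes N :: "nat \<Rightarrow> nat \<Rightarrow> 'k::field"
  assumes "trivial_kernel x n (\<lambda>l i. N i l)"
  shows "\<exists>w. (\<forall>k<n. (\<Sum>l<x. N k l * w l) = y k) \<and> (\<forall>l\<ge>x. w l = 0)"
proof -
  obtain j where j: "inj_on j {..<n}" "\<forall>i<n. j i < x" "trivial_kernel n n (\<lambda>k i. N k (j i))"
    using pivot_columns[OF assms] by blast
  obtain u where u: "\<forall>k<n. (\<Sum>i<n. N k (j i) * u i) = y k"
    using square_solve[OF j(3), of y] by blast
  define w where "w l = (if l \<in> j ` {..<n} then u (inv_into {..<n} j l) else 0)" for l
  show ?thesis
  proof (intro exI[of _ w] conjI allI impI)
    fix k assume k: "k < n"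
    have "(\<Sum>l<x. N k l * w l) = (\<Sum>l\<in>j ` {..<n}. N k l * w l)"
      by (rule sum.mono_neutral_right) (use j(2) in \<open>auto simp: w_def\<close>)
    also have "\<dots> = (\<Sum>i<n. N k (j i) * u i)"
      by (subst sum.reindex[OF j(1)]) (auto simp: w_def inv_into_f_f[OF j(1)])
    finally show "(\<Sum>l<x. N k l * w l) = y k" using u k by simp
  qed (use j(2) in \<open>force simp: w_def\<close>)
qed

text \<open>A nonzero polynomial p of least degree with p(f) u = 0 has a root a, p = (X - a) q. By
  minimality q(f) u is nonzero, and \<open>f\<close> acts on it as a. Linearity of \<open>f\<close>
  is asked on \<open>U\<close> only, since some of the operators to come are defined by choices that
  mean nothing outside.\<close>

lemma fvec_eigenvector:
  fixes U :: "('i \<Rightarrow> 'k::alg_closed_field) set" and f :: "('i \<Rightarrow> 'k) \<Rightarrow> 'i \<Rightarrow> 'k"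
  assumes sub: "fvec.subspace U" and fin: "finite B" "U \<subseteq> fvec.span B"
    and u: "u \<in> U" "u \<noteq> 0" and inv: "\<And>x. x \<in> U \<Longrightarrow> f x \<in> U"
    and add: "\<And>x y. x \<in> U \<Longrightarrow> y \<in> U \<Longrightarrow> f (x + y) = f x + f y"
    and scale: "\<And>a x. x \<in> U \<Longrightarrow> f (fscale a x) = fscale a (f x)"
  obtains w a where "w \<in> U" "w \<noteq> 0" "f w = fscale a w"
proof -
  \<comment> \<open>This is p(f) applied to \<open>u\<close> as soon as \<open>N\<close> exceeds the
    degree. A fixed number of terms keeps the product rule \<open>ev_mult\<close> free of
    degrees.\<close>
  define ev where "ev p N = (\<Sum>i<N. fscale (coeff p i) ((f ^^ i) u))" for p N
  have powU: "(f ^^ i) u \<in> U" for i by (induction i) (use u inv in auto)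
  have evU: "ev p N \<in> U" for p N
    unfolding ev_def by (intro fvec.subspace_sum[OF sub] fvec.subspace_scale[OF sub] powU)
  have f0: "f 0 = 0" using scale[of 0 0] fvec.subspace_0[OF sub] by simp
  have f_sum: "f (\<Sum>i<N. g i) = (\<Sum>i<N. f (g i))" if "\<And>i. g i \<in> U" for g and N :: nat
  proof (induction N)
    case (Suc N)
    have "(\<Sum>i<N. g i) \<in> U" by (intro fvec.subspace_sum[OF sub] that)
    thus ?case by (simp only: sum.lessThan_Suc add that Suc.IH)
  qed (use f0 in \<open>simp add: zero_fun_def\<close>)
  have f_ev: "f (ev p N) = (\<Sum>i<N. fscale (coeff p i) ((f ^^ Suc i) u))" for p N
    unfolding ev_def
    by (subst f_sum) (auto simp: scale powU intro: fvec.subspace_scale[OF sub])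
  have ev_mult: "ev ([:- a, 1:] * q) (Suc N) = f (ev q N) - fscale a (ev q (Suc N))" for a q N
  proof -
    have c0: "coeff ([:- a, 1:] * q) 0 = - a * coeff q 0" by simp
    have cS: "coeff ([:- a, 1:] * q) (Suc i) = coeff q i - a * coeff q (Suc i)" for i by simp
    have "ev ([:- a, 1:] * q) (Suc N) = fscale (- a * coeff q 0) u +
        (\<Sum>i<N. fscale (coeff q i - a * coeff q (Suc i)) ((f ^^ Suc i) u))"
      unfolding ev_def sum.lessThan_Suc_shift c0 cS by simp
    also have "\<dots> = f (ev q N) - fscale a (fscale (coeff q 0) u + (\<Sum>i<N. fscale (coeff q (Suc i)) ((f ^^ Suc i) u)))"
      unfolding f_ev
      by (simp add: fun_eq_iff fscale_def sum_fun_apply algebra_simps sum_distrib_left sum.distrib sum_subtractf)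
    also have "fscale (coeff q 0) u + (\<Sum>i<N. fscale (coeff q (Suc i)) ((f ^^ Suc i) u)) = ev q (Suc N)"
      unfolding ev_def sum.lessThan_Suc_shift by simp
    finally show ?thesis .
  qed
  have ev_deg: "ev q (Suc N) = ev q N" if "degree q < N" for q N
    unfolding ev_def using that by (simp add: coeff_eq_0)
  \<comment> \<open>A member of least degree is, up to a scalar, the minimal polynomial of
    \<open>u\<close>.\<close>
  define K where "K p \<longleftrightarrow> p \<noteq> 0 \<and> (\<exists>N > degree p. ev p N = 0)" for p
  have "\<exists>p. K p"
  proof -
    define n where "n = Suc (card B)"
    have "\<exists>c. (\<exists>i<n. c i \<noteq> 0) \<and> (\<Sum>i<n. fscale (c i) ((f ^^ i) u)) = 0"
      by (rule nontrivial_relation[OF fin(1)]) (use fin powU in \<open>auto simp: n_def\<close>)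
    then obtain c where c: "\<exists>i<n. c i \<noteq> 0" "(\<Sum>i<n. fscale (c i) ((f ^^ i) u)) = 0"
      by blast
    define p where "p = (\<Sum>i<n. monom (c i) i)"
    have cp: "coeff p i = (if i < n then c i else 0)" for i
      by (auto simp: p_def coeff_sum)
    have "p \<noteq> 0" using c(1) cp by (metis coeff_0)
    moreover have "degree p < n"
      using \<open>p \<noteq> 0\<close> cp by (metis leading_coeff_0_iff)
    moreover have "ev p n = 0" using c(2) by (simp add: ev_def cp)
    ultimately show ?thesis by (auto simp: K_def)
  qed
  then obtain p where p: "K p" "\<And>q. K q \<Longrightarrow> degree p \<le> degree q"
    using ex_has_least_nat[of K _ degree] by blast
  then obtain N where N: "N > degree p" "ev p N = 0" "p \<noteq> 0" by (auto simp: K_def)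
  have "degree p > 0"
  proof (rule ccontr)
    assume "\<not> degree p > 0"
    then obtain a where a: "p = [:a:]" by (metis degree_eq_zeroE gr0I)
    hence "ev p N = fscale a u"
      unfolding ev_def using N(1) by (cases N) (auto simp del: sum.lessThan_Suc simp: sum.lessThan_Suc_shift)
    moreover have "a \<noteq> 0" using a N(3) by simp
    ultimately show False using N(2) u(2) by simp
  qed
  then obtain a where "poly p a = 0" using alg_closed_imp_poly_has_root by blast
  then obtain q where q: "p = [:- a, 1:] * q" unfolding poly_eq_0_iff_dvd by (auto simp: dvd_def)
  have "q \<noteq> 0" using q N(3) by auto
  have "degree p = degree [:- a, 1:] + degree q"
    unfolding q by (rule degree_mult_eq) (use \<open>q \<noteq> 0\<close> in auto)
  hence dq: "degree p = Suc (degree q)" by simp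
  obtain N' where N': "N = Suc N'" "degree q < N'" using N(1) dq by (cases N) auto
  have "ev q N' \<noteq> 0"
  proof
    assume "ev q N' = 0"
    hence "K q" using N' \<open>q \<noteq> 0\<close> by (auto simp: K_def)
    thus False using p(2)[of q] dq by simp
  qed
  moreover have "f (ev q N') = fscale a (ev q N')"
    using N(2) ev_mult[of a q N'] ev_deg[OF N'(2)] N'(1) q by simp
  ultimately show ?thesis using that evU by blast
qed

subsection \<open>Nonsingular triples of matrices\<close>

text \<open>Matrices are functions on all pairs of indices, with sizes expressed by support
  conditions. So they form one vector space over \<open>fscale\<close>, to which
  \<open>fvec_eigenvector\<close> applies, and only the inner dimension of a product has to be
  named.\<close>

definition mmul :: "nat \<Rightarrow> (nat \<times> nat \<Rightarrow> 'k::field) \<Rightarrow> (nat \<times> nat \<Rightarrow> 'k) \<Rightarrow> nat \<times> nat \<Rightarrow> 'k" where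
  "mmul n X Y = (\<lambda>(i, k). \<Sum>j<n. X (i, j) * Y (j, k))"

definition mtr :: "(nat \<times> nat \<Rightarrow> 'k) \<Rightarrow> nat \<times> nat \<Rightarrow> 'k" where
  "mtr X = (\<lambda>(i, j). X (j, i))"

lemma mmul_apply: "mmul n X Y (i, k) = (\<Sum>j<n. X (i, j) * Y (j, k))"
  by (simp add: mmul_def)

lemma mtr_apply: "mtr X (i, j) = X (j, i)"
  by (simp add: mtr_def)

lemma fscale_apply: "fscale a f i = a * f i"
  by (simp add: fscale_def)

lemma mmul_assoc: "mmul n (mmul m X Y) Z = mmul m X (mmul n Y Z)"
proof (rule ext, clarify)
  fix i k
  have "mmul n (mmul m X Y) Z (i, k) = (\<Sum>j<n. \<Sum>l<m. X (i, l) * Y (l, j) * Z (j, k))"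
    by (simp add: mmul_apply sum_distrib_right)
  also have "\<dots> = (\<Sum>l<m. \<Sum>j<n. X (i, l) * Y (l, j) * Z (j, k))" by (rule sum.swap)
  also have "\<dots> = mmul m X (mmul n Y Z) (i, k)"
    by (simp add: mmul_apply sum_distrib_left mult.assoc)
  finally show "mmul n (mmul m X Y) Z (i, k) = mmul m X (mmul n Y Z) (i, k)" .
qed

lemma mtr_mmul: "mtr (mmul n X Y) = mmul n (mtr Y) (mtr X)"
  by (auto simp: fun_eq_iff mmul_def mtr_def mult.commute)

lemma mtr_mtr: "mtr (mtr X) = X"
  by (auto simp: fun_eq_iff mtr_def)

lemma mtr_add: "mtr (X + Y) = mtr X + mtr Y"
  and mtr_diff: "mtr (X - Z) = mtr X - mtr Z"
  and mtr_scale: "mtr (fscale a Z) = fscale a (mtr Z)"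
  and mtr_minus: "mtr (- Z) = - mtr Z"
  by (auto simp: fun_eq_iff mtr_def fscale_def)

lemma mmul_add_left: "mmul n (X + Y) Z = mmul n X Z + mmul n Y Z"
  and mmul_add_right: "mmul n Z (X + Y) = mmul n Z X + mmul n Z Y"
  and mmul_diff_left: "mmul n (X - Y) Z = mmul n X Z - mmul n Y Z"
  and mmul_diff_right: "mmul n Z (X - Y) = mmul n Z X - mmul n Z Y"
  and mmul_scale_left: "mmul n (fscale a X) Z = fscale a (mmul n X Z)"
  and mmul_scale_right: "mmul n Z (fscale a X) = fscale a (mmul n Z X)"
  and mmul_minus_left: "mmul n (- X) Z = - mmul n X Z"
  and mmul_minus_right: "mmul n Z (- X) = - mmul n Z X"
  by (auto simp: fun_eq_iff mmul_def fscale_def algebra_simps sum.distrib sum_subtractf sum_distrib_left sum_negf)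

lemma mmul_0_right: "mmul n Z 0 = 0" and mmul_0_left: "mmul n 0 Z = 0"
  by (auto simp: fun_eq_iff mmul_def)

lemmas mmul_linear = mmul_add_left mmul_add_right mmul_diff_left mmul_diff_right
  mmul_scale_left mmul_scale_right mmul_0_right mmul_0_left
  mmul_minus_left mmul_minus_right

lemmas mtr_linear = mtr_add mtr_diff mtr_scale mtr_minus

lemma finite_support_span:
  fixes X :: "'i \<Rightarrow> 'k::field"
  assumes "finite S" "\<And>p. p \<notin> S \<Longrightarrow> X p = 0"
  shows "X \<in> fvec.span ((\<lambda>p q. if q = p then 1 else 0) ` S)"
proof -
  have "X = (\<Sum>p\<in>S. fscale (X p) (\<lambda>q. if q = p then 1 else 0))"
    using assms by (auto simp: fun_eq_iff sum_fun_apply fscale_def if_distrib cong: if_cong)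
  also have "\<dots> \<in> fvec.span ((\<lambda>p q. if q = p then 1 else 0) ` S)"
    by (intro fvec.span_sum fvec.span_scale fvec.span_base) auto
  finally show ?thesis .
qed

text \<open>The extreme case of the rank bound, set up for a contradiction:
  \<open>dimension_zero\<close> shows that the assumptions can hold only for
  \<open>m = 0\<close>.\<close>

locale nonsingular_triple =
  fixes A B C :: "nat \<times> nat \<Rightarrow> 'k::alg_closed_field" and m :: nat
  assumes supp: "\<And>i j. \<not> (i < Suc m \<and> j < m) \<Longrightarrow> A (i, j) = 0 \<and> B (i, j) = 0 \<and> C (i, j) = 0"
    and nonsing: "\<And>x y z p j. (\<And>i. i < Suc m \<Longrightarrow>
          (\<Sum>j<m. (x * A (i, j) + y * B (i, j) + z * C (i, j)) * p j) = 0) \<Longrightarrow>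
          x \<noteq> 0 \<or> y \<noteq> 0 \<or> z \<noteq> 0 \<Longrightarrow> j < m \<Longrightarrow> p j = 0"
begin

lemma cancel:
  assumes eq: "fscale x (mmul m A Y) + fscale y (mmul m B Y) + fscale z (mmul m C Y) = 0"
    and xyz: "x \<noteq> 0 \<or> y \<noteq> 0 \<or> z \<noteq> 0" and Y: "\<And>j k. j \<ge> m \<Longrightarrow> Y (j, k) = 0"
  shows "Y = 0"
proof (rule ext, clarify)
  fix j k
  have "Y (j, k) = 0" if "j < m"
  proof (rule nonsing[of x y z "\<lambda>j. Y (j, k)", OF _ xyz that])
    fix i
    have "(\<Sum>j<m. (x * A (i, j) + y * B (i, j) + z * C (i, j)) * Y (j, k)) =
        (fscale x (mmul m A Y) + fscale y (mmul m B Y) + fscale z (mmul m C Y)) (i, k)"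
      by (simp add: mmul_apply fscale_def algebra_simps sum.distrib sum_distrib_left)
    thus "(\<Sum>j<m. (x * A (i, j) + y * B (i, j) + z * C (i, j)) * Y (j, k)) = 0"
      by (simp add: eq)
  qed
  thus "Y (j, k) = 0 (j, k)" using Y[of j k] by (cases "j < m") auto
qed

lemma cancel_A: "mmul m A Y = 0 \<Longrightarrow> (\<And>j k. j \<ge> m \<Longrightarrow> Y (j, k) = 0) \<Longrightarrow> Y = 0"
  by (rule cancel[of 1 Y 0 0]) (auto simp: fscale_def fun_eq_iff)

lemma cancel_B: "mmul m B Y = 0 \<Longrightarrow> (\<And>j k. j \<ge> m \<Longrightarrow> Y (j, k) = 0) \<Longrightarrow> Y = 0"
  by (rule cancel[of 0 Y 1 0]) (auto simp: fscale_def fun_eq_iff)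

lemma cancel_mtr_A: "mmul m Y (mtr A) = 0 \<Longrightarrow> (\<And>j k. j \<ge> m \<Longrightarrow> Y (k, j) = 0) \<Longrightarrow> Y = 0"
  using cancel_A[of "mtr Y"] by (auto simp: mtr_mtr mtr_mmul fun_eq_iff mtr_def mmul_def mult.commute)

lemma cancel_mtr_B: "mmul m Y (mtr B) = 0 \<Longrightarrow> (\<And>j k. j \<ge> m \<Longrightarrow> Y (k, j) = 0) \<Longrightarrow> Y = 0"
  using cancel_B[of "mtr Y"] by (auto simp: mtr_mtr mtr_mmul fun_eq_iff mtr_def mmul_def mult.commute)

text \<open>The image \<open>U\<close> of \<open>X\<close> satisfies \<open>A U = B U\<close>, so otherwise \<open>A\<^sup>-\<^sup>1 B\<close> would have an
  eigenvector in \<open>U\<close>.\<close>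

lemma symmetric_pencil_zero:
  assumes X: "\<And>j k. j \<ge> m \<Longrightarrow> X (j, k) = 0" "\<And>j k. k \<ge> Suc m \<Longrightarrow> X (j, k) = 0"
    and symA: "mtr (mmul m A X) = mmul m A X" and symB: "mtr (mmul m B X) = mmul m B X"
  shows "X = 0"
proof (rule ccontr)
  assume "X \<noteq> 0"
  then obtain j0 k0 where jk: "X (j0, k0) \<noteq> 0" by (auto simp: fun_eq_iff)
  \<comment> \<open>Vectors are matrices supported in column 0, so that the algebra of
    \<open>mmul\<close> applies to them.\<close>
  define col where "col F \<longleftrightarrow> (\<forall>i k. k \<noteq> 0 \<longrightarrow> F (i, k) = 0)" for F :: "nat \<times> nat \<Rightarrow> 'k"
  define U where "U = {mmul (Suc m) X F | F. col F}"
  have Urow: "u (j, k) = 0" if "u \<in> U" "j \<ge> m \<or> k \<noteq> 0" for u j k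
    using that X(1) by (auto simp: U_def mmul_def col_def)
  have sub: "fvec.subspace U"
  proof (rule fvec.subspaceI)
    show "0 \<in> U" unfolding U_def by (rule CollectI, rule exI[of _ 0]) (auto simp: mmul_linear col_def)
  next
    fix x y assume "x \<in> U" "y \<in> U"
    then obtain F G where FG: "x = mmul (Suc m) X F" "col F" "y = mmul (Suc m) X G" "col G"
      by (auto simp: U_def)
    show "x + y \<in> U" unfolding U_def
      by (rule CollectI, rule exI[of _ "F + G"]) (use FG in \<open>simp add: mmul_linear col_def\<close>)
  next
    fix a x assume "x \<in> U"
    then obtain F where FG: "x = mmul (Suc m) X F" "col F" by (auto simp: U_def)
    show "fscale a x \<in> U" unfolding U_def
      by (rule CollectI, rule exI[of _ "fscale a F"]) (use FG in \<open>simp add: mmul_linear col_def fscale_apply\<close>)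
  qed
  \<comment> \<open>For u = X F, solve A^T G = B^T F, which is possible because A is injective.
    Symmetry of A X and B X then gives A X G = X^T A^T G = X^T B^T F = B X F, so X G is the element
    sought.\<close>
  have ex: "\<exists>u'. u' \<in> U \<and> mmul m A u' = mmul m B u" if "u \<in> U" for u
  proof -
    obtain F where F: "u = mmul (Suc m) X F" "col F" using \<open>u \<in> U\<close> by (auto simp: U_def)
    have "trivial_kernel (Suc m) m (\<lambda>l i. A (l, i))"
      by (rule trivial_kernelI) (use nonsing[of 1 0 0] in simp)
    from full_row_rank_surj[OF this, of "\<lambda>k. mmul (Suc m) (mtr B) F (k, 0)"]
    obtain w where w: "\<forall>k<m. (\<Sum>l<Suc m. A (l, k) * w l) = mmul (Suc m) (mtr B) F (k, 0)" by blast
    define G where "G = (\<lambda>(i, k :: nat). if k = 0 then w i else 0 :: 'k)"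
    have colG: "col G" by (auto simp: G_def col_def)
    have eq: "mmul (Suc m) (mtr A) G = mmul (Suc m) (mtr B) F"
    proof (rule ext, clarify)
      fix k i
      show "mmul (Suc m) (mtr A) G (k, i) = mmul (Suc m) (mtr B) F (k, i)"
      proof (cases "k < m \<and> i = 0")
        case True
        thus ?thesis using w by (simp add: mmul_apply G_def mtr_apply del: sum.lessThan_Suc)
      next
        case False
        thus ?thesis using F(2) supp
          by (auto simp: mmul_apply G_def mtr_apply col_def del: sum.lessThan_Suc intro!: sum.cong)
      qed
    qed
    have "mmul m A (mmul (Suc m) X G) = mmul (Suc m) (mtr (mmul m A X)) G"
      by (simp only: symA mmul_assoc)
    also have "\<dots> = mmul m (mtr X) (mmul (Suc m) (mtr A) G)" by (simp only: mtr_mmul mmul_assoc)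
    also have "\<dots> = mmul (Suc m) (mtr (mmul m B X)) F" by (simp only: eq mtr_mmul mmul_assoc)
    also have "\<dots> = mmul m B u" unfolding symB by (simp only: F(1) mmul_assoc)
    finally show ?thesis using colG by (auto simp: U_def)
  qed
  define \<tau> where "\<tau> u = (SOME u'. u' \<in> U \<and> mmul m A u' = mmul m B u)" for u
  have \<tau>: "\<tau> u \<in> U" "mmul m A (\<tau> u) = mmul m B u" if "u \<in> U" for u
    using someI_ex[OF ex[OF that]] by (auto simp: \<tau>_def)
  have uniq: "u' = \<tau> u" if "u \<in> U" "u' \<in> U" "mmul m A u' = mmul m B u" for u u'
  proof -
    have "u' - \<tau> u = 0"
    proof (rule cancel_A)
      show "mmul m A (u' - \<tau> u) = 0" using that \<tau>[OF that(1)] by (simp add: mmul_linear)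
      show "(u' - \<tau> u) (j, k) = 0" if "j \<ge> m" for j k
        using Urow[OF \<open>u' \<in> U\<close>, of j k] Urow[OF \<tau>(1)[OF \<open>u \<in> U\<close>], of j k] that by simp
    qed
    thus ?thesis by simp
  qed
  define S where "S = (\<lambda>i. (i, 0::nat)) ` {..<m}"
  define Bs where "Bs = (\<lambda>p q. if q = p then 1 else (0::'k)) ` S"
  have U0: "mmul (Suc m) X (\<lambda>(i, k). if i = k0 \<and> k = 0 then 1 else 0) \<in> U" (is "?u0 \<in> U")
    unfolding U_def by (rule CollectI, rule exI[of _ "\<lambda>(i, k). if i = k0 \<and> k = 0 then 1 else 0"])
      (auto simp: col_def)
  have "k0 < Suc m" using jk X(2) by (meson not_le)
  hence "?u0 (j0, 0) = X (j0, k0)"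
    by (simp add: mmul_apply if_distrib del: sum.lessThan_Suc cong: if_cong)
  hence "?u0 \<noteq> 0" using jk by auto
  obtain w a where w: "w \<in> U" "w \<noteq> 0" "\<tau> w = fscale a w"
  proof (rule fvec_eigenvector[OF sub _ _ U0 \<open>?u0 \<noteq> 0\<close>, of Bs \<tau>])
    show "finite Bs" by (simp add: Bs_def S_def)
    show "U \<subseteq> fvec.span Bs"
    proof
      fix u assume u: "u \<in> U"
      show "u \<in> fvec.span Bs" unfolding Bs_def
      proof (rule finite_support_span)
        fix p assume "p \<notin> S"
        moreover obtain a b where p: "p = (a, b)" by (cases p)
        ultimately have "a \<ge> m \<or> b \<noteq> 0" by (auto simp: S_def image_iff)
        thus "u p = 0" using Urow[OF u] p by blast
      qed (simp add: S_def)
    qed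
  next
    fix x assume x: "x \<in> U" thus "\<tau> x \<in> U" by (rule \<tau>)
    fix a
    show "\<tau> (fscale a x) = fscale a (\<tau> x)"
      by (rule uniq[symmetric]) (use x \<tau>[OF x] fvec.subspace_scale[OF sub] in \<open>auto simp: mmul_linear\<close>)
    fix y assume y: "y \<in> U"
    show "\<tau> (x + y) = \<tau> x + \<tau> y"
      by (rule uniq[symmetric]) (use x y \<tau>[OF x] \<tau>[OF y] fvec.subspace_add[OF sub] in \<open>auto simp: mmul_linear\<close>)
  qed (rule that)
  \<comment> \<open>Hence \<open>B - a A\<close> kills the nonzero \<open>w\<close>, against
    nonsingularity.\<close>
  have "mmul m B w = fscale a (mmul m A w)" using \<tau>(2)[OF w(1)] w(3) by (simp add: mmul_linear)
  hence "w = 0"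
    by (intro cancel[of "- a" w 1 0]) (use Urow[OF w(1)] in \<open>auto simp: fun_eq_iff fscale_def\<close>)
  thus False using w(2) by simp
qed

definition Sym :: "(nat \<times> nat \<Rightarrow> 'k) set" where
  "Sym = {Q. mtr Q = Q \<and> (\<forall>i j. i \<ge> m \<longrightarrow> Q (i, j) = 0)}"

lemma SymD: "Q \<in> Sym \<Longrightarrow> mtr Q = Q" "Q \<in> Sym \<Longrightarrow> i \<ge> m \<Longrightarrow> Q (i, j) = 0"
  "Q \<in> Sym \<Longrightarrow> j \<ge> m \<Longrightarrow> Q (i, j) = 0"
  unfolding Sym_def by (auto simp: mtr_def fun_eq_iff)

lemma Sym_subspace: "fvec.subspace Sym"
  by (rule fvec.subspaceI) (auto simp: Sym_def mtr_linear fscale_def mtr_def fun_eq_iff)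

lemma Sym_diff: "Q \<in> Sym \<Longrightarrow> Q' \<in> Sym \<Longrightarrow> Q - Q' \<in> Sym"
  by (auto simp: Sym_def mtr_linear)

lemma Sym_minus: "Q \<in> Sym \<Longrightarrow> - Q \<in> Sym"
  by (auto simp: Sym_def mtr_linear)

lemma mmul_Sym_zero:
  assumes "Q \<in> Sym" "mmul m Q (mtr B) = 0 \<or> mmul m Q (mtr A) = 0" shows "Q = 0"
  using assms cancel_mtr_A[of Q] cancel_mtr_B[of Q] SymD by blast

text \<open>For symmetric \<open>Q\<close> this is A Q B^T minus its transpose, hence an alternating
  matrix of size \<open>m + 1\<close>. Its bijectivity makes the factorisation of Q C^T through A^T
  and B^T exist and be unique.\<close>

definition Delta :: "(nat \<times> nat \<Rightarrow> 'k) \<Rightarrow> nat \<times> nat \<Rightarrow> 'k" where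
  "Delta Q = mmul m A (mmul m Q (mtr B)) - mmul m B (mmul m Q (mtr A))"

lemma Delta_linear:
  "Delta (P + Q) = Delta P + Delta Q" "Delta (fscale a Q) = fscale a (Delta Q)" "Delta 0 = 0"
  "Delta (- Q) = - Delta Q"
  by (auto simp: Delta_def mmul_linear fun_eq_iff fscale_apply algebra_simps)

text \<open>Put X = Q B^T. Then B X = B Q B^T is symmetric for every symmetric Q, and A X is
  symmetric because \<open>Delta Q = 0\<close>, so \<open>symmetric_pencil_zero\<close>
  applies.\<close>

lemma Delta_inj:
  assumes Q: "Q \<in> Sym" and D: "Delta Q = 0" shows "Q = 0"
proof -
  have "mmul m Q (mtr B) = 0"
  proof (rule symmetric_pencil_zero)
    show "mmul m Q (mtr B) (j, k) = 0" if "j \<ge> m" for j k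
      using SymD(2)[OF Q that] by (simp add: mmul_apply)
    show "mmul m Q (mtr B) (j, k) = 0" if "k \<ge> Suc m" for j k
      using that supp by (auto simp: mmul_apply mtr_apply)
    show "mtr (mmul m A (mmul m Q (mtr B))) = mmul m A (mmul m Q (mtr B))"
      using D by (simp add: mtr_mmul mtr_mtr SymD(1)[OF Q] Delta_def mmul_assoc)
    show "mtr (mmul m B (mmul m Q (mtr B))) = mmul m B (mmul m Q (mtr B))"
      by (simp add: mtr_mmul mtr_mtr SymD(1)[OF Q] mmul_assoc)
  qed
  thus ?thesis using mmul_Sym_zero[OF Q] by simp
qed

text \<open>Symmetric matrices of size \<open>m\<close> and skew-symmetric ones of size \<open>m + 1\<close> form spaces of
  the same dimension.\<close>

lemma Delta_surj:
  assumes Z: "\<And>i j. i \<ge> Suc m \<Longrightarrow> Z (i, j) = 0" "\<And>i j. j \<ge> Suc m \<Longrightarrow> Z (i, j) = 0"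
  shows "\<exists>Q. Q \<in> Sym \<and> Delta Q = Z - mtr Z"
proof -
  define P where "P = {(i, j). i \<le> j \<and> j < m}"
  have "P \<subseteq> {..<m} \<times> {..<m}" by (auto simp: P_def)
  hence "finite P" by (rule finite_subset) auto
  then obtain e where "bij_betw e {0..<card P} P" using ex_bij_betw_nat_finite by blast
  hence e: "bij_betw e {..<card P} P" by (simp add: atLeast0LessThan)
  define N where "N = card P"
  have eP: "e l \<in> P" if "l < N" for l using e that by (auto simp: N_def bij_betw_def)
  have e_inj: "e l = e l' \<longleftrightarrow> l = l'" if "l < N" "l' < N" for l l'
    using e that by (auto simp: N_def bij_betw_def inj_on_def)
  have e_surj: "\<exists>l<N. e l = (i, j)" if "i \<le> j" "j < m" for i j
  proof -
    have "(i, j) \<in> e ` {..<N}" using e that by (auto simp: N_def bij_betw_def P_def)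
    thus ?thesis by force
  qed
  define E where "E p = (\<lambda>(i, j). if (i, j) = p \<or> (j, i) = p then 1 else (0::'k))" for p :: "nat \<times> nat"
  define Qw where "Qw w = (\<Sum>l<N. fscale (w l) (E (e l)))" for w
  have E_Sym: "E p \<in> Sym" if "p \<in> P" for p
    using that by (auto simp: Sym_def E_def mtr_def P_def fun_eq_iff)
  have Qw_Sym: "Qw w \<in> Sym" for w unfolding Qw_def
    by (intro fvec.subspace_sum[OF Sym_subspace] fvec.subspace_scale[OF Sym_subspace] E_Sym eP) auto
  have Qw_e: "Qw w (e l) = w l" if l: "l < N" for w l
  proof -
    obtain i j where ij: "e l = (i, j)" "i \<le> j" using eP[OF l] by (auto simp: P_def)
    have "E (e k) (e l) = (if k = l then 1 else 0)" if k: "k < N" for k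
    proof -
      obtain i' j' where ij': "e k = (i', j')" "i' \<le> j'" using eP[OF k] by (auto simp: P_def)
      have "E (e k) (e l) = (if e k = e l then 1 else 0)"
        using ij ij' by (auto simp: E_def)
      thus ?thesis using e_inj[OF k l] by simp
    qed
    hence "Qw w (e l) = (\<Sum>k<N. if k = l then w k else 0)"
      unfolding Qw_def sum_fun_apply by (intro sum.cong) (auto simp: fscale_def)
    thus ?thesis using l by simp
  qed
  have DQw: "Delta (Qw w) q = (\<Sum>l<N. Delta (E (e l)) q * w l)" for w q
  proof -
    have "Delta (\<Sum>l<n. fscale (w l) (E (e l))) = (\<Sum>l<n. fscale (w l) (Delta (E (e l))))" for n
    proof (induction n)
      case (Suc n)
      thus ?case by (simp only: sum.lessThan_Suc Delta_linear)
    qed (simp add: Delta_linear del: zero_fun_apply)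
    thus ?thesis by (simp add: Qw_def sum_fun_apply fscale_def mult.commute)
  qed
  \<comment> \<open>The shift \<open>Suc\<close> matches the pairs i \<le> j < m, which index
    symmetric matrices of size m, with the entries (i, j + 1) strictly above the diagonal of a
    matrix of size m + 1. This makes \<open>Delta\<close> a square system.\<close>
  define S where "S k l = Delta (E (e l)) (fst (e k), Suc (snd (e k)))" for k l
  have skew: "Y = 0" if Y: "mtr Y = - Y" "\<And>i. Y (i, i) = 0" "\<And>i j. i \<ge> Suc m \<Longrightarrow> Y (i, j) = 0"
     "\<And>k. k < N \<Longrightarrow> Y (fst (e k), Suc (snd (e k))) = 0" for Y :: "nat \<times> nat \<Rightarrow> 'k"
  proof -
    have upper: "Y (i, j) = 0" if ij: "i < j" for i j
    proof (cases "j < Suc m")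
      case True
      hence "i \<le> j - 1" "j - 1 < m" using ij by auto
      then obtain k where "k < N" "e k = (i, j - 1)" using e_surj by blast
      thus ?thesis using Y(4)[of k] ij by simp
    next
      case False
      hence "Y (j, i) = 0" by (intro Y(3)) simp
      thus ?thesis using fun_cong[OF Y(1), of "(j, i)"] by (simp add: mtr_def)
    qed
    have "Y (i, j) = 0" for i j
    proof -
      consider "i < j" | "i = j" | "j < i" by linarith
      thus ?thesis
      proof cases
        case 3
        thus ?thesis using upper[OF 3] fun_cong[OF Y(1), of "(j, i)"] by (simp add: mtr_def)
      qed (use upper Y(2) in auto)
    qed
    thus ?thesis by (simp add: fun_eq_iff)
  qed
  have Delta_skew: "\<exists>V. Delta Q = V - mtr V \<and> (\<forall>i j. i \<ge> Suc m \<or> j \<ge> Suc m \<longrightarrow> V (i, j) = 0)" if "Q \<in> Sym" for Q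
  proof (intro exI[of _ "mmul m A (mmul m Q (mtr B))"] conjI allI impI)
    show "Delta Q = mmul m A (mmul m Q (mtr B)) - mtr (mmul m A (mmul m Q (mtr B)))"
      by (simp add: Delta_def mtr_mmul mtr_mtr SymD(1)[OF that] mmul_assoc)
    show "mmul m A (mmul m Q (mtr B)) (i, j) = 0" if "i \<ge> Suc m \<or> j \<ge> Suc m" for i j
      using that supp by (auto simp: mmul_apply mtr_apply)
  qed
  have "trivial_kernel N N S"
  proof (rule trivial_kernelI)
    fix w l assume w: "\<And>k. k < N \<Longrightarrow> (\<Sum>l<N. S k l * w l) = 0" and l: "l < N"
    obtain V where V: "Delta (Qw w) = V - mtr V" "\<forall>i j. i \<ge> Suc m \<or> j \<ge> Suc m \<longrightarrow> V (i, j) = 0"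
      using Delta_skew[OF Qw_Sym] by blast
    have "Delta (Qw w) = 0"
    proof (rule skew)
      show "mtr (Delta (Qw w)) = - Delta (Qw w)" by (simp add: V(1) mtr_linear mtr_mtr)
      show "Delta (Qw w) (i, i) = 0" for i by (simp add: V(1) mtr_def)
      show "Delta (Qw w) (i, j) = 0" if "i \<ge> Suc m" for i j using V(2) that by (simp add: V(1) mtr_def)
      show "Delta (Qw w) (fst (e k), Suc (snd (e k))) = 0" if "k < N" for k
        using w[OF that] by (simp add: DQw S_def)
    qed
    hence "Qw w = 0" by (rule Delta_inj[OF Qw_Sym])
    thus "w l = 0" using Qw_e[OF l, of w] by simp
  qed
  from square_solve[OF this, of "\<lambda>k. (Z - mtr Z) (fst (e k), Suc (snd (e k)))"] obtain w
    where w: "\<forall>k<N. (\<Sum>l<N. S k l * w l) = (Z - mtr Z) (fst (e k), Suc (snd (e k)))" by blast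
  obtain V where V: "Delta (Qw w) = V - mtr V" "\<forall>i j. i \<ge> Suc m \<or> j \<ge> Suc m \<longrightarrow> V (i, j) = 0"
    using Delta_skew[OF Qw_Sym] by blast
  have "Delta (Qw w) - (Z - mtr Z) = 0"
  proof (rule skew)
    show "mtr (Delta (Qw w) - (Z - mtr Z)) = - (Delta (Qw w) - (Z - mtr Z))" by (simp add: V(1) mtr_linear mtr_mtr)
    show "(Delta (Qw w) - (Z - mtr Z)) (i, i) = 0" for i by (simp add: V(1) mtr_def)
    show "(Delta (Qw w) - (Z - mtr Z)) (i, j) = 0" if "i \<ge> Suc m" for i j using V(2) that Z by (simp add: V(1) mtr_def)
    show "(Delta (Qw w) - (Z - mtr Z)) (fst (e k), Suc (snd (e k))) = 0" if "k < N" for k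
      using w that by (simp add: DQw S_def)
  qed
  thus ?thesis using Qw_Sym by auto
qed

text \<open>Let X = Q C^T - G2 A^T - G1 B^T. In A X the term with G2 is symmetric, and in B X the
  one with G1, so making these products symmetric prescribes \<open>Delta G1\<close> and
  \<open>Delta G2\<close> separately. Surjectivity of \<open>Delta\<close> solves both conditions,
  and \<open>symmetric_pencil_zero\<close> gives X = 0.\<close>

lemma C_factor:
  assumes Q: "Q \<in> Sym"
  shows "\<exists>G1 G2. G1 \<in> Sym \<and> G2 \<in> Sym \<and>
    mmul m Q (mtr C) = mmul m G2 (mtr A) + mmul m G1 (mtr B)"
proof -
  have out: "mmul m A (mmul m Q (mtr C)) (i, j) = 0 \<and> mmul m B (mmul m Q (mtr C)) (i, j) = 0"
    if "i \<ge> Suc m \<or> j \<ge> Suc m" for i j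
    using that supp by (auto simp: mmul_apply mtr_apply)
  obtain G1 where G1: "G1 \<in> Sym"
    "Delta G1 = mmul m A (mmul m Q (mtr C)) - mtr (mmul m A (mmul m Q (mtr C)))"
    using Delta_surj[of "mmul m A (mmul m Q (mtr C))"] out by blast
  obtain G2' where G2': "G2' \<in> Sym"
    "Delta G2' = mmul m B (mmul m Q (mtr C)) - mtr (mmul m B (mmul m Q (mtr C)))"
    using Delta_surj[of "mmul m B (mmul m Q (mtr C))"] out by blast
  define G2 where "G2 = - G2'"
  have G2: "G2 \<in> Sym" "Delta G2 = mtr (mmul m B (mmul m Q (mtr C))) - mmul m B (mmul m Q (mtr C))"
    using G2' Sym_minus by (auto simp: G2_def Delta_linear)
  define X where "X = mmul m Q (mtr C) - mmul m G2 (mtr A) - mmul m G1 (mtr B)"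
  note sym = SymD(1)[OF Q] SymD(1)[OF G1(1)] SymD(1)[OF G2(1)]
  have "X = 0"
  proof (rule symmetric_pencil_zero)
    show "X (j, k) = 0" if "j \<ge> m" for j k
      using SymD(2)[OF Q that] SymD(2)[OF G1(1) that] SymD(2)[OF G2(1) that]
      by (simp add: X_def mmul_apply)
    show "X (j, k) = 0" if "k \<ge> Suc m" for j k
      using that supp by (auto simp: X_def mmul_apply mtr_apply)
    show "mtr (mmul m A X) = mmul m A X"
      using G1(2) by (simp add: X_def mmul_linear mtr_linear mtr_mmul mtr_mtr sym mmul_assoc Delta_def algebra_simps)
    show "mtr (mmul m B X) = mmul m B X"
      using G2(2) by (simp add: X_def mmul_linear mtr_linear mtr_mmul mtr_mtr sym mmul_assoc Delta_def algebra_simps)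
  qed
  thus ?thesis using G1(1) G2(1)
    by (intro exI[of _ G1] exI[of _ G2]) (simp add: X_def algebra_simps)
qed

text \<open>The differences satisfy D1 B^T = - D2 A^T. So A D1 B^T = - A D2 A^T is symmetric, that
  is, \<open>Delta D1 = 0\<close>.\<close>

lemma C_factor_unique:
  assumes Q: "G1 \<in> Sym" "G2 \<in> Sym" "H1 \<in> Sym" "H2 \<in> Sym"
    and eq: "mmul m G2 (mtr A) + mmul m G1 (mtr B) = mmul m H2 (mtr A) + mmul m H1 (mtr B)"
  shows "G1 = H1" "G2 = H2"
proof -
  define D1 where "D1 = G1 - H1"
  define D2 where "D2 = G2 - H2"
  have D: "D1 \<in> Sym" "D2 \<in> Sym" using Q by (auto simp: D1_def D2_def intro: Sym_diff)
  have "mmul m D2 (mtr A) + mmul m D1 (mtr B) = 0"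
    using eq by (simp add: D1_def D2_def mmul_linear algebra_simps)
  hence e: "mmul m D1 (mtr B) = - mmul m D2 (mtr A)" by (simp add: eq_neg_iff_add_eq_0 add.commute)
  hence e': "mmul m D1 (mtr B) = mmul m (- D2) (mtr A)"
    by (simp add: mmul_linear)
  have "mmul m A (mmul m D1 (mtr B)) = mmul m A (mmul m (- D2) (mtr A))"
    by (simp only: e')
  moreover have "mtr (mmul m A (mmul m (- D2) (mtr A))) = mmul m A (mmul m (- D2) (mtr A))"
    by (simp add: mtr_mmul mtr_mtr mtr_linear SymD(1)[OF D(2)] mmul_assoc)
  ultimately have "mtr (mmul m A (mmul m D1 (mtr B))) = mmul m A (mmul m D1 (mtr B))" by simp
  hence "Delta D1 = 0"
    by (simp add: Delta_def mtr_mmul mtr_mtr SymD(1)[OF D(1)] mmul_assoc)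
  hence D1: "D1 = 0" by (rule Delta_inj[OF D(1)])
  hence "mmul m D2 (mtr A) = 0" using e by (simp add: mmul_linear)
  hence "D2 = 0" using mmul_Sym_zero[OF D(2)] by simp
  thus "G1 = H1" "G2 = H2" using D1 by (auto simp: D1_def D2_def)
qed

lemma Sym_span: "finite ((\<lambda>p q. if q = p then 1 else (0::'k)) ` ({..<m} \<times> {..<m}))"
    "Sym \<subseteq> fvec.span ((\<lambda>p q. if q = p then 1 else (0::'k)) ` ({..<m} \<times> {..<m}))"
proof -
  show "Sym \<subseteq> fvec.span ((\<lambda>p q. if q = p then 1 else (0::'k)) ` ({..<m} \<times> {..<m}))"
  proof
    fix Q assume Q: "Q \<in> Sym"
    show "Q \<in> fvec.span ((\<lambda>p q. if q = p then 1 else (0::'k)) ` ({..<m} \<times> {..<m}))"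
    proof (rule finite_support_span)
      fix p :: "nat \<times> nat" assume "p \<notin> {..<m} \<times> {..<m}"
      moreover obtain i j where p: "p = (i, j)" by (cases p)
      ultimately have "i \<ge> m \<or> j \<ge> m" by auto
      thus "Q p = 0" using SymD(2,3)[OF Q] p by blast
    qed auto
  qed
qed auto

text \<open>The operators \<open>\<Gamma>\<^sub>1, \<Gamma>\<^sub>2\<close> on symmetric matrices defined by
  \<open>Q C\<^sup>T = \<Gamma>\<^sub>2(Q) A\<^sup>T + \<Gamma>\<^sub>1(Q) B\<^sup>T\<close> commute because \<open>C Q C\<^sup>T\<close> is symmetric. A common
  eigenvector \<open>Q\<close> satisfies \<open>(C - a B - b A) Q = 0\<close>.\<close>

lemma dimension_zero: "m = 0"
proof (rule ccontr)
  assume "m \<noteq> 0"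
  have "\<forall>Q\<in>Sym. \<exists>G. fst G \<in> Sym \<and> snd G \<in> Sym \<and>
      mmul m Q (mtr C) = mmul m (snd G) (mtr A) + mmul m (fst G) (mtr B)"
  proof
    fix Q assume "Q \<in> Sym"
    then obtain G1 G2 where "G1 \<in> Sym" "G2 \<in> Sym"
      "mmul m Q (mtr C) = mmul m G2 (mtr A) + mmul m G1 (mtr B)" using C_factor by blast
    thus "\<exists>G. fst G \<in> Sym \<and> snd G \<in> Sym \<and>
      mmul m Q (mtr C) = mmul m (snd G) (mtr A) + mmul m (fst G) (mtr B)"
      by (intro exI[of _ "(G1, G2)"]) simp
  qed
  from bchoice[OF this] obtain G where G: "\<forall>Q\<in>Sym. fst (G Q) \<in> Sym \<and> snd (G Q) \<in> Sym \<and>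
      mmul m Q (mtr C) = mmul m (snd (G Q)) (mtr A) + mmul m (fst (G Q)) (mtr B)" ..
  define g1 g2 where "g1 Q = fst (G Q)" and "g2 Q = snd (G Q)" for Q
  have g: "g1 Q \<in> Sym" "g2 Q \<in> Sym"
      "mmul m Q (mtr C) = mmul m (g2 Q) (mtr A) + mmul m (g1 Q) (mtr B)" if "Q \<in> Sym" for Q
    using bspec[OF G that] unfolding g1_def g2_def by blast+
  have g': "mmul m C Q = mmul m A (g2 Q) + mmul m B (g1 Q)" if "Q \<in> Sym" for Q
    using arg_cong[OF g(3)[OF that], of mtr] SymD(1) that g(1,2)[OF that]
    by (simp add: mtr_mmul mtr_mtr mtr_linear)
  note add_Sym = fvec.subspace_add[OF Sym_subspace]
  note scale_Sym = fvec.subspace_scale[OF Sym_subspace]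
  have g_add: "g1 (Q + Q') = g1 Q + g1 Q'" "g2 (Q + Q') = g2 Q + g2 Q'" if "Q \<in> Sym" "Q' \<in> Sym" for Q Q'
  proof -
    have S: "Q + Q' \<in> Sym" "g1 Q + g1 Q' \<in> Sym" "g2 Q + g2 Q' \<in> Sym"
      using that g add_Sym by auto
    have "mmul m (g2 (Q + Q')) (mtr A) + mmul m (g1 (Q + Q')) (mtr B) =
       mmul m (g2 Q + g2 Q') (mtr A) + mmul m (g1 Q + g1 Q') (mtr B)"
      using g(3)[OF S(1)] g(3)[OF that(1)] g(3)[OF that(2)] by (simp add: mmul_linear algebra_simps)
    from C_factor_unique[OF g(1)[OF S(1)] g(2)[OF S(1)] S(2,3) this]
    show "g1 (Q + Q') = g1 Q + g1 Q'" "g2 (Q + Q') = g2 Q + g2 Q'" by auto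
  qed
  have g_scale: "g1 (fscale a Q) = fscale a (g1 Q)" "g2 (fscale a Q) = fscale a (g2 Q)" if "Q \<in> Sym" for Q a
  proof -
    have S: "fscale a Q \<in> Sym" "fscale a (g1 Q) \<in> Sym" "fscale a (g2 Q) \<in> Sym"
      using that g scale_Sym by auto
    have "mmul m (g2 (fscale a Q)) (mtr A) + mmul m (g1 (fscale a Q)) (mtr B) = fscale a (mmul m Q (mtr C))"
      using g(3)[OF S(1)] by (simp add: mmul_linear)
    also have "\<dots> = mmul m (fscale a (g2 Q)) (mtr A) + mmul m (fscale a (g1 Q)) (mtr B)"
      unfolding g(3)[OF that] by (simp add: mmul_linear fun_eq_iff fscale_apply algebra_simps)
    finally have "mmul m (g2 (fscale a Q)) (mtr A) + mmul m (g1 (fscale a Q)) (mtr B) =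
        mmul m (fscale a (g2 Q)) (mtr A) + mmul m (fscale a (g1 Q)) (mtr B)" .
    from C_factor_unique[OF g(1)[OF S(1)] g(2)[OF S(1)] S(2,3) this]
    show "g1 (fscale a Q) = fscale a (g1 Q)" "g2 (fscale a Q) = fscale a (g2 Q)" by auto
  qed
  \<comment> \<open>Expand C Q C^T first in the right factor and then in the left one. In the
    difference with its transpose the terms between A and A^T and between B and B^T cancel, and
    \<open>Delta\<close> of the commutator is left.\<close>
  have commute: "g1 (g2 Q) = g2 (g1 Q)" if Q: "Q \<in> Sym" for Q
  proof -
    note S = g(1)[OF Q] g(2)[OF Q]
    note SS = g(1)[OF S(1)] g(2)[OF S(1)] g(1)[OF S(2)] g(2)[OF S(2)]
    define Y where "Y = mmul m C (mmul m Q (mtr C))"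
    have "mtr Y = Y" by (simp add: Y_def mtr_mmul mtr_mtr SymD(1)[OF Q] mmul_assoc)
    have "Y = mmul m (mmul m C (g2 Q)) (mtr A) + mmul m (mmul m C (g1 Q)) (mtr B)"
      unfolding Y_def g(3)[OF Q] by (simp add: mmul_linear mmul_assoc)
    also have "\<dots> = mmul m A (mmul m (g2 (g2 Q)) (mtr A)) + mmul m B (mmul m (g1 (g2 Q)) (mtr A)) +
        (mmul m A (mmul m (g2 (g1 Q)) (mtr B)) + mmul m B (mmul m (g1 (g1 Q)) (mtr B)))"
      unfolding g'[OF S(1)] g'[OF S(2)] by (simp add: mmul_linear mmul_assoc)
    finally have Y: "Y = \<dots>" .
    have Y': "mtr Y = mmul m A (mmul m (g2 (g2 Q)) (mtr A)) + mmul m A (mmul m (g1 (g2 Q)) (mtr B)) +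
        (mmul m B (mmul m (g2 (g1 Q)) (mtr A)) + mmul m B (mmul m (g1 (g1 Q)) (mtr B)))"
      unfolding Y by (simp add: mtr_linear mtr_mmul mtr_mtr SymD(1)[OF SS(1)] SymD(1)[OF SS(2)]
          SymD(1)[OF SS(3)] SymD(1)[OF SS(4)] mmul_assoc)
    have "Delta (g2 (g1 Q) - g1 (g2 Q)) = Y - mtr Y"
      unfolding Y' unfolding Y by (simp add: Delta_def mmul_linear algebra_simps)
    hence "Delta (g2 (g1 Q) - g1 (g2 Q)) = 0" using \<open>mtr Y = Y\<close> by simp
    hence "g2 (g1 Q) - g1 (g2 Q) = 0" using Delta_inj Sym_diff SS by blast
    thus ?thesis by simp
  qed
  \<comment> \<open>A nonzero symmetric matrix to start from; this is where
    \<open>m \<noteq> 0\<close> enters.\<close>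
  define E where "E = (\<lambda>p :: nat \<times> nat. if p = (0, 0) then 1 else (0::'k))"
  have E: "E \<in> Sym" "E \<noteq> 0"
    using \<open>m \<noteq> 0\<close> by (auto simp: E_def Sym_def mtr_def fun_eq_iff)
  obtain Q1 a where Q1: "Q1 \<in> Sym" "Q1 \<noteq> 0" "g1 Q1 = fscale a Q1"
    by (rule fvec_eigenvector[OF Sym_subspace Sym_span E, of g1]) (use g(1) g_add g_scale in auto)
  \<comment> \<open>The eigenspace of \<open>g1\<close> is preserved by \<open>g2\<close>, since the
    two commute, and so contains an eigenvector of \<open>g2\<close>.\<close>
  define U where "U = {Q \<in> Sym. g1 Q = fscale a Q}"
  have U: "fvec.subspace U"
  proof (rule fvec.subspaceI)
    show "0 \<in> U" using fvec.subspace_0[OF Sym_subspace] g_scale(1)[of 0 0] by (simp add: U_def)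
  qed (auto simp: U_def add_Sym scale_Sym g_add g_scale fun_eq_iff fscale_apply algebra_simps)
  have US: "U \<subseteq> Sym" by (auto simp: U_def)
  have "Q1 \<in> U" using Q1 by (simp add: U_def)
  obtain Q b where Q: "Q \<in> U" "Q \<noteq> 0" "g2 Q = fscale b Q"
  proof (rule fvec_eigenvector[OF U Sym_span(1) _ \<open>Q1 \<in> U\<close> Q1(2), of g2])
    show "U \<subseteq> fvec.span ((\<lambda>p q. if q = p then 1 else 0) ` ({..<m} \<times> {..<m}))"
      using US Sym_span(2) by (rule subset_trans)
    show "g2 Q \<in> U" if "Q \<in> U" for Q
      using that g(2) commute[of Q] g_scale(2) by (auto simp: U_def)
    show "g2 (x + y) = g2 x + g2 y" if "x \<in> U" "y \<in> U" for x y
      using g_add(2) that US by blast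
    show "g2 (fscale a x) = fscale a (g2 x)" if "x \<in> U" for a x
      using g_scale(2) that US by blast
  qed
  have "mmul m C Q = fscale b (mmul m A Q) + fscale a (mmul m B Q)"
    using g'[of Q] Q US by (auto simp: U_def mmul_linear)
  hence "Q = 0"
    by (intro cancel[of "- b" Q "- a" 1]) (use SymD(2) Q(1) US in \<open>auto simp: fun_eq_iff fscale_apply\<close>)
  thus False using Q(2) by simp
qed

end

section \<open>Locally rational functions\<close>

definition monomial_fn :: "('n::finite \<Rightarrow> nat) \<Rightarrow> 'k::field ^ 'n \<Rightarrow> 'k" where
  "monomial_fn e v = (\<Prod>i\<in>UNIV. (v $ i) ^ e i)"

lemma finite_exponents: "finite {e :: 'n::finite \<Rightarrow> nat. (\<Sum>i\<in>UNIV. e i) = d}"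
proof (rule finite_subset)
  show "{e :: 'n \<Rightarrow> nat. (\<Sum>i\<in>UNIV. e i) = d} \<subseteq> {e. \<forall>i. (i \<in> UNIV \<longrightarrow> e i \<in> {..d}) \<and> (i \<notin> UNIV \<longrightarrow> e i = 0)}"
    using member_le_sum[of _ UNIV] by force
qed (rule finite_set_of_finite_funs, auto)

lemma homogeneous_iff:
  "homogeneous d g \<longleftrightarrow> (\<exists>a. g = (\<lambda>v. \<Sum>e | (\<Sum>i\<in>UNIV. e i) = d. a e * monomial_fn e v))"
  by (simp add: homogeneous_def monomial_fn_def)

lemma homogeneous_monomial:
  assumes "(\<Sum>i\<in>UNIV. e i) = d"
  shows "homogeneous d (monomial_fn e)"
proof -
  have "monomial_fn e = (\<lambda>v. \<Sum>e' | (\<Sum>i\<in>UNIV. e' i) = d. (if e' = e then 1 else 0) * monomial_fn e' v)"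
    by (rule ext) (use assms in \<open>simp add: finite_exponents if_distrib[of "\<lambda>x. x * _"] cong: if_cong\<close>)
  thus ?thesis unfolding homogeneous_iff by (rule exI[of _ "\<lambda>e'. if e' = e then 1 else 0"])
qed

lemma homogeneous_0: "homogeneous d (\<lambda>v. 0)"
  unfolding homogeneous_iff by (rule exI[of _ "\<lambda>_. 0"]) auto

lemma homogeneous_add:
  assumes "homogeneous d g" "homogeneous d h"
  shows "homogeneous d (\<lambda>v. g v + h v)"
proof -
  obtain a b where "g = (\<lambda>v. \<Sum>e | (\<Sum>i\<in>UNIV. e i) = d. a e * monomial_fn e v)"
    "h = (\<lambda>v. \<Sum>e | (\<Sum>i\<in>UNIV. e i) = d. b e * monomial_fn e v)"
    using assms unfolding homogeneous_iff by blast
  thus ?thesis unfolding homogeneous_iff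
    by (intro exI[of _ "\<lambda>e. a e + b e"]) (auto simp: fun_eq_iff algebra_simps sum.distrib)
qed

lemma homogeneous_scale:
  assumes "homogeneous d g"
  shows "homogeneous d (\<lambda>v. c * g v)"
proof -
  obtain a where "g = (\<lambda>v. \<Sum>e | (\<Sum>i\<in>UNIV. e i) = d. a e * monomial_fn e v)"
    using assms unfolding homogeneous_iff by blast
  thus ?thesis unfolding homogeneous_iff
    by (intro exI[of _ "\<lambda>e. c * a e"]) (auto simp: fun_eq_iff sum_distrib_left mult.assoc)
qed

lemma homogeneous_sum:
  assumes "\<And>s. s \<in> S \<Longrightarrow> homogeneous d (g s)"
  shows "homogeneous d (\<lambda>v. \<Sum>s\<in>S. g s v)"
  using assms
  by (induction S rule: infinite_finite_induct) (auto intro: homogeneous_0 homogeneous_add)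

lemma homogeneous_mult:
  assumes "homogeneous d g" "homogeneous e h"
  shows "homogeneous (d + e) (\<lambda>v. g v * h v)"
proof -
  obtain a b where ab: "g = (\<lambda>v. \<Sum>e | (\<Sum>i\<in>UNIV. e i) = d. a e * monomial_fn e v)"
    "h = (\<lambda>v. \<Sum>f | (\<Sum>i\<in>UNIV. f i) = e. b f * monomial_fn f v)"
    using assms unfolding homogeneous_iff by blast
  have eq: "(\<lambda>v. g v * h v) = (\<lambda>v. \<Sum>e' | (\<Sum>i\<in>UNIV. e' i) = d. \<Sum>f | (\<Sum>i\<in>UNIV. f i) = e.
      (a e' * b f) * monomial_fn (\<lambda>i. e' i + f i) v)"
    unfolding ab sum_product monomial_fn_def
    by (intro ext sum.cong refl) (simp add: power_add prod.distrib mult_ac)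
  show ?thesis unfolding eq
    by (intro homogeneous_sum homogeneous_scale homogeneous_monomial) (auto simp: sum.distrib)
qed

lemma homogeneous_const: "homogeneous 0 (\<lambda>v. c)"
proof -
  have "homogeneous 0 (\<lambda>v :: 'a ^ 'b. c * monomial_fn (\<lambda>i. 0) v)"
    by (intro homogeneous_scale homogeneous_monomial) simp
  thus ?thesis by (simp add: monomial_fn_def)
qed

lemma homogeneous_coord: "homogeneous 1 (\<lambda>v. v $ i)"
proof -
  have "homogeneous 1 (monomial_fn (\<lambda>j. if j = i then 1 else 0) :: 'a ^ 'b \<Rightarrow> 'a)"
    by (intro homogeneous_monomial) simp
  also have "(monomial_fn (\<lambda>j. if j = i then 1 else 0) :: 'a ^ 'b \<Rightarrow> 'a) = (\<lambda>v. v $ i)"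
    by (auto simp: monomial_fn_def fun_eq_iff if_distrib[of "\<lambda>e. _ ^ e"] cong: if_cong)
  finally show ?thesis .
qed

lemma homogeneous_prod:
  assumes "finite S" "\<And>s. s \<in> S \<Longrightarrow> homogeneous (d s) (g s)"
  shows "homogeneous (\<Sum>s\<in>S. d s) (\<lambda>v. \<Prod>s\<in>S. g s v)"
  using assms by (induction S rule: finite_induct) (auto intro: homogeneous_const homogeneous_mult)

lemma homogeneous_prod_const:
  assumes "finite S" "\<And>s. s \<in> S \<Longrightarrow> homogeneous d (g s)"
  shows "homogeneous (card S * d) (\<lambda>v. \<Prod>s\<in>S. g s v)"
  using homogeneous_prod[of S "\<lambda>_. d" g] assms by simp

lemma homogeneous_power:
  "homogeneous d g \<Longrightarrow> homogeneous (n * d) (\<lambda>v. g v ^ n)"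
  using homogeneous_prod_const[of "{..<n}" d "\<lambda>_. g"] by simp

lemma homogeneous_scaling:
  assumes "homogeneous d g"
  shows "g (c *s v) = c ^ d * g v"
proof -
  obtain a where g: "g = (\<lambda>v. \<Sum>e | (\<Sum>i\<in>UNIV. e i) = d. a e * monomial_fn e v)"
    using assms unfolding homogeneous_iff by blast
  have "monomial_fn e (c *s v) = c ^ (\<Sum>i\<in>UNIV. e i) * monomial_fn e v" for e
    by (simp add: monomial_fn_def power_mult_distrib prod.distrib power_sum)
  thus ?thesis unfolding g by (auto simp: sum_distrib_left mult_ac intro!: sum.cong)
qed

lemma homogeneous_on_line:
  assumes "homogeneous d g"
  shows "\<exists>p. \<forall>t. g (u + t *s w) = poly p t"
proof -
  obtain a where g: "g = (\<lambda>v. \<Sum>e | (\<Sum>i\<in>UNIV. e i) = d. a e * monomial_fn e v)"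
    using assms unfolding homogeneous_iff by blast
  define p where "p = (\<Sum>e | (\<Sum>i\<in>UNIV. e i) = d. Polynomial.smult (a e) (\<Prod>i\<in>UNIV. [:u $ i, w $ i:] ^ e i))"
  have "g (u + t *s w) = poly p t" for t
    unfolding g p_def monomial_fn_def by (simp add: poly_sum poly_prod)
  thus ?thesis by blast
qed

text \<open>The germ at \<open>v\<close> of a section of O(d), read as a function of degree
  \<open>d\<close> on the cone \<open>X\<close>. The set where the denominator does not vanish
  serves as the neighbourhood, so no topology on the cone is needed.\<close>

definition rat_at :: "('k::field ^ 'n::finite) set \<Rightarrow> 'k ^ 'n \<Rightarrow> int \<Rightarrow> ('k ^ 'n \<Rightarrow> 'k) \<Rightarrow> bool" where
  "rat_at X v d F \<longleftrightarrow> (\<exists>e e' g h. homogeneous e g \<and> homogeneous e' h \<and> int e = int e' + d \<and>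
     h v \<noteq> 0 \<and> (\<forall>u\<in>X. h u \<noteq> 0 \<longrightarrow> F u = g u / h u))"

definition rational :: "('k::field ^ 'n::finite) set \<Rightarrow> int \<Rightarrow> ('k ^ 'n \<Rightarrow> 'k) \<Rightarrow> bool" where
  "rational X d F \<longleftrightarrow> (\<forall>v\<in>X. rat_at X v d F)"

lemma rat_atI:
  assumes "homogeneous e g" "homogeneous e' h" "int e = int e' + d" "h v \<noteq> 0"
    "\<And>u. u \<in> X \<Longrightarrow> h u \<noteq> 0 \<Longrightarrow> F u = g u / h u"
  shows "rat_at X v d F"
  using assms unfolding rat_at_def by blast

lemma rat_atE:
  assumes "rat_at X v d F"
  obtains e e' g h where "homogeneous e g" "homogeneous e' h" "int e = int e' + d" "h v \<noteq> 0"
    "\<And>u. u \<in> X \<Longrightarrow> h u \<noteq> 0 \<Longrightarrow> F u = g u / h u"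
  using assms unfolding rat_at_def by blast

lemma rat_at_homogeneous: "homogeneous d g \<Longrightarrow> rat_at X v (int d) g"
  by (rule rat_atI[of d g 0 "\<lambda>_. 1"]) (auto intro: homogeneous_const)

lemma rat_at_0:
  assumes "v \<noteq> 0"
  shows "rat_at X v d (\<lambda>u. 0)"
proof -
  obtain i where i: "v $ i \<noteq> 0" using assms by (auto simp: Finite_Cartesian_Product.vec_eq_iff)
  \<comment> \<open>For negative \<open>d\<close> the degree has to come from the denominator, hence
    the power of a coordinate that is nonzero at \<open>v\<close>. Truncation by \<open>nat\<close>
    makes one of the two exponents vanish.\<close>
  show ?thesis
    by (rule rat_atI[of "nat d" "\<lambda>_. 0" "nat (- d)" "\<lambda>v. (v $ i) ^ nat (- d)"])
      (use i homogeneous_power[OF homogeneous_coord, of "nat (- d)" i] in \<open>auto intro: homogeneous_0\<close>)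
qed

lemma rat_at_const: "rat_at X v 0 (\<lambda>u. c)"
  using rat_at_homogeneous[OF homogeneous_const, of X v c] by simp

lemma rat_at_mono: "rat_at X v d F \<Longrightarrow> Y \<subseteq> X \<Longrightarrow> rat_at Y v d F"
  unfolding rat_at_def by blast

lemma rat_at_cong: "rat_at X v d F \<Longrightarrow> (\<And>u. u \<in> X \<Longrightarrow> F u = G u) \<Longrightarrow> rat_at X v d G"
  unfolding rat_at_def by auto

lemma rat_at_mult:
  assumes "rat_at X v d F" "rat_at X v e G"
  shows "rat_at X v (d + e) (\<lambda>u. F u * G u)"
proof -
  obtain a a' g h where 1: "homogeneous a g" "homogeneous a' h" "int a = int a' + d" "h v \<noteq> 0"
    "\<And>u. u \<in> X \<Longrightarrow> h u \<noteq> 0 \<Longrightarrow> F u = g u / h u" using assms(1) by (rule rat_atE) blast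
  obtain b b' k l where 2: "homogeneous b k" "homogeneous b' l" "int b = int b' + e" "l v \<noteq> 0"
    "\<And>u. u \<in> X \<Longrightarrow> l u \<noteq> 0 \<Longrightarrow> G u = k u / l u" using assms(2) by (rule rat_atE) blast
  show ?thesis
    by (rule rat_atI[OF homogeneous_mult[OF 1(1) 2(1)] homogeneous_mult[OF 1(2) 2(2)]])
      (use 1(3-) 2(3-) in auto)
qed

lemma rat_at_add:
  assumes "rat_at X v d F" "rat_at X v d G"
  shows "rat_at X v d (\<lambda>u. F u + G u)"
proof -
  obtain a a' g h where 1: "homogeneous a g" "homogeneous a' h" "int a = int a' + d" "h v \<noteq> 0"
    "\<And>u. u \<in> X \<Longrightarrow> h u \<noteq> 0 \<Longrightarrow> F u = g u / h u" using assms(1) by (rule rat_atE) blast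
  obtain b b' k l where 2: "homogeneous b k" "homogeneous b' l" "int b = int b' + d" "l v \<noteq> 0"
    "\<And>u. u \<in> X \<Longrightarrow> l u \<noteq> 0 \<Longrightarrow> G u = k u / l u" using assms(2) by (rule rat_atE) blast
  have eq: "a' + b = a + b'" using 1(3) 2(3) by linarith
  have "homogeneous (a + b') (\<lambda>u. h u * k u)" using homogeneous_mult[OF 1(2) 2(1)] eq by simp
  from homogeneous_add[OF homogeneous_mult[OF 1(1) 2(2)] this]
  have h: "homogeneous (a + b') (\<lambda>u. g u * l u + h u * k u)" .
  show ?thesis
    by (rule rat_atI[OF h homogeneous_mult[OF 1(2) 2(2)]])
      (use 1(3-) 2(3-) in \<open>auto simp: field_simps\<close>)
qed

lemma rat_at_scale: "rat_at X v d F \<Longrightarrow> rat_at X v d (\<lambda>u. c * F u)"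
  using rat_at_mult[OF rat_at_const, of X v d F c] by simp

lemma rat_at_diff:
  assumes "rat_at X v d F" "rat_at X v d G"
  shows "rat_at X v d (\<lambda>u. F u - G u)"
  using rat_at_add[OF assms(1) rat_at_scale[OF assms(2), of "- 1"]] by simp

lemma rat_at_sum:
  assumes "v \<noteq> 0" "\<And>s. s \<in> S \<Longrightarrow> rat_at X v d (F s)"
  shows "rat_at X v d (\<lambda>u. \<Sum>s\<in>S. F s u)"
  using assms(2)
  by (induction S rule: infinite_finite_induct) (auto intro: rat_at_0[OF assms(1)] rat_at_add)

lemma rat_at_prod:
  assumes "finite S" "\<And>s. s \<in> S \<Longrightarrow> rat_at X v (d s) (F s)"
  shows "rat_at X v (\<Sum>s\<in>S. d s) (\<lambda>u. \<Prod>s\<in>S. F s u)"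
  using assms
  by (induction S rule: finite_induct) (auto intro: rat_at_const rat_at_mult)

lemma rat_at_inverse:
  assumes "rat_at X v d F" "v \<in> X" "F v \<noteq> 0"
  shows "rat_at X v (- d) (\<lambda>u. 1 / F u)"
proof -
  obtain a a' g h where 1: "homogeneous a g" "homogeneous a' h" "int a = int a' + d" "h v \<noteq> 0"
    "\<And>u. u \<in> X \<Longrightarrow> h u \<noteq> 0 \<Longrightarrow> F u = g u / h u" using assms(1) by (rule rat_atE) blast
  have "g v \<noteq> 0" using 1(5)[OF assms(2) 1(4)] assms(3) by auto
  \<comment> \<open>Extending the inverted fraction by \<open>h\<close> confines its domain to the
    set where the formula for \<open>F\<close> holds.\<close>
  show ?thesis
    by (rule rat_atI[OF homogeneous_mult[OF 1(2) 1(2)] homogeneous_mult[OF 1(1) 1(2)]])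
      (use 1(3-) \<open>g v \<noteq> 0\<close> in auto)
qed

lemma rat_at_divide:
  assumes "rat_at X v d F" "rat_at X v e G" "v \<in> X" "G v \<noteq> 0"
  shows "rat_at X v (d - e) (\<lambda>u. F u / G u)"
  using rat_at_mult[OF assms(1) rat_at_inverse[OF assms(2-4)]] by simp

lemma rat_at_power_int:
  assumes "v \<in> X" "v $ i \<noteq> 0"
  shows "rat_at X v d (\<lambda>u. (u $ i) powi d)"
proof (cases "d \<ge> 0")
  case True
  have "homogeneous (nat d) (\<lambda>u :: 'a ^ 'b. (u $ i) ^ nat d)"
    using homogeneous_power[OF homogeneous_coord, of "nat d" i] by simp
  from rat_at_homogeneous[OF this, of X v] True show ?thesis
    by (simp add: power_int_def)
next
  case False
  have "homogeneous (nat (- d)) (\<lambda>u :: 'a ^ 'b. (u $ i) ^ nat (- d))"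
    using homogeneous_power[OF homogeneous_coord, of "nat (- d)" i] by simp
  from rat_at_inverse[OF rat_at_homogeneous[OF this] assms(1)] False assms(2) show ?thesis
    by (simp add: power_int_def field_simps)
qed

text \<open>Locality: extending the fraction by \<open>k\<close> makes the new denominator vanish
  outside the smaller set.\<close>

lemma rat_at_open:
  assumes "homogeneous e k" "k v \<noteq> 0" "rat_at (X \<inter> {u. k u \<noteq> 0}) v d F"
  shows "rat_at X v d F"
proof -
  obtain a a' g h where 1: "homogeneous a g" "homogeneous a' h" "int a = int a' + d" "h v \<noteq> 0"
    "\<And>u. u \<in> X \<inter> {u. k u \<noteq> 0} \<Longrightarrow> h u \<noteq> 0 \<Longrightarrow> F u = g u / h u" using assms(3) by (rule rat_atE) blast
  show ?thesis
    by (rule rat_atI[OF homogeneous_mult[OF 1(1) assms(1)] homogeneous_mult[OF 1(2) assms(1)]])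
      (use 1(3-) assms(2) in auto)
qed

lemma rat_at_nonzero_open:
  assumes "rat_at X v d F" "v \<in> X" "F v \<noteq> 0"
  shows "\<exists>e k. homogeneous e k \<and> k v \<noteq> 0 \<and> (\<forall>u\<in>X. k u \<noteq> 0 \<longrightarrow> F u \<noteq> 0)"
proof -
  obtain a a' g h where 1: "homogeneous a g" "homogeneous a' h" "int a = int a' + d" "h v \<noteq> 0"
    "\<And>u. u \<in> X \<Longrightarrow> h u \<noteq> 0 \<Longrightarrow> F u = g u / h u" using assms(1) by (rule rat_atE) blast
  have "g v \<noteq> 0" using 1(5)[OF assms(2) 1(4)] assms(3) by auto
  show ?thesis
    by (rule exI, rule exI, rule conjI[OF homogeneous_mult[OF 1(1) 1(2)]])
      (use 1(3-) \<open>g v \<noteq> 0\<close> in auto)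
qed

text \<open>Homogeneity of \<open>F\<close> along a ray follows from the local form, since the
  denominator has no zero on the ray of \<open>v\<close> away from the origin.\<close>

lemma rat_at_scaling:
  assumes "rat_at X v d F" "v \<in> X" "c *s v \<in> X" "c \<noteq> 0"
  shows "F (c *s v) = c powi d * F v"
proof -
  obtain a a' g h where 1: "homogeneous a g" "homogeneous a' h" "int a = int a' + d" "h v \<noteq> 0"
    "\<And>u. u \<in> X \<Longrightarrow> h u \<noteq> 0 \<Longrightarrow> F u = g u / h u" using assms(1) by (rule rat_atE) blast
  have "h (c *s v) \<noteq> 0" using 1(4) assms(4) by (simp add: homogeneous_scaling[OF 1(2)])
  hence "F (c *s v) = (c ^ a * g v) / (c ^ a' * h v)"
    using 1(5)[OF assms(3)] by (simp add: homogeneous_scaling[OF 1(1)] homogeneous_scaling[OF 1(2)])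
  also have "\<dots> = c powi (int a - int a') * (g v / h v)"
    using assms(4) by (simp add: power_int_diff)
  finally show ?thesis using 1(3) 1(5)[OF assms(2) 1(4)] by simp
qed

text \<open>Gaussian elimination, one unknown at a time.\<close>

lemma rat_at_solve:
  fixes B :: "nat \<Rightarrow> nat \<Rightarrow> 'k::field ^ 'n::finite \<Rightarrow> 'k"
  assumes "v \<in> X" "v \<noteq> 0"
    and "\<And>l j. l < x \<Longrightarrow> j < r \<Longrightarrow> rat_at X v \<beta> (B l j)"
    and "\<And>l. l < x \<Longrightarrow> rat_at X v (\<alpha> + \<beta>) (W l)"
    and "\<And>u l. u \<in> X \<Longrightarrow> l < x \<Longrightarrow> (\<Sum>j<r. B l j u * a j u) = W l u"
    and "trivial_kernel x r (\<lambda>l j. B l j v)" and "j < r"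
  shows "rat_at X v \<alpha> (a j)"
  using assms
proof (induction r arbitrary: X B W j)
  case (Suc r)
  note vX = Suc.prems(1,2) and Brat = Suc.prems(3) and Wrat = Suc.prems(4) and eq = Suc.prems(5)
    and ker = Suc.prems(6)
  have "\<exists>l0<x. B l0 r v \<noteq> 0"
  proof (rule ccontr)
    assume "\<not> (\<exists>l0<x. B l0 r v \<noteq> 0)"
    hence "(\<Sum>j<Suc r. B l j v * (if j = r then 1 else 0)) = 0" if "l < x" for l
      using that by simp
    from trivial_kernelD[OF ker this, of r] show False by simp
  qed
  then obtain l0 where l0: "l0 < x" "B l0 r v \<noteq> 0" by blast
  \<comment> \<open>On the neighbourhood given by \<open>k\<close> the pivot stays nonzero; the
    elimination takes place there, and \<open>rat_at_open\<close> returns to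
    \<open>X\<close>.\<close>
  obtain e k where k: "homogeneous e k" "k v \<noteq> 0" "\<And>u. u \<in> X \<Longrightarrow> k u \<noteq> 0 \<Longrightarrow> B l0 r u \<noteq> 0"
    using rat_at_nonzero_open[OF Brat[OF l0(1) lessI] vX(1) l0(2)] by blast
  define Y where "Y = X \<inter> {u. k u \<noteq> 0}"
  have vY: "v \<in> Y" using vX k by (simp add: Y_def)
  have BY: "rat_at Y v \<beta> (B l j)" if "l < x" "j < Suc r" for l j
    by (rule rat_at_mono[OF Brat[OF that]]) (simp add: Y_def)
  have WY: "rat_at Y v (\<alpha> + \<beta>) (W l)" if "l < x" for l
    by (rule rat_at_mono[OF Wrat[OF that]]) (simp add: Y_def)
  have B0: "B l0 r u \<noteq> 0" if "u \<in> Y" for u using that k(3) by (simp add: Y_def)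
  \<comment> \<open>Row \<open>l0\<close> eliminates the unknown \<open>r\<close>. All entries have
    degree \<open>\<beta>\<close>, so the degree is preserved. Row \<open>l0\<close> itself becomes
    0 and is kept, which leaves the numbering of the rows alone.\<close>
  define B' where "B' l j u = B l j u - B l r u * B l0 j u / B l0 r u" for l j u
  define W' where "W' l u = W l u - B l r u * W l0 u / B l0 r u" for l u
  have B': "rat_at Y v \<beta> (B' l j)" if "l < x" "j < r" for l j
  proof -
    have "rat_at Y v (\<beta> + \<beta> - \<beta>) (\<lambda>u. B l r u * B l0 j u / B l0 r u)"
      by (intro rat_at_divide rat_at_mult BY B0 vY) (use that l0 in auto)
    from rat_at_diff[OF BY[OF that(1)] this[simplified]] that show ?thesis
      unfolding B'_def[abs_def] by simp
  qed
  have W': "rat_at Y v (\<alpha> + \<beta>) (W' l)" if "l < x" for l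
  proof -
    have "rat_at Y v (\<beta> + (\<alpha> + \<beta>) - \<beta>) (\<lambda>u. B l r u * W l0 u / B l0 r u)"
      by (intro rat_at_divide rat_at_mult BY WY B0 vY) (use that l0 in auto)
    hence "rat_at Y v (\<alpha> + \<beta>) (\<lambda>u. B l r u * W l0 u / B l0 r u)" by (simp add: add.commute)
    from rat_at_diff[OF WY[OF that] this] show ?thesis
      unfolding W'_def[abs_def] by simp
  qed
  have eq': "(\<Sum>j<r. B' l j u * a j u) = W' l u" if "u \<in> Y" "l < x" for u l
  proof -
    have uX: "u \<in> X" using that by (simp add: Y_def)
    have "(\<Sum>j<r. B' l j u * a j u) = (\<Sum>j<r. B l j u * a j u) - B l r u * (\<Sum>j<r. B l0 j u * a j u) / B l0 r u"
      by (simp add: B'_def algebra_simps sum_subtractf sum_distrib_left sum_divide_distrib)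
    also have "(\<Sum>j<r. B l j u * a j u) = W l u - B l r u * a r u" using eq[OF uX that(2)] by (simp add: algebra_simps)
    also have "(\<Sum>j<r. B l0 j u * a j u) = W l0 u - B l0 r u * a r u" using eq[OF uX l0(1)] by (simp add: algebra_simps)
    finally show ?thesis using B0[OF that(1)] by (simp add: W'_def field_simps)
  qed
  have ker': "trivial_kernel x r (\<lambda>l j. B' l j v)"
  proof (rule trivial_kernelI)
    fix w j assume w: "\<And>l. l < x \<Longrightarrow> (\<Sum>j<r. B' l j v * w j) = 0" and j: "j < r"
    define w' where "w' = w(r := - (\<Sum>j<r. B l0 j v * w j) / B l0 r v)"
    have "(\<Sum>j<Suc r. B l j v * w' j) = 0" if "l < x" for l
    proof -
      have "(\<Sum>j<r. B' l j v * w j) = (\<Sum>j<r. B l j v * w j) - B l r v * (\<Sum>j<r. B l0 j v * w j) / B l0 r v"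
        by (simp add: B'_def algebra_simps sum_subtractf sum_distrib_left sum_divide_distrib)
      thus ?thesis using w[OF that] l0 by (simp add: w'_def)
    qed
    from trivial_kernelD[OF ker this, of j] j show "w j = 0" by (simp add: w'_def)
  qed
  have IH: "rat_at Y v \<alpha> (a j)" if "j < r" for j
    by (rule Suc.IH[of Y B' W' j, OF vY vX(2) B' W' eq' ker' that])
  have ar: "rat_at Y v \<alpha> (a r)"
  proof (rule rat_at_cong)
    have "rat_at Y v (\<alpha> + \<beta>) (\<lambda>u. \<Sum>j<r. B l0 j u * a j u)"
    proof (rule rat_at_sum[OF vX(2)])
      fix j assume "j \<in> {..<r}"
      hence "rat_at Y v (\<beta> + \<alpha>) (\<lambda>u. B l0 j u * a j u)" by (intro rat_at_mult BY IH) (use l0 in auto)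
      thus "rat_at Y v (\<alpha> + \<beta>) (\<lambda>u. B l0 j u * a j u)" by (simp add: add.commute)
    qed
    from rat_at_divide[OF rat_at_diff[OF WY[OF l0(1)] this] BY[OF l0(1) lessI] vY B0[OF vY]]
    show "rat_at Y v \<alpha> (\<lambda>u. (W l0 u - (\<Sum>j<r. B l0 j u * a j u)) / B l0 r u)" by simp
    fix u assume u: "u \<in> Y"
    hence "(\<Sum>j<Suc r. B l0 j u * a j u) = W l0 u" by (intro eq l0) (simp add: Y_def)
    thus "(W l0 u - (\<Sum>j<r. B l0 j u * a j u)) / B l0 r u = a r u"
      using B0[OF u] by (simp add: field_simps)
  qed
  have "rat_at Y v \<alpha> (a j)" using IH ar Suc.prems(7) by (auto simp: less_Suc_eq)
  thus ?case unfolding Y_def by (rule rat_at_open[OF k(1,2)])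
qed auto

subsection \<open>Restriction to lines\<close>

text \<open>Among the fractions that represent \<open>f\<close> off the zeros of their denominators
  take one whose denominator has least degree. At a root \<open>a\<close> of it, comparison with a
  fraction regular at \<open>a\<close> shows that the numerator vanishes too, and a linear factor
  cancels.\<close>

lemma locally_rational_imp_poly:
  fixes f :: "'k::{alg_closed_field, field_char_0} \<Rightarrow> 'k"
  assumes loc: "\<And>t0. \<exists>G H. poly H t0 \<noteq> 0 \<and> (\<forall>t. poly H t \<noteq> 0 \<longrightarrow> f t = poly G t / poly H t)"
  shows "\<exists>P. \<forall>t. f t = poly P t"
proof -
  define R where "R GH \<longleftrightarrow> snd GH \<noteq> 0 \<and> (\<forall>t. poly (snd GH) t \<noteq> 0 \<longrightarrow> f t = poly (fst GH) t / poly (snd GH) t)"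
    for GH :: "'k poly \<times> 'k poly"
  obtain G0 H0 where "poly H0 0 \<noteq> 0" "\<forall>t. poly H0 t \<noteq> 0 \<longrightarrow> f t = poly G0 t / poly H0 t"
    using loc[of 0] by blast
  hence "R (G0, H0)" by (auto simp: R_def)
  then obtain GH where GH: "R GH" "\<And>GH'. R GH' \<Longrightarrow> degree (snd GH) \<le> degree (snd GH')"
    using ex_has_least_nat[of R _ "\<lambda>GH. degree (snd GH)"] by blast
  obtain G H where GHeq: "GH = (G, H)" by (cases GH)
  have H: "H \<noteq> 0" "\<And>t. poly H t \<noteq> 0 \<Longrightarrow> f t = poly G t / poly H t"
    using GH(1) by (auto simp: R_def GHeq)
  have "degree H = 0"
  proof (rule ccontr)
    assume "degree H \<noteq> 0"
    then obtain a where a: "poly H a = 0" using alg_closed_imp_poly_has_root by blast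
    obtain G1 H1 where 1: "poly H1 a \<noteq> 0" "\<And>t. poly H1 t \<noteq> 0 \<Longrightarrow> f t = poly G1 t / poly H1 t"
      using loc[of a] by blast
    \<comment> \<open>The factors \<open>H * H1\<close> make the equation true also where a
      denominator vanishes, so that it becomes an identity of polynomials.\<close>
    have "poly ((G * H1 - G1 * H) * H * H1) t = 0" for t
    proof (cases "poly H t = 0 \<or> poly H1 t = 0")
      case False
      hence "poly G t / poly H t = poly G1 t / poly H1 t" using H(2)[of t] 1(2)[of t] by simp
      thus ?thesis using False by (simp add: field_simps)
    qed auto
    hence "(G * H1 - G1 * H) * H * H1 = 0" using poly_all_0_iff_0 by blast
    hence eq: "G * H1 = G1 * H" using H(1) 1(1) by auto
    have "poly G a * poly H1 a = 0" using arg_cong[OF eq, of "\<lambda>p. poly p a"] a by simp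
    hence "poly G a = 0" using 1(1) by simp
    then obtain G' where G': "G = [:- a, 1:] * G'" by (auto simp: poly_eq_0_iff_dvd dvd_def)
    obtain H' where H': "H = [:- a, 1:] * H'" using a by (auto simp: poly_eq_0_iff_dvd dvd_def)
    have H'0: "H' \<noteq> 0" using H' H(1) by auto
    have "[:- a, 1:] * (G' * H1) = [:- a, 1:] * (G1 * H')"
      using eq unfolding G' H' by (simp only: mult_ac)
    hence eq': "G' * H1 = G1 * H'" by (subst (asm) mult_cancel_left) auto
    have "R (G', H')" unfolding R_def fst_conv snd_conv
    proof (intro conjI allI impI H'0)
      fix t assume t: "poly H' t \<noteq> 0"
      show "f t = poly G' t / poly H' t"
      proof (cases "t = a")
        \<comment> \<open>At \<open>a\<close> the old fraction says nothing about \<open>f\<close>;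
          the cancelled one is compared with the local fraction instead.\<close>
        case True
        have "poly G' a * poly H1 a = poly G1 a * poly H' a"
          using arg_cong[OF eq', of "\<lambda>p. poly p a"] by simp
        hence "poly G' a / poly H' a = poly G1 a / poly H1 a"
          using 1(1) t True by (simp add: frac_eq_eq)
        thus ?thesis using 1(2)[OF 1(1)] True by simp
      next
        case False
        hence "poly H t \<noteq> 0" using t by (simp add: H')
        from H(2)[OF this] show ?thesis
          using False t unfolding G' H' poly_mult by (simp add: divide_simps)
      qed
    qed
    from GH(2)[OF this] have "degree H \<le> degree H'" by (simp add: GHeq)
    moreover have "degree H = degree [:- a, 1:] + degree H'"
      unfolding H' by (rule degree_mult_eq) (use H'0 in auto)
    ultimately show False by simp
  qed
  then obtain h where h: "H = [:h:]" by (metis degree_eq_zeroE)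
  hence "f t = poly (Polynomial.smult (1 / h) G) t" for t using H(1) H(2)[of t] by simp
  thus ?thesis by blast
qed

lemma rational_line_poly:
  fixes F :: "'k::{alg_closed_field, field_char_0} ^ 'n::finite \<Rightarrow> 'k"
  assumes "rational X d F" "\<And>t. u + t *s w \<in> X"
  shows "\<exists>P. \<forall>t. F (u + t *s w) = poly P t"
proof (rule locally_rational_imp_poly)
  fix t0
  have "rat_at X (u + t0 *s w) d F" using assms by (auto simp: rational_def)
  then obtain a a' g h where 1: "homogeneous a g" "homogeneous a' h" "int a = int a' + d"
    "h (u + t0 *s w) \<noteq> 0" "\<And>u. u \<in> X \<Longrightarrow> h u \<noteq> 0 \<Longrightarrow> F u = g u / h u" by (rule rat_atE) blast
  obtain G H where "\<forall>t. g (u + t *s w) = poly G t" "\<forall>t. h (u + t *s w) = poly H t"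
    using homogeneous_on_line[OF 1(1)] homogeneous_on_line[OF 1(2)] by metis
  thus "\<exists>G H. poly H t0 \<noteq> 0 \<and> (\<forall>t. poly H t \<noteq> 0 \<longrightarrow> F (u + t *s w) = poly G t / poly H t)"
    using 1(4,5) assms(2) by (intro exI[of _ G] exI[of _ H]) auto
qed

text \<open>\<open>P\<close> and \<open>Q\<close> describe \<open>F\<close> on the two affine charts
  of the line. Homogeneity gives P(t) = t^d Q(1/t), so P has degree at most \<open>d\<close>, with
  lowest coefficient \<open>F u\<close> and coefficient \<open>F w\<close> in degree
  \<open>d\<close>. Thus sections of O on a line are constant and those of O(1) are linear.\<close>

lemma rational_line:
  fixes F :: "'k::{alg_closed_field, field_char_0} ^ 'n::finite \<Rightarrow> 'k"
  assumes rat: "rational X (int d) F"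
    and X: "\<And>a b. a \<noteq> 0 \<or> b \<noteq> 0 \<Longrightarrow> a *s u + b *s w \<in> X"
  shows "d = 0 \<Longrightarrow> F u = F w" "d = 1 \<Longrightarrow> F (u + w) = F u + F w"
proof -
  have Xu: "u + t *s w \<in> X" for t using X[of 1 t] by simp
  have Xw: "w + t *s u \<in> X" for t using X[of t 1] by (simp add: add.commute)
  obtain P where P: "\<And>t. F (u + t *s w) = poly P t" using rational_line_poly[OF rat Xu] by blast
  obtain Q where Q: "\<And>t. F (w + t *s u) = poly Q t" using rational_line_poly[OF rat Xw] by blast
  have inv: "poly P t = t ^ d * poly Q (1 / t)" if "t \<noteq> 0" for t
  proof -
    have e: "t *s (w + (1 / t) *s u) = u + t *s w"
      using that by (simp add: Finite_Cartesian_Product.vec_eq_iff algebra_simps)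
    have "rat_at X (w + (1 / t) *s u) (int d) F" using rat Xw by (simp add: rational_def)
    from rat_at_scaling[OF this Xw _ that] show ?thesis
      unfolding e by (simp add: Xu P Q)
  qed
  define N where "N = degree Q"
  \<comment> \<open>The reversal t^N Q(1/t) of \<open>Q\<close>, which turns the transition between
    the charts into the polynomial identity t^N P = t^d Qr.\<close>
  define Qr where "Qr = (\<Sum>i\<le>N. monom (coeff Q i) (N - i))"
  have cQr: "coeff Qr k = (if k \<le> N then coeff Q (N - k) else 0)" for k
  proof -
    have "coeff Qr k = (\<Sum>i\<le>N. if i = N - k \<and> k \<le> N then coeff Q i else 0)"
      unfolding Qr_def coeff_sum coeff_monom by (rule sum.cong) auto
    thus ?thesis by auto
  qed
  have pQr: "poly Qr t = t ^ N * poly Q (1 / t)" if "t \<noteq> 0" for t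
  proof -
    have "t ^ N * poly Q (1 / t) = (\<Sum>i\<le>N. coeff Q i * (t ^ N * (1 / t) ^ i))"
      unfolding poly_altdef N_def[symmetric] sum_distrib_left by (simp add: mult_ac)
    also have "\<dots> = (\<Sum>i\<le>N. coeff Q i * t ^ (N - i))"
      using that by (intro sum.cong) (auto simp: power_diff power_divide)
    also have "\<dots> = poly Qr t" by (simp add: Qr_def poly_sum poly_monom)
    finally show ?thesis ..
  qed
  have "poly (monom 1 1 * (monom 1 N * P - monom 1 d * Qr)) t = 0" for t
    by (cases "t = 0") (simp_all add: poly_monom inv pQr)
  hence "monom 1 1 * (monom 1 N * P - monom 1 d * Qr) = 0" using poly_all_0_iff_0 by blast
  hence eq: "monom 1 N * P = monom 1 d * Qr" by auto
  have cP: "coeff P k = (if d \<le> k + N then coeff Qr (k + N - d) else 0)" for k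
    using arg_cong[OF eq, of "\<lambda>p. coeff p (k + N)"] by (simp add: coeff_monom_mult)
  have high: "coeff P k = 0" if "k > d" for k using that by (simp add: cP cQr)
  have Q0: "coeff Q 0 = F w" using Q[of 0] by (simp add: poly_0_coeff_0)
  have P0: "coeff P 0 = F u" using P[of 0] by (simp add: poly_0_coeff_0)
  have cPd: "coeff P d = F w" by (simp add: cP cQr Q0)
  show "F u = F w" if "d = 0" using cPd P0 that by simp
  show "F (u + w) = F u + F w" if "d = 1"
  proof -
    have "P = [:coeff P 0, coeff P 1:]"
      by (rule poly_eqI) (use high that in \<open>auto simp: coeff_pCons split: nat.split\<close>)
    hence "poly P 1 = coeff P 0 + coeff P 1" by (metis mult_1 poly_pCons mult_zero_right poly_0 add_0_right)
    thus ?thesis using P[of 1] cPd P0 that by simp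
  qed
qed

section \<open>Sections of bundles in homogeneous coordinates\<close>

text \<open>Sets of points are handled through their nonzero representatives, because a section of a
  twist in homogeneous coordinates is a function of the vector and not of the point.\<close>

definition cone :: "('k::field ^ 'n::finite) set set \<Rightarrow> ('k ^ 'n) set" where
  "cone V = {v. v \<noteq> 0 \<and> vec.span {v} \<in> V}"

lemma in_span_singleton: "u \<in> vec.span {v} \<longleftrightarrow> (\<exists>c. u = c *s v)"
  by (auto simp: vec.span_singleton)

lemma span_in_proj_space: "v \<noteq> 0 \<Longrightarrow> vec.span {v} \<in> proj_space"
  by (auto simp: proj_space_def)

lemma cone_mono: "V \<subseteq> W \<Longrightarrow> cone V \<subseteq> cone W"
  by (auto simp: cone_def)

lemma cone_Int: "cone (V \<inter> W) = cone V \<inter> cone W"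
  by (auto simp: cone_def)

lemma cone_proj_space: "cone proj_space = {v. v \<noteq> 0}"
  by (auto simp: cone_def span_in_proj_space)

lemma span_eqI:
  assumes "p \<in> proj_space" "v \<in> p" "v \<noteq> 0"
  shows "vec.span {v} = p"
proof -
  obtain w where w: "p = vec.span {w}" "w \<noteq> 0" using assms(1) by (auto simp: proj_space_def)
  then obtain c where c: "v = c *s w" using assms(2) by (auto simp: in_span_singleton)
  hence "c \<noteq> 0" using assms(3) by auto
  hence w': "w = (1 / c) *s v" using c by simp
  show ?thesis unfolding w
  proof (intro equalityI subsetI)
    fix x assume "x \<in> vec.span {v}"
    thus "x \<in> vec.span {w}" unfolding in_span_singleton c by auto
  next
    fix x assume "x \<in> vec.span {w}"
    then obtain d where "x = d *s w" by (auto simp: in_span_singleton)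
    thus "x \<in> vec.span {v}" unfolding in_span_singleton using w' by (metis vector_smult_assoc)
  qed
qed

lemma span_scaled: "c \<noteq> 0 \<Longrightarrow> v \<noteq> 0 \<Longrightarrow> vec.span {c *s v} = vec.span {v}"
  by (rule span_eqI) (auto simp: span_in_proj_space in_span_singleton)

lemma proj_space_obtain:
  assumes "p \<in> proj_space"
  obtains v where "v \<noteq> 0" "p = vec.span {v}"
  using assms by (auto simp: proj_space_def)

lemma self_in_span: "v \<in> vec.span {v}"
  by (rule vec.span_base) simp

lemma span_in_basic_open:
  assumes "homogeneous d h"
  shows "vec.span {v} \<in> basic_open h \<longleftrightarrow> v \<noteq> 0 \<and> h v \<noteq> 0"
proof
  assume a: "vec.span {v} \<in> basic_open h"
  have "v \<noteq> 0"
  proof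
    assume v0: "v = 0"
    have "vec.span {v} \<in> proj_space" using a by (simp add: basic_open_def)
    then obtain w where w: "w \<noteq> 0" "vec.span {v} = vec.span {w}" by (rule proj_space_obtain)
    have "w \<in> vec.span {v}" unfolding w(2) by (rule self_in_span)
    thus False using v0 w(1) by (simp add: in_span_singleton)
  qed
  thus "v \<noteq> 0 \<and> h v \<noteq> 0" using a self_in_span[of v] by (auto simp: basic_open_def)
next
  assume v: "v \<noteq> 0 \<and> h v \<noteq> 0"
  thus "vec.span {v} \<in> basic_open h"
    by (auto simp: basic_open_def span_in_proj_space in_span_singleton homogeneous_scaling[OF assms])
qed

lemma cone_basic_open: "homogeneous d h \<Longrightarrow> cone (basic_open h) = {v. v \<noteq> 0 \<and> h v \<noteq> 0}"
  by (auto simp: cone_def span_in_basic_open)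

lemma coord_open: "vec.span {v} \<in> basic_open (\<lambda>v. v $ i) \<longleftrightarrow> v $ i \<noteq> 0"
  by (auto simp: span_in_basic_open[OF homogeneous_coord])

lemma basic_open_subset: "basic_open h \<subseteq> proj_space"
  by (auto simp: basic_open_def)

lemma regular_on_iff:
  assumes V: "V \<subseteq> proj_space"
  shows "regular_on V f \<longleftrightarrow> rational (cone V) 0 (\<lambda>v. f (vec.span {v}))"
proof
  assume reg: "regular_on V f"
  show "rational (cone V) 0 (\<lambda>v. f (vec.span {v}))"
    unfolding rational_def
  proof
    fix v assume v: "v \<in> cone V"
    then obtain d g h where 1: "homogeneous d g" "homogeneous d h" "vec.span {v} \<in> basic_open h"
      "\<forall>q\<in>V \<inter> basic_open h. \<forall>v\<in>q - {0}. f q = g v / h v"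
      using reg by (auto simp: regular_on_def cone_def)
    show "rat_at (cone V) v 0 (\<lambda>v. f (vec.span {v}))"
    proof (rule rat_atI[OF 1(1,2)])
      show "h v \<noteq> 0" using 1(3) by (simp add: span_in_basic_open[OF 1(2)])
      fix u assume u: "u \<in> cone V" "h u \<noteq> 0"
      hence "vec.span {u} \<in> V \<inter> basic_open h" by (auto simp: cone_def span_in_basic_open[OF 1(2)])
      moreover have "u \<in> vec.span {u} - {0}" using u self_in_span by (auto simp: cone_def)
      ultimately show "f (vec.span {u}) = g u / h u" using 1(4) by blast
    qed simp
  qed
next
  assume rat: "rational (cone V) 0 (\<lambda>v. f (vec.span {v}))"
  show "regular_on V f" unfolding regular_on_def
  proof
    fix p assume p: "p \<in> V"
    then obtain v where v: "v \<noteq> 0" "p = vec.span {v}" using V by (auto elim: proj_space_obtain)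
    hence "rat_at (cone V) v 0 (\<lambda>v. f (vec.span {v}))"
      using p rat by (auto simp: rational_def cone_def)
    then obtain e e' g h where 1: "homogeneous e g" "homogeneous e' h" "int e = int e' + 0" "h v \<noteq> 0"
      "\<And>u. u \<in> cone V \<Longrightarrow> h u \<noteq> 0 \<Longrightarrow> f (vec.span {u}) = g u / h u" by (rule rat_atE) blast
    have "homogeneous e h" using 1(2,3) by simp
    moreover have "p \<in> basic_open h" using v 1(4) by (simp add: span_in_basic_open[OF 1(2)])
    moreover have "\<forall>q\<in>V \<inter> basic_open h. \<forall>v\<in>q - {0}. f q = g v / h v"
    proof (intro ballI)
      fix q u assume q: "q \<in> V \<inter> basic_open h" and u: "u \<in> q - {0}"
      hence "q = vec.span {u}" using span_eqI[of q u] V by auto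
      moreover have "h u \<noteq> 0" using q u by (auto simp: basic_open_def)
      ultimately show "f q = g u / h u" using 1(5)[of u] q u by (auto simp: cone_def)
    qed
    ultimately show "\<exists>d g h. homogeneous d g \<and> homogeneous d h \<and> p \<in> basic_open h \<and>
       (\<forall>q\<in>V \<inter> basic_open h. \<forall>v\<in>q - {0}. f q = g v / h v)"
      using 1(1) by blast
  qed
qed

lemma zariski_open_in_subset: "zariski_open_in B U \<Longrightarrow> U \<subseteq> B"
  by (auto simp: zariski_open_in_def)

text \<open>The family of polynomials is traded for a condition at each point, which is what local
  arguments use. Conversely, all polynomials admissible at some point together form a suitable
  family.\<close>

lemma zariski_open_in_iff:
  assumes B: "B \<subseteq> proj_space"
  shows "zariski_open_in B U \<longleftrightarrow> U \<subseteq> B \<and> (\<forall>v\<in>cone U. \<exists>e k. homogeneous e k \<and> k v \<noteq> 0 \<and>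
    (\<forall>u\<in>cone B. k u \<noteq> 0 \<longrightarrow> u \<in> cone U))" (is "_ \<longleftrightarrow> ?R")
proof
  assume "zariski_open_in B U"
  then obtain H where H: "\<And>h. h \<in> H \<Longrightarrow> \<exists>d. homogeneous d h" "U = B \<inter> (\<Union>h\<in>H. basic_open h)"
    by (auto simp: zariski_open_in_def)
  show ?R
  proof (intro conjI ballI)
    fix v assume "v \<in> cone U"
    hence v: "v \<noteq> 0" "vec.span {v} \<in> U" by (auto simp: cone_def)
    then obtain h where h: "h \<in> H" "vec.span {v} \<in> basic_open h" using H(2) by auto
    obtain d where d: "homogeneous d h" using H(1) h by auto
    have "u \<in> cone U" if "u \<in> cone B" "h u \<noteq> 0" for u
      using that h(1) span_in_basic_open[OF d, of u] unfolding H(2) cone_def by blast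
    thus "\<exists>e k. homogeneous e k \<and> k v \<noteq> 0 \<and> (\<forall>u\<in>cone B. k u \<noteq> 0 \<longrightarrow> u \<in> cone U)"
      using d h(2) span_in_basic_open[OF d] by blast
  qed (use H(2) in auto)
next
  assume R: ?R
  define H where "H = {k. (\<exists>e. homogeneous e k) \<and> (\<forall>u\<in>cone B. k u \<noteq> 0 \<longrightarrow> u \<in> cone U)}"
  have "U = B \<inter> (\<Union>h\<in>H. basic_open h)"
  proof (intro equalityI subsetI)
    fix p assume p: "p \<in> U"
    then obtain v where v: "v \<noteq> 0" "p = vec.span {v}" using R B by (meson proj_space_obtain subsetD)
    hence "v \<in> cone U" using p by (auto simp: cone_def)
    then obtain e k where k: "homogeneous e k" "k v \<noteq> 0" "\<forall>u\<in>cone B. k u \<noteq> 0 \<longrightarrow> u \<in> cone U"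
      using R by blast
    hence "k \<in> H" "p \<in> basic_open k" using v by (auto simp: H_def span_in_basic_open[OF k(1)])
    thus "p \<in> B \<inter> (\<Union>h\<in>H. basic_open h)" using p R by auto
  next
    fix p assume "p \<in> B \<inter> (\<Union>h\<in>H. basic_open h)"
    then obtain h where h: "p \<in> B" "h \<in> H" "p \<in> basic_open h" by auto
    obtain v where v: "v \<noteq> 0" "p = vec.span {v}" using h(1) B by (meson proj_space_obtain subsetD)
    obtain e where e: "homogeneous e h" using h(2) by (auto simp: H_def)
    have "h v \<noteq> 0" using h(3) v by (simp add: span_in_basic_open[OF e])
    hence "v \<in> cone U" using h v by (auto simp: H_def cone_def)
    thus "p \<in> U" using v by (simp add: cone_def)
  qed
  moreover have "\<forall>h\<in>H. \<exists>d. homogeneous d h" by (simp add: H_def)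
  ultimately show "zariski_open_in B U" unfolding zariski_open_in_def by blast
qed

lemma rat_at_zariski_open:
  assumes "B \<subseteq> proj_space" "zariski_open_in B U" "V \<subseteq> B" "v \<in> cone U" "rat_at (cone (U \<inter> V)) v d F"
  shows "rat_at (cone V) v d F"
proof -
  obtain e k where k: "homogeneous e k" "k v \<noteq> 0" "\<forall>u\<in>cone B. k u \<noteq> 0 \<longrightarrow> u \<in> cone U"
    using assms(2,4) unfolding zariski_open_in_iff[OF assms(1)] by blast
  show ?thesis
  proof (rule rat_at_open[OF k(1,2)], rule rat_at_mono[OF assms(5)])
    show "cone V \<inter> {u. k u \<noteq> 0} \<subseteq> cone (U \<inter> V)"
      using k(3) cone_mono[OF assms(3)] by (auto simp: cone_Int)
  qed
qed

subsection \<open>Sums of line bundles\<close>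

text \<open>One shape for the middle and right terms of a Steiner sequence and for the split bundles
  on lines.\<close>

definition twist_sum :: "('k::field ^ 'n::finite) set set \<Rightarrow> int list \<Rightarrow> ('k, 'n, nat \<times> ('k ^ 'n)) vbundle" where
  "twist_sum B as = direct_sum_list B (map (\<lambda>a. restrict_bundle (twist a) B) as)"

lemma restrict_twist: "restrict_bundle (twist a) proj_space = twist a"
  by (simp add: restrict_bundle_def twist_def image_image Int_absorb2 basic_open_subset)

lemma twist_sum_replicate:
  "direct_sum_list proj_space (replicate x (twist d)) = twist_sum proj_space (replicate x d)"
  by (simp add: twist_sum_def map_replicate_const restrict_twist)

lemma splits_on_iff: "splits_on E L as \<longleftrightarrow> bundle_iso (restrict_bundle E L) (twist_sum L as)"
  by (simp add: splits_on_def twist_sum_def)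

definition coord_power :: "int \<Rightarrow> 'n \<Rightarrow> ('k::field ^ 'n::finite) set \<Rightarrow> 'k ^ 'n \<Rightarrow> 'k" where
  "coord_power a i p = (\<lambda>v. if v \<in> p - {0} then (v $ i) powi a else 0)"

definition slot :: "nat \<Rightarrow> ('v \<Rightarrow> 'k::zero) \<Rightarrow> nat \<times> 'v \<Rightarrow> 'k" where
  "slot j f = (\<lambda>(j', v). if j' = j then f v else 0)"

lemma base_twist_sum: "base (twist_sum B as) = B"
  by (simp add: twist_sum_def direct_sum_list_def)

lemma fibre_twist: "fibre (twist a) p = {f. (\<forall>v. v \<notin> p - {0} \<longrightarrow> f v = 0) \<and>
                       (\<forall>v\<in>p - {0}. \<forall>c. c \<noteq> 0 \<longrightarrow> f (c *s v) = c powi a * f v)}"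
  by (simp add: twist_def)

lemma fibre_twist_sum: "fibre (twist_sum B as) p =
   {f. (\<forall>j<length as. (\<lambda>v. f (j, v)) \<in> fibre (twist (as ! j)) p) \<and> (\<forall>j\<ge>length as. \<forall>v. f (j, v) = 0)}"
  by (auto simp: twist_sum_def direct_sum_list_def restrict_bundle_def)

lemma frames_twist: "frames (restrict_bundle (twist a) B) =
   range (\<lambda>i. (basic_open (\<lambda>v. v $ i) \<inter> B, [coord_power a i]))"
  by (auto simp: restrict_bundle_def twist_def coord_power_def[abs_def])

definition twist_frame :: "int list \<Rightarrow> (nat \<Rightarrow> 'n) \<Rightarrow> (('k::field ^ 'n::finite) set \<Rightarrow> nat \<times> ('k ^ 'n) \<Rightarrow> 'k) list" where
  "twist_frame as i = map (\<lambda>j p. slot j (coord_power (as ! j) (i j) p)) [0..<length as]"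

lemma frames_twist_sum:
  fixes B :: "('k::field ^ 'n::finite) set set"
  shows "frames (twist_sum B as) = range (\<lambda>i. (B \<inter> (\<Inter>j<length as. basic_open (\<lambda>v. v $ (i j)) \<inter> B), twist_frame as i))"
proof -
  have "frames (twist_sum B as) = {(B \<inter> (\<Inter>j<length as. fst (t j)),
          concat (map (\<lambda>j. map (\<lambda>s p (j', i). if j' = j then s p i else 0) (snd (t j))) [0..<length as]))
                | t. \<forall>j<length as. t j \<in> frames (restrict_bundle (twist (as ! j)) B)}"
    by (simp add: twist_sum_def direct_sum_list_def cong: conj_cong)
  also have "\<dots> = range (\<lambda>i. (B \<inter> (\<Inter>j<length as. basic_open (\<lambda>v. v $ (i j)) \<inter> B), twist_frame as i))"
  proof (intro equalityI subsetI)
    fix Ufs assume "Ufs \<in> {(B \<inter> (\<Inter>j<length as. fst (t j)),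
          concat (map (\<lambda>j. map (\<lambda>s p (j', i). if j' = j then s p i else 0) (snd (t j))) [0..<length as]))
                | t. \<forall>j<length as. t j \<in> frames (restrict_bundle (twist (as ! j)) B)}"
    then obtain t where t: "Ufs = (B \<inter> (\<Inter>j<length as. fst (t j)),
          concat (map (\<lambda>j. map (\<lambda>s p (j', i). if j' = j then s p i else 0) (snd (t j))) [0..<length as]))"
      "\<forall>j<length as. t j \<in> frames (restrict_bundle (twist (as ! j)) B)" by blast
    have "\<forall>j\<in>{..<length as}. \<exists>i. t j = (basic_open (\<lambda>v. v $ i) \<inter> B, [coord_power (as ! j) i])"
      using t(2) by (auto simp: frames_twist)
    from bchoice[OF this] obtain i
      where i: "\<forall>j\<in>{..<length as}. t j = (basic_open (\<lambda>v. v $ i j) \<inter> B, [coord_power (as ! j) (i j)])" ..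
    have "map (\<lambda>j. map (\<lambda>s p (j', i). if j' = j then s p i else 0) (snd (t j))) [0..<length as] =
        map (\<lambda>j. [\<lambda>p. slot j (coord_power (as ! j) (i j) p)]) [0..<length as]"
      using i by (intro map_cong) (auto simp: slot_def)
    hence "concat (map (\<lambda>j. map (\<lambda>s p (j', i). if j' = j then s p i else 0) (snd (t j))) [0..<length as]) =
        twist_frame as i"
      by (simp only: twist_frame_def concat_map_singleton)
    moreover have "(\<Inter>j<length as. fst (t j)) = (\<Inter>j<length as. basic_open (\<lambda>v. v $ (i j)) \<inter> B)"
      using i by (intro INF_cong) auto
    ultimately show "Ufs \<in> range (\<lambda>i. (B \<inter> (\<Inter>j<length as. basic_open (\<lambda>v. v $ (i j)) \<inter> B), twist_frame as i))"
      using t(1) by auto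
  next
    fix Ufs :: "('k ^ 'n) set set \<times> (('k ^ 'n) set \<Rightarrow> nat \<times> ('k ^ 'n) \<Rightarrow> 'k) list"
    assume "Ufs \<in> range (\<lambda>i. (B \<inter> (\<Inter>j<length as. basic_open (\<lambda>v. v $ (i j)) \<inter> B), twist_frame as i))"
    then obtain i :: "nat \<Rightarrow> 'n" where i: "Ufs = (B \<inter> (\<Inter>j<length as. basic_open (\<lambda>v. v $ (i j)) \<inter> B), twist_frame as i)" by blast
    define t where "t j = (basic_open (\<lambda>v. v $ i j) \<inter> B,
      [coord_power (as ! j) (i j) :: ('k ^ 'n) set \<Rightarrow> 'k ^ 'n \<Rightarrow> 'k])" for j
    have "map (\<lambda>j. map (\<lambda>s p (j', i). if j' = j then s p i else 0) (snd (t j))) [0..<length as] =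
        map (\<lambda>j. [\<lambda>p. slot j (coord_power (as ! j) (i j) p)]) [0..<length as]"
      by (intro map_cong) (auto simp: slot_def t_def)
    hence "concat (map (\<lambda>j. map (\<lambda>s p (j', i). if j' = j then s p i else 0) (snd (t j))) [0..<length as]) =
        twist_frame as i"
      by (simp only: twist_frame_def concat_map_singleton)
    moreover have "\<forall>j<length as. t j \<in> frames (restrict_bundle (twist (as ! j)) B)"
      by (auto simp: frames_twist t_def)
    ultimately show "Ufs \<in> {(B \<inter> (\<Inter>j<length as. fst (t j)),
          concat (map (\<lambda>j. map (\<lambda>s p (j', i). if j' = j then s p i else 0) (snd (t j))) [0..<length as]))
                | t. \<forall>j<length as. t j \<in> frames (restrict_bundle (twist (as ! j)) B)}"
      by (intro CollectI exI[of _ t]) (simp add: i t_def)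
  qed
  finally show ?thesis .
qed

lemma twist_frame_length: "length (twist_frame as i) = length as"
  by (simp add: twist_frame_def)

lemma twist_frame_nth: "j < length as \<Longrightarrow> twist_frame as i ! j = (\<lambda>p. slot j (coord_power (as ! j) (i j) p))"
  by (simp add: twist_frame_def)

lemma twist_frame_sum:
  "(\<Sum>j<length as. fscale (a j) ((twist_frame as i ! j) p)) (j', v) =
     (if j' < length as then a j' * coord_power (as ! j') (i j') p v else 0)"
proof -
  have "(\<Sum>j<length as. fscale (a j) ((twist_frame as i ! j) p)) (j', v) =
      (\<Sum>j<length as. if j = j' then a j' * coord_power (as ! j') (i j') p v else 0)"
    unfolding sum_fun_apply by (intro sum.cong) (auto simp: twist_frame_nth slot_def fscale_apply)
  thus ?thesis by simp
qed

lemma nonzero_coord: "v \<noteq> 0 \<Longrightarrow> \<exists>i. v $ i \<noteq> 0"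
  by (auto simp: Finite_Cartesian_Product.vec_eq_iff)

lemma regular_sectionD:
  assumes "regular_section E V s"
  shows "p \<in> V \<Longrightarrow> s p \<in> fibre E p"
    and "(U, fs) \<in> frames E \<Longrightarrow> \<exists>a. (\<forall>j<length fs. regular_on (U \<inter> V) (a j)) \<and>
        (\<forall>p\<in>U \<inter> V. s p = (\<Sum>j<length fs. fscale (a j p) ((fs ! j) p)))"
  using assms unfolding regular_section_def by blast+

lemma regular_sectionI:
  assumes "\<And>p. p \<in> V \<Longrightarrow> s p \<in> fibre E p"
    and "\<And>U fs. (U, fs) \<in> frames E \<Longrightarrow> \<exists>a. (\<forall>j<length fs. regular_on (U \<inter> V) (a j)) \<and>
        (\<forall>p\<in>U \<inter> V. s p = (\<Sum>j<length fs. fscale (a j p) ((fs ! j) p)))"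
  shows "regular_section E V s"
  using assms unfolding regular_section_def by blast

text \<open>The dictionary between frames and homogeneous coordinates. Component \<open>j\<close> of
  the value over the point of \<open>v\<close>, evaluated at \<open>v\<close> itself, differs from
  the coefficient in a frame by the power \<open>as ! j\<close> of a nonvanishing coordinate, and
  this power accounts for the degree.\<close>

lemma regular_section_twist_sum:
  fixes V B :: "('k::field ^ 'n::finite) set set"
  assumes B: "B \<subseteq> proj_space" and V: "V \<subseteq> B"
  shows "regular_section (twist_sum B as) V s \<longleftrightarrow> (\<forall>p\<in>V. s p \<in> fibre (twist_sum B as) p) \<and>
     (\<forall>j<length as. rational (cone V) (as ! j) (\<lambda>v. s (vec.span {v}) (j, v)))"
proof -
  have VP: "V \<subseteq> proj_space" using B V by blast
  show ?thesis
  proof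
    assume reg: "regular_section (twist_sum B as) V s"
    show "(\<forall>p\<in>V. s p \<in> fibre (twist_sum B as) p) \<and>
       (\<forall>j<length as. rational (cone V) (as ! j) (\<lambda>v. s (vec.span {v}) (j, v)))"
      unfolding rational_def
    proof (intro conjI allI impI ballI)
      fix j v assume j: "j < length as" and v: "v \<in> cone V"
      hence "v \<noteq> 0" by (simp add: cone_def)
      then obtain i where i: "v $ i \<noteq> 0" using nonzero_coord by blast
      \<comment> \<open>A frame may use a different coordinate in each summand; here the same
        \<open>i\<close>, nonzero at \<open>v\<close>, is used for all.\<close>
      define U where "U = B \<inter> (\<Inter>j<length as. basic_open (\<lambda>v. v $ i) \<inter> B)"
      have U: "U = B \<inter> basic_open (\<lambda>v. v $ i)" using j by (auto simp: U_def)
      have "(U, twist_frame as (\<lambda>_. i)) \<in> frames (twist_sum B as)"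
        unfolding frames_twist_sum U_def by (rule range_eqI[of _ _ "\<lambda>_. i"]) (rule refl)
      from regular_sectionD(2)[OF reg this, unfolded twist_frame_length] obtain a
        where a: "\<forall>j<length as. regular_on (U \<inter> V) (a j)"
         "\<forall>p\<in>U \<inter> V. s p = (\<Sum>j<length as. fscale (a j p) ((twist_frame as (\<lambda>_. i) ! j) p))" by blast
      have vU: "v \<in> cone (U \<inter> V)" using v i V by (auto simp: cone_def U coord_open)
      have 1: "rat_at (cone (U \<inter> V)) v 0 (\<lambda>v. a j (vec.span {v}))"
        using a(1) j vU VP by (subst (asm) regular_on_iff) (auto simp: rational_def)
      have 2: "rat_at (cone (U \<inter> V)) v (as ! j) (\<lambda>v. a j (vec.span {v}) * (v $ i) powi (as ! j))"
        using rat_at_mult[OF 1 rat_at_power_int[OF vU i]] by simp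
      have "rat_at (cone (U \<inter> V)) v (as ! j) (\<lambda>v. s (vec.span {v}) (j, v))"
      proof (rule rat_at_cong[OF 2])
        fix u assume u: "u \<in> cone (U \<inter> V)"
        hence "s (vec.span {u}) = (\<Sum>j<length as. fscale (a j (vec.span {u})) ((twist_frame as (\<lambda>_. i) ! j) (vec.span {u})))"
          by (intro a(2)[rule_format]) (simp add: cone_def)
        thus "a j (vec.span {u}) * (u $ i) powi (as ! j) = s (vec.span {u}) (j, u)"
          using j u self_in_span[of u] by (simp add: twist_frame_sum coord_power_def cone_def)
      qed
      moreover have "cone V \<inter> {u. u $ i \<noteq> 0} \<subseteq> cone (U \<inter> V)"
        using V by (auto simp: cone_def U coord_open)
      ultimately show "rat_at (cone V) v (as ! j) (\<lambda>v. s (vec.span {v}) (j, v))"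
        by (rule rat_at_open[OF homogeneous_coord[of i] i, OF rat_at_mono])
    qed (use reg in \<open>auto simp: regular_section_def\<close>)
  next
    assume R: "(\<forall>p\<in>V. s p \<in> fibre (twist_sum B as) p) \<and>
       (\<forall>j<length as. rational (cone V) (as ! j) (\<lambda>v. s (vec.span {v}) (j, v)))"
    have "\<exists>a. (\<forall>j<length fs. regular_on (U \<inter> V) (a j)) \<and>
        (\<forall>p\<in>U \<inter> V. s p = (\<Sum>j<length fs. fscale (a j p) ((fs ! j) p)))"
      if fr: "(U, fs) \<in> frames (twist_sum B as)" for U fs
    proof -
      obtain i where U: "U = B \<inter> (\<Inter>j<length as. basic_open (\<lambda>v. v $ (i j)) \<inter> B)" and fs: "fs = twist_frame as i"
        using fr unfolding frames_twist_sum by (elim rangeE) simp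
      \<comment> \<open>Coefficients have to be functions of the point, so they are computed at a
        chosen representative; \<open>a_eq\<close> shows that by homogeneity any other gives the
        same value.\<close>
      define rep where "rep p = (SOME v. v \<in> p - {0 :: 'k ^ 'n})" for p
      define a where "a j p = s p (j, rep p) / (rep p $ i j) powi (as ! j)" for j p
      have rep: "rep p \<in> p - {0}" if p: "p \<in> proj_space" for p
      proof -
        obtain v where "v \<noteq> 0" "p = vec.span {v}" using p by (rule proj_space_obtain)
        hence "v \<in> p - {0}" using self_in_span by auto
        thus ?thesis unfolding rep_def by (rule someI)
      qed
      have a_eq: "a j (vec.span {v}) = s (vec.span {v}) (j, v) / (v $ i j) powi (as ! j) \<and> v $ i j \<noteq> 0"
        if "j < length as" "v \<in> cone (U \<inter> V)" for j v
      proof -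
        have v: "v \<noteq> 0" "vec.span {v} \<in> V" using that by (auto simp: cone_def)
        have "vec.span {v} \<in> basic_open (\<lambda>v. v $ i j)" using that unfolding cone_def U by blast
        hence v: "v \<noteq> 0" "vec.span {v} \<in> V" "v $ i j \<noteq> 0" using v by (auto simp: coord_open)
        have "rep (vec.span {v}) \<in> vec.span {v} - {0}" using rep span_in_proj_space[OF v(1)] by blast
        then obtain c where c: "rep (vec.span {v}) = c *s v" "c \<noteq> 0" by (auto simp: in_span_singleton)
        have "(\<lambda>w. s (vec.span {v}) (j, w)) \<in> fibre (twist (as ! j)) (vec.span {v})"
          using R v(2) that(1) by (auto simp: fibre_twist_sum)
        hence "s (vec.span {v}) (j, c *s v) = c powi (as ! j) * s (vec.span {v}) (j, v)"
          using v(1) self_in_span[of v] c(2) by (auto simp: fibre_twist)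
        thus ?thesis unfolding a_def c(1) using c(2) v(3) by (simp add: power_int_mult_distrib)
      qed
      have "regular_on (U \<inter> V) (a j)" if j: "j < length as" for j
      proof (subst regular_on_iff)
        show "U \<inter> V \<subseteq> proj_space" using VP by blast
        show "rational (cone (U \<inter> V)) 0 (\<lambda>v. a j (vec.span {v}))" unfolding rational_def
        proof
          fix v assume v: "v \<in> cone (U \<inter> V)"
          hence "rat_at (cone V) v (as ! j) (\<lambda>v. s (vec.span {v}) (j, v))"
            using R j by (auto simp: rational_def cone_Int)
          hence 1: "rat_at (cone (U \<inter> V)) v (as ! j) (\<lambda>v. s (vec.span {v}) (j, v))"
            by (rule rat_at_mono) (auto simp: cone_Int)
          have vi: "v $ i j \<noteq> 0" using a_eq[OF j v] by blast
          from rat_at_divide[OF 1 rat_at_power_int[OF v vi, of "as ! j"] v] vi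
          have "rat_at (cone (U \<inter> V)) v 0 (\<lambda>v. s (vec.span {v}) (j, v) / (v $ i j) powi (as ! j))" by simp
          thus "rat_at (cone (U \<inter> V)) v 0 (\<lambda>v. a j (vec.span {v}))"
            by (rule rat_at_cong) (use a_eq[OF j] in auto)
        qed
      qed
      moreover have "s p = (\<Sum>j<length as. fscale (a j p) ((fs ! j) p))" if p: "p \<in> U \<inter> V" for p
      proof (rule ext, clarify)
        fix j w
        have fib: "s p \<in> fibre (twist_sum B as) p" using R p by auto
        show "s p (j, w) = (\<Sum>j<length as. fscale (a j p) ((fs ! j) p)) (j, w)"
        proof (cases "j < length as \<and> w \<in> p - {0}")
          case True
          hence pw: "p = vec.span {w}" using p VP span_eqI[of p w] by auto
          hence "w \<in> cone (U \<inter> V)" using p True by (auto simp: cone_def)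
          with a_eq[of j w] True show ?thesis unfolding fs twist_frame_sum
            by (simp add: coord_power_def pw)
        next
          case False
          thus ?thesis unfolding fs twist_frame_sum using fib
            by (auto simp: coord_power_def fibre_twist_sum fibre_twist)
        qed
      qed
      ultimately show ?thesis by (intro exI[of _ a]) (simp add: fs twist_frame_length)
    qed
    thus "regular_section (twist_sum B as) V s"
      by (intro regular_sectionI) (use R in auto)
  qed
qed

text \<open>The element of the fibre of \<open>\<O>(a)\<close> over the point \<open>[v]\<close> taking the value \<open>1\<close> at \<open>v\<close>.\<close>

definition unit_at :: "int \<Rightarrow> 'k::field ^ 'n::finite \<Rightarrow> 'k ^ 'n \<Rightarrow> 'k" where
  "unit_at a v w = (if w \<in> vec.span {v} - {0} then (THE c. w = c *s v) powi a else 0)"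

lemma smult_cancel: "v \<noteq> 0 \<Longrightarrow> c *s v = d *s v \<longleftrightarrow> c = d"
  for v :: "'k::field ^ 'n::finite"
  by simp

lemma unit_at_scaled: "v \<noteq> 0 \<Longrightarrow> c \<noteq> 0 \<Longrightarrow> unit_at a v (c *s v) = c powi a"
  by (auto simp: unit_at_def in_span_singleton smult_cancel)

lemma unit_at_self: "v \<noteq> 0 \<Longrightarrow> unit_at a v v = 1"
  using unit_at_scaled[of v 1 a] by simp

lemma unit_at_outside: "w \<notin> vec.span {v} - {0} \<Longrightarrow> unit_at a v w = 0"
  unfolding unit_at_def by (rule if_not_P)

lemma nonzero_in_span_singletonE:
  assumes "w \<in> vec.span {v} - {0}"
  obtains c where "c \<noteq> 0" "v \<noteq> 0" "w = c *s v"
proof -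
  obtain c where "w = c *s v" using assms by (auto simp: in_span_singleton)
  thus ?thesis using that[of c] assms by auto
qed

lemma unit_at_fibre: "unit_at a v \<in> fibre (twist a) (vec.span {v})"
proof -
  have "unit_at a v (c *s w) = c powi a * unit_at a v w" if w: "w \<in> vec.span {v} - {0}" and c: "c \<noteq> 0" for w c
  proof -
    obtain d where d: "d \<noteq> 0" "v \<noteq> 0" "w = d *s v"
      using w by (rule nonzero_in_span_singletonE)
    have "unit_at a v ((c * d) *s v) = (c * d) powi a" using d c by (intro unit_at_scaled) auto
    thus ?thesis using d unit_at_scaled[OF d(2,1), of a] by (simp add: power_int_mult_distrib)
  qed
  thus ?thesis by (simp add: fibre_twist unit_at_outside)
qed

lemma fibre_twist_eq:
  assumes "f \<in> fibre (twist a) (vec.span {v})"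
  shows "f = fscale (f v) (unit_at a v)"
proof
  fix w
  show "f w = fscale (f v) (unit_at a v) w"
  proof (cases "w \<in> vec.span {v} - {0}")
    case True
    then obtain c where c: "c \<noteq> 0" "v \<noteq> 0" "w = c *s v"
      by (rule nonzero_in_span_singletonE)
    have "v \<in> vec.span {v} - {0}" using c self_in_span by auto
    hence "f (c *s v) = c powi a * f v" using assms c(1) by (simp add: fibre_twist)
    thus ?thesis using c by (simp add: unit_at_scaled fscale_apply)
  next
    case False
    thus ?thesis using assms by (simp add: fibre_twist unit_at_outside fscale_apply)
  qed
qed

lemma coord_power_fibre: "p \<in> basic_open (\<lambda>v. v $ i) \<Longrightarrow> coord_power a i p \<in> fibre (twist a) p"
proof -
  assume p: "p \<in> basic_open (\<lambda>v. v $ i)"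
  then obtain v where v: "v \<noteq> 0" "p = vec.span {v}" using basic_open_subset by (blast elim: proj_space_obtain)
  have "c *s w \<in> p - {0}" if "w \<in> p - {0}" "c \<noteq> 0" for c w
    using that vec.span_scale[of w "{v}" c] by (auto simp: v(2))
  thus ?thesis by (auto simp: fibre_twist coord_power_def power_int_mult_distrib)
qed

lemma coord_power_eq:
  assumes "v $ i \<noteq> 0"
  shows "coord_power a i (vec.span {v}) = fscale ((v $ i) powi a) (unit_at a v)"
proof -
  have "v \<noteq> 0" using assms by auto
  thus ?thesis
    using fibre_twist_eq[OF coord_power_fibre[of "vec.span {v}" i a]] assms self_in_span[of v]
    by (simp add: coord_open coord_power_def)
qed

lemma slot_scale: "slot j (fscale c f) = fscale c (slot j f)"
  by (auto simp: slot_def fscale_def)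

lemma slot_apply: "slot j f (j', v) = (if j' = j then f v else 0)"
  by (simp add: slot_def)

lemma fibre_twist_subspace: "fvec.subspace (fibre (twist a) p)"
  by (rule fvec.subspaceI) (auto simp: fibre_twist fscale_apply algebra_simps)

lemma fibre_twist_sum_subspace: "fvec.subspace (fibre (twist_sum B as) p)"
  by (rule fvec.subspaceI) (auto simp: fibre_twist_sum fibre_twist fscale_apply algebra_simps)

lemma slot_fibre:
  assumes "j < length as" "f \<in> fibre (twist (as ! j)) p"
  shows "slot j f \<in> fibre (twist_sum B as) p"
  using assms by (auto simp: fibre_twist_sum slot_apply fibre_twist)

lemma slot_unit_fibre:
  "j < length as \<Longrightarrow> slot j (unit_at (as ! j) v) \<in> fibre (twist_sum B as) (vec.span {v})"
  by (intro slot_fibre unit_at_fibre)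

lemma fibre_twist_sum_eq:
  assumes "f \<in> fibre (twist_sum B as) (vec.span {v})"
  shows "f = (\<Sum>j<length as. fscale (f (j, v)) (slot j (unit_at (as ! j) v)))"
proof (rule ext, clarify)
  fix j w
  have "(\<Sum>j<length as. fscale (f (j, v)) (slot j (unit_at (as ! j) v))) (j, w) =
      (\<Sum>i<length as. if i = j then f (j, v) * unit_at (as ! j) v w else 0)"
    unfolding sum_fun_apply by (intro sum.cong) (auto simp: fscale_apply slot_apply)
  also have "\<dots> = f (j, w)"
  proof (cases "j < length as")
    case True
    hence "(\<lambda>w. f (j, w)) \<in> fibre (twist (as ! j)) (vec.span {v})"
      using assms by (simp add: fibre_twist_sum)
    from fun_cong[OF fibre_twist_eq[OF this], of w] True show ?thesis by (simp add: fscale_apply)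
  qed (use assms in \<open>auto simp: fibre_twist_sum\<close>)
  finally show "f (j, w) = (\<Sum>j<length as. fscale (f (j, v)) (slot j (unit_at (as ! j) v))) (j, w)" ..
qed

subsection \<open>Homomorphisms\<close>

lemma bundle_homD:
  assumes "bundle_hom E F \<phi>"
  shows "base E = base F"
    and "p \<in> base E \<Longrightarrow> x \<in> fibre E p \<Longrightarrow> \<phi> p x \<in> fibre F p"
    and "p \<in> base E \<Longrightarrow> x \<in> fibre E p \<Longrightarrow> y \<in> fibre E p \<Longrightarrow> \<phi> p (x + y) = \<phi> p x + \<phi> p y"
    and "p \<in> base E \<Longrightarrow> x \<in> fibre E p \<Longrightarrow> \<phi> p (fscale a x) = fscale a (\<phi> p x)"
    and "(U, fs) \<in> frames E \<Longrightarrow> s \<in> set fs \<Longrightarrow> regular_section F U (\<lambda>p. \<phi> p (s p))"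
  using assms unfolding bundle_hom_def by blast+

lemma bundle_homI:
  assumes "base E = base F"
    and "\<And>p x. p \<in> base E \<Longrightarrow> x \<in> fibre E p \<Longrightarrow> \<phi> p x \<in> fibre F p"
    and "\<And>p x y. p \<in> base E \<Longrightarrow> x \<in> fibre E p \<Longrightarrow> y \<in> fibre E p \<Longrightarrow> \<phi> p (x + y) = \<phi> p x + \<phi> p y"
    and "\<And>p x a. p \<in> base E \<Longrightarrow> x \<in> fibre E p \<Longrightarrow> \<phi> p (fscale a x) = fscale a (\<phi> p x)"
    and "\<And>U fs s. (U, fs) \<in> frames E \<Longrightarrow> s \<in> set fs \<Longrightarrow> regular_section F U (\<lambda>p. \<phi> p (s p))"
  shows "bundle_hom E F \<phi>"
  unfolding bundle_hom_def
proof (intro conjI ballI)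
  fix x assume "x \<in> frames E"
  thus "case x of (U, fs) \<Rightarrow> \<forall>s\<in>set fs. regular_section F U (\<lambda>p. \<phi> p (s p))"
    using assms(5) by (cases x) auto
qed (use assms in auto)

lemma bundle_hom_sum:
  fixes n :: nat
  assumes "bundle_hom E F \<phi>" "p \<in> base E" "fvec.subspace (fibre E p)" "\<And>j. j < n \<Longrightarrow> x j \<in> fibre E p"
  shows "\<phi> p (\<Sum>j<n. fscale (a j) (x j)) = (\<Sum>j<n. fscale (a j) (\<phi> p (x j)))"
  using assms(4)
proof (induction n)
  case 0
  have "\<phi> p (fscale 0 0) = fscale 0 (\<phi> p 0)"
    by (rule bundle_homD(4)[OF assms(1,2)]) (rule fvec.subspace_0[OF assms(3)])
  hence "\<phi> p 0 = 0" by simp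
  thus ?case by (simp only: lessThan_0 sum.empty)
next
  case (Suc n)
  have "(\<Sum>j<n. fscale (a j) (x j)) \<in> fibre E p" "fscale (a n) (x n) \<in> fibre E p"
    using Suc.prems by (auto intro!: fvec.subspace_sum[OF assms(3)] fvec.subspace_scale[OF assms(3)])
  from bundle_homD(3)[OF assms(1,2) this] show ?case
    using Suc bundle_homD(4)[OF assms(1,2) Suc.prems[OF lessI], of "a n"]
    by (simp only: sum.lessThan_Suc less_SucI)
qed

section \<open>Frames as bases of the fibres, and regular sections under homomorphisms\<close>

lemma vector_bundleD:
  assumes "vector_bundle r E"
  shows "base E \<subseteq> proj_space"
    and "(U, fs) \<in> frames E \<Longrightarrow> zariski_open_in (base E) U"
    and "(U, fs) \<in> frames E \<Longrightarrow> length fs = r"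
    and "(U, fs) \<in> frames E \<Longrightarrow> p \<in> U \<Longrightarrow> is_basis (fibre E p) (map (\<lambda>s. s p) fs)"
    and "p \<in> base E \<Longrightarrow> \<exists>U fs. (U, fs) \<in> frames E \<and> p \<in> U"
    and "(U, fs) \<in> frames E \<Longrightarrow> s \<in> set fs \<Longrightarrow> regular_section E U s"
proof -
  show "p \<in> base E \<Longrightarrow> \<exists>U fs. (U, fs) \<in> frames E \<and> p \<in> U"
    using assms unfolding vector_bundle_def by blast
qed (use assms in \<open>auto simp: vector_bundle_def\<close>)

lemma vector_bundleI:
  assumes "base E \<subseteq> proj_space"
    and "\<And>U fs. (U, fs) \<in> frames E \<Longrightarrow> zariski_open_in (base E) U"
    and "\<And>U fs. (U, fs) \<in> frames E \<Longrightarrow> length fs = r"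
    and "\<And>U fs p. (U, fs) \<in> frames E \<Longrightarrow> p \<in> U \<Longrightarrow> is_basis (fibre E p) (map (\<lambda>s. s p) fs)"
    and "\<And>p. p \<in> base E \<Longrightarrow> \<exists>U fs. (U, fs) \<in> frames E \<and> p \<in> U"
    and "\<And>U fs s. (U, fs) \<in> frames E \<Longrightarrow> s \<in> set fs \<Longrightarrow> regular_section E U s"
  shows "vector_bundle r E"
proof -
  have "(\<Union>(U, fs)\<in>frames E. U) = base E"
  proof (intro equalityI subsetI)
    fix p assume "p \<in> (\<Union>(U, fs)\<in>frames E. U)"
    thus "p \<in> base E" using zariski_open_in_subset[OF assms(2)] by auto
  next
    fix p assume "p \<in> base E"
    thus "p \<in> (\<Union>(U, fs)\<in>frames E. U)" using assms(5) by blast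
  qed
  thus ?thesis using assms(1-4,6) by (auto simp: vector_bundle_def)
qed

lemma is_basis_sum:
  assumes "is_basis V bs"
  shows "x \<in> V \<longleftrightarrow> (\<exists>a. x = (\<Sum>j<length bs. fscale (a j) (bs ! j)))"
proof -
  have bs: "distinct bs" "V = fvec.span (set bs)" using assms by (auto simp: is_basis_def)
  have sum_eq: "(\<Sum>b\<in>set bs. fscale (u b) b) = (\<Sum>j<length bs. fscale (u (bs ! j)) (bs ! j))" for u
  proof -
    have "(\<Sum>b\<in>(!) bs ` {..<length bs}. fscale (u b) b) = (\<Sum>j<length bs. fscale (u (bs ! j)) (bs ! j))"
      by (subst sum.reindex) (auto simp: inj_on_def nth_eq_iff_index_eq[OF bs(1)])
    moreover have "(!) bs ` {..<length bs} = set bs" by (auto simp: set_conv_nth)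
    ultimately show ?thesis by simp
  qed
  show ?thesis
  proof
    assume "x \<in> V"
    then obtain u where "x = (\<Sum>b\<in>set bs. fscale (u b) b)"
      unfolding bs(2) fvec.span_finite[OF finite_set] by auto
    thus "\<exists>a. x = (\<Sum>j<length bs. fscale (a j) (bs ! j))"
      unfolding sum_eq by (intro exI[of _ "\<lambda>j. u (bs ! j)"])
  next
    assume "\<exists>a. x = (\<Sum>j<length bs. fscale (a j) (bs ! j))"
    then obtain a where x: "x = (\<Sum>j<length bs. fscale (a j) (bs ! j))" ..
    show "x \<in> V" unfolding bs(2) x
      by (intro fvec.span_sum fvec.span_scale fvec.span_base) simp
  qed
qed

lemma is_basis_independent:
  assumes "is_basis V bs" "(\<Sum>j<length bs. fscale (a j) (bs ! j)) = 0" "j < length bs"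
  shows "a j = 0"
proof -
  have bs: "distinct bs" "fvec.independent (set bs)" using assms(1) by (auto simp: is_basis_def)
  define u where "u b = a (THE j. j < length bs \<and> bs ! j = b)" for b
  have u: "u (bs ! j) = a j" if "j < length bs" for j
  proof -
    have "(THE i. i < length bs \<and> bs ! i = bs ! j) = j"
      using that by (intro the_equality) (auto simp: nth_eq_iff_index_eq[OF bs(1)])
    thus ?thesis by (simp add: u_def)
  qed
  have "(\<Sum>b\<in>(!) bs ` {..<length bs}. fscale (u b) b) = (\<Sum>j<length bs. fscale (a j) (bs ! j))"
    by (subst sum.reindex) (auto simp: inj_on_def nth_eq_iff_index_eq[OF bs(1)] u)
  moreover have "(!) bs ` {..<length bs} = set bs" by (auto simp: set_conv_nth)
  ultimately have "(\<Sum>b\<in>set bs. fscale (u b) b) = 0" using assms(2) by simp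
  hence "u (bs ! j) = 0"
    using bs(2) assms(3) unfolding fvec.dependent_finite[OF finite_set] by (metis nth_mem)
  thus ?thesis using u[OF assms(3)] by simp
qed

lemma is_basisI:
  fixes bs :: "('i \<Rightarrow> 'k::field) list"
  assumes indep: "\<And>a j. (\<Sum>j<length bs. fscale (a j) (bs ! j)) = 0 \<Longrightarrow> j < length bs \<Longrightarrow> a j = 0"
    and span: "\<And>x. x \<in> V \<longleftrightarrow> (\<exists>a. x = (\<Sum>j<length bs. fscale (a j) (bs ! j)))"
  shows "is_basis V bs"
proof -
  have dist: "distinct bs" unfolding distinct_conv_nth
  proof (intro allI impI notI)
    fix i j assume ij: "i < length bs" "j < length bs" "i \<noteq> j" "bs ! i = bs ! j"
    define a where "a k = (if k = i then 1 else if k = j then - 1 else (0::'k))" for k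
    have "(\<Sum>k<length bs. fscale (a k) (bs ! k)) = (\<Sum>k\<in>{i, j}. fscale (a k) (bs ! k))"
      by (rule sum.mono_neutral_right) (use ij in \<open>auto simp: a_def\<close>)
    also have "\<dots> = 0" using ij by (auto simp: a_def fscale_def fun_eq_iff)
    finally have "a i = 0" using indep ij(1) by blast
    thus False by (simp add: a_def)
  qed
  have sum_eq: "(\<Sum>b\<in>set bs. fscale (u b) b) = (\<Sum>j<length bs. fscale (u (bs ! j)) (bs ! j))" for u
  proof -
    have "(\<Sum>b\<in>(!) bs ` {..<length bs}. fscale (u b) b) = (\<Sum>j<length bs. fscale (u (bs ! j)) (bs ! j))"
      by (subst sum.reindex) (auto simp: inj_on_def nth_eq_iff_index_eq[OF dist])
    moreover have "(!) bs ` {..<length bs} = set bs" by (auto simp: set_conv_nth)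
    ultimately show ?thesis by simp
  qed
  have "fvec.independent (set bs)"
    unfolding fvec.dependent_finite[OF finite_set] sum_eq
  proof (rule notI, elim exE conjE bexE)
    fix u b assume u: "b \<in> set bs" "u b \<noteq> 0" "(\<Sum>j<length bs. fscale (u (bs ! j)) (bs ! j)) = 0"
    then obtain i where "i < length bs" "b = bs ! i" by (auto simp: in_set_conv_nth)
    thus False using indep[OF u(3)] u(2) by simp
  qed
  moreover have "fvec.span (set bs) = V"
  proof (intro equalityI subsetI)
    fix x assume "x \<in> fvec.span (set bs)"
    thus "x \<in> V" unfolding fvec.span_finite[OF finite_set] sum_eq span by auto
  next
    fix x assume "x \<in> V"
    then obtain a where x: "x = (\<Sum>j<length bs. fscale (a j) (bs ! j))" unfolding span ..
    show "x \<in> fvec.span (set bs)" unfolding x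
      by (intro fvec.span_sum fvec.span_scale fvec.span_base) simp
  qed
  ultimately show ?thesis using dist by (simp add: is_basis_def)
qed

lemma fibre_subspace:
  assumes "vector_bundle r E" "p \<in> base E"
  shows "fvec.subspace (fibre E p)"
proof -
  obtain U fs where "(U, fs) \<in> frames E" "p \<in> U" using vector_bundleD(5)[OF assms] by blast
  hence "is_basis (fibre E p) (map (\<lambda>s. s p) fs)" using vector_bundleD(4)[OF assms(1)] by blast
  thus ?thesis unfolding is_basis_def using fvec.subspace_span by metis
qed

lemma frame_in_fibre:
  assumes "vector_bundle r E" "(U, fs) \<in> frames E" "p \<in> U" "s \<in> set fs"
  shows "s p \<in> fibre E p"
  using vector_bundleD(6)[OF assms(1,2,4)] assms(3) by (rule regular_sectionD(1))

text \<open>A homomorphism is required to be regular on the given frames only. Near each point the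
  section is expanded in a frame, and linearity on the fibres carries regularity over.\<close>

lemma bundle_hom_regular_section:
  fixes E :: "('k::field, 'n::finite, 'i) vbundle"
  assumes E: "vector_bundle r E" and \<phi>: "bundle_hom E (twist_sum B bs) \<phi>"
    and s: "regular_section E V s" and V: "V \<subseteq> base E" and l: "l < length bs"
  shows "rational (cone V) (bs ! l) (\<lambda>v. \<phi> (vec.span {v}) (s (vec.span {v})) (l, v))"
  unfolding rational_def
proof
  fix v assume v: "v \<in> cone V"
  have BE: "base E = B" using bundle_homD(1)[OF \<phi>] by (simp add: base_twist_sum)
  have BP: "B \<subseteq> proj_space" using vector_bundleD(1)[OF E] BE by simp
  have "vec.span {v} \<in> base E" using v V by (auto simp: cone_def)
  then obtain U fs where U: "(U, fs) \<in> frames E" "vec.span {v} \<in> U"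
    using vector_bundleD(5)[OF E] by blast
  have UB: "U \<subseteq> base E" using zariski_open_in_subset[OF vector_bundleD(2)[OF E U(1)]] .
  obtain a where a: "\<forall>j<length fs. regular_on (U \<inter> V) (a j)"
     "\<forall>p\<in>U \<inter> V. s p = (\<Sum>j<length fs. fscale (a j p) ((fs ! j) p))"
    using regular_sectionD(2)[OF s U(1)] by blast
  have vU: "v \<in> cone U" "v \<in> cone (U \<inter> V)" "v \<noteq> 0" using v U(2) by (auto simp: cone_def)
  have "rat_at (cone (U \<inter> V)) v (0 + bs ! l)
     (\<lambda>u. \<Sum>j<length fs. a j (vec.span {u}) * \<phi> (vec.span {u}) ((fs ! j) (vec.span {u})) (l, u))"
  proof (intro rat_at_sum vU(3) rat_at_mult)
    fix j assume j: "j \<in> {..<length fs}"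
    have "rational (cone (U \<inter> V)) 0 (\<lambda>u. a j (vec.span {u}))"
      using a(1) j UB BE BP by (subst (asm) regular_on_iff) auto
    thus "rat_at (cone (U \<inter> V)) v 0 (\<lambda>u. a j (vec.span {u}))" using vU by (simp add: rational_def)
    have "regular_section (twist_sum B bs) U (\<lambda>p. \<phi> p ((fs ! j) p))"
      using j by (intro bundle_homD(5)[OF \<phi> U(1)]) auto
    hence "rational (cone U) (bs ! l) (\<lambda>u. \<phi> (vec.span {u}) ((fs ! j) (vec.span {u})) (l, u))"
      using UB BE BP l by (subst (asm) regular_section_twist_sum) auto
    thus "rat_at (cone (U \<inter> V)) v (bs ! l) (\<lambda>u. \<phi> (vec.span {u}) ((fs ! j) (vec.span {u})) (l, u))"
      using rat_at_mono[of "cone U" v "bs ! l" _ "cone (U \<inter> V)"] vU(1)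
      unfolding rational_def cone_Int by blast
  qed
  hence rat: "rat_at (cone (U \<inter> V)) v (bs ! l)
     (\<lambda>u. \<Sum>j<length fs. a j (vec.span {u}) * \<phi> (vec.span {u}) ((fs ! j) (vec.span {u})) (l, u))" by simp
  have "rat_at (cone (U \<inter> V)) v (bs ! l) (\<lambda>v. \<phi> (vec.span {v}) (s (vec.span {v})) (l, v))"
  proof (rule rat_at_cong[OF rat])
    fix u assume u: "u \<in> cone (U \<inter> V)"
    hence p: "vec.span {u} \<in> U \<inter> V" by (simp add: cone_def)
    hence pE: "vec.span {u} \<in> base E" using V by blast
    have "\<phi> (vec.span {u}) (\<Sum>j<length fs. fscale (a j (vec.span {u})) ((fs ! j) (vec.span {u}))) =
       (\<Sum>j<length fs. fscale (a j (vec.span {u})) (\<phi> (vec.span {u}) ((fs ! j) (vec.span {u}))))"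
      by (rule bundle_hom_sum[OF \<phi> pE fibre_subspace[OF E pE]])
        (use p in \<open>auto intro!: frame_in_fibre[OF E U(1)]\<close>)
    thus "(\<Sum>j<length fs. a j (vec.span {u}) * \<phi> (vec.span {u}) ((fs ! j) (vec.span {u})) (l, u)) =
        \<phi> (vec.span {u}) (s (vec.span {u})) (l, u)"
      using a(2) p by (simp add: sum_fun_apply fscale_apply)
  qed
  thus "rat_at (cone V) v (bs ! l) (\<lambda>v. \<phi> (vec.span {v}) (s (vec.span {v})) (l, v))"
    by (rule rat_at_zariski_open[OF vector_bundleD(1)[OF E] vector_bundleD(2)[OF E U(1)] V vU(1)])
qed

lemma regular_section_restrict:
  assumes "V \<subseteq> L"
  shows "regular_section (restrict_bundle E L) V s \<longleftrightarrow> regular_section E V s"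
proof -
  have "U \<inter> L \<inter> V = U \<inter> V" for U using assms by blast
  thus ?thesis by (simp add: regular_section_def restrict_bundle_def case_prod_unfold)
qed

lemma twist_sum_hom_section:
  assumes \<phi>: "bundle_hom (twist_sum B as) F \<phi>" and j: "j < length as"
  shows "regular_section F (B \<inter> basic_open (\<lambda>v. v $ i)) (\<lambda>p. \<phi> p (slot j (coord_power (as ! j) i p)))"
proof -
  define U where "U = B \<inter> (\<Inter>j<length as. basic_open (\<lambda>v. v $ i) \<inter> B)"
  have U: "U = B \<inter> basic_open (\<lambda>v. v $ i)" using j by (auto simp: U_def)
  have fr: "(U, twist_frame as (\<lambda>_. i)) \<in> frames (twist_sum B as)"
    unfolding frames_twist_sum U_def by (rule range_eqI[of _ _ "\<lambda>_. i"]) (rule refl)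
  have "twist_frame as (\<lambda>_. i) ! j \<in> set (twist_frame as (\<lambda>_. i))"
    using j by (simp add: twist_frame_length)
  from bundle_homD(5)[OF \<phi> fr this] show ?thesis using j by (simp add: twist_frame_nth U)
qed

text \<open>The unit vector at \<open>v\<close> itself depends on \<open>v\<close>: the local frame
  \<open>coord_power\<close> is the power \<open>as ! j\<close> of a coordinate times it. Dividing
  by this power lowers the degree from \<open>b\<close> to \<open>b - as ! j\<close>.\<close>

lemma rational_unit:
  fixes B :: "('k::field ^ 'n::finite) set set"
  assumes j: "j < length as"
    and scale: "\<And>p a x. p \<in> B \<Longrightarrow> x \<in> fibre (twist_sum B as) p \<Longrightarrow> \<Phi> p (fscale a x) = fscale a (\<Phi> p x)"
    and rat: "\<And>i. rational (cone (B \<inter> basic_open (\<lambda>v. v $ i))) b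
       (\<lambda>v. \<Phi> (vec.span {v}) (slot j (coord_power (as ! j) i (vec.span {v}))) (l, v))"
  shows "rational (cone B) (b - as ! j) (\<lambda>v. \<Phi> (vec.span {v}) (slot j (unit_at (as ! j) v)) (l, v))"
  unfolding rational_def
proof
  fix v assume v: "v \<in> cone B"
  hence "v \<noteq> 0" by (simp add: cone_def)
  then obtain i where i: "v $ i \<noteq> 0" using nonzero_coord by blast
  define Y where "Y = cone (B \<inter> basic_open (\<lambda>v. v $ i))"
  have Y: "Y = cone B \<inter> {v. v $ i \<noteq> 0}" by (auto simp: Y_def cone_def coord_open)
  have vY: "v \<in> Y" using v i by (simp add: Y)
  have 1: "rat_at Y v b (\<lambda>v. \<Phi> (vec.span {v}) (slot j (coord_power (as ! j) i (vec.span {v}))) (l, v))"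
    using rat[of i] vY by (simp add: rational_def Y_def)
  have "rat_at Y v (b - as ! j) (\<lambda>v. \<Phi> (vec.span {v}) (slot j (unit_at (as ! j) v)) (l, v))"
  proof (rule rat_at_cong[OF rat_at_divide[OF 1 rat_at_power_int[OF vY i, of "as ! j"] vY]])
    show "(v $ i) powi (as ! j) \<noteq> 0" using i by simp
    fix u assume u: "u \<in> Y"
    hence ui: "u $ i \<noteq> 0" "vec.span {u} \<in> B" by (auto simp: Y cone_def)
    show "\<Phi> (vec.span {u}) (slot j (coord_power (as ! j) i (vec.span {u}))) (l, u) / (u $ i) powi (as ! j) =
        \<Phi> (vec.span {u}) (slot j (unit_at (as ! j) u)) (l, u)"
      using scale[OF ui(2) slot_unit_fibre[OF j]] ui(1)
      by (simp add: coord_power_eq[OF ui(1)] slot_scale fscale_apply)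
  qed
  thus "rat_at (cone B) v (b - as ! j) (\<lambda>v. \<Phi> (vec.span {v}) (slot j (unit_at (as ! j) v)) (l, v))"
    unfolding Y by (rule rat_at_open[OF homogeneous_coord i])
qed

lemma twist_sum_hom_rational:
  assumes B: "B \<subseteq> proj_space" and \<phi>: "bundle_hom (twist_sum B as) (twist_sum B bs) \<phi>"
    and j: "j < length as" and l: "l < length bs"
  shows "rational (cone B) (bs ! l - as ! j) (\<lambda>v. \<phi> (vec.span {v}) (slot j (unit_at (as ! j) v)) (l, v))"
proof (rule rational_unit[where \<Phi> = \<phi>, OF j])
  show "\<phi> p (fscale a x) = fscale a (\<phi> p x)" if "p \<in> B" "x \<in> fibre (twist_sum B as) p" for p a x
    using that bundle_homD(4)[OF \<phi>] by (simp add: base_twist_sum)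
  show "rational (cone (B \<inter> basic_open (\<lambda>v. v $ i))) (bs ! l)
       (\<lambda>v. \<phi> (vec.span {v}) (slot j (coord_power (as ! j) i (vec.span {v}))) (l, v))" for i
    using twist_sum_hom_section[OF \<phi> j, of i] l by (subst (asm) regular_section_twist_sum) (use B in auto)
qed

text \<open>Meant for a splitting \<open>\<rho>\<close> over a line followed by the inclusion
  \<open>\<phi>\<close> into a trivial bundle: summands O and O(-1) then have coordinates of degree
  0 and 1.\<close>

lemma twist_sum_comp_rational:
  assumes E: "vector_bundle r E" and L: "L \<subseteq> base E"
    and \<rho>: "bundle_hom (twist_sum L as) (restrict_bundle E L) \<rho>"
    and \<phi>: "bundle_hom E (twist_sum B bs) \<phi>"
    and j: "j < length as" and l: "l < length bs"
  shows "rational (cone L) (bs ! l - as ! j)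
     (\<lambda>v. \<phi> (vec.span {v}) (\<rho> (vec.span {v}) (slot j (unit_at (as ! j) v))) (l, v))"
proof (rule rational_unit[where \<Phi> = "\<lambda>p x. \<phi> p (\<rho> p x)", OF j])
  have fib: "fibre (restrict_bundle E L) p = fibre E p" for p by (simp add: restrict_bundle_def)
  show "\<phi> p (\<rho> p (fscale a x)) = fscale a (\<phi> p (\<rho> p x))" if "p \<in> L" "x \<in> fibre (twist_sum L as) p" for p a x
    using that bundle_homD(2,4)[OF \<rho>, of p x] bundle_homD(4)[OF \<phi>, of p "\<rho> p x"] L
    by (auto simp: base_twist_sum fib)
  show "rational (cone (L \<inter> basic_open (\<lambda>v. v $ i))) (bs ! l)
       (\<lambda>v. \<phi> (vec.span {v}) (\<rho> (vec.span {v}) (slot j (coord_power (as ! j) i (vec.span {v})))) (l, v))" for i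
    using twist_sum_hom_section[OF \<rho> j, of i] L l
    by (intro bundle_hom_regular_section[OF E \<phi>]) (auto simp: regular_section_restrict)
qed

section \<open>The rank is at least \<open>c + 2\<close>\<close>

definition mv :: "nat \<Rightarrow> (nat \<Rightarrow> nat \<Rightarrow> 'k::field) \<Rightarrow> (nat \<Rightarrow> 'k) \<Rightarrow> nat \<Rightarrow> 'k" where
  "mv x M w k = (\<Sum>l<x. M k l * w l)"

lemma left_mv: "(\<Sum>k<c. f k * mv x M w k) = (\<Sum>l<x. (\<Sum>k<c. f k * M k l) * w l)"
proof -
  have "(\<Sum>k<c. f k * mv x M w k) = (\<Sum>k<c. \<Sum>l<x. f k * M k l * w l)"
    by (simp add: mv_def sum_distrib_left mult.assoc)
  also have "\<dots> = (\<Sum>l<x. \<Sum>k<c. f k * M k l * w l)" by (rule sum.swap)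
  finally show ?thesis by (simp add: sum_distrib_right)
qed

lemma mv_unit: "l < x \<Longrightarrow> mv x M (\<lambda>i. if i = l then 1 else 0) k = M k l"
  by (simp add: mv_def if_distrib cong: if_cong)

lemma mv_add: "mv x M (\<lambda>l. w l + w' l) k = mv x M w k + mv x M w' k"
  and mv_diff: "mv x M (\<lambda>l. w l - w' l) k = mv x M w k - mv x M w' k"
  and mv_scale: "mv x M (\<lambda>l. a * w l) k = a * mv x M w k"
  by (simp_all add: mv_def algebra_simps sum.distrib sum_subtractf sum_distrib_left)

lemma mv_sum: "mv x M (\<lambda>l. \<Sum>j\<in>J. a j * w j l) k = (\<Sum>j\<in>J. a j * mv x M (w j) k)"
proof -
  have "mv x M (\<lambda>l. \<Sum>j\<in>J. a j * w j l) k = (\<Sum>l<x. \<Sum>j\<in>J. M k l * (a j * w j l))"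
    by (simp add: mv_def sum_distrib_left)
  also have "\<dots> = (\<Sum>j\<in>J. \<Sum>l<x. M k l * (a j * w j l))" by (rule sum.swap)
  finally show ?thesis by (simp add: mv_def sum_distrib_left mult_ac)
qed

lemma mv_cong: "(\<And>l. l < x \<Longrightarrow> w l = w' l) \<Longrightarrow> mv x M w k = mv x M w' k"
  by (simp add: mv_def)

text \<open>On a line spanned by \<open>u\<^sub>0, u\<^sub>1\<close>, the kernel bundle of \<open>M\<close> is trivialised by constant sections
  \<open>N\<close> and linear ones \<open>P\<close>. The relations \<open>f\<^sub>0\<close> form a space on which \<open>f \<mapsto> f'\<close> with
  \<open>f M(u\<^sub>0) = f' M(u\<^sub>1)\<close> acts, and an eigenvector contradicts surjectivity of \<open>M\<close> at a point.\<close>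

lemma pencil_left_kernel:
  fixes M0 M1 N P0 P1 :: "nat \<Rightarrow> nat \<Rightarrow> 'k::alg_closed_field"
  assumes surj: "\<And>s t. s \<noteq> 0 \<or> t \<noteq> 0 \<Longrightarrow> trivial_kernel x c (\<lambda>l k. s * M0 k l + t * M1 k l)"
    and N: "\<And>j k. j < a \<Longrightarrow> k < c \<Longrightarrow> mv x M0 (N j) k = 0"
    and P: "\<And>j k. j < b \<Longrightarrow> k < c \<Longrightarrow> mv x M0 (P0 j) k = 0"
       "\<And>j k. j < b \<Longrightarrow> k < c \<Longrightarrow> mv x M1 (P1 j) k = 0"
       "\<And>j k. j < b \<Longrightarrow> k < c \<Longrightarrow> mv x M0 (P1 j) k + mv x M1 (P0 j) k = 0"
    and ker1: "\<And>w. \<forall>k<c. mv x M1 w k = 0 \<Longrightarrow>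
       \<exists>\<alpha> \<beta>. \<forall>l<x. w l = (\<Sum>j<a. \<alpha> j * N j l) + (\<Sum>j<b. \<beta> j * P1 j l)"
    and rel: "\<And>l. l < x \<Longrightarrow> (\<Sum>k<c. f0 k * M0 k l + f1 k * M1 k l) = 0"
    and k: "k < c"
  shows "f0 k = 0 \<and> f1 k = 0"
proof -
  \<comment> \<open>The \<open>m i\<close> lift the standard basis through \<open>M1\<close>, which
    is onto by \<open>surj\<close> at \<open>s = 0\<close>, \<open>t = 1\<close>.\<close>
  have "\<forall>i\<in>{..<c}. \<exists>w. \<forall>k<c. mv x M1 w k = (if k = i then 1 else 0)"
  proof
    fix i
    have "trivial_kernel x c (\<lambda>l k. M1 k l)" using surj[of 0 1] by simp
    from full_row_rank_surj[OF this, of "\<lambda>k. if k = i then 1 else 0"]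
    show "\<exists>w. \<forall>k<c. mv x M1 w k = (if k = i then 1 else 0)"
      unfolding mv_def by blast
  qed
  from bchoice[OF this] obtain m where m: "\<forall>i\<in>{..<c}. \<forall>k<c. mv x M1 (m i) k = (if k = i then 1 else 0)" ..
  \<comment> \<open>The values of f M0 on the lifts. One has f M0 = (\<tau> f) M1 once f M0 vanishes
    on the kernel of \<open>M1\<close>. That kernel is spanned by the \<open>N j\<close>, killed by
    \<open>M0\<close>, and the \<open>P1 j\<close>, so the condition in \<open>U\<close> below is
    enough.\<close>
  define \<tau> where "\<tau> f = (\<lambda>i. if i < c then \<Sum>k<c. f k * mv x M0 (m i) k else 0)" for f :: "nat \<Rightarrow> 'k"
  define U where "U = {f. (\<forall>i\<ge>c. f i = 0) \<and> (\<forall>j<b. (\<Sum>k<c. f k * mv x M0 (P1 j) k) = 0)}"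
  have U: "fvec.subspace U"
    by (rule fvec.subspaceI)
      (auto simp: U_def fscale_apply distrib_right sum.distrib mult.assoc sum_distrib_left[symmetric])
  have \<tau>: "(\<Sum>k<c. f k * mv x M0 w k) = (\<Sum>k<c. \<tau> f k * mv x M1 w k)" if f: "f \<in> U" for f w
  proof -
    define w' where "w' = (\<lambda>l. w l - (\<Sum>i<c. mv x M1 w i * m i l))"
    have "mv x M1 w' k = 0" if "k < c" for k
    proof -
      have "(\<Sum>i<c. mv x M1 w i * mv x M1 (m i) k) = (\<Sum>i<c. if i = k then mv x M1 w k else 0)"
        by (rule sum.cong) (use m that in auto)
      thus ?thesis using that by (simp add: w'_def mv_diff mv_sum)
    qed
    then obtain \<alpha> \<beta> where w': "\<forall>l<x. w' l = (\<Sum>j<a. \<alpha> j * N j l) + (\<Sum>j<b. \<beta> j * P1 j l)"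
      using ker1 by blast
    have "mv x M0 w' k = (\<Sum>j<a. \<alpha> j * mv x M0 (N j) k) + (\<Sum>j<b. \<beta> j * mv x M0 (P1 j) k)" for k
    proof -
      have "mv x M0 w' k = mv x M0 (\<lambda>l. (\<Sum>j<a. \<alpha> j * N j l) + (\<Sum>j<b. \<beta> j * P1 j l)) k"
        by (rule mv_cong) (use w' in auto)
      thus ?thesis by (simp add: mv_add mv_sum)
    qed
    hence "(\<Sum>k<c. f k * mv x M0 w' k) = (\<Sum>k<c. \<Sum>j<b. f k * (\<beta> j * mv x M0 (P1 j) k))"
      using N by (simp add: sum_distrib_left)
    also have "\<dots> = (\<Sum>j<b. \<Sum>k<c. f k * (\<beta> j * mv x M0 (P1 j) k))" by (rule sum.swap)
    also have "\<dots> = (\<Sum>j<b. \<beta> j * (\<Sum>k<c. f k * mv x M0 (P1 j) k))"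
      by (simp add: sum_distrib_left mult_ac)
    also have "\<dots> = 0" using f by (simp add: U_def)
    finally have 0: "(\<Sum>k<c. f k * mv x M0 w' k) = 0" .
    have w: "mv x M0 w k = mv x M0 w' k + (\<Sum>i<c. mv x M1 w i * mv x M0 (m i) k)" for k
      by (simp add: w'_def mv_diff mv_sum)
    have "(\<Sum>k<c. f k * mv x M0 w k) = (\<Sum>k<c. \<Sum>i<c. f k * (mv x M1 w i * mv x M0 (m i) k))"
      unfolding w distrib_left sum.distrib 0 by (simp add: sum_distrib_left)
    also have "\<dots> = (\<Sum>i<c. \<Sum>k<c. f k * (mv x M1 w i * mv x M0 (m i) k))" by (rule sum.swap)
    also have "\<dots> = (\<Sum>i<c. \<tau> f i * mv x M1 w i)"
      by (rule sum.cong) (auto simp: \<tau>_def sum_distrib_right sum_distrib_left mult_ac)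
    finally show ?thesis .
  qed
  \<comment> \<open>Invariance: M0 P1 = - M1 P0, hence (\<tau> f) M0 P1 = - (\<tau> f) M1 P0 = - f
    M0 P0 = 0.\<close>
  have \<tau>U: "\<tau> f \<in> U" if f: "f \<in> U" for f
  proof -
    have "(\<Sum>k<c. \<tau> f k * mv x M0 (P1 j) k) = 0" if j: "j < b" for j
    proof -
      have "(\<Sum>k<c. \<tau> f k * mv x M0 (P1 j) k) = - (\<Sum>k<c. \<tau> f k * mv x M1 (P0 j) k)"
        unfolding sum_negf[symmetric]
      proof (rule sum.cong)
        fix k assume "k \<in> {..<c}"
        hence "mv x M0 (P1 j) k = - mv x M1 (P0 j) k" using P(3)[OF j, of k] by (simp add: eq_neg_iff_add_eq_0)
        thus "\<tau> f k * mv x M0 (P1 j) k = - (\<tau> f k * mv x M1 (P0 j) k)" by simp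
      qed simp
      also have "\<dots> = - (\<Sum>k<c. f k * mv x M0 (P0 j) k)" using \<tau>[OF f] by simp
      also have "\<dots> = 0" using P(1)[OF j] by simp
      finally show ?thesis .
    qed
    thus ?thesis by (simp add: U_def \<tau>_def)
  qed
  have U0: "f = 0" if f: "f \<in> U" for f
  proof (rule ccontr)
    assume "f \<noteq> 0"
    obtain g e where g: "g \<in> U" "g \<noteq> 0" "\<tau> g = fscale e g"
    proof (rule fvec_eigenvector[OF U _ _ f \<open>f \<noteq> 0\<close>, of "(\<lambda>p q. if q = p then 1 else 0) ` {..<c}" \<tau>])
      show "U \<subseteq> fvec.span ((\<lambda>p q. if q = p then 1 else 0) ` {..<c})"
      proof
        fix f assume "f \<in> U"
        thus "f \<in> fvec.span ((\<lambda>p q. if q = p then 1 else 0) ` {..<c})"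
          by (intro finite_support_span) (auto simp: U_def)
      qed
      show "\<tau> f \<in> U" if "f \<in> U" for f using that by (rule \<tau>U)
    qed (auto simp: \<tau>_def fun_eq_iff fscale_apply algebra_simps sum.distrib sum_distrib_left)
    \<comment> \<open>An eigenvector \<open>g\<close> is a left kernel vector of
      \<open>M0 - e M1\<close>, a member of the pencil and therefore onto.\<close>
    have "(\<Sum>k<c. (1 * M0 k l + (- e) * M1 k l) * g k) = 0" if l: "l < x" for l
    proof -
      have "(\<Sum>k<c. g k * M0 k l) = (\<Sum>k<c. e * g k * M1 k l)"
        using \<tau>[OF g(1), of "\<lambda>i. if i = l then 1 else 0"] l by (simp add: mv_unit g(3) fscale_apply)
      thus ?thesis by (simp add: algebra_simps sum_subtractf)
    qed
    hence "g k = 0" if "k < c" for k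
      using trivial_kernelD[OF surj[of 1 "- e"], of g k] that by simp
    moreover have "g k = 0" if "k \<ge> c" for k using g(1) that by (simp add: U_def)
    ultimately have "g = 0" by (auto simp: fun_eq_iff not_less[symmetric])
    thus False using g(2) by simp
  qed
  define f where "f k = (if k < c then f0 k else 0)" for k
  have rel': "(\<Sum>k<c. f0 k * mv x M0 w k) + (\<Sum>k<c. f1 k * mv x M1 w k) = 0" for w
  proof -
    have "(\<Sum>k<c. f0 k * mv x M0 w k) + (\<Sum>k<c. f1 k * mv x M1 w k) =
        (\<Sum>l<x. (\<Sum>k<c. f0 k * M0 k l + f1 k * M1 k l) * w l)"
      unfolding left_mv by (simp add: sum.distrib algebra_simps)
    thus ?thesis using rel by simp
  qed
  \<comment> \<open>On \<open>P1 j\<close>, which \<open>M1\<close> kills, the relation loses its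
    part with \<open>f1\<close> and says that \<open>f0\<close> lies in \<open>U\<close>.\<close>
  have "(\<Sum>k<c. f k * mv x M0 (P1 j) k) = 0" if "j < b" for j
    using rel'[of "P1 j"] P(2)[OF that] by (simp add: f_def)
  hence "f \<in> U" by (simp add: U_def f_def)
  from U0[OF this] have f0: "f0 k = 0" if "k < c" for k
    using that by (auto simp: f_def fun_eq_iff split: if_splits)
  have "(\<Sum>k<c. (0 * M0 k l + 1 * M1 k l) * f1 k) = 0" if l: "l < x" for l
    using rel[OF l] f0 by (simp add: mult.commute)
  hence "f1 k = 0" using trivial_kernelD[OF surj[of 0 1], of f1 k] k by simp
  thus ?thesis using f0 k by simp
qed

section \<open>From surjectivity on lines to the nonsingular triple\<close>

definition indep2 :: "'k::field ^ 'n::finite \<Rightarrow> 'k ^ 'n \<Rightarrow> bool" where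
  "indep2 u w \<longleftrightarrow> (\<forall>a b. a *s u + b *s w = 0 \<longrightarrow> a = 0 \<and> b = 0)"

lemma indep2_comb: "indep2 u w \<Longrightarrow> a \<noteq> 0 \<or> b \<noteq> 0 \<Longrightarrow> a *s u + b *s w \<noteq> 0"
  unfolding indep2_def by blast

lemma indep2_nonzero: "indep2 u w \<Longrightarrow> u \<noteq> 0" "indep2 u w \<Longrightarrow> w \<noteq> 0"
  using indep2_comb[of u w 1 0] indep2_comb[of u w 0 1] by auto

lemma sum_three_blocks: "(\<Sum>q<3 * c. h q) = (\<Sum>k<c. h k + h (c + k) + h (2 * c + k))"
  for h :: "nat \<Rightarrow> 'a::comm_monoid_add"
proof -
  have split: "(\<Sum>q<a + b. g q) = (\<Sum>q<a. g q) + (\<Sum>q<b. g (a + q))" for a b and g :: "nat \<Rightarrow> 'a"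
    by (induction b) (simp_all add: add.assoc)
  have "(\<Sum>q<3 * c. h q) = (\<Sum>q<c + (c + c). h q)" by (simp add: numeral_3_eq_3)
  also have "\<dots> = (\<Sum>k<c. h k) + ((\<Sum>k<c. h (c + k)) + (\<Sum>k<c. h (c + (c + k))))"
    by (simp only: split)
  finally show ?thesis by (simp add: sum.distrib add.assoc mult_2)
qed

text \<open>If \<open>x \<le> 2 * c + 1\<close>, there are \<open>c - 1\<close> independent
  annihilators \<open>z j\<close>. A combination Z = \<Sum> p_j z_j with X Z_1 + Y Z_2 + W Z_3 = 0
  is a sum of two products of a vector of length 3 with a functional, the two vectors spanning the
  plane orthogonal to (X, Y, W). By \<open>line\<close> such a Z vanishes, and then so does
  p.\<close>

lemma rank_lower_bound:
  fixes M :: "'k::alg_closed_field ^ 3 \<Rightarrow> nat \<Rightarrow> nat \<Rightarrow> 'k"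
  assumes lin: "\<And>v k l. v \<noteq> 0 \<Longrightarrow> k < c \<Longrightarrow> l < x \<Longrightarrow> M v k l = (\<Sum>i\<in>UNIV. v $ i * m i k l)"
    and line: "\<And>u0 u1 f0 f1 k. indep2 u0 u1 \<Longrightarrow>
      (\<And>l. l < x \<Longrightarrow> (\<Sum>k<c. f0 k * M u0 k l + f1 k * M u1 k l) = 0) \<Longrightarrow> k < c \<Longrightarrow> f0 k = 0 \<and> f1 k = 0"
    and c: "c \<ge> 2"
  shows "x \<ge> 2 * c + 2"
proof (rule ccontr)
  assume "\<not> x \<ge> 2 * c + 2"
  hence x: "x + (c - 1) \<le> 3 * c" using c by linarith
  \<comment> \<open>A triple of vectors of length \<open>c\<close> is stored as one vector of length
    \<open>3 * c\<close>: entry \<open>q\<close> is entry \<open>q mod c\<close> of the member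
    \<open>tri (q div c)\<close>.\<close>
  define tri :: "nat \<Rightarrow> 3" where "tri q = (if q = 0 then 1 else if q = 1 then 2 else 3)" for q
  obtain z g where z: "\<forall>j<c - 1. \<forall>l<x. (\<Sum>q<3 * c. m (tri (q div c)) (q mod c) l * z j q) = 0"
      "\<forall>i<c - 1. \<forall>j<c - 1. (\<Sum>q<3 * c. g i q * z j q) = (if i = j then 1 else 0)"
    using kernel_biorthogonal_system[OF x, of "\<lambda>l q. m (tri (q div c)) (q mod c) l"] by blast
  define A where "A b = (\<lambda>(k, j). if k < c \<and> j < c - 1 then z j (b * c + k) else 0)" for b
  have A: "A b (k, j) = z j (b * c + k)" if "k < c" "j < c - 1" for b k j using that by (simp add: A_def)
  \<comment> \<open>An annihilator of rank at most two is a relation over the line through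
    \<open>u0\<close> and \<open>u1\<close>, hence 0.\<close>
  have zero: "Z q = 0" if q: "q < 3 * c" and Z: "\<And>l. l < x \<Longrightarrow> (\<Sum>q<3 * c. m (tri (q div c)) (q mod c) l * Z q) = 0"
      and u: "indep2 u0 u1" and f: "\<And>k. k < c \<Longrightarrow> Z k = u0 $ 1 * f0 k + u1 $ 1 * f1 k"
        "\<And>k. k < c \<Longrightarrow> Z (c + k) = u0 $ 2 * f0 k + u1 $ 2 * f1 k"
        "\<And>k. k < c \<Longrightarrow> Z (2 * c + k) = u0 $ 3 * f0 k + u1 $ 3 * f1 k" for Z q f0 f1 and u0 u1 :: "'k ^ 3"
  proof -
    note [simp] = indep2_nonzero[OF u]
    have "f0 k = 0 \<and> f1 k = 0" if "k < c" for k
    proof (rule line[OF u _ that])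
      fix l assume l: "l < x"
      have "(\<Sum>k<c. f0 k * M u0 k l + f1 k * M u1 k l) =
         (\<Sum>k<c. m 1 k l * Z k + m 2 k l * Z (c + k) + m 3 k l * Z (2 * c + k))"
        by (rule sum.cong) (use l f in \<open>auto simp: lin sum_3 algebra_simps\<close>)
      also have "\<dots> = (\<Sum>q<3 * c. m (tri (q div c)) (q mod c) l * Z q)"
        unfolding sum_three_blocks by (rule sum.cong) (use c in \<open>auto simp: tri_def\<close>)
      finally show "(\<Sum>k<c. f0 k * M u0 k l + f1 k * M u1 k l) = 0" using Z[OF l] by simp
    qed
    hence Z0: "Z k = 0 \<and> Z (c + k) = 0 \<and> Z (2 * c + k) = 0" if "k < c" for k using f that by simp
    consider "q < c" | "c \<le> q" "q < 2 * c" | "2 * c \<le> q" by linarith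
    thus "Z q = 0"
    proof cases
      case 2 thus ?thesis using Z0[of "q - c"] by simp
    next
      case 3 thus ?thesis using Z0[of "q - 2 * c"] q by simp
    qed (use Z0 in simp)
  qed
  interpret nonsingular_triple "A 0" "A 1" "A 2" "c - 1"
  proof
    show "A 0 (i, j) = 0 \<and> A 1 (i, j) = 0 \<and> A 2 (i, j) = 0" if "\<not> (i < Suc (c - 1) \<and> j < c - 1)" for i j
      using that c by (auto simp: A_def)
    fix X Y W p j
    assume eq: "\<And>i. i < Suc (c - 1) \<Longrightarrow> (\<Sum>j<c - 1. (X * A 0 (i, j) + Y * A 1 (i, j) + W * A 2 (i, j)) * p j) = 0"
      and nz: "X \<noteq> 0 \<or> Y \<noteq> 0 \<or> W \<noteq> 0" and j: "j < c - 1"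
    define Z where "Z q = (\<Sum>j<c - 1. z j q * p j)" for q
    have e: "X * Z k + Y * Z (c + k) + W * Z (2 * c + k) = 0" if k: "k < c" for k
      using eq[of k] k c by (simp add: A Z_def algebra_simps sum.distrib sum_distrib_left)
    have Zsum: "(\<Sum>q<3 * c. h q * Z q) = (\<Sum>j<c - 1. (\<Sum>q<3 * c. h q * z j q) * p j)" for h
    proof -
      have "(\<Sum>q<3 * c. h q * Z q) = (\<Sum>q<3 * c. \<Sum>j<c - 1. h q * z j q * p j)"
        by (simp add: Z_def sum_distrib_left mult.assoc)
      also have "\<dots> = (\<Sum>j<c - 1. \<Sum>q<3 * c. h q * z j q * p j)" by (rule sum.swap)
      finally show ?thesis by (simp add: sum_distrib_right)
    qed
    have Zeq: "(\<Sum>q<3 * c. m (tri (q div c)) (q mod c) l * Z q) = 0" if "l < x" for l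
      unfolding Zsum using z(1) that by simp
    have Z0: "Z q = 0" if q: "q < 3 * c" for q
    proof -
      \<comment> \<open>Solving for a block with nonzero coefficient leaves the other two blocks as
        the functionals \<open>f0\<close> and \<open>f1\<close>.\<close>
      consider "X \<noteq> 0" | "X = 0" "Y \<noteq> 0" | "X = 0" "Y = 0" "W \<noteq> 0" using nz by blast
      thus ?thesis
      proof cases
        case 1
        let ?u = "vector [- Y / X, 1, 0] :: 'k ^ 3" and ?w = "vector [- W / X, 0, 1] :: 'k ^ 3"
        show ?thesis
        proof (rule zero[OF q Zeq, of ?u ?w])
          show "indep2 ?u ?w"
            by (auto simp: indep2_def Finite_Cartesian_Product.vec_eq_iff forall_3 vector_3)
          show "Z k = ?u $ 1 * Z (c + k) + ?w $ 1 * Z (2 * c + k)" if "k < c" for k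
            using e[OF that] 1 by (simp add: vector_3 field_simps eq_neg_iff_add_eq_0)
        qed (auto simp: vector_3)
      next
        case 2
        let ?u = "vector [1, 0, 0] :: 'k ^ 3" and ?w = "vector [0, - W / Y, 1] :: 'k ^ 3"
        show ?thesis
        proof (rule zero[OF q Zeq, of ?u ?w])
          show "indep2 ?u ?w"
            by (auto simp: indep2_def Finite_Cartesian_Product.vec_eq_iff forall_3 vector_3)
          show "Z (c + k) = ?u $ 2 * Z k + ?w $ 2 * Z (2 * c + k)" if "k < c" for k
            using e[OF that] 2 by (simp add: vector_3 field_simps eq_neg_iff_add_eq_0)
        qed (auto simp: vector_3)
      next
        case 3
        let ?u = "vector [1, 0, 0] :: 'k ^ 3" and ?w = "vector [0, 1, 0] :: 'k ^ 3"
        show ?thesis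
        proof (rule zero[OF q Zeq, of ?u ?w])
          show "indep2 ?u ?w"
            by (auto simp: indep2_def Finite_Cartesian_Product.vec_eq_iff forall_3 vector_3)
          show "Z (2 * c + k) = ?u $ 3 * Z k + ?w $ 3 * Z (c + k)" if "k < c" for k
            using e[OF that] 3 by (simp add: vector_3)
        qed (auto simp: vector_3)
      qed
    qed
    \<comment> \<open>Pairing with the biorthogonal functional returns the coefficient
      \<open>p j\<close>.\<close>
    have "(\<Sum>q<3 * c. g j q * Z q) = (\<Sum>i<c - 1. (if j = i then 1 else 0) * p i)"
      unfolding Zsum using z(2) j by simp
    also have "\<dots> = p j" using j by (simp add: if_distrib[of "\<lambda>t. t * _"] cong: if_cong)
    finally show "p j = 0" using Z0 by simp
  qed
  show False using dimension_zero c by simp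
qed

section \<open>Lines in coordinates, and linearity of rational functions of degree one\<close>

lemma indep2_line:
  assumes "indep2 u w"
  shows "{p \<in> proj_space. p \<subseteq> vec.span {u, w}} \<in> proj_lines"
proof -
  have "u \<noteq> w"
  proof
    assume "u = w"
    thus False using indep2_comb[OF assms, of 1 "- 1"] by simp
  qed
  moreover have "vec.independent {u, w}"
  proof (rule ccontr)
    assume "\<not> vec.independent {u, w}"
    then obtain f where f: "\<exists>v\<in>{u, w}. f v \<noteq> 0" "(\<Sum>v\<in>{u, w}. f v *s v) = 0"
      by (auto simp: vec.dependent_finite)
    hence "f u *s u + f w *s w = 0" using \<open>u \<noteq> w\<close> by simp
    thus False using f(1) assms by (auto simp: indep2_def)
  qed
  ultimately have "vec.dim (vec.span {u, w}) = 2"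
    by (simp add: vec.dim_eq_card_independent)
  thus ?thesis unfolding proj_lines_def using vec.subspace_span by blast
qed

lemma in_span_pair: "v \<in> vec.span {u, w} \<longleftrightarrow> (\<exists>a b. v = a *s u + b *s w)"
proof
  assume "v \<in> vec.span {u, w}"
  then obtain a where "v - a *s u \<in> vec.span {w}" by (auto simp: vec.span_breakdown_eq)
  then obtain b where "v - a *s u = b *s w" by (auto simp: in_span_singleton)
  thus "\<exists>a b. v = a *s u + b *s w" by (metis add.commute diff_add_cancel)
next
  assume "\<exists>a b. v = a *s u + b *s w"
  then obtain a b where v: "v = a *s u + b *s w" by blast
  show "v \<in> vec.span {u, w}"
    unfolding v by (intro vec.span_add vec.span_scale vec.span_base) auto
qed

lemma cone_line: "cone {p \<in> proj_space. p \<subseteq> vec.span {u, w}} = {v. v \<noteq> 0 \<and> v \<in> vec.span {u, w}}"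
proof -
  have "vec.span {v} \<subseteq> vec.span {u, w} \<longleftrightarrow> v \<in> vec.span {u, w}" for v
    using vec.span_minimal[of "{v}" "vec.span {u, w}"] self_in_span[of v] vec.subspace_span by blast
  thus ?thesis by (auto simp: cone_def span_in_proj_space)
qed

text \<open>After extension by 0 at the origin, additivity involves only two vectors at a time. For
  an independent pair it is the statement on a line, and for a dependent pair it follows from
  homogeneity.\<close>

lemma rational_linear:
  fixes F :: "'k::{alg_closed_field, field_char_0} ^ 'n::finite \<Rightarrow> 'k"
  assumes F: "rational {v. v \<noteq> 0} 1 F" and v: "v \<noteq> 0"
  shows "F v = (\<Sum>i\<in>UNIV. v $ i * F (axis i 1))"
proof -
  define G where "G v = (if v = 0 then 0 else F v)" for v
  have scale: "G (a *s v) = a * G v" for a v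
  proof (cases "a = 0 \<or> v = 0")
    case False
    hence "rat_at {v. v \<noteq> 0} v 1 F" using F by (simp add: rational_def)
    from rat_at_scaling[OF this, of a] False show ?thesis by (simp add: G_def)
  qed (auto simp: G_def)
  have add: "G (u + w) = G u + G w" for u w
  proof (cases "indep2 u w")
    case True
    have "u \<noteq> 0" "w \<noteq> 0" "u + w \<noteq> 0"
      using indep2_nonzero[OF True] indep2_comb[OF True, of 1 1] by auto
    moreover have "F (u + w) = F u + F w"
      by (rule rational_line(2)[of "{v. v \<noteq> 0}" 1]) (use F indep2_comb[OF True] in auto)
    ultimately show ?thesis by (simp add: G_def)
  next
    case False
    then obtain a b where ab: "a *s u + b *s w = 0" "a \<noteq> 0 \<or> b \<noteq> 0" by (auto simp: indep2_def)
    show ?thesis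
    proof (cases "a = 0")
      case True
      hence "w = 0" using ab by simp
      thus ?thesis by (simp add: G_def)
    next
      case a: False
      have "a *s u = - (b *s w)" using ab(1) by (simp add: eq_neg_iff_add_eq_0)
      hence "(1 / a) *s (a *s u) = (1 / a) *s (- (b *s w))" by simp
      hence u: "u = (- b / a) *s w" using a by (simp add: Finite_Cartesian_Product.vec_eq_iff)
      have e: "u + w = (1 - b / a) *s w" unfolding u by (simp add: Finite_Cartesian_Product.vec_eq_iff algebra_simps)
      have "G (u + w) = (1 - b / a) * G w" unfolding e by (rule scale)
      moreover have "G u = (- b / a) * G w" unfolding u by (rule scale)
      ultimately show ?thesis by (simp add: algebra_simps)
    qed
  qed
  have G_sum: "G (\<Sum>i\<in>S. f i) = (\<Sum>i\<in>S. G (f i))" for S and f :: "'n \<Rightarrow> 'k ^ 'n"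
  proof (induction S rule: infinite_finite_induct)
    case (insert i S)
    thus ?case by (simp add: add)
  qed (auto simp: G_def)
  have "G v = G (\<Sum>i\<in>UNIV. v $ i *s axis i 1)" by (simp add: basis_expansion)
  also have "\<dots> = (\<Sum>i\<in>UNIV. v $ i * G (axis i 1))" by (simp only: G_sum scale)
  finally show ?thesis using v by (simp add: G_def axis_eq_0_iff)
qed

section \<open>The linear matrix of a Steiner sequence and its restriction to lines\<close>

locale steiner_data =
  fixes E :: "('k::{alg_closed_field, field_char_0}, 'n::finite, 'i) vbundle" and r x c \<phi> \<psi>
  assumes E: "vector_bundle r E"
    and exact: "short_exact E (twist_sum proj_space (replicate x 0)) (twist_sum proj_space (replicate c 1)) \<phi> \<psi>"
begin

lemma phi_hom: "bundle_hom E (twist_sum proj_space (replicate x 0)) \<phi>"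
  and psi_hom: "bundle_hom (twist_sum proj_space (replicate x 0)) (twist_sum proj_space (replicate c 1)) \<psi>"
  using exact by (auto simp: short_exact_def)

lemma base_E: "base E = proj_space"
  using bundle_homD(1)[OF phi_hom] by (simp add: base_twist_sum)

lemma exactD:
  assumes "p \<in> proj_space"
  shows "inj_on (\<phi> p) (fibre E p)"
    and "\<phi> p ` fibre E p = {y \<in> fibre (twist_sum proj_space (replicate x 0)) p. \<psi> p y = 0}"
    and "\<psi> p ` fibre (twist_sum proj_space (replicate x 0)) p = fibre (twist_sum proj_space (replicate c 1)) p"
  using exact assms unfolding short_exact_def base_E by auto

text \<open>Attaching the matrix of \<open>\<psi>\<close> to the vector \<open>v\<close> instead of
  its point makes the entries functions of degree 1, which are then linear. The value at
  \<open>v = 0\<close> carries no information.\<close>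

definition M :: "'k ^ 'n \<Rightarrow> nat \<Rightarrow> nat \<Rightarrow> 'k" where
  "M v k l = \<psi> (vec.span {v}) (slot l (unit_at 0 v)) (k, v)"

lemma M_rational:
  assumes "k < c" "l < x"
  shows "rational {v. v \<noteq> 0} 1 (\<lambda>v. M v k l)"
  using twist_sum_hom_rational[OF subset_refl psi_hom, of l k] assms
  by (simp add: M_def cone_proj_space)

lemma M_linear:
  assumes "v \<noteq> 0" "k < c" "l < x"
  shows "M v k l = (\<Sum>i\<in>UNIV. v $ i * M (axis i 1) k l)"
  by (rule rational_linear[OF M_rational]) (use assms in auto)

lemma M_comb:
  assumes "indep2 u w" "s \<noteq> 0 \<or> t \<noteq> 0" "k < c" "l < x"
  shows "M (s *s u + t *s w) k l = s * M u k l + t * M w k l"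
  using M_linear[of "s *s u + t *s w" k l] M_linear[of u k l] M_linear[of w k l]
    indep2_comb[OF assms(1,2)] indep2_nonzero[OF assms(1)] assms(3,4)
  by (simp add: algebra_simps sum.distrib sum_distrib_left)

text \<open>The value over the point of \<open>v\<close> of the constant section of O^x given by
  \<open>w\<close>.\<close>

definition cst :: "(nat \<Rightarrow> 'k) \<Rightarrow> 'k ^ 'n \<Rightarrow> nat \<times> ('k ^ 'n) \<Rightarrow> 'k" where
  "cst w v = (\<Sum>l<x. fscale (w l) (slot l (unit_at 0 v)))"

lemma cst_fibre: "cst w v \<in> fibre (twist_sum proj_space (replicate x 0)) (vec.span {v})"
proof -
  have "slot l (unit_at 0 v) \<in> fibre (twist_sum proj_space (replicate x 0)) (vec.span {v})" if "l < x" for l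
    using slot_unit_fibre[of l "replicate x 0" v] that by simp
  thus ?thesis unfolding cst_def
    by (intro fvec.subspace_sum fvec.subspace_scale fibre_twist_sum_subspace) auto
qed

lemma cst_apply: "v \<noteq> 0 \<Longrightarrow> l < x \<Longrightarrow> cst w v (l, v) = w l"
proof -
  assume a: "v \<noteq> 0" "l < x"
  have "cst w v (l, v) = (\<Sum>j<x. if j = l then w l else 0)"
    unfolding cst_def sum_fun_apply
    by (rule sum.cong) (auto simp: fscale_apply slot_apply unit_at_self[OF a(1)])
  thus ?thesis using a by simp
qed

lemma fibre_cst:
  assumes "y \<in> fibre (twist_sum proj_space (replicate x 0)) (vec.span {v})"
  shows "y = cst (\<lambda>l. y (l, v)) v"
proof -
  have "(\<Sum>j<x. fscale (y (j, v)) (slot j (unit_at (replicate x 0 ! j) v))) = cst (\<lambda>l. y (l, v)) v"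
    unfolding cst_def by (rule sum.cong) auto
  thus ?thesis using fibre_twist_sum_eq[OF assms] by simp
qed

lemma psi_cst:
  assumes "v \<noteq> 0"
  shows "\<psi> (vec.span {v}) (cst w v) (k, v) = mv x (M v) w k"
proof -
  have p: "vec.span {v} \<in> base (twist_sum proj_space (replicate x 0))"
    using assms by (simp add: base_twist_sum span_in_proj_space)
  have "\<psi> (vec.span {v}) (cst w v) = (\<Sum>l<x. fscale (w l) (\<psi> (vec.span {v}) (slot l (unit_at 0 v))))"
    unfolding cst_def
    by (rule bundle_hom_sum[OF psi_hom p fibre_twist_sum_subspace])
      (use slot_unit_fibre[of _ "replicate x 0" v] in auto)
  thus ?thesis by (simp add: sum_fun_apply fscale_apply mv_def M_def mult.commute)
qed

text \<open>This is exactness in the middle, read in coordinates.\<close>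

lemma kernel_iff:
  assumes v: "v \<noteq> 0"
  shows "(\<forall>k<c. mv x (M v) w k = 0) \<longleftrightarrow> (\<exists>e\<in>fibre E (vec.span {v}). \<phi> (vec.span {v}) e = cst w v)"
proof -
  note p = span_in_proj_space[OF v]
  have "(\<forall>k<c. mv x (M v) w k = 0) \<longleftrightarrow> \<psi> (vec.span {v}) (cst w v) = 0"
  proof
    assume "\<forall>k<c. mv x (M v) w k = 0"
    hence 0: "\<psi> (vec.span {v}) (cst w v) (k, v) = 0" if "k < c" for k
      using that by (simp add: psi_cst[OF v])
    have "\<psi> (vec.span {v}) (cst w v) \<in> fibre (twist_sum proj_space (replicate c 1)) (vec.span {v})"
      using exactD(3)[OF p] cst_fibre by blast
    from fibre_twist_sum_eq[OF this] 0 show "\<psi> (vec.span {v}) (cst w v) = 0" by simp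
  next
    assume "\<psi> (vec.span {v}) (cst w v) = 0"
    thus "\<forall>k<c. mv x (M v) w k = 0" by (simp add: psi_cst[OF v, symmetric])
  qed
  also have "\<dots> \<longleftrightarrow> cst w v \<in> \<phi> (vec.span {v}) ` fibre E (vec.span {v})"
    unfolding exactD(2)[OF p] using cst_fibre by blast
  also have "\<dots> \<longleftrightarrow> (\<exists>e\<in>fibre E (vec.span {v}). \<phi> (vec.span {v}) e = cst w v)"
  proof
    assume "cst w v \<in> \<phi> (vec.span {v}) ` fibre E (vec.span {v})"
    then obtain e where "cst w v = \<phi> (vec.span {v}) e" "e \<in> fibre E (vec.span {v})" by (rule imageE)
    thus "\<exists>e\<in>fibre E (vec.span {v}). \<phi> (vec.span {v}) e = cst w v" by (intro bexI[of _ e]) simp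
  next
    assume "\<exists>e\<in>fibre E (vec.span {v}). \<phi> (vec.span {v}) e = cst w v"
    then obtain e where e: "e \<in> fibre E (vec.span {v})" "\<phi> (vec.span {v}) e = cst w v" by (rule bexE)
    show "cst w v \<in> \<phi> (vec.span {v}) ` fibre E (vec.span {v})"
      using imageI[OF e(1), of "\<phi> (vec.span {v})"] unfolding e(2) .
  qed
  finally show ?thesis .
qed

lemma phi_fibre:
  assumes "v \<noteq> 0" "e \<in> fibre E (vec.span {v})"
  shows "\<phi> (vec.span {v}) e \<in> fibre (twist_sum proj_space (replicate x 0)) (vec.span {v})"
  using bundle_homD(2)[OF phi_hom] span_in_proj_space[OF assms(1)] assms(2) by (simp add: base_E)

lemma phi_cst:
  assumes "v \<noteq> 0" "e \<in> fibre E (vec.span {v})"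
  shows "\<phi> (vec.span {v}) e = cst (\<lambda>l. \<phi> (vec.span {v}) e (l, v)) v"
  by (rule fibre_cst[OF phi_fibre[OF assms]])

lemma M_phi:
  assumes "v \<noteq> 0" "e \<in> fibre E (vec.span {v})" "k < c"
  shows "mv x (M v) (\<lambda>l. \<phi> (vec.span {v}) e (l, v)) k = 0"
  using kernel_iff[OF assms(1), of "\<lambda>l. \<phi> (vec.span {v}) e (l, v)"] phi_cst[OF assms(1,2)] assms(2,3) by blast

lemma M_surj:
  assumes v: "v \<noteq> 0"
  shows "trivial_kernel x c (\<lambda>l k. M v k l)"
proof (rule trivial_kernelI)
  fix f k0 assume f: "\<And>l. l < x \<Longrightarrow> (\<Sum>k<c. M v k l * f k) = 0" and k0: "k0 < c"
  have "slot k0 (unit_at 1 v) \<in> fibre (twist_sum proj_space (replicate c 1)) (vec.span {v})"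
    using slot_unit_fibre[of k0 "replicate c 1" v] k0 by simp
  hence "slot k0 (unit_at 1 v) \<in> \<psi> (vec.span {v}) ` fibre (twist_sum proj_space (replicate x 0)) (vec.span {v})"
    unfolding exactD(3)[OF span_in_proj_space[OF v]] .
  then obtain y where y: "slot k0 (unit_at 1 v) = \<psi> (vec.span {v}) y"
      "y \<in> fibre (twist_sum proj_space (replicate x 0)) (vec.span {v})" by (rule imageE)
  define w where "w l = y (l, v)" for l
  have "mv x (M v) w k = (if k = k0 then 1 else 0)" for k
    using psi_cst[OF v, of w k] fibre_cst[OF y(2)] y(1)[symmetric]
    by (simp add: slot_apply unit_at_self[OF v] w_def[abs_def] split: if_splits)
  hence "(\<Sum>k<c. f k * mv x (M v) w k) = (\<Sum>k<c. if k = k0 then f k else 0)"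
    by (intro sum.cong) auto
  also have "\<dots> = f k0" using k0 by simp
  finally show "f k0 = 0" using f by (simp add: left_mv mult.commute)
qed

text \<open>The splitting supplies the data of \<open>pencil_left_kernel\<close>: a summand O gives
  sections of the kernel with constant coordinates, a summand O(-1) sections with linear
  ones.\<close>

lemma line_left_kernel:
  assumes u: "indep2 u0 u1"
    and split: "splits_on E {p \<in> proj_space. p \<subseteq> vec.span {u0, u1}} (replicate a 0 @ replicate b (- 1))"
    and rel: "\<And>l. l < x \<Longrightarrow> (\<Sum>k<c. f0 k * M u0 k l + f1 k * M u1 k l) = 0"
    and k: "k < c"
  shows "f0 k = 0 \<and> f1 k = 0"
proof -
  define L where "L = {p \<in> proj_space. p \<subseteq> vec.span {u0, u1}}"
  define as where "as = replicate a (0::int) @ replicate b (- 1)"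
  have L: "L \<subseteq> base E" by (auto simp: L_def base_E)
  have len: "length as = a + b" by (simp add: as_def)
  have as0: "as ! j = 0" if "j < a" for j using that by (simp add: as_def nth_append)
  have as1: "as ! (a + j) = - 1" if "j < b" for j using that by (simp add: as_def nth_append)
  have coneL: "s *s u0 + t *s u1 \<in> cone L" if "s \<noteq> 0 \<or> t \<noteq> 0" for s t
    unfolding L_def cone_line using indep2_comb[OF u that] in_span_pair by blast
  have u0L: "u0 \<in> cone L" and u1L: "u1 \<in> cone L" and u01L: "u0 + u1 \<in> cone L"
    using coneL[of 1 0] coneL[of 0 1] coneL[of 1 1] by simp_all
  have nz: "u0 \<noteq> 0" "u1 \<noteq> 0" "u0 + u1 \<noteq> 0" using u0L u1L u01L by (auto simp: cone_def)
  have fib: "fibre (restrict_bundle E L) p = fibre E p" for p by (simp add: restrict_bundle_def)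
  have baseL: "base (restrict_bundle E L) = L" using L by (auto simp: restrict_bundle_def)
  obtain \<rho>' \<rho> where \<rho>': "bundle_hom (restrict_bundle E L) (twist_sum L as) \<rho>'"
    and \<rho>: "bundle_hom (twist_sum L as) (restrict_bundle E L) \<rho>"
    and inv: "\<forall>p\<in>L. \<forall>e\<in>fibre E p. \<rho> p (\<rho>' p e) = e"
    using split unfolding splits_on_iff bundle_iso_def L_def[symmetric] as_def[symmetric] baseL fib by blast
  define \<Phi> where "\<Phi> v j l = \<phi> (vec.span {v}) (\<rho> (vec.span {v}) (slot j (unit_at (as ! j) v))) (l, v)" for v j l
  have rat: "rational (cone L) (- as ! j) (\<lambda>v. \<Phi> v j l)" if "j < a + b" "l < x" for j l
    using twist_sum_comp_rational[OF E L \<rho> phi_hom, of j l] that by (simp add: \<Phi>_def len)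
  have \<rho>_fibre: "\<rho> (vec.span {v}) z \<in> fibre E (vec.span {v})"
    if "v \<in> cone L" "z \<in> fibre (twist_sum L as) (vec.span {v})" for v z
    using bundle_homD(2)[OF \<rho>, of "vec.span {v}" z] that by (simp add: base_twist_sum cone_def fib)
  have kills: "mv x (M v) (\<Phi> v j) k = 0" if "v \<in> cone L" "j < a + b" "k < c" for v j k
    unfolding \<Phi>_def by (rule M_phi)
      (use that slot_unit_fibre[of j as v] \<rho>_fibre len in \<open>auto simp: cone_def\<close>)
  have const: "\<Phi> u0 j l = \<Phi> u1 j l" if "j < a" "l < x" for j l
    by (rule rational_line(1)[of "cone L" 0]) (use rat[of j l] that coneL as0 in auto)
  have lin: "\<Phi> (u0 + u1) (a + j) l = \<Phi> u0 (a + j) l + \<Phi> u1 (a + j) l" if "j < b" "l < x" for j l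
    by (rule rational_line(2)[of "cone L" 1]) (use rat[of "a + j" l] that coneL as1 in auto)
  have Mlin: "M (u0 + u1) k l = M u0 k l + M u1 k l" if "k < c" "l < x" for k l
    using M_comb[OF u, of 1 1] that by simp
  show ?thesis
  proof (rule pencil_left_kernel[where ?M0.0 = "M u0" and ?M1.0 = "M u1" and N = "\<Phi> u0" and a = a and b = b
        and ?P0.0 = "\<lambda>j. \<Phi> u0 (a + j)" and ?P1.0 = "\<lambda>j. \<Phi> u1 (a + j)", OF _ _ _ _ _ _ rel k])
    show "trivial_kernel x c (\<lambda>l k. s * M u0 k l + t * M u1 k l)" if st: "s \<noteq> 0 \<or> t \<noteq> 0" for s t
    proof (rule trivial_kernelI)
      fix f k assume f: "\<And>l. l < x \<Longrightarrow> (\<Sum>k<c. (s * M u0 k l + t * M u1 k l) * f k) = 0" and k: "k < c"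
      show "f k = 0"
      proof (rule trivial_kernelD[OF M_surj[OF indep2_comb[OF u st]] _ k])
        fix l assume l: "l < x"
        have "(\<Sum>k<c. M (s *s u0 + t *s u1) k l * f k) = (\<Sum>k<c. (s * M u0 k l + t * M u1 k l) * f k)"
          by (rule sum.cong) (use M_comb[OF u st] l in auto)
        thus "(\<Sum>k<c. M (s *s u0 + t *s u1) k l * f k) = 0" using f[OF l] by simp
      qed
    qed
    show "mv x (M u0) (\<Phi> u0 j) k = 0" if "j < a" "k < c" for j k
      using kills[OF u0L] that by simp
    show "mv x (M u0) (\<Phi> u0 (a + j)) k = 0" if "j < b" "k < c" for j k
      using kills[OF u0L] that by simp
    show "mv x (M u1) (\<Phi> u1 (a + j)) k = 0" if "j < b" "k < c" for j k
      using kills[OF u1L] that by simp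
    \<comment> \<open>Matrix and section are both linear on the line, so this is the mixed term of
      the quadratic identity M(v) \<Phi>(v) = 0, isolated by its values at \<open>u0\<close>,
      \<open>u1\<close> and \<open>u0 + u1\<close>.\<close>
    show "mv x (M u0) (\<Phi> u1 (a + j)) k + mv x (M u1) (\<Phi> u0 (a + j)) k = 0" if "j < b" "k < c" for j k
    proof -
      have "0 = mv x (M (u0 + u1)) (\<Phi> (u0 + u1) (a + j)) k" using kills[OF u01L] that by simp
      also have "\<dots> = (\<Sum>l<x. (M u0 k l + M u1 k l) * (\<Phi> u0 (a + j) l + \<Phi> u1 (a + j) l))"
        unfolding mv_def by (rule sum.cong) (use that Mlin lin in auto)
      also have "\<dots> = mv x (M u0) (\<Phi> u0 (a + j)) k + mv x (M u0) (\<Phi> u1 (a + j)) k +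
           (mv x (M u1) (\<Phi> u0 (a + j)) k + mv x (M u1) (\<Phi> u1 (a + j)) k)"
        by (simp add: mv_def algebra_simps sum.distrib)
      finally show ?thesis using kills[OF u0L, of "a + j"] kills[OF u1L, of "a + j"] that by simp
    qed
    \<comment> \<open>A kernel vector at \<open>u1\<close> comes from the fibre of \<open>E\<close>
      and is expanded through the splitting. The constant sections take the same values at
      \<open>u0\<close>, which is why \<open>N\<close> can be read there.\<close>
    show "\<exists>\<alpha> \<beta>. \<forall>l<x. w l = (\<Sum>j<a. \<alpha> j * \<Phi> u0 j l) + (\<Sum>j<b. \<beta> j * \<Phi> u1 (a + j) l)"
      if w: "\<forall>k<c. mv x (M u1) w k = 0" for w
    proof -
      let ?p = "vec.span {u1}"
      obtain e where e: "e \<in> fibre E ?p" "\<phi> ?p e = cst w u1" using w kernel_iff[OF nz(2)] by blast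
      have p: "?p \<in> L" "?p \<in> base E" using u1L L by (auto simp: cone_def)
      define z where "z = \<rho>' ?p e"
      have z: "z \<in> fibre (twist_sum L as) ?p" "\<rho> ?p z = e"
        using bundle_homD(2)[OF \<rho>', of ?p e] e(1) p inv by (auto simp: z_def baseL fib)
      have "\<rho> ?p (\<Sum>j<a + b. fscale (z (j, u1)) (slot j (unit_at (as ! j) u1))) =
          (\<Sum>j<a + b. fscale (z (j, u1)) (\<rho> ?p (slot j (unit_at (as ! j) u1))))"
        by (rule bundle_hom_sum[OF \<rho> _ fibre_twist_sum_subspace])
          (use p slot_unit_fibre[of _ as u1] len in \<open>auto simp: base_twist_sum\<close>)
      hence e_eq: "e = (\<Sum>j<a + b. fscale (z (j, u1)) (\<rho> ?p (slot j (unit_at (as ! j) u1))))"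
        using fibre_twist_sum_eq[OF z(1)] z(2) len by simp
      have "\<phi> ?p e = (\<Sum>j<a + b. fscale (z (j, u1)) (\<phi> ?p (\<rho> ?p (slot j (unit_at (as ! j) u1)))))"
        unfolding e_eq
        by (rule bundle_hom_sum[OF phi_hom p(2) fibre_subspace[OF E p(2)]])
          (use \<rho>_fibre[OF u1L] slot_unit_fibre[of _ as u1] len in auto)
      hence "w l = (\<Sum>j<a + b. z (j, u1) * \<Phi> u1 j l)" if "l < x" for l
        using e(2) cst_apply[OF nz(2) that, of w] by (simp add: sum_fun_apply fscale_apply \<Phi>_def)
      moreover have "(\<Sum>j<a + b. z (j, u1) * \<Phi> u1 j l) =
          (\<Sum>j<a. z (j, u1) * \<Phi> u0 j l) + (\<Sum>j<b. z (a + j, u1) * \<Phi> u1 (a + j) l)" if "l < x" for l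
      proof -
        have split: "(\<Sum>j<a + b. g j) = (\<Sum>j<a. g j) + (\<Sum>j<b. g (a + j))" for g :: "nat \<Rightarrow> 'k"
          by (induction b) (simp_all add: add.assoc)
        show ?thesis unfolding split using const that by simp
      qed
      ultimately show ?thesis by (intro exI[of _ "\<lambda>j. z (j, u1)"] exI[of _ "\<lambda>j. z (a + j, u1)"]) simp
    qed
  qed
qed

end

lemma type_one_list:
  "concat (map (\<lambda>i. replicate (a i) (- int i)) [0..<Suc 1]) = replicate (a 0) 0 @ replicate (a 1) (- 1)"
  by simp

theorem steiner_rank_lower_bound:
  fixes E :: "('k::{alg_closed_field, field_char_0}, 3, 'i) vbundle"
  assumes c: "c \<ge> 2" and E: "vector_bundle r E" and type: "type_uniform_steiner 1 E" and seq: "steiner_sequence x c E"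
  shows "2 * c + 2 \<le> x"
proof -
  obtain \<phi> \<psi> where "short_exact E (twist_sum proj_space (replicate x 0)) (twist_sum proj_space (replicate c 1)) \<phi> \<psi>"
    using seq unfolding steiner_sequence_def twist_sum_replicate by blast
  then interpret steiner_data E r x c \<phi> \<psi> using E by unfold_locales
  obtain a :: "nat \<Rightarrow> nat" where a: "\<forall>L\<in>proj_lines. splits_on E L (replicate (a 0) 0 @ replicate (a 1) (- 1))"
    using type unfolding type_uniform_steiner_def type_one_list by blast
  show ?thesis
  proof (rule rank_lower_bound[OF M_linear _ c])
    show "f0 k = 0 \<and> f1 k = 0" if u: "indep2 u0 u1" and rel: "\<And>l. l < x \<Longrightarrow> (\<Sum>k<c. f0 k * M u0 k l + f1 k * M u1 k l) = 0"
      and k: "k < c" for u0 u1 f0 f1 k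
      by (rule line_left_kernel[OF u _ rel k]) (use a indep2_line[OF u] in auto)
  qed
qed

section \<open>Bundles with a maximal atlas\<close>

lemma regular_on_mono: "regular_on V f \<Longrightarrow> W \<subseteq> V \<Longrightarrow> regular_on W f"
  unfolding regular_on_def
  apply (intro ballI)
  apply (drule bspec, erule subsetD, assumption)
  apply (elim exE conjE)
  apply (intro exI conjI)
     prefer 4
     apply (intro ballI, drule bspec)
      prefer 2
      apply (erule bspec, assumption)
     apply (erule IntE, intro IntI, erule subsetD, assumption+)
  done

lemma rational_mono: "rational X d F \<Longrightarrow> Y \<subseteq> X \<Longrightarrow> rational Y d F"
  unfolding rational_def using rat_at_mono by blast

lemma rational_cong: "rational X d F \<Longrightarrow> (\<And>u. u \<in> X \<Longrightarrow> F u = G u) \<Longrightarrow> rational X d G"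
  unfolding rational_def using rat_at_cong by blast

lemma regular_section_cong:
  assumes s: "regular_section E V s" and eq: "\<And>p. p \<in> V \<Longrightarrow> s p = t p"
  shows "regular_section E V t"
proof (rule regular_sectionI)
  show "t p \<in> fibre E p" if "p \<in> V" for p using regular_sectionD(1)[OF s that] eq[OF that] by simp
  fix U fs assume "(U, fs) \<in> frames E"
  from regular_sectionD(2)[OF s this] obtain a where a: "\<forall>j<length fs. regular_on (U \<inter> V) (a j)"
     "\<forall>p\<in>U \<inter> V. s p = (\<Sum>j<length fs. fscale (a j p) ((fs ! j) p))" by blast
  show "\<exists>a. (\<forall>j<length fs. regular_on (U \<inter> V) (a j)) \<and>
        (\<forall>p\<in>U \<inter> V. t p = (\<Sum>j<length fs. fscale (a j p) ((fs ! j) p)))"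
  proof (intro exI[of _ a] conjI ballI)
    fix p assume p: "p \<in> U \<inter> V"
    hence "t p = s p" using eq by simp
    thus "t p = (\<Sum>j<length fs. fscale (a j p) ((fs ! j) p))" using a(2) p by simp
  qed (rule a(1))
qed

text \<open>The atlas takes all frames with regular coordinates, so a bundle is determined by fibres
  and coordinates without a chosen cover. That enough frames exist is proved separately in each
  case.\<close>

definition atlas_bundle :: "('k::field ^ 'n::finite) set set \<Rightarrow> (('k ^ 'n) set \<Rightarrow> ('i \<Rightarrow> 'k) set) \<Rightarrow>
    ('k ^ 'n \<Rightarrow> ('i \<Rightarrow> 'k) \<Rightarrow> nat \<Rightarrow> 'k) \<Rightarrow> nat \<Rightarrow> nat \<Rightarrow> ('k, 'n, 'i) vbundle" where
  "atlas_bundle B S co x r = \<lparr>base = B, fibre = S, frames = {(U, fs). zariski_open_in B U \<and> length fs = r \<and>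
     (\<forall>p\<in>U. is_basis (S p) (map (\<lambda>s. s p) fs)) \<and>
     (\<forall>s\<in>set fs. \<forall>l<x. rational (cone U) 0 (\<lambda>v. co v (s (vec.span {v})) l))}\<rparr>"

text \<open>\<open>co v\<close> embeds the fibre over the point of \<open>v\<close> into k^x, and
  regularity is tested on these coordinates. The coordinates may depend on the representative, which
  covers both those induced by \<open>\<phi>\<close> and the standard ones on a kernel
  bundle.\<close>

locale coordinate_family =
  fixes B :: "('k::field ^ 'n::finite) set set" and S :: "('k ^ 'n) set \<Rightarrow> ('i \<Rightarrow> 'k) set"
    and co :: "'k ^ 'n \<Rightarrow> ('i \<Rightarrow> 'k) \<Rightarrow> nat \<Rightarrow> 'k" and x :: nat
  assumes B: "B \<subseteq> proj_space"
    and sub: "\<And>v. v \<in> cone B \<Longrightarrow> fvec.subspace (S (vec.span {v}))"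
    and add: "\<And>v e f l. v \<in> cone B \<Longrightarrow> e \<in> S (vec.span {v}) \<Longrightarrow> f \<in> S (vec.span {v}) \<Longrightarrow> l < x \<Longrightarrow>
        co v (e + f) l = co v e l + co v f l"
    and scale: "\<And>v e a l. v \<in> cone B \<Longrightarrow> e \<in> S (vec.span {v}) \<Longrightarrow> l < x \<Longrightarrow>
        co v (fscale a e) l = a * co v e l"
    and inj: "\<And>v e. v \<in> cone B \<Longrightarrow> e \<in> S (vec.span {v}) \<Longrightarrow> (\<And>l. l < x \<Longrightarrow> co v e l = 0) \<Longrightarrow> e = 0"
begin

lemma co_sum:
  fixes n :: nat
  assumes v: "v \<in> cone B" and l: "l < x" and f: "\<And>j. j < n \<Longrightarrow> f j \<in> S (vec.span {v})"
  shows "co v (\<Sum>j<n. fscale (a j) (f j)) l = (\<Sum>j<n. a j * co v (f j) l)"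
  using f
proof (induction n)
  case 0
  have "co v (fscale 0 0) l = 0" by (subst scale[OF v fvec.subspace_0[OF sub[OF v]] l]) simp
  hence "co v 0 l = 0" by simp
  thus ?case by (simp only: lessThan_0 sum.empty)
next
  case (Suc n)
  have "(\<Sum>j<n. fscale (a j) (f j)) \<in> S (vec.span {v})" "fscale (a n) (f n) \<in> S (vec.span {v})"
    using Suc.prems by (auto intro!: fvec.subspace_sum[OF sub[OF v]] fvec.subspace_scale[OF sub[OF v]])
  from add[OF v this l] show ?case
    using Suc scale[OF v Suc.prems[OF lessI] l, of "a n"] by (simp only: sum.lessThan_Suc less_SucI)
qed

lemma trivial_kernel_basis:
  assumes v: "v \<in> cone B" and bs: "is_basis (S (vec.span {v})) bs"
  shows "trivial_kernel x (length bs) (\<lambda>l j. co v (bs ! j) l)"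
proof (rule trivial_kernelI)
  fix w j assume w: "\<And>l. l < x \<Longrightarrow> (\<Sum>j<length bs. co v (bs ! j) l * w j) = 0" and j: "j < length bs"
  have mem: "bs ! j \<in> S (vec.span {v})" if "j < length bs" for j
    using bs that fvec.span_base[of "bs ! j" "set bs"] by (auto simp: is_basis_def)
  have "(\<Sum>j<length bs. fscale (w j) (bs ! j)) = 0"
  proof (rule inj[OF v])
    show "(\<Sum>j<length bs. fscale (w j) (bs ! j)) \<in> S (vec.span {v})"
      using is_basis_sum[OF bs] by blast
    show "co v (\<Sum>j<length bs. fscale (w j) (bs ! j)) l = 0" if "l < x" for l
      using w[OF that] co_sum[OF v that mem] by (simp add: mult.commute)
  qed
  thus "w j = 0" by (rule is_basis_independent[OF bs _ j])
qed

text \<open>The coefficients of \<open>s\<close> in a frame solve a linear system whose matrix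
  consists of the coordinates of the frame. It has trivial kernel at each point, so
  \<open>rat_at_solve\<close> makes them regular.\<close>

lemma regular_sectionI_coords:
  assumes E: "base E = B" "\<And>p. p \<in> B \<Longrightarrow> fibre E p = S p"
    and frames: "\<And>U fs. (U, fs) \<in> frames E \<Longrightarrow> U \<subseteq> B \<and> (\<forall>p\<in>U. is_basis (S p) (map (\<lambda>s. s p) fs)) \<and>
      (\<forall>s\<in>set fs. \<forall>l<x. rational (cone U) 0 (\<lambda>v. co v (s (vec.span {v})) l))"
    and V: "V \<subseteq> B" and s: "\<And>p. p \<in> V \<Longrightarrow> s p \<in> S p"
    and rat: "\<And>l. l < x \<Longrightarrow> rational (cone V) 0 (\<lambda>v. co v (s (vec.span {v})) l)"
  shows "regular_section E V s"
proof (rule regular_sectionI)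
  show "s p \<in> fibre E p" if "p \<in> V" for p using that s E V by auto
  fix U fs assume fr: "(U, fs) \<in> frames E"
  have U: "U \<subseteq> B" "\<And>p. p \<in> U \<Longrightarrow> is_basis (S p) (map (\<lambda>s. s p) fs)"
    "\<And>s l. s \<in> set fs \<Longrightarrow> l < x \<Longrightarrow> rational (cone U) 0 (\<lambda>v. co v (s (vec.span {v})) l)"
    using frames[OF fr] by auto
  have "\<forall>p\<in>U \<inter> V. \<exists>a. s p = (\<Sum>j<length fs. fscale (a j) ((fs ! j) p))"
  proof
    fix p assume p: "p \<in> U \<inter> V"
    have "s p \<in> S p" using s p by simp
    then obtain a where "s p = (\<Sum>j<length (map (\<lambda>s. s p) fs). fscale (a j) (map (\<lambda>s. s p) fs ! j))"
      using is_basis_sum[OF U(2)[of p], of "s p"] p by auto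
    moreover have "\<dots> = (\<Sum>j<length fs. fscale (a j) ((fs ! j) p))" by (rule sum.cong) auto
    ultimately show "\<exists>a. s p = (\<Sum>j<length fs. fscale (a j) ((fs ! j) p))" by auto
  qed
  from bchoice[OF this] obtain a where a: "\<forall>p\<in>U \<inter> V. s p = (\<Sum>j<length fs. fscale (a p j) ((fs ! j) p))" ..
  have "regular_on (U \<inter> V) (\<lambda>p. a p j)" if j: "j < length fs" for j
  proof (subst regular_on_iff)
    show "U \<inter> V \<subseteq> proj_space" using V B by blast
    show "rational (cone (U \<inter> V)) 0 (\<lambda>v. a (vec.span {v}) j)" unfolding rational_def
    proof
      fix v assume v: "v \<in> cone (U \<inter> V)"
      hence vU: "v \<in> cone U" "v \<in> cone V" "v \<in> cone B" "vec.span {v} \<in> U" "v \<noteq> 0" using U(1) by (auto simp: cone_def)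
      show "rat_at (cone (U \<inter> V)) v 0 (\<lambda>v. a (vec.span {v}) j)"
      proof (rule rat_at_solve[where x = x and r = "length fs" and \<beta> = 0 and
            B = "\<lambda>l j u. co u ((fs ! j) (vec.span {u})) l" and W = "\<lambda>l u. co u (s (vec.span {u})) l"])
        show "rat_at (cone (U \<inter> V)) v 0 (\<lambda>u. co u ((fs ! j) (vec.span {u})) l)" if "l < x" "j < length fs" for l j
          using U(3)[of "fs ! j" l] that vU rat_at_mono[of "cone U" v 0 _ "cone (U \<inter> V)"]
          by (auto simp: rational_def cone_Int)
        show "rat_at (cone (U \<inter> V)) v (0 + 0) (\<lambda>u. co u (s (vec.span {u})) l)" if "l < x" for l
          using rat[OF that] vU rat_at_mono[of "cone V" v 0 _ "cone (U \<inter> V)"]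
          by (auto simp: rational_def cone_Int)
        show "(\<Sum>j<length fs. co u ((fs ! j) (vec.span {u})) l * a (vec.span {u}) j) = co u (s (vec.span {u})) l"
          if "u \<in> cone (U \<inter> V)" "l < x" for u l
        proof -
          have u: "vec.span {u} \<in> U \<inter> V" "u \<in> cone B" "vec.span {u} \<in> U" using that U(1) by (auto simp: cone_def)
          have "(fs ! j) (vec.span {u}) \<in> S (vec.span {u})" if "j < length fs" for j
            using U(2)[OF u(3)] that fvec.span_base[of "(fs ! j) (vec.span {u})" "set (map (\<lambda>s. s (vec.span {u})) fs)"]
            by (auto simp: is_basis_def)
          from co_sum[OF u(2) that(2) this, where a = "a (vec.span {u})"] show ?thesis
            using a u(1) by (simp add: mult.commute)
        qed
        show "trivial_kernel x (length fs) (\<lambda>l j. co v ((fs ! j) (vec.span {v})) l)"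
        proof (rule trivial_kernelI)
          fix w j assume w: "\<And>l. l < x \<Longrightarrow> (\<Sum>j<length fs. co v ((fs ! j) (vec.span {v})) l * w j) = 0" and j: "j < length fs"
          show "w j = 0"
            by (rule trivial_kernelD[OF trivial_kernel_basis[OF vU(3) U(2)[OF vU(4)]]]) (use w j in auto)
        qed
      qed (use v vU j in auto)
    qed
  qed
  thus "\<exists>a. (\<forall>j<length fs. regular_on (U \<inter> V) (a j)) \<and>
        (\<forall>p\<in>U \<inter> V. s p = (\<Sum>j<length fs. fscale (a j p) ((fs ! j) p)))"
    using a by (intro exI[of _ "\<lambda>j p. a p j"]) auto
qed

lemma atlas_frames:
  assumes "(U, fs) \<in> frames (atlas_bundle B S co x r)"
  shows "zariski_open_in B U" "length fs = r" "U \<subseteq> B" "\<And>p. p \<in> U \<Longrightarrow> is_basis (S p) (map (\<lambda>s. s p) fs)"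
    "\<And>s l. s \<in> set fs \<Longrightarrow> l < x \<Longrightarrow> rational (cone U) 0 (\<lambda>v. co v (s (vec.span {v})) l)"
  using assms zariski_open_in_subset[of B U] by (auto simp: atlas_bundle_def)

lemma atlas_regular_sectionI:
  assumes "V \<subseteq> B" "\<And>p. p \<in> V \<Longrightarrow> s p \<in> S p"
    and "\<And>l. l < x \<Longrightarrow> rational (cone V) 0 (\<lambda>v. co v (s (vec.span {v})) l)"
  shows "regular_section (atlas_bundle B S co x r) V s"
proof (rule regular_sectionI_coords[OF _ _ _ assms])
  show "U \<subseteq> B \<and> (\<forall>p\<in>U. is_basis (S p) (map (\<lambda>s. s p) fs)) \<and>
      (\<forall>s\<in>set fs. \<forall>l<x. rational (cone U) 0 (\<lambda>v. co v (s (vec.span {v})) l))"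
    if "(U, fs) \<in> frames (atlas_bundle B S co x r)" for U fs
    using atlas_frames[OF that] by blast
qed (auto simp: atlas_bundle_def)

lemma atlas_vector_bundle:
  assumes cover: "\<And>p. p \<in> B \<Longrightarrow> \<exists>U fs. (U, fs) \<in> frames (atlas_bundle B S co x r) \<and> p \<in> U"
  shows "vector_bundle r (atlas_bundle B S co x r)"
proof (rule vector_bundleI)
  fix U fs s assume fr: "(U, fs) \<in> frames (atlas_bundle B S co x r)" and s: "s \<in> set fs"
  show "regular_section (atlas_bundle B S co x r) U s"
  proof (rule atlas_regular_sectionI)
    show "s p \<in> S p" if "p \<in> U" for p
      using atlas_frames(4)[OF fr that] s fvec.span_base[of "s p" "set (map (\<lambda>s. s p) fs)"]
      by (auto simp: is_basis_def)
  qed (use atlas_frames[OF fr] s in auto)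
next
  fix U fs assume fr: "(U, fs) \<in> frames (atlas_bundle B S co x r)"
  show "zariski_open_in (base (atlas_bundle B S co x r)) U" "length fs = r"
    using atlas_frames(1,2)[OF fr] by (simp_all add: atlas_bundle_def)
  show "is_basis (fibre (atlas_bundle B S co x r) p) (map (\<lambda>s. s p) fs)" if "p \<in> U" for p
    using atlas_frames(4)[OF fr that] by (simp add: atlas_bundle_def)
next
  fix p assume "p \<in> base (atlas_bundle B S co x r)"
  hence "p \<in> B" by (simp add: atlas_bundle_def)
  thus "\<exists>U fs. (U, fs) \<in> frames (atlas_bundle B S co x r) \<and> p \<in> U" by (rule cover)
qed (use B in \<open>simp add: atlas_bundle_def\<close>)

lemma atlas_regular_sectionD:
  assumes cover: "\<And>p. p \<in> B \<Longrightarrow> \<exists>U fs. (U, fs) \<in> frames (atlas_bundle B S co x r) \<and> p \<in> U"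
    and s: "regular_section (atlas_bundle B S co x r) V s" and V: "V \<subseteq> B" and l: "l < x"
  shows "rational (cone V) 0 (\<lambda>v. co v (s (vec.span {v})) l)"
  unfolding rational_def
proof
  fix v assume v: "v \<in> cone V"
  hence "vec.span {v} \<in> B" "v \<noteq> 0" using V by (auto simp: cone_def)
  then obtain U fs where fr: "(U, fs) \<in> frames (atlas_bundle B S co x r)" and U: "vec.span {v} \<in> U"
    using cover by blast
  note F = atlas_frames[OF fr]
  obtain a where a: "\<forall>j<length fs. regular_on (U \<inter> V) (a j)"
     "\<forall>p\<in>U \<inter> V. s p = (\<Sum>j<length fs. fscale (a j p) ((fs ! j) p))"
    using regular_sectionD(2)[OF s fr] by blast
  have vU: "v \<in> cone U" "v \<in> cone (U \<inter> V)" using U v by (auto simp: cone_def)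
  have 1: "rat_at (cone (U \<inter> V)) v (0 + 0)
     (\<lambda>u. \<Sum>j<length fs. a j (vec.span {u}) * co u ((fs ! j) (vec.span {u})) l)"
  proof (intro rat_at_sum \<open>v \<noteq> 0\<close> rat_at_mult)
    fix j assume j: "j \<in> {..<length fs}"
    have UP: "U \<inter> V \<subseteq> proj_space" using V B by blast
    show "rat_at (cone (U \<inter> V)) v 0 (\<lambda>u. a j (vec.span {u}))"
      using a(1) j vU regular_on_iff[OF UP] by (auto simp: rational_def)
    have "rational (cone U) 0 (\<lambda>u. co u ((fs ! j) (vec.span {u})) l)" using j by (intro F(5) l) auto
    thus "rat_at (cone (U \<inter> V)) v 0 (\<lambda>u. co u ((fs ! j) (vec.span {u})) l)"
      using vU rat_at_mono[of "cone U" v 0 _ "cone (U \<inter> V)"] by (auto simp: rational_def cone_Int)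
  qed
  have "rat_at (cone (U \<inter> V)) v 0 (\<lambda>v. co v (s (vec.span {v})) l)"
  proof (rule rat_at_cong[OF 1[simplified]])
    fix u assume "u \<in> cone (U \<inter> V)"
    hence u: "vec.span {u} \<in> U \<inter> V" "u \<in> cone B" "vec.span {u} \<in> U" using V by (auto simp: cone_def)
    have "(fs ! j) (vec.span {u}) \<in> S (vec.span {u})" if "j < length fs" for j
      using F(4)[OF u(3)] that fvec.span_base[of "(fs ! j) (vec.span {u})" "set (map (\<lambda>s. s (vec.span {u})) fs)"]
      by (auto simp: is_basis_def)
    from co_sum[OF u(2) l this, where a = "\<lambda>j. a j (vec.span {u})"]
    show "(\<Sum>j<length fs. a j (vec.span {u}) * co u ((fs ! j) (vec.span {u})) l) = co u (s (vec.span {u})) l"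
      using a(2) u(1) by simp
  qed
  thus "rat_at (cone V) v 0 (\<lambda>v. co v (s (vec.span {v})) l)"
    by (rule rat_at_zariski_open[OF B F(1) V vU(1)])
qed

end

section \<open>Trivial summands\<close>

text \<open>Deduced from the sum with the single summand \<open>a\<close>, whose frames are those of
  \<open>twist a\<close> up to \<open>slot\<close>.\<close>

lemma twist_regular_section:
  fixes s :: "('k::field ^ 'n::finite) set \<Rightarrow> 'k ^ 'n \<Rightarrow> 'k"
  assumes V: "V \<subseteq> proj_space" and s: "\<And>p. p \<in> V \<Longrightarrow> s p \<in> fibre (twist a) p"
    and rat: "rational (cone V) a (\<lambda>v. s (vec.span {v}) v)"
  shows "regular_section (twist a) V s"
proof (rule regular_sectionI)
  show "s p \<in> fibre (twist a) p" if "p \<in> V" for p using s that .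
  have slot0: "regular_section (twist_sum proj_space [a]) V (\<lambda>p. slot 0 (s p))"
  proof (subst regular_section_twist_sum)
    show "(\<forall>p\<in>V. slot 0 (s p) \<in> fibre (twist_sum proj_space [a]) p) \<and>
      (\<forall>j<length [a]. rational (cone V) ([a] ! j) (\<lambda>v. slot 0 (s (vec.span {v})) (j, v)))"
      using rat s slot_fibre[of 0 "[a]"] by (auto simp: slot_apply)
  qed (use V in auto)
  fix U fs assume "(U, fs) \<in> frames (twist a :: ('k, 'n, 'k ^ 'n) vbundle)"
  then obtain i where i: "U = basic_open (\<lambda>v. v $ i)" "fs = [coord_power a i]"
    by (auto simp: twist_def coord_power_def[abs_def])
  have "(U, twist_frame [a] (\<lambda>_. i)) \<in> frames (twist_sum proj_space [a])"
    unfolding frames_twist_sum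
    by (rule range_eqI[of _ _ "\<lambda>_. i"]) (use basic_open_subset[of "\<lambda>v :: 'k ^ 'n. v $ i"] in \<open>auto simp: i\<close>)
  from regular_sectionD(2)[OF slot0 this] obtain b where b: "\<forall>j<1. regular_on (U \<inter> V) (b j)"
    "\<forall>p\<in>U \<inter> V. slot 0 (s p) = (\<Sum>j<length [a]. fscale (b j p) ((twist_frame [a] (\<lambda>_. i) ! j) p))"
    unfolding twist_frame_length by auto
  have "s p = fscale (b 0 p) (coord_power a i p)" if "p \<in> U \<inter> V" for p
  proof
    fix v
    have "slot 0 (s p) (0, v) = (\<Sum>j<length [a]. fscale (b j p) ((twist_frame [a] (\<lambda>_. i) ! j) p)) (0, v)"
      using b(2) that by simp
    thus "s p v = fscale (b 0 p) (coord_power a i p) v"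
      unfolding twist_frame_sum by (simp add: slot_apply fscale_apply)
  qed
  thus "\<exists>b. (\<forall>j<length fs. regular_on (U \<inter> V) (b j)) \<and>
       (\<forall>p\<in>U \<inter> V. s p = (\<Sum>j<length fs. fscale (b j p) ((fs ! j) p)))"
    using b(1) by (intro exI[of _ b]) (simp add: i(2))
qed

lemma direct_sum_regular_section:
  assumes "regular_section E V (\<lambda>p. s p \<circ> Inl)" "regular_section F V (\<lambda>p. s p \<circ> Inr)"
  shows "regular_section (direct_sum E F) V s"
proof (rule regular_sectionI)
  show "s p \<in> fibre (direct_sum E F) p" if "p \<in> V" for p
    using regular_sectionD(1)[OF assms(1) that] regular_sectionD(1)[OF assms(2) that] by (simp add: direct_sum_def)
  fix W hs assume "(W, hs) \<in> frames (direct_sum E F)"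
  then obtain U fs U' gs where U: "(U, fs) \<in> frames E" "(U', gs) \<in> frames F" "W = U \<inter> U'"
    and hs: "hs = map (\<lambda>s p. case_sum (s p) (\<lambda>_. 0)) fs @ map (\<lambda>s p. case_sum (\<lambda>_. 0) (s p)) gs"
    by (auto simp: direct_sum_def)
  obtain a where a: "\<forall>j<length fs. regular_on (U \<inter> V) (a j)"
     "\<forall>p\<in>U \<inter> V. s p \<circ> Inl = (\<Sum>j<length fs. fscale (a j p) ((fs ! j) p))"
    using regular_sectionD(2)[OF assms(1) U(1)] by blast
  obtain b where b: "\<forall>j<length gs. regular_on (U' \<inter> V) (b j)"
     "\<forall>p\<in>U' \<inter> V. s p \<circ> Inr = (\<Sum>j<length gs. fscale (b j p) ((gs ! j) p))"
    using regular_sectionD(2)[OF assms(2) U(2)] by blast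
  define d where "d j = (if j < length fs then a j else b (j - length fs))" for j
  show "\<exists>d. (\<forall>j<length hs. regular_on (W \<inter> V) (d j)) \<and>
       (\<forall>p\<in>W \<inter> V. s p = (\<Sum>j<length hs. fscale (d j p) ((hs ! j) p)))"
  proof (intro exI[of _ d] conjI allI impI ballI)
    fix j assume j: "j < length hs"
    have W: "W \<inter> V \<subseteq> U \<inter> V" "W \<inter> V \<subseteq> U' \<inter> V" by (auto simp: U(3))
    show "regular_on (W \<inter> V) (d j)"
    proof (cases "j < length fs")
      case True
      thus ?thesis using regular_on_mono[OF _ W(1)] a(1) by (simp add: d_def)
    next
      case False
      hence "j - length fs < length gs" using j by (auto simp: hs)
      thus ?thesis using regular_on_mono[OF _ W(2)] b(1) False by (simp add: d_def)
    qed
  next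
    fix p assume p: "p \<in> W \<inter> V"
    have split: "(\<Sum>j<m + n. g j) = (\<Sum>j<m. g j) + (\<Sum>j<n. g (m + j))" for m n and g :: "nat \<Rightarrow> 'a"
      by (induction n) (simp_all add: add.assoc)
    show "s p = (\<Sum>j<length hs. fscale (d j p) ((hs ! j) p))"
    proof
      fix i
      have len: "length hs = length fs + length gs" by (simp add: hs)
      have "(\<Sum>j<length hs. fscale (d j p) ((hs ! j) p)) i =
          (\<Sum>j<length fs. a j p * (case i of Inl i' \<Rightarrow> (fs ! j) p i' | Inr _ \<Rightarrow> 0)) +
          (\<Sum>j<length gs. b j p * (case i of Inl _ \<Rightarrow> 0 | Inr i' \<Rightarrow> (gs ! j) p i'))"
        unfolding len sum_fun_apply split
        by (intro arg_cong2[where f = "(+)"] sum.cong)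
          (auto simp: d_def hs nth_append fscale_apply split: sum.split)
      also have "\<dots> = s p i"
      proof (cases i)
        case (Inl i')
        have "(s p \<circ> Inl) i' = (\<Sum>j<length fs. fscale (a j p) ((fs ! j) p)) i'" using a(2) p U(3) by simp
        thus ?thesis using Inl by (simp add: sum_fun_apply fscale_apply)
      next
        case (Inr i')
        have "(s p \<circ> Inr) i' = (\<Sum>j<length gs. fscale (b j p) ((gs ! j) p)) i'" using b(2) p U(3) by simp
        thus ?thesis using Inr by (simp add: sum_fun_apply fscale_apply)
      qed
      finally show "s p i = (\<Sum>j<length hs. fscale (d j p) ((hs ! j) p)) i" ..
    qed
  qed
qed

definition skip :: "nat \<Rightarrow> nat \<Rightarrow> nat" where
  "skip j i = (if i < j then i else Suc i)"

lemma bij_betw_skip: "j < n \<Longrightarrow> bij_betw (skip j) {..<n - 1} ({..<n} - {j})"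
proof (rule bij_betw_byWitness[where f' = "\<lambda>i. if i < j then i else i - 1"])
qed (auto simp: skip_def)

lemma sum_skip: "j < n \<Longrightarrow> (\<Sum>i<n. g i) = g j + (\<Sum>i<n - 1. g (skip j i))"
  for g :: "nat \<Rightarrow> 'a::comm_monoid_add"
proof -
  assume j: "j < n"
  have "(\<Sum>i<n - 1. g (skip j i)) = (\<Sum>i\<in>{..<n} - {j}. g i)"
    by (rule sum.reindex_bij_betw[OF bij_betw_skip[OF j]])
  thus ?thesis using j by (subst sum.remove[of _ j]) auto
qed

text \<open>The vector \<open>bs ! j\<close> is transverse to the hyperplane
  \<open>\<pi> = 0\<close>; subtracting the right multiple of it moves each of the other basis
  vectors into the hyperplane.\<close>

lemma is_basis_hyperplane:
  assumes bs: "is_basis V bs" and j: "j < length bs"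
    and lin: "\<And>a. \<pi> (\<Sum>i<length bs. fscale (a i) (bs ! i)) = (\<Sum>i<length bs. a i * \<pi> (bs ! i))"
    and nz: "\<pi> (bs ! j) \<noteq> (0 :: 'k::field)"
  shows "is_basis {e \<in> V. \<pi> e = 0}
    (map (\<lambda>i. bs ! skip j i - fscale (\<pi> (bs ! skip j i) / \<pi> (bs ! j)) (bs ! j)) [0..<length bs - 1])"
proof -
  define n where "n = length bs"
  define cs where "cs = map (\<lambda>i. bs ! skip j i - fscale (\<pi> (bs ! skip j i) / \<pi> (bs ! j)) (bs ! j)) [0..<n - 1]"
  have cs: "length cs = n - 1" "i < n - 1 \<Longrightarrow> cs ! i = bs ! skip j i - fscale (\<pi> (bs ! skip j i) / \<pi> (bs ! j)) (bs ! j)" for i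
    by (simp_all add: cs_def)
  have jn: "j < n" using j by (simp add: n_def)
  have skip: "skip j i < n \<and> skip j i \<noteq> j" if "i < n - 1" for i using that jn by (auto simp: skip_def)
  have skip_inj: "skip j i = skip j i' \<longleftrightarrow> i = i'" for i i' by (auto simp: skip_def)
  \<comment> \<open>The coefficients in the old basis of a combination of the new vectors; the one
    of \<open>bs ! j\<close> is forced by \<open>\<pi> = 0\<close>.\<close>
  define ext where "ext a k = (if k = j then - (\<Sum>i<n - 1. a i * \<pi> (bs ! skip j i)) / \<pi> (bs ! j)
      else a (THE i. skip j i = k))" for a k
  have ext: "ext a (skip j i) = a i" if "i < n - 1" for a i
    using skip[OF that] by (simp add: ext_def skip_inj)
  have sum_eq: "(\<Sum>i<n - 1. fscale (a i) (cs ! i)) = (\<Sum>k<n. fscale (ext a k) (bs ! k))" for a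
  proof
    fix t
    have "(\<Sum>i<n - 1. fscale (a i) (cs ! i)) t =
        (\<Sum>i<n - 1. a i * (bs ! skip j i) t) - (\<Sum>i<n - 1. a i * \<pi> (bs ! skip j i)) / \<pi> (bs ! j) * (bs ! j) t"
      by (simp add: sum_fun_apply fscale_apply cs(2) algebra_simps sum_subtractf sum_distrib_left sum_distrib_right sum_divide_distrib)
    also have "\<dots> = (\<Sum>k<n. fscale (ext a k) (bs ! k)) t"
      unfolding sum_skip[OF jn] by (simp add: sum_fun_apply fscale_apply ext) (simp add: ext_def)
    finally show "(\<Sum>i<n - 1. fscale (a i) (cs ! i)) t = (\<Sum>k<n. fscale (ext a k) (bs ! k)) t" .
  qed
  have \<pi>_ext: "\<pi> (\<Sum>k<n. fscale (ext a k) (bs ! k)) = 0" for a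
  proof -
    have "\<pi> (\<Sum>k<n. fscale (ext a k) (bs ! k)) = (\<Sum>k<n. ext a k * \<pi> (bs ! k))" using lin by (simp add: n_def)
    also have "\<dots> = ext a j * \<pi> (bs ! j) + (\<Sum>i<n - 1. a i * \<pi> (bs ! skip j i))"
      unfolding sum_skip[OF jn] by (simp add: ext)
    also have "\<dots> = 0" using nz by (simp add: ext_def)
    finally show ?thesis .
  qed
  have "is_basis {e \<in> V. \<pi> e = 0} cs"
  proof (rule is_basisI)
    fix a i assume a: "(\<Sum>i<length cs. fscale (a i) (cs ! i)) = 0" and i: "i < length cs"
    hence "(\<Sum>k<length bs. fscale (ext a k) (bs ! k)) = 0" using sum_eq by (simp add: cs n_def)
    from is_basis_independent[OF bs this, of "skip j i"] skip[of i] ext[of i a] i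
    show "a i = 0" by (simp add: cs n_def)
  next
    fix e
    show "e \<in> {e \<in> V. \<pi> e = 0} \<longleftrightarrow> (\<exists>a. e = (\<Sum>i<length cs. fscale (a i) (cs ! i)))"
    proof
      assume e: "e \<in> {e \<in> V. \<pi> e = 0}"
      then obtain b where b: "e = (\<Sum>k<n. fscale (b k) (bs ! k))" using is_basis_sum[OF bs, of e] by (auto simp: n_def)
      have "\<pi> e = b j * \<pi> (bs ! j) + (\<Sum>i<n - 1. b (skip j i) * \<pi> (bs ! skip j i))"
        using lin[of b] unfolding b n_def[symmetric] by (simp add: sum_skip[OF jn])
      hence bj: "b j = - (\<Sum>i<n - 1. b (skip j i) * \<pi> (bs ! skip j i)) / \<pi> (bs ! j)"
        using e nz by (simp add: field_simps eq_neg_iff_add_eq_0)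
      have "ext (\<lambda>i. b (skip j i)) k = b k" if "k < n" for k
      proof (cases "k = j")
        case False
        hence "\<exists>i. skip j i = k" by (intro exI[of _ "if k < j then k else k - 1"]) (auto simp: skip_def)
        then obtain i where "skip j i = k" ..
        hence "(THE i. skip j i = k) = i" using skip_inj by auto
        thus ?thesis using False \<open>skip j i = k\<close> by (simp add: ext_def)
      qed (simp add: ext_def bj)
      hence "e = (\<Sum>k<n. fscale (ext (\<lambda>i. b (skip j i)) k) (bs ! k))" unfolding b by simp
      thus "\<exists>a. e = (\<Sum>i<length cs. fscale (a i) (cs ! i))" unfolding sum_eq[symmetric] cs(1)
        by (rule exI[of _ "\<lambda>i. b (skip j i)"])
    next
      assume "\<exists>a. e = (\<Sum>i<length cs. fscale (a i) (cs ! i))"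
      then obtain a where a: "e = (\<Sum>k<n. fscale (ext a k) (bs ! k))" unfolding cs(1) sum_eq by blast
      hence "e \<in> V" using is_basis_sum[OF bs, of e] by (auto simp: n_def)
      thus "e \<in> {e \<in> V. \<pi> e = 0}" using \<pi>_ext a by simp
    qed
  qed
  thus ?thesis by (simp add: cs_def n_def)
qed

context steiner_data
begin

section \<open>Splitting off a constant section\<close>

lemma phi_scale:
  assumes "v \<noteq> 0" "e \<in> fibre E (vec.span {v})" "a \<noteq> 0" "l < x"
  shows "\<phi> (vec.span {v}) e (l, a *s v) = \<phi> (vec.span {v}) e (l, v)"
proof -
  have "(\<lambda>u. \<phi> (vec.span {v}) e (l, u)) \<in> fibre (twist 0) (vec.span {v})"
    using phi_fibre[OF assms(1,2)] assms(4) by (simp add: fibre_twist_sum)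
  thus ?thesis using assms(1,3) self_in_span[of v] by (simp add: fibre_twist)
qed

lemma phi_eq_0:
  assumes "v \<noteq> 0" "e \<in> fibre E (vec.span {v})" "\<And>l. l < x \<Longrightarrow> \<phi> (vec.span {v}) e (l, v) = 0"
  shows "e = 0"
proof -
  note p = span_in_proj_space[OF assms(1)]
  have sub: "fvec.subspace (fibre E (vec.span {v}))" using fibre_subspace[OF E] p by (simp add: base_E)
  have "\<phi> (vec.span {v}) e = 0"
    using phi_cst[OF assms(1,2)] assms(3) by (simp add: cst_def)
  moreover have "\<phi> (vec.span {v}) (fscale 0 0) = fscale 0 (\<phi> (vec.span {v}) 0)"
    by (rule bundle_homD(4)[OF phi_hom]) (use p fvec.subspace_0[OF sub] in \<open>auto simp: base_E\<close>)
  ultimately have "\<phi> (vec.span {v}) e = \<phi> (vec.span {v}) 0" by simp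
  thus ?thesis using exactD(1)[OF p] assms(2) fvec.subspace_0[OF sub] by (auto dest: inj_onD)
qed

text \<open>Stated for families of subspaces, since it serves both \<open>E\<close> itself and the
  complement of a trivial summand.\<close>

lemma phi_family:
  assumes sub: "\<And>v. v \<noteq> 0 \<Longrightarrow> fvec.subspace (S (vec.span {v}))" and S: "\<And>p. S p \<subseteq> fibre E p"
  shows "coordinate_family proj_space S (\<lambda>v e l. \<phi> (vec.span {v}) e (l, v)) x"
proof
  fix v :: "'k ^ 'n" assume v: "v \<in> cone proj_space"
  hence v0: "v \<noteq> 0" "vec.span {v} \<in> base E" by (auto simp: cone_def base_E)
  show "fvec.subspace (S (vec.span {v}))" using sub v0 by blast
  fix e assume "e \<in> S (vec.span {v})"
  hence e: "e \<in> fibre E (vec.span {v})" using S by blast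
  show "e = 0" if "\<And>l. l < x \<Longrightarrow> \<phi> (vec.span {v}) e (l, v) = 0"
    using phi_eq_0[OF v0(1) e that] .
  fix l
  show "\<phi> (vec.span {v}) (fscale a e) (l, v) = a * \<phi> (vec.span {v}) e (l, v)" for a
    using bundle_homD(4)[OF phi_hom v0(2) e] by (simp add: fscale_apply)
  fix f assume "f \<in> S (vec.span {v})"
  hence f: "f \<in> fibre E (vec.span {v})" using S by blast
  show "\<phi> (vec.span {v}) (e + f) (l, v) = \<phi> (vec.span {v}) e (l, v) + \<phi> (vec.span {v}) f (l, v)"
    using bundle_homD(3)[OF phi_hom v0(2) e f] by simp
qed simp

lemma E_sectionD:
  assumes "regular_section E V s" "V \<subseteq> proj_space" "l < x"
  shows "rational (cone V) 0 (\<lambda>v. \<phi> (vec.span {v}) (s (vec.span {v})) (l, v))"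
  using bundle_hom_regular_section[OF E phi_hom assms(1), of l] assms(2,3) by (simp add: base_E)

lemma E_sectionI:
  assumes V: "V \<subseteq> proj_space" and s: "\<And>p. p \<in> V \<Longrightarrow> s p \<in> fibre E p"
    and rat: "\<And>l. l < x \<Longrightarrow> rational (cone V) 0 (\<lambda>v. \<phi> (vec.span {v}) (s (vec.span {v})) (l, v))"
  shows "regular_section E V s"
proof -
  have sub: "fvec.subspace (fibre E (vec.span {v}))" if "v \<noteq> 0" for v
    using fibre_subspace[OF E] span_in_proj_space[OF that] by (simp add: base_E)
  interpret CE: coordinate_family proj_space "fibre E" "\<lambda>v e l. \<phi> (vec.span {v}) e (l, v)" x
    by (rule phi_family) (use sub in auto)
  show ?thesis
  proof (rule CE.regular_sectionI_coords[OF base_E _ _ V s rat])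
    fix U fs assume fr: "(U, fs) \<in> frames E"
    have U: "U \<subseteq> proj_space" using zariski_open_in_subset[OF vector_bundleD(2)[OF E fr]] by (simp add: base_E)
    show "U \<subseteq> proj_space \<and> (\<forall>p\<in>U. is_basis (fibre E p) (map (\<lambda>s. s p) fs)) \<and>
       (\<forall>s\<in>set fs. \<forall>l<x. rational (cone U) 0 (\<lambda>v. \<phi> (vec.span {v}) (s (vec.span {v})) (l, v)))"
      using U vector_bundleD(4)[OF E fr] E_sectionD[OF vector_bundleD(6)[OF E fr]] by blast
  qed auto
qed

text \<open>The constant vector \<open>w\<close> is a global section \<sigma> of \<open>E\<close>.
  The coordinate \<open>l0\<close> is a regular functional \<pi> on \<open>E\<close> with
  \<pi>(\<sigma>) = 1, so \<open>E\<close> is the sum of the trivial line bundle spanned by \<sigma>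
  and the kernel of \<pi>.\<close>

theorem trivial_summand:
  assumes w: "\<And>v k. v \<noteq> 0 \<Longrightarrow> k < c \<Longrightarrow> mv x (M v) w k = 0" and l0: "l0 < x" "w l0 = 1"
  shows "has_trivial_summand E"
proof -
  have ex: "\<exists>e. e \<in> fibre E p \<and> (\<forall>v. v \<noteq> 0 \<longrightarrow> p = vec.span {v} \<longrightarrow> (\<forall>l<x. \<phi> p e (l, v) = w l))"
    if p: "p \<in> proj_space" for p
  proof -
    obtain v where v: "v \<noteq> 0" "p = vec.span {v}" using p by (rule proj_space_obtain)
    obtain e where e: "e \<in> fibre E p" "\<phi> p e = cst w v"
      using kernel_iff[OF v(1), of w] w[OF v(1)] v(2) by blast
    have "\<phi> p e (l, u) = w l" if "u \<noteq> 0" "p = vec.span {u}" "l < x" for u l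
    proof -
      have "u \<in> vec.span {v} - {0}" using that(1,2) v(2) self_in_span[of u] by auto
      then obtain a where "a \<noteq> 0" "v \<noteq> 0" "u = a *s v" by (rule nonzero_in_span_singletonE)
      thus ?thesis using phi_scale[OF v(1), of e a l] e cst_apply[OF v(1) that(3), of w] that(3) v(2) by simp
    qed
    thus ?thesis using e(1) by blast
  qed
  \<comment> \<open>The global section of \<open>E\<close> with constant coordinates
    \<open>w\<close>.\<close>
  define \<sigma> where "\<sigma> p = (SOME e. e \<in> fibre E p \<and> (\<forall>v. v \<noteq> 0 \<longrightarrow> p = vec.span {v} \<longrightarrow> (\<forall>l<x. \<phi> p e (l, v) = w l)))" for p
  have \<sigma>: "\<sigma> p \<in> fibre E p" if "p \<in> proj_space" for p
    using someI_ex[OF ex[OF that]] unfolding \<sigma>_def by blast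
  have \<sigma>_coord: "\<phi> (vec.span {v}) (\<sigma> (vec.span {v})) (l, v) = w l" if "v \<noteq> 0" "l < x" for v l
    using someI_ex[OF ex[OF span_in_proj_space[OF that(1)]]] that unfolding \<sigma>_def by blast
  define rep where "rep p = (SOME v. v \<in> p - {0 :: 'k ^ 'n})" for p
  have rep: "rep p \<noteq> 0 \<and> vec.span {rep p} = p" if p: "p \<in> proj_space" for p
  proof -
    obtain v where "v \<noteq> 0" "p = vec.span {v}" using p by (rule proj_space_obtain)
    hence "v \<in> p - {0}" using self_in_span by auto
    hence "rep p \<in> p - {0}" unfolding rep_def by (rule someI)
    thus ?thesis using span_eqI[OF p] by auto
  qed
  \<comment> \<open>Coordinates in O^x have degree 0, so the choice of representative does not
    matter; \<open>w l0 = 1\<close> makes \<open>\<pi>\<close> equal to 1 on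
    \<open>\<sigma>\<close>.\<close>
  define \<pi> where "\<pi> p e = \<phi> p e (l0, rep p)" for p e
  have \<pi>_eq: "\<pi> (vec.span {v}) e = \<phi> (vec.span {v}) e (l0, v)" if v: "v \<noteq> 0" "e \<in> fibre E (vec.span {v})" for v e
  proof -
    have "rep (vec.span {v}) \<in> vec.span {v} - {0}"
      using rep[OF span_in_proj_space[OF v(1)]] self_in_span[of "rep (vec.span {v})"] by simp
    then obtain a where "a \<noteq> 0" "v \<noteq> 0" "rep (vec.span {v}) = a *s v" by (rule nonzero_in_span_singletonE)
    thus ?thesis using phi_scale[OF v _ l0(1)] by (simp add: \<pi>_def)
  qed
  have \<pi>_add: "\<pi> p (e + f) = \<pi> p e + \<pi> p f" if "p \<in> proj_space" "e \<in> fibre E p" "f \<in> fibre E p" for p e f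
    using bundle_homD(3)[OF phi_hom, of p e f] that by (simp add: \<pi>_def base_E)
  have \<pi>_scale: "\<pi> p (fscale a e) = a * \<pi> p e" if "p \<in> proj_space" "e \<in> fibre E p" for p e a
    using bundle_homD(4)[OF phi_hom, of p e a] that by (simp add: \<pi>_def base_E fscale_apply)
  have \<pi>\<sigma>: "\<pi> p (\<sigma> p) = 1" if p: "p \<in> proj_space" for p
    using rep[OF p] \<sigma>_coord[of "rep p" l0] l0 by (simp add: \<pi>_def)
  have subE: "fvec.subspace (fibre E p)" if "p \<in> proj_space" for p
    using fibre_subspace[OF E] that by (simp add: base_E)
  have \<pi>_sum: "\<pi> p (\<Sum>j<n. fscale (a j) (f j)) = (\<Sum>j<n. a j * \<pi> p (f j))"
    if p: "p \<in> proj_space" and f: "\<And>j. j < n \<Longrightarrow> f j \<in> fibre E p" for p a and n :: nat and f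
    using bundle_hom_sum[OF phi_hom _ subE[OF p], of n f a] p f
    by (simp add: \<pi>_def base_E sum_fun_apply fscale_apply)
  have \<pi>_rational: "rational (cone V) 0 (\<lambda>v. \<pi> (vec.span {v}) (s (vec.span {v})))"
    if s: "regular_section E V s" and V: "V \<subseteq> proj_space" for V s
    by (rule rational_cong[OF E_sectionD[OF s V l0(1)]])
      (use \<pi>_eq regular_sectionD(1)[OF s] in \<open>auto simp: cone_def\<close>)
  define co where "co v e l = \<phi> (vec.span {v}) e (l, v)" for v e l
  define S where "S p = {e \<in> fibre E p. \<pi> p e = 0}" for p
  have subS: "fvec.subspace (S p)" if p: "p \<in> proj_space" for p
  proof (rule fvec.subspaceI)
    have "\<pi> p (fscale 0 0) = 0 * \<pi> p 0" by (rule \<pi>_scale[OF p fvec.subspace_0[OF subE[OF p]]])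
    thus "0 \<in> S p" using fvec.subspace_0[OF subE[OF p]] by (simp add: S_def)
  qed (use \<pi>_add[OF p] \<pi>_scale[OF p] fvec.subspace_add[OF subE[OF p]] fvec.subspace_scale[OF subE[OF p]] in
      \<open>auto simp: S_def\<close>)
  interpret CF: coordinate_family proj_space S co x
    unfolding co_def by (rule phi_family) (auto simp: S_def subS[unfolded S_def] span_in_proj_space)
  define F where "F = atlas_bundle proj_space S co x (r - 1)"
  have cover: "\<exists>U fs. (U, fs) \<in> frames F \<and> p \<in> U" if p: "p \<in> proj_space" for p
  proof -
    obtain U fs where fr: "(U, fs) \<in> frames E" and pU: "p \<in> U"
      using vector_bundleD(5)[OF E] p by (metis base_E)
    have U: "U \<subseteq> proj_space" using zariski_open_in_subset[OF vector_bundleD(2)[OF E fr]] by (simp add: base_E)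
    have len: "length fs = r" using vector_bundleD(3)[OF E fr] .
    have basis: "is_basis (fibre E q) (map (\<lambda>s. s q) fs)" if "q \<in> U" for q
      using vector_bundleD(4)[OF E fr that] .
    have reg: "regular_section E U (fs ! j)" if "j < r" for j
      using vector_bundleD(6)[OF E fr] that len by simp
    have mem: "(fs ! j) q \<in> fibre E q" if "j < r" "q \<in> U" for j q
      using regular_sectionD(1)[OF reg] that by blast
    have "\<exists>j<r. \<pi> p ((fs ! j) p) \<noteq> 0"
    proof (rule ccontr)
      assume 0: "\<not> (\<exists>j<r. \<pi> p ((fs ! j) p) \<noteq> 0)"
      obtain a where "\<sigma> p = (\<Sum>j<length (map (\<lambda>s. s p) fs). fscale (a j) (map (\<lambda>s. s p) fs ! j))"
        using is_basis_sum[OF basis[OF pU], of "\<sigma> p"] \<sigma>[OF p] by auto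
      also have "\<dots> = (\<Sum>j<r. fscale (a j) ((fs ! j) p))" by (rule sum.cong) (auto simp: len)
      finally have "\<pi> p (\<sigma> p) = (\<Sum>j<r. a j * \<pi> p ((fs ! j) p))"
        using \<pi>_sum[OF p mem[OF _ pU]] by simp
      thus False using 0 \<pi>\<sigma>[OF p] by simp
    qed
    then obtain j where j: "j < r" "\<pi> p ((fs ! j) p) \<noteq> 0" by blast
    \<comment> \<open>Here frame vector \<open>j\<close> stays transverse to the kernel of
      \<open>\<pi>\<close>, and \<open>is_basis_hyperplane\<close> turns the others into a frame of
      that kernel.\<close>
    define W where "W = {q \<in> U. \<pi> q ((fs ! j) q) \<noteq> 0}"
    define gs where "gs = map (\<lambda>i q. (fs ! skip j i) q - fscale (\<pi> q ((fs ! skip j i) q) / \<pi> q ((fs ! j) q)) ((fs ! j) q)) [0..<r - 1]"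
    have skip: "skip j i < r" if "i < r - 1" for i using that j by (auto simp: skip_def)
    have WU: "W \<subseteq> U" by (auto simp: W_def)
    have \<pi>rat: "rational (cone U) 0 (\<lambda>v. \<pi> (vec.span {v}) ((fs ! i) (vec.span {v})))" if "i < r" for i
      by (rule \<pi>_rational[OF reg[OF that] U])
    have "zariski_open_in proj_space W"
    proof (subst zariski_open_in_iff, simp, intro conjI ballI)
      show "W \<subseteq> proj_space" using WU U by blast
      fix v assume v: "v \<in> cone W"
      hence vU: "v \<in> cone U" and nz: "\<pi> (vec.span {v}) ((fs ! j) (vec.span {v})) \<noteq> 0" by (auto simp: cone_def W_def)
      obtain e k where k: "homogeneous e k" "k v \<noteq> 0" "\<forall>u\<in>cone proj_space. k u \<noteq> 0 \<longrightarrow> u \<in> cone U"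
        using vector_bundleD(2)[OF E fr] vU unfolding base_E by (subst (asm) zariski_open_in_iff) auto
      have "rat_at (cone U) v 0 (\<lambda>v. \<pi> (vec.span {v}) ((fs ! j) (vec.span {v})))"
        using \<pi>rat[OF j(1)] vU by (simp add: rational_def)
      from rat_at_nonzero_open[OF this vU nz] obtain e' k' where k': "homogeneous e' k'" "k' v \<noteq> 0"
        "\<forall>u\<in>cone U. k' u \<noteq> 0 \<longrightarrow> \<pi> (vec.span {u}) ((fs ! j) (vec.span {u})) \<noteq> 0" by blast
      show "\<exists>e k. homogeneous e k \<and> k v \<noteq> 0 \<and> (\<forall>u\<in>cone proj_space. k u \<noteq> 0 \<longrightarrow> u \<in> cone W)"
      proof (intro exI conjI ballI impI)
        show "homogeneous (e + e') (\<lambda>u. k u * k' u)" by (rule homogeneous_mult[OF k(1) k'(1)])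
        show "k v * k' v \<noteq> 0" using k k' by simp
        fix u assume "u \<in> cone proj_space" "k u * k' u \<noteq> 0"
        thus "u \<in> cone W" using k(3) k'(3) by (auto simp: cone_def W_def)
      qed
    qed
    moreover have "is_basis (S q) (map (\<lambda>s. s q) gs)" if q: "q \<in> W" for q
    proof -
      have qU: "q \<in> U" "q \<in> proj_space" and nz: "\<pi> q ((fs ! j) q) \<noteq> 0" using q U by (auto simp: W_def)
      have "is_basis (S q) (map (\<lambda>i. map (\<lambda>s. s q) fs ! skip j i -
         fscale (\<pi> q (map (\<lambda>s. s q) fs ! skip j i) / \<pi> q (map (\<lambda>s. s q) fs ! j)) (map (\<lambda>s. s q) fs ! j))
           [0..<length (map (\<lambda>s. s q) fs) - 1])"
        unfolding S_def
      proof (rule is_basis_hyperplane[OF basis[OF qU(1)]])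
        show "j < length (map (\<lambda>s. s q) fs)" using j len by simp
        show "\<pi> q (map (\<lambda>s. s q) fs ! j) \<noteq> 0" using nz j len by simp
        show "\<pi> q (\<Sum>i<length (map (\<lambda>s. s q) fs). fscale (a i) (map (\<lambda>s. s q) fs ! i)) =
           (\<Sum>i<length (map (\<lambda>s. s q) fs). a i * \<pi> q (map (\<lambda>s. s q) fs ! i))" for a
          by (rule \<pi>_sum[OF qU(2)]) (use mem[OF _ qU(1)] len in auto)
      qed
      moreover have "map (\<lambda>i. map (\<lambda>s. s q) fs ! skip j i -
         fscale (\<pi> q (map (\<lambda>s. s q) fs ! skip j i) / \<pi> q (map (\<lambda>s. s q) fs ! j)) (map (\<lambda>s. s q) fs ! j))
           [0..<length (map (\<lambda>s. s q) fs) - 1] = map (\<lambda>s. s q) gs"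
        unfolding gs_def map_map using j len skip by (intro map_cong) auto
      ultimately show ?thesis by simp
    qed
    moreover have "rational (cone W) 0 (\<lambda>v. co v (s (vec.span {v})) l)" if s: "s \<in> set gs" and l: "l < x" for s l
    proof -
      obtain i where i: "i < r - 1" "s = (\<lambda>q. (fs ! skip j i) q - fscale (\<pi> q ((fs ! skip j i) q) / \<pi> q ((fs ! j) q)) ((fs ! j) q))"
        using s by (auto simp: gs_def)
      have coW: "rational (cone W) 0 (\<lambda>v. co v ((fs ! i) (vec.span {v})) l)" if "i < r" for i
        unfolding co_def by (rule rational_mono[OF E_sectionD[OF reg[OF that] U l] cone_mono[OF WU]])
      have \<pi>W: "rational (cone W) 0 (\<lambda>v. \<pi> (vec.span {v}) ((fs ! i) (vec.span {v})))" if "i < r" for i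
        by (rule rational_mono[OF \<pi>rat[OF that] cone_mono[OF WU]])
      have "rational (cone W) 0 (\<lambda>v. co v ((fs ! skip j i) (vec.span {v})) l -
         \<pi> (vec.span {v}) ((fs ! skip j i) (vec.span {v})) / \<pi> (vec.span {v}) ((fs ! j) (vec.span {v})) *
           co v ((fs ! j) (vec.span {v})) l)"
        unfolding rational_def
      proof
        fix v assume v: "v \<in> cone W"
        hence nz: "\<pi> (vec.span {v}) ((fs ! j) (vec.span {v})) \<noteq> 0" by (auto simp: cone_def W_def)
        have 1: "rat_at (cone W) v 0 (\<lambda>v. co v ((fs ! skip j i) (vec.span {v})) l)"
          "rat_at (cone W) v 0 (\<lambda>v. co v ((fs ! j) (vec.span {v})) l)"
          "rat_at (cone W) v 0 (\<lambda>v. \<pi> (vec.span {v}) ((fs ! skip j i) (vec.span {v})))"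
          "rat_at (cone W) v 0 (\<lambda>v. \<pi> (vec.span {v}) ((fs ! j) (vec.span {v})))"
          using coW[OF skip[OF i(1)]] coW[OF j(1)] \<pi>W[OF skip[OF i(1)]] \<pi>W[OF j(1)] v by (auto simp: rational_def)
        from rat_at_diff[OF 1(1) rat_at_mult[OF rat_at_divide[OF 1(3,4) v nz] 1(2), simplified]]
        show "rat_at (cone W) v 0 (\<lambda>v. co v ((fs ! skip j i) (vec.span {v})) l -
         \<pi> (vec.span {v}) ((fs ! skip j i) (vec.span {v})) / \<pi> (vec.span {v}) ((fs ! j) (vec.span {v})) *
           co v ((fs ! j) (vec.span {v})) l)" by simp
      qed
      thus ?thesis
      proof (rule rational_cong)
        fix u assume "u \<in> cone W"
        hence u: "vec.span {u} \<in> U" "vec.span {u} \<in> base E" using U by (auto simp: cone_def W_def base_E)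
        note P = subE[OF u(2)[unfolded base_E]]
        let ?t = "- (\<pi> (vec.span {u}) ((fs ! skip j i) (vec.span {u})) / \<pi> (vec.span {u}) ((fs ! j) (vec.span {u})))"
        have s_eq: "s (vec.span {u}) = (fs ! skip j i) (vec.span {u}) + fscale ?t ((fs ! j) (vec.span {u}))"
          unfolding i(2) by (simp add: fun_eq_iff fscale_apply)
        have m: "(fs ! skip j i) (vec.span {u}) \<in> fibre E (vec.span {u})" "(fs ! j) (vec.span {u}) \<in> fibre E (vec.span {u})"
          using mem[OF skip[OF i(1)] u(1)] mem[OF j(1) u(1)] by auto
        have "\<phi> (vec.span {u}) (s (vec.span {u})) = \<phi> (vec.span {u}) ((fs ! skip j i) (vec.span {u})) +
            fscale ?t (\<phi> (vec.span {u}) ((fs ! j) (vec.span {u})))"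
          unfolding s_eq bundle_homD(3)[OF phi_hom u(2) m(1) fvec.subspace_scale[OF P m(2)]]
            bundle_homD(4)[OF phi_hom u(2) m(2)] ..
        thus "co u ((fs ! skip j i) (vec.span {u})) l - \<pi> (vec.span {u}) ((fs ! skip j i) (vec.span {u})) /
            \<pi> (vec.span {u}) ((fs ! j) (vec.span {u})) * co u ((fs ! j) (vec.span {u})) l = co u (s (vec.span {u})) l"
          by (simp add: co_def fscale_apply)
      qed
    qed
    moreover have "p \<in> W" using pU j by (simp add: W_def)
    moreover have "length gs = r - 1" by (simp add: gs_def)
    ultimately show ?thesis by (intro exI[of _ W] exI[of _ gs]) (simp add: F_def atlas_bundle_def)
  qed
  have F: "vector_bundle (r - 1) F"
    unfolding F_def by (rule CF.atlas_vector_bundle) (use cover in \<open>simp add: F_def\<close>)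
  have baseF: "base F = proj_space" and fibF: "fibre F p = S p" for p by (simp_all add: F_def atlas_bundle_def)
  have \<sigma>_reg: "regular_section E V \<sigma>" if V: "V \<subseteq> proj_space" for V
  proof (rule E_sectionI[OF V])
    show "\<sigma> p \<in> fibre E p" if "p \<in> V" for p using \<sigma> that V by blast
    show "rational (cone V) 0 (\<lambda>v. \<phi> (vec.span {v}) (\<sigma> (vec.span {v})) (l, v))" if "l < x" for l
    proof (rule rational_cong[of _ _ "\<lambda>_. w l"])
      show "rational (cone V) 0 (\<lambda>_. w l)" by (simp add: rational_def rat_at_const)
    qed (use \<sigma>_coord that in \<open>auto simp: cone_def\<close>)
  qed
  define one where "one p a = (\<lambda>v :: 'k ^ 'n. if v \<in> p - {0} then a else (0::'k))" for p a
  have one_fibre: "one p a \<in> fibre (twist 0) p" if "p \<in> proj_space" for p a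
  proof -
    obtain u where u: "u \<noteq> 0" "p = vec.span {u}" using \<open>p \<in> proj_space\<close> by (rule proj_space_obtain)
    have "b *s v \<in> p" if "v \<in> p" for b v using that vec.span_scale[of v "{u}" b] by (simp add: u(2))
    thus ?thesis by (auto simp: fibre_twist one_def)
  qed
  have fibre_one: "f = one p (f (rep p))" if "p \<in> proj_space" "f \<in> fibre (twist 0) p" for p f
  proof -
    have r: "rep p \<noteq> 0" "vec.span {rep p} = p" using rep[OF that(1)] by auto
    have "f v = f (rep p)" if "v \<in> p - {0}" for v
    proof -
      have "v \<in> vec.span {rep p} - {0}" using that r by simp
      then obtain a where "a \<noteq> 0" "rep p \<noteq> 0" "v = a *s rep p" by (rule nonzero_in_span_singletonE)
      moreover have "rep p \<in> p - {0}" using r self_in_span[of "rep p"] by simp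
      ultimately show ?thesis using \<open>f \<in> fibre (twist 0) p\<close> by (simp add: fibre_twist)
    qed
    thus ?thesis using that by (auto simp: fun_eq_iff one_def fibre_twist)
  qed
  have one_rep: "one p a (rep p) = a" if "p \<in> proj_space" for p a
    using rep[OF that] self_in_span[of "rep p"] by (simp add: one_def)
  define D where "D = direct_sum (twist 0 :: ('k, 'n, 'k ^ 'n) vbundle) F"
  have baseD: "base D = proj_space" by (simp add: D_def direct_sum_def baseF twist_def)
  have fibD: "f \<in> fibre D p \<longleftrightarrow> f \<circ> Inl \<in> fibre (twist 0) p \<and> f \<circ> Inr \<in> S p" for f p
    by (simp add: D_def direct_sum_def fibF)
  \<comment> \<open>The decomposition e = \<pi>(e) \<sigma> + (e - \<pi>(e) \<sigma>);
    \<open>\<beta>\<close> below adds the two parts up again.\<close>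
  define \<alpha> where "\<alpha> p e = case_sum (one p (\<pi> p e)) (e - fscale (\<pi> p e) (\<sigma> p))" for p e
  define \<beta> where "\<beta> p f = fscale (f (Inl (rep p))) (\<sigma> p) + (f \<circ> Inr)" for p and f :: "'k ^ 'n + 'i \<Rightarrow> 'k"
  have proj: "e - fscale (\<pi> p e) (\<sigma> p) \<in> S p" if "p \<in> proj_space" "e \<in> fibre E p" for p e
  proof -
    have eq: "e - fscale (\<pi> p e) (\<sigma> p) = e + fscale (- \<pi> p e) (\<sigma> p)" by (simp add: fun_eq_iff fscale_apply)
    have m: "fscale (- \<pi> p e) (\<sigma> p) \<in> fibre E p" by (rule fvec.subspace_scale[OF subE[OF that(1)] \<sigma>[OF that(1)]])
    have "\<pi> p (e + fscale (- \<pi> p e) (\<sigma> p)) = 0"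
      unfolding \<pi>_add[OF that m] \<pi>_scale[OF that(1) \<sigma>[OF that(1)]] \<pi>\<sigma>[OF that(1)] by simp
    thus ?thesis unfolding S_def eq
      using fvec.subspace_add[OF subE[OF that(1)] that(2) m] by blast
  qed
  have \<alpha>_fib: "\<alpha> p e \<in> fibre D p" if "p \<in> proj_space" "e \<in> fibre E p" for p e
    using proj[OF that] one_fibre[OF that(1)] by (simp add: fibD \<alpha>_def case_sum_o_inj)
  have \<beta>_fib: "\<beta> p f \<in> fibre E p" if "p \<in> proj_space" "f \<in> fibre D p" for p f
    unfolding \<beta>_def using that \<sigma>[OF that(1)]
    by (intro fvec.subspace_add[OF subE[OF that(1)]] fvec.subspace_scale[OF subE[OF that(1)]]) (auto simp: fibD S_def)
  have \<beta>\<alpha>: "\<beta> p (\<alpha> p e) = e" if "p \<in> proj_space" for p e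
    by (simp add: \<beta>_def \<alpha>_def case_sum_o_inj one_rep[OF that])
  have \<alpha>\<beta>: "\<alpha> p (\<beta> p f) = f" if p: "p \<in> proj_space" and f: "f \<in> fibre D p" for p f
  proof -
    have "\<pi> p (\<beta> p f) = f (Inl (rep p))" unfolding \<beta>_def
      using \<pi>_add[OF p fvec.subspace_scale[OF subE[OF p] \<sigma>[OF p]], of "f \<circ> Inr"] \<pi>_scale[OF p \<sigma>[OF p]] \<pi>\<sigma>[OF p] f
      by (simp add: fibD S_def)
    hence "\<alpha> p (\<beta> p f) = case_sum (one p (f (Inl (rep p)))) (f \<circ> Inr)"
      unfolding \<alpha>_def by (simp add: \<beta>_def)
    also have "one p (f (Inl (rep p))) = f \<circ> Inl" using fibre_one[OF p, of "f \<circ> Inl"] f by (simp add: fibD)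
    also have "case_sum (f \<circ> Inl) (f \<circ> Inr) = f" by (auto simp: fun_eq_iff split: sum.split)
    finally show ?thesis .
  qed
  have F_section: "regular_section F V s" if V: "V \<subseteq> proj_space" and s: "regular_section E V s" "\<And>p. p \<in> V \<Longrightarrow> s p \<in> S p" for V s
    unfolding F_def
    by (rule CF.atlas_regular_sectionI[OF V s(2)]) (use E_sectionD[OF s(1) V] in \<open>auto simp: co_def\<close>)
  have E_section: "regular_section E V s" if V: "V \<subseteq> proj_space" and s: "regular_section F V s" for V s
  proof (rule E_sectionI[OF V])
    show "s p \<in> fibre E p" if "p \<in> V" for p using regular_sectionD(1)[OF s that] by (simp add: fibF S_def)
    show "rational (cone V) 0 (\<lambda>v. \<phi> (vec.span {v}) (s (vec.span {v})) (l, v))" if "l < x" for l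
      using CF.atlas_regular_sectionD[OF _ s[unfolded F_def] V that] cover by (simp add: F_def co_def)
  qed
  have \<alpha>_hom: "bundle_hom E D \<alpha>"
  proof (rule bundle_homI)
    show "base E = base D" by (simp add: base_E baseD)
    fix p e assume "p \<in> base E" and e: "e \<in> fibre E p"
    hence p: "p \<in> proj_space" by (simp add: base_E)
    show "\<alpha> p e \<in> fibre D p" by (rule \<alpha>_fib[OF p e])
    show "\<alpha> p (fscale a e) = fscale a (\<alpha> p e)" for a
      by (auto simp: \<alpha>_def \<pi>_scale[OF p e] fun_eq_iff fscale_apply one_def algebra_simps split: sum.split)
    show "\<alpha> p (e + f) = \<alpha> p e + \<alpha> p f" if "f \<in> fibre E p" for f
      by (auto simp: \<alpha>_def \<pi>_add[OF p e that] fun_eq_iff fscale_apply one_def algebra_simps split: sum.split)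
  next
    fix U fs s assume fr: "(U, fs) \<in> frames E" and s: "s \<in> set fs"
    have U: "U \<subseteq> proj_space" using zariski_open_in_subset[OF vector_bundleD(2)[OF E fr]] by (simp add: base_E)
    have reg: "regular_section E U s" using vector_bundleD(6)[OF E fr s] .
    have mem: "s p \<in> fibre E p" if "p \<in> U" for p using regular_sectionD(1)[OF reg that] .
    have \<pi>s: "rational (cone U) 0 (\<lambda>v. \<pi> (vec.span {v}) (s (vec.span {v})))" by (rule \<pi>_rational[OF reg U])
    show "regular_section D U (\<lambda>p. \<alpha> p (s p))" unfolding D_def
    proof (rule direct_sum_regular_section)
      show "regular_section (twist 0) U (\<lambda>p. \<alpha> p (s p) \<circ> Inl)"
      proof (rule twist_regular_section[OF U])
        show "\<alpha> p (s p) \<circ> Inl \<in> fibre (twist 0) p" if "p \<in> U" for p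
          using \<alpha>_fib[of p "s p"] mem[OF that] that U by (auto simp: fibD)
        show "rational (cone U) 0 (\<lambda>v. (\<alpha> (vec.span {v}) (s (vec.span {v})) \<circ> Inl) v)"
          by (rule rational_cong[OF \<pi>s]) (auto simp: \<alpha>_def one_def cone_def self_in_span)
      qed
      show "regular_section F U (\<lambda>p. \<alpha> p (s p) \<circ> Inr)"
      proof (rule F_section[OF U])
        show "\<alpha> p (s p) \<circ> Inr \<in> S p" if "p \<in> U" for p
          using \<alpha>_fib[of p "s p"] mem[OF that] that U by (auto simp: fibD)
        show "regular_section E U (\<lambda>p. \<alpha> p (s p) \<circ> Inr)"
        proof (rule E_sectionI[OF U])
          show "\<alpha> p (s p) \<circ> Inr \<in> fibre E p" if "p \<in> U" for p
            using \<alpha>_fib[of p "s p"] mem[OF that] that U by (auto simp: fibD S_def)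
          fix l assume l: "l < x"
          \<comment> \<open>The coordinates of e - \<pi>(e) \<sigma>, written with the constants
            \<open>w\<close> for those of \<sigma>.\<close>
          have "rational (cone U) 0 (\<lambda>v. \<phi> (vec.span {v}) (s (vec.span {v})) (l, v) + (- w l) * \<pi> (vec.span {v}) (s (vec.span {v})))"
            unfolding rational_def
            using E_sectionD[OF reg U l] \<pi>s by (intro ballI rat_at_add rat_at_scale) (auto simp: rational_def)
          thus "rational (cone U) 0 (\<lambda>v. \<phi> (vec.span {v}) (\<alpha> (vec.span {v}) (s (vec.span {v})) \<circ> Inr) (l, v))"
          proof (rule rational_cong)
            fix u assume "u \<in> cone U"
            hence u: "u \<noteq> 0" "vec.span {u} \<in> U" "vec.span {u} \<in> base E" using U by (auto simp: cone_def base_E)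
            let ?p = "vec.span {u}"
            have eq: "\<alpha> ?p (s ?p) \<circ> Inr = s ?p + fscale (- \<pi> ?p (s ?p)) (\<sigma> ?p)"
              by (simp add: \<alpha>_def fun_eq_iff fscale_apply)
            have m: "s ?p \<in> fibre E ?p" "\<sigma> ?p \<in> fibre E ?p" using mem u \<sigma> by (auto simp: base_E)
            have "\<phi> ?p (s ?p + fscale (- \<pi> ?p (s ?p)) (\<sigma> ?p)) = \<phi> ?p (s ?p) + fscale (- \<pi> ?p (s ?p)) (\<phi> ?p (\<sigma> ?p))"
              unfolding bundle_homD(3)[OF phi_hom u(3) m(1) fvec.subspace_scale[OF subE[OF u(3)[unfolded base_E]] m(2)]]
                bundle_homD(4)[OF phi_hom u(3) m(2)] ..
            thus "\<phi> ?p (s ?p) (l, u) + (- w l) * \<pi> ?p (s ?p) = \<phi> ?p (\<alpha> ?p (s ?p) \<circ> Inr) (l, u)"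
              unfolding eq by (simp add: fscale_apply \<sigma>_coord[OF u(1) l])
          qed
        qed
      qed
    qed
  qed
  have \<beta>_hom: "bundle_hom D E \<beta>"
  proof (rule bundle_homI)
    show "base D = base E" by (simp add: base_E baseD)
    fix p f assume "p \<in> base D" and f: "f \<in> fibre D p"
    hence p: "p \<in> proj_space" by (simp add: baseD)
    show "\<beta> p f \<in> fibre E p" by (rule \<beta>_fib[OF p f])
    show "\<beta> p (fscale a f) = fscale a (\<beta> p f)" for a
      by (simp add: \<beta>_def fun_eq_iff fscale_apply algebra_simps)
    show "\<beta> p (f + g) = \<beta> p f + \<beta> p g" if "g \<in> fibre D p" for g
      by (simp add: \<beta>_def fun_eq_iff fscale_apply algebra_simps)
  next
    fix U hs s assume "(U, hs) \<in> frames D" and s: "s \<in> set hs"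
    then obtain i V gs where VF: "(V, gs) \<in> frames F" and U: "U = basic_open (\<lambda>v. v $ i) \<inter> V"
      and hs: "hs = map (\<lambda>s p. case_sum (s p) (\<lambda>_. 0)) [coord_power 0 i] @ map (\<lambda>s p. case_sum (\<lambda>_. 0) (s p)) gs"
      by (auto simp: D_def direct_sum_def twist_def coord_power_def[abs_def])
    have V: "V \<subseteq> proj_space" using zariski_open_in_subset[OF vector_bundleD(2)[OF F VF]] by (simp add: baseF)
    have UP: "U \<subseteq> proj_space" using V U by blast
    from s hs consider "s = (\<lambda>p. case_sum (coord_power 0 i p) (\<lambda>_. 0))"
      | g where "g \<in> set gs" "s = (\<lambda>p. case_sum (\<lambda>_. 0) (g p))" by auto
    thus "regular_section E U (\<lambda>p. \<beta> p (s p))"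
    proof cases
      case 1
      have "\<beta> p (s p) = \<sigma> p" if "p \<in> U" for p
      proof -
        have "rep p \<in> p - {0}" using rep[of p] self_in_span[of "rep p"] that UP by auto
        thus ?thesis by (simp add: \<beta>_def 1 coord_power_def fun_eq_iff fscale_apply)
      qed
      thus ?thesis by (intro regular_section_cong[OF \<sigma>_reg[OF UP]]) simp
    next
      case 2
      have "\<beta> p (s p) = g p" for p by (simp add: \<beta>_def 2 fun_eq_iff fscale_apply)
      moreover have "regular_section E V g" by (rule E_section[OF V vector_bundleD(6)[OF F VF 2(1)]])
      hence "regular_section E U g"
      proof (intro E_sectionI[OF UP])
        assume g: "regular_section E V g"
        show "g p \<in> fibre E p" if "p \<in> U" for p using regular_sectionD(1)[OF g] that U by blast
        show "rational (cone U) 0 (\<lambda>v. \<phi> (vec.span {v}) (g (vec.span {v})) (l, v))" if "l < x" for l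
          by (rule rational_mono[OF E_sectionD[OF g V that]]) (auto simp: U cone_def)
      qed
      ultimately show ?thesis by simp
    qed
  qed
  have "bundle_iso E D" unfolding bundle_iso_def
    by (intro exI[of _ \<alpha>] exI[of _ \<beta>]) (use \<alpha>_hom \<beta>_hom \<beta>\<alpha> \<alpha>\<beta> in \<open>auto simp: base_E\<close>)
  thus ?thesis unfolding has_trivial_summand_def D_def using F baseF by blast
qed

end

theorem steiner_rank_upper_bound:
  fixes E :: "('k::{alg_closed_field, field_char_0}, 3, 'i) vbundle"
  assumes E: "vector_bundle r E" and seq: "steiner_sequence x c E" and nt: "\<not> has_trivial_summand E"
  shows "x \<le> 3 * c"
proof (rule ccontr)
  assume "\<not> x \<le> 3 * c"
  hence x: "3 * c < x" by simp
  obtain \<phi> \<psi> where "short_exact E (twist_sum proj_space (replicate x 0)) (twist_sum proj_space (replicate c 1)) \<phi> \<psi>"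
    using seq unfolding steiner_sequence_def twist_sum_replicate by blast
  then interpret steiner_data E r x c \<phi> \<psi> using E by unfold_locales
  define tri :: "nat \<Rightarrow> 3" where "tri q = (if q = 0 then 1 else if q = 1 then 2 else 3)" for q
  \<comment> \<open>Row \<open>q\<close> belongs to the coordinate vector with index
    \<open>tri (q div c)\<close>; by linearity of \<open>M\<close> these three vectors control all
    others.\<close>
  obtain w where w: "\<exists>l<x. w l \<noteq> 0" "\<forall>q<3 * c. (\<Sum>l<x. M (axis (tri (q div c)) 1) (q mod c) l * w l) = 0"
    using homogeneous_system[OF x, of "\<lambda>q l. M (axis (tri (q div c)) 1) (q mod c) l"] by blast
  obtain l0 where l0: "l0 < x" "w l0 \<noteq> 0" using w(1) by blast
  have ax: "(\<Sum>l<x. M (axis i 1) k l * w l) = 0" if k: "k < c" for i k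
  proof -
    have "i = tri 0 \<or> i = tri 1 \<or> i = tri 2" using exhaust_3[of i] by (simp add: tri_def)
    moreover have "(0::nat) < 3" "(1::nat) < 3" "(2::nat) < 3" by simp_all
    ultimately obtain b where b: "b < 3" "i = tri b" by blast
    have "b * c + k < 3 * c"
    proof -
      have "b = 0 \<or> b = 1 \<or> b = 2" using b by linarith
      thus ?thesis using k by auto
    qed
    from w(2)[rule_format, OF this] show ?thesis using k b by simp
  qed
  have "mv x (M v) w k = 0" if v: "v \<noteq> 0" "k < c" for v k
  proof -
    have "mv x (M v) w k = (\<Sum>l<x. \<Sum>i\<in>UNIV. v $ i * (M (axis i 1) k l * w l))"
      unfolding mv_def by (rule sum.cong) (use M_linear[OF v] in \<open>auto simp: sum_distrib_right mult.assoc\<close>)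
    also have "\<dots> = (\<Sum>i\<in>UNIV. \<Sum>l<x. v $ i * (M (axis i 1) k l * w l))" by (rule sum.swap)
    also have "\<dots> = 0" using ax[OF v(2)] by (simp add: sum_distrib_left[symmetric])
    finally show ?thesis .
  qed
  hence "mv x (M v) (\<lambda>l. (1 / w l0) * w l) k = 0" if "v \<noteq> 0" "k < c" for v k
    using that by (simp only: mv_scale) simp
  from trivial_summand[OF this l0(1)] l0 nt show False by simp
qed

section \<open>Kernel bundles\<close>

lemma fibre_twist_sum_outside:
  assumes "f \<in> fibre (twist_sum B as) p" "\<not> (j < length as \<and> v \<in> p - {0})"
  shows "f (j, v) = 0"
proof (cases "j < length as")
  case True
  hence "(\<lambda>v. f (j, v)) \<in> fibre (twist (as ! j)) p" using assms(1) by (simp add: fibre_twist_sum)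
  thus ?thesis using assms(2) True by (simp add: fibre_twist)
qed (use assms(1) in \<open>simp add: fibre_twist_sum\<close>)

section \<open>Echelon bases of kernels and minors\<close>

lemma mv_support:
  assumes j: "inj_on j {..<n}" "\<forall>i<n. j i < x" and w: "\<And>l. l \<notin> j ` {..<n} \<Longrightarrow> w l = 0"
  shows "mv x N w k = (\<Sum>i<n. N k (j i) * w (j i))"
proof -
  have "mv x N w k = (\<Sum>l\<in>j ` {..<n}. N k l * w l)"
    unfolding mv_def by (rule sum.mono_neutral_right) (use j(2) w in auto)
  thus ?thesis by (simp add: sum.reindex[OF j(1)])
qed

lemma complement_bij:
  assumes j: "inj_on j {..<n}" "\<forall>i<n. j i < (x::nat)"
  obtains q where "bij_betw q {..<x - n} ({..<x} - j ` {..<n})" "n \<le> x"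
proof -
  have sub: "j ` {..<n} \<subseteq> {..<x}" using j(2) by auto
  have cj: "card (j ` {..<n}) = n" using card_image[OF j(1)] by simp
  have "n \<le> x" using card_mono[OF _ sub] cj by simp
  have "card ({..<x} - j ` {..<n}) = x - n" using card_Diff_subset[OF _ sub] cj by simp
  then obtain q where "bij_betw q {0..<x - n} ({..<x} - j ` {..<n})"
    using ex_bij_betw_nat_finite[of "{..<x} - j ` {..<n}"] by auto
  thus ?thesis using that \<open>n \<le> x\<close> by (simp add: atLeast0LessThan)
qed

lemma pivot_solve:
  assumes j: "inj_on j {..<n}" "\<forall>i<n. j i < x" "trivial_kernel n n (\<lambda>k i. N k (j i))"
  shows "\<exists>w. (\<forall>k<n. mv x N w k = y k) \<and> (\<forall>l. l \<notin> j ` {..<n} \<longrightarrow> w l = 0)"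
proof -
  obtain u where u: "\<forall>k<n. (\<Sum>i<n. N k (j i) * u i) = y k" using square_solve[OF j(3), of y] by blast
  define w where "w l = (if l \<in> j ` {..<n} then u (inv_into {..<n} j l) else 0)" for l
  have "mv x N w k = y k" if "k < n" for k
  proof -
    have "mv x N w k = (\<Sum>i<n. N k (j i) * w (j i))"
      by (rule mv_support[OF j(1,2)]) (simp add: w_def)
    also have "\<dots> = (\<Sum>i<n. N k (j i) * u i)"
      by (rule sum.cong) (auto simp: w_def inv_into_f_f[OF j(1)])
    finally show ?thesis using u that by simp
  qed
  thus ?thesis by (intro exI[of _ w]) (simp add: w_def)
qed

lemma pivot_unique:
  assumes j: "inj_on j {..<n}" "\<forall>i<n. j i < x" "trivial_kernel n n (\<lambda>k i. N k (j i))"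
    and w: "\<And>k. k < n \<Longrightarrow> mv x N w k = 0" "\<And>l. l \<notin> j ` {..<n} \<Longrightarrow> w l = 0"
  shows "w l = 0"
proof (cases "l \<in> j ` {..<n}")
  case True
  then obtain i where i: "i < n" "l = j i" by auto
  have "w (j i) = 0"
    by (rule trivial_kernelD[OF j(3), of "\<lambda>i. w (j i)"]) (use w mv_support[OF j(1,2) w(2), where N = N] i in auto)
  thus ?thesis using i by simp
qed (rule w(2))

text \<open>The reduced echelon basis of the kernel: one free coordinate \<open>q t\<close> is 1,
  the other free ones are 0, and the pivot entries are solved for.\<close>

lemma pivot_kernel_vectors:
  assumes j: "inj_on j {..<n}" "\<forall>i<n. j i < x" "trivial_kernel n n (\<lambda>k i. N k (j i))"
    and q: "bij_betw q {..<x - n} ({..<x} - j ` {..<n})" and t: "t < x - n"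
  shows "\<exists>w. (\<forall>l\<ge>x. w l = 0) \<and> (\<forall>k<n. mv x N w k = 0) \<and> (\<forall>t'<x - n. w (q t') = (if t' = t then 1 else 0))"
proof -
  have qt: "q t \<in> {..<x} - j ` {..<n}" if "t < x - n" for t using q that by (auto simp: bij_betw_def)
  have qinj: "q t = q t' \<longleftrightarrow> t = t'" if "t < x - n" "t' < x - n" for t t'
    using q that by (auto simp: bij_betw_def inj_on_def)
  obtain w where w: "\<forall>k<n. mv x N w k = N k (q t)" "\<forall>l. l \<notin> j ` {..<n} \<longrightarrow> w l = 0"
    using pivot_solve[OF j, of "\<lambda>k. N k (q t)"] by blast
  define e where "e l = (if l = q t then 1 else 0) - w l" for l
  have "mv x N e k = 0" if "k < n" for k
    unfolding e_def mv_diff using w(1) that qt[OF t] by (simp add: mv_unit)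
  moreover have "e l = 0" if "l \<ge> x" for l
  proof -
    have "l \<notin> j ` {..<n}" using j(2) that by force
    thus ?thesis using that w(2) qt[OF t] by (auto simp: e_def)
  qed
  moreover have "e (q t') = (if t' = t then 1 else 0)" if "t' < x - n" for t'
    using w(2) qt[OF that] qinj[OF that t] by (simp add: e_def)
  ultimately show ?thesis by blast
qed

text \<open>The minor of the columns \<open>j\<close>. It turns invertibility of this block into the
  nonvanishing of a polynomial in the entries, and hence into an open condition.\<close>

definition pivot_det :: "nat \<Rightarrow> (nat \<Rightarrow> nat \<Rightarrow> 'k::field) \<Rightarrow> (nat \<Rightarrow> nat) \<Rightarrow> 'k" where
  "pivot_det n N j = Determinant.det (Matrix.mat n n (\<lambda>(k, i). N k (j i)))"

lemma pivot_det_sum: "pivot_det n N j = (\<Sum>p\<in>{p. p permutes {0..<n}}. signof p * (\<Prod>i = 0..<n. N i (j (p i))))"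
proof -
  have "pivot_det n N j = (\<Sum>p\<in>{p. p permutes {0..<n}}. signof p *
      (\<Prod>i = 0..<n. Matrix.mat n n (\<lambda>(k, i). N k (j i)) $$ (i, p i)))"
    unfolding pivot_det_def by (rule det_def') simp
  also have "\<dots> = (\<Sum>p\<in>{p. p permutes {0..<n}}. signof p * (\<Prod>i = 0..<n. N i (j (p i))))"
    by (intro sum.cong prod.cong arg_cong2[where f = "(*)"] refl) (auto simp: permutes_in_image[of _ "{0..<n}"] intro!: index_mat)
  finally show ?thesis .
qed

lemma pivot_det_trivial_kernel: "pivot_det n N j \<noteq> 0 \<longleftrightarrow> trivial_kernel n n (\<lambda>k i. N k (j i))"
proof -
  define A where "A = Matrix.mat n n (\<lambda>(k, i). N k (j i))"
  have A: "A \<in> carrier_mat n n" by (simp add: A_def)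
  have mult: "(A *\<^sub>v v) = 0\<^sub>v n \<longleftrightarrow> (\<forall>k<n. (\<Sum>i<n. N k (j i) * vec_index v i) = 0)"
    if v: "v \<in> carrier_vec n" for v
  proof -
    have "vec_index (A *\<^sub>v v) k = (\<Sum>i<n. N k (j i) * vec_index v i)" if "k < n" for k
      using that v by (simp add: A_def scalar_prod_def atLeast0LessThan)
    thus ?thesis by (auto simp: vec_eq_iff A_def)
  qed
  have "pivot_det n N j = 0 \<longleftrightarrow> (\<exists>v. v \<in> carrier_vec n \<and> v \<noteq> 0\<^sub>v n \<and> A *\<^sub>v v = 0\<^sub>v n)"
    unfolding pivot_det_def A_def[symmetric] by (rule det_0_iff_vec_prod_zero_field[OF A])
  also have "\<dots> \<longleftrightarrow> \<not> trivial_kernel n n (\<lambda>k i. N k (j i))"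
  proof
    assume "\<exists>v. v \<in> carrier_vec n \<and> v \<noteq> 0\<^sub>v n \<and> A *\<^sub>v v = 0\<^sub>v n"
    then obtain v where v: "v \<in> carrier_vec n" "v \<noteq> 0\<^sub>v n" "A *\<^sub>v v = 0\<^sub>v n" by blast
    show "\<not> trivial_kernel n n (\<lambda>k i. N k (j i))"
    proof
      assume t: "trivial_kernel n n (\<lambda>k i. N k (j i))"
      have "vec_index v i = 0" if "i < n" for i
        by (rule trivial_kernelD[OF t _ that]) (use v mult in auto)
      hence "v = 0\<^sub>v n" using v(1) by (intro eq_vecI) auto
      thus False using v(2) by simp
    qed
  next
    assume "\<not> trivial_kernel n n (\<lambda>k i. N k (j i))"
    then obtain w i where w: "\<forall>k<n. (\<Sum>i<n. N k (j i) * w i) = 0" "i < n" "w i \<noteq> 0"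
      unfolding trivial_kernel_def by blast
    define v where "v = Matrix.vec n w"
    have "v \<in> carrier_vec n" by (simp add: v_def)
    moreover have "v \<noteq> 0\<^sub>v n"
    proof
      assume "v = 0\<^sub>v n"
      hence "vec_index v i = 0" using w(2) by simp
      thus False using w(2,3) by (simp add: v_def)
    qed
    moreover have "A *\<^sub>v v = 0\<^sub>v n"
      using mult[OF \<open>v \<in> carrier_vec n\<close>] w(1) by (simp add: v_def)
    ultimately show "\<exists>v. v \<in> carrier_vec n \<and> v \<noteq> 0\<^sub>v n \<and> A *\<^sub>v v = 0\<^sub>v n" by blast
  qed
  finally show ?thesis by blast
qed

text \<open>\<open>M_surj\<close> makes the kernels the fibres of a bundle, \<open>M_line\<close>
  splits it over each line as wanted, and \<open>M_const\<close> excludes trivial summands.\<close>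

locale steiner_matrix =
  fixes M :: "'k::{alg_closed_field, field_char_0} ^ 'n::finite \<Rightarrow> nat \<Rightarrow> nat \<Rightarrow> 'k" and x c r :: nat
  assumes M_hom: "\<And>k l. k < c \<Longrightarrow> l < x \<Longrightarrow> homogeneous 1 (\<lambda>v. M v k l)"
    and M_add: "\<And>u v k l. k < c \<Longrightarrow> l < x \<Longrightarrow> M (u + v) k l = M u k l + M v k l"
    and M_surj: "\<And>v. v \<noteq> 0 \<Longrightarrow> trivial_kernel x c (\<lambda>l k. M v k l)"
    and M_line: "\<And>u0 u1 f0 f1 k. indep2 u0 u1 \<Longrightarrow>
      (\<And>l. l < x \<Longrightarrow> (\<Sum>k<c. f0 k * M u0 k l + f1 k * M u1 k l) = 0) \<Longrightarrow> k < c \<Longrightarrow> f0 k = 0 \<and> f1 k = 0"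
    and M_const: "\<And>w l. (\<And>v k. v \<noteq> 0 \<Longrightarrow> k < c \<Longrightarrow> mv x (M v) w k = 0) \<Longrightarrow> l < x \<Longrightarrow> w l = 0"
    and xr: "x = r + c"
begin

section \<open>The kernel bundle and its Steiner sequence\<close>

lemma M_scale: "k < c \<Longrightarrow> l < x \<Longrightarrow> M (a *s v) k l = a * M v k l"
  using homogeneous_scaling[OF M_hom, of k l a v] by simp

lemma mv_M_scale: "k < c \<Longrightarrow> mv x (M (a *s v)) w k = a * mv x (M v) w k"
  by (simp add: mv_def M_scale sum_distrib_left mult.assoc)

lemma mv_M_comb: "k < c \<Longrightarrow> mv x (M (a *s u + b *s v)) w k = a * mv x (M u) w k + b * mv x (M v) w k"
  by (simp add: mv_def M_add M_scale distrib_right sum.distrib sum_distrib_left mult.assoc)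

definition K :: "('k ^ 'n) set \<Rightarrow> (nat \<Rightarrow> 'k) set" where
  "K p = {w. (\<forall>l\<ge>x. w l = 0) \<and> (\<forall>v\<in>p. \<forall>k<c. mv x (M v) w k = 0)}"

lemma K_span: "w \<in> K (vec.span {v}) \<longleftrightarrow> (\<forall>l\<ge>x. w l = 0) \<and> (\<forall>k<c. mv x (M v) w k = 0)"
  using self_in_span[of v] by (auto simp: K_def in_span_singleton mv_M_scale)

lemma K_subspace: "fvec.subspace (K p)"
proof (rule fvec.subspaceI)
  show "0 \<in> K p" by (simp add: K_def mv_def)
  show "w + w' \<in> K p" if "w \<in> K p" "w' \<in> K p" for w w'
    using that mv_add[of x _ w w'] by (auto simp: K_def plus_fun_def)
  show "fscale a w \<in> K p" if "w \<in> K p" for w a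
    using that mv_scale[of x _ a w] by (auto simp: K_def fscale_def)
qed

sublocale CK: coordinate_family proj_space K "\<lambda>v e l. e l" x
proof
  fix v e assume "e \<in> K (vec.span {v})" "\<And>l. l < x \<Longrightarrow> e l = 0"
  moreover from this(1) have "e l = 0" if "l \<ge> x" for l using that by (simp add: K_def)
  ultimately show "e = 0" by (auto simp: fun_eq_iff) (meson not_le)
qed (auto simp: K_subspace fscale_apply)

definition E :: "('k, 'n, nat) vbundle" where
  "E = atlas_bundle proj_space K (\<lambda>v e l. e l) x r"

lemma base_E: "base E = proj_space" and fibre_E: "fibre E p = K p"
  by (simp_all add: E_def atlas_bundle_def)

lemma pivot_open:
  assumes "\<forall>i<c. j i < x"
  shows "homogeneous c (\<lambda>v. pivot_det c (M v) j)"
  unfolding pivot_det_sum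
proof (intro homogeneous_sum homogeneous_scale)
  fix p assume "p \<in> {p. p permutes {0..<c}}"
  hence "homogeneous (card {0..<c} * 1) (\<lambda>v. \<Prod>i = 0..<c. M v i (j (p i)))"
    using assms permutes_in_image[of p "{0..<c}"] by (intro homogeneous_prod_const M_hom) auto
  thus "homogeneous c (\<lambda>v. \<Prod>i = 0..<c. M v i (j (p i)))" by simp
qed

lemma pivots:
  assumes "v \<noteq> 0"
  obtains j where "inj_on j {..<c}" "\<forall>i<c. j i < x" "pivot_det c (M v) j \<noteq> 0"
  using pivot_columns[OF M_surj[OF assms]] pivot_det_trivial_kernel by blast

text \<open>Where a maximal minor of \<open>M\<close> is nonzero, the echelon basis is a frame: the
  free coordinates of its vectors are constant, and the pivot entries are rational.\<close>

lemma E_cover: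
  assumes p: "p \<in> proj_space"
  shows "\<exists>U fs. (U, fs) \<in> frames E \<and> p \<in> U"
proof -
  obtain v0 where v0: "v0 \<noteq> 0" "p = vec.span {v0}" using p by (rule proj_space_obtain)
  obtain j where j: "inj_on j {..<c}" "\<forall>i<c. j i < x" and det: "pivot_det c (M v0) j \<noteq> 0"
    using pivots[OF v0(1)] by blast
  note hom = pivot_open[OF j(2)]
  define U where "U = basic_open (\<lambda>v. pivot_det c (M v) j)"
  have coneU: "v \<in> cone U \<longleftrightarrow> v \<noteq> 0 \<and> pivot_det c (M v) j \<noteq> 0" for v
    unfolding U_def cone_basic_open[OF hom] by simp
  have UP: "U \<subseteq> proj_space" by (simp add: U_def basic_open_subset)
  have piv: "trivial_kernel c c (\<lambda>k i. M v k (j i))" if "v \<in> cone U" for v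
    using that by (simp add: coneU pivot_det_trivial_kernel)
  obtain q where q: "bij_betw q {..<x - c} ({..<x} - j ` {..<c})" using complement_bij[OF j] by blast
  have r: "x - c = r" by (simp add: xr)
  have ex: "\<exists>w. w \<in> K p \<and> (\<forall>t'<r. w (q t') = (if t' = t then 1 else 0))" if p: "p \<in> U" and t: "t < r" for p t
  proof -
    obtain v where v: "v \<noteq> 0" "p = vec.span {v}" using p UP by (blast elim: proj_space_obtain)
    hence vU: "v \<in> cone U" using p by (simp add: cone_def)
    show ?thesis
      using pivot_kernel_vectors[OF j piv[OF vU] q, of t] t by (simp add: r v(2) K_span)
  qed
  define f where "f t p = (SOME w. w \<in> K p \<and> (\<forall>t'<r. w (q t') = (if t' = t then 1 else 0)))" for t p
  have f: "f t p \<in> K p" "\<And>t'. t' < r \<Longrightarrow> f t p (q t') = (if t' = t then 1 else 0)" if "p \<in> U" "t < r" for p t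
    using someI_ex[OF ex[OF that]] unfolding f_def by blast+
  define fs where "fs = map f [0..<r]"
  \<comment> \<open>A kernel vector is determined by its free coordinates.\<close>
  have zero: "w = 0" if p: "p \<in> U" and w: "w \<in> K p" "\<And>t. t < r \<Longrightarrow> w (q t) = 0" for p w
  proof
    fix l
    obtain v where v: "v \<noteq> 0" "p = vec.span {v}" using p UP by (blast elim: proj_space_obtain)
    hence vU: "v \<in> cone U" using p by (simp add: cone_def)
    have "w l = 0"
    proof (rule pivot_unique[OF j piv[OF vU]])
      show "mv x (M v) w k = 0" if "k < c" for k using w(1) that by (simp add: v(2) K_span)
      show "w l = 0" if l: "l \<notin> j ` {..<c}" for l
      proof (cases "l < x")
        case True
        hence "l \<in> q ` {..<x - c}" using q l by (auto simp: bij_betw_def)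
        thus ?thesis using w(2) r by auto
      next
        case False
        thus ?thesis using w(1) by (simp add: K_def)
      qed
    qed
    thus "w l = 0 l" by simp
  qed
  have basis: "is_basis (K p) (map (\<lambda>s. s p) fs)" if p: "p \<in> U" for p
  proof (rule is_basisI)
    have sum_eq: "(\<Sum>t<length (map (\<lambda>s. s p) fs). fscale (a t) (map (\<lambda>s. s p) fs ! t)) = (\<Sum>t<r. fscale (a t) (f t p))" for a
      by (rule sum.cong) (auto simp: fs_def)
    have eval: "(\<Sum>t<r. fscale (a t) (f t p)) (q t') = a t'" if "t' < r" for a t'
    proof -
      have "(\<Sum>t<r. fscale (a t) (f t p)) (q t') = (\<Sum>t<r. if t = t' then a t else 0)"
        unfolding sum_fun_apply by (rule sum.cong) (use f(2)[OF p] that in \<open>auto simp: fscale_apply\<close>)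
      thus ?thesis using that by simp
    qed
    have mem: "(\<Sum>t<r. fscale (a t) (f t p)) \<in> K p" for a
      by (intro fvec.subspace_sum fvec.subspace_scale K_subspace f(1)[OF p]) simp
    show "a t = 0" if "(\<Sum>t<length (map (\<lambda>s. s p) fs). fscale (a t) (map (\<lambda>s. s p) fs ! t)) = 0"
        "t < length (map (\<lambda>s. s p) fs)" for a t
      using that eval[of t a] unfolding sum_eq by (simp add: fs_def)
    show "w \<in> K p \<longleftrightarrow> (\<exists>a. w = (\<Sum>t<length (map (\<lambda>s. s p) fs). fscale (a t) (map (\<lambda>s. s p) fs ! t)))" for w
      unfolding sum_eq
    proof
      assume w: "w \<in> K p"
      have "w - (\<Sum>t<r. fscale (w (q t)) (f t p)) = 0"
        by (rule zero[OF p]) (use fvec.subspace_diff[OF K_subspace w mem] eval in auto)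
      thus "\<exists>a. w = (\<Sum>t<r. fscale (a t) (f t p))" by (intro exI[of _ "\<lambda>t. w (q t)"]) simp
    qed (use mem in auto)
  qed
  have rat: "rational (cone U) 0 (\<lambda>v. f t (vec.span {v}) l)" if t: "t < r" and l: "l < x" for t l
  proof (cases "l \<in> j ` {..<c}")
    case False
    hence "l \<in> q ` {..<x - c}" using q l by (auto simp: bij_betw_def)
    then obtain t' where t': "t' < r" "l = q t'" using r by auto
    show ?thesis
      by (rule rational_cong[of _ _ "\<lambda>_. if t' = t then 1 else 0"])
        (use f(2)[OF _ t] t' in \<open>auto simp: rational_def rat_at_const cone_def\<close>)
  next
    case True
    then obtain i where i: "i < c" "l = j i" by auto
    show ?thesis unfolding rational_def
    proof
      fix v assume v: "v \<in> cone U"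
      have qt: "q t \<in> {..<x} - j ` {..<c}" using q t r by (auto simp: bij_betw_def)
      \<comment> \<open>The pivot entries are the unknowns, and column \<open>q t\<close>, whose
        free coordinate is 1, moves to the right. Coefficients and right side have degree 1, so the
        solution has degree 0.\<close>
      have "rat_at (cone U) v 0 (\<lambda>v. f t (vec.span {v}) (j i))"
      proof (rule rat_at_solve[where x = c and r = c and \<beta> = 1 and B = "\<lambda>k i v. M v k (j i)"
            and W = "\<lambda>k v. (- 1) * M v k (q t)" and a = "\<lambda>i v. f t (vec.span {v}) (j i)"])
        show "rat_at (cone U) v 1 (\<lambda>v. M v k (j i))" if "k < c" "i < c" for k i
          using rat_at_homogeneous[OF M_hom, of k "j i" "cone U" v] that j(2) by simp
        show "rat_at (cone U) v (0 + 1) (\<lambda>v. (- 1) * M v k (q t))" if "k < c" for k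
          using rat_at_scale[OF rat_at_homogeneous[OF M_hom], of k "q t" "cone U" v "- 1"] that qt by simp
        show "(\<Sum>i<c. M u k (j i) * f t (vec.span {u}) (j i)) = (- 1) * M u k (q t)" if u: "u \<in> cone U" and k: "k < c" for u k
        proof -
          have pu: "vec.span {u} \<in> U" using u by (simp add: cone_def)
          define w where "w l = f t (vec.span {u}) l - (if l = q t then 1 else 0)" for l
          have w0: "w l = 0" if l: "l \<notin> j ` {..<c}" for l
          proof (cases "l < x")
            case True
            hence "l \<in> q ` {..<x - c}" using q l by (auto simp: bij_betw_def)
            then obtain t' where t': "t' < r" "l = q t'" using r by auto
            have "q t = q t' \<longleftrightarrow> t = t'" using q t t' r by (auto simp: bij_betw_def inj_on_def)
            thus ?thesis using f(2)[OF pu t t'(1)] t' by (auto simp: w_def)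
          next
            case False
            thus ?thesis using f(1)[OF pu t] qt by (auto simp: w_def K_def)
          qed
          have "(\<Sum>i<c. M u k (j i) * w (j i)) = mv x (M u) w k" by (rule mv_support[OF j w0, symmetric])
          also have "\<dots> = - M u k (q t)"
            unfolding w_def mv_diff using f(1)[OF pu t] k qt by (simp add: mv_unit K_span)
          also have "(\<Sum>i<c. M u k (j i) * w (j i)) = (\<Sum>i<c. M u k (j i) * f t (vec.span {u}) (j i))"
          proof (rule sum.cong)
            fix i assume "i \<in> {..<c}"
            hence "j i \<in> j ` {..<c}" by (rule imageI)
            hence "j i \<noteq> q t" using qt by auto
            thus "M u k (j i) * w (j i) = M u k (j i) * f t (vec.span {u}) (j i)" by (simp add: w_def)
          qed simp
          finally show ?thesis by simp
        qed
        show "trivial_kernel c c (\<lambda>k i. M v k (j i))" by (rule piv[OF v])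
      qed (use v i in \<open>auto simp: cone_def\<close>)
      thus "rat_at (cone U) v 0 (\<lambda>v. f t (vec.span {v}) l)" by (simp add: i(2))
    qed
  qed
  have "zariski_open_in proj_space U"
    unfolding zariski_open_in_iff[OF subset_refl]
  proof (intro conjI ballI UP)
    fix v assume "v \<in> cone U"
    thus "\<exists>e k. homogeneous e k \<and> k v \<noteq> 0 \<and> (\<forall>u\<in>cone proj_space. k u \<noteq> 0 \<longrightarrow> u \<in> cone U)"
      using hom by (intro exI[of _ c] exI[of _ "\<lambda>v. pivot_det c (M v) j"]) (auto simp: coneU cone_proj_space)
  qed
  hence "(U, fs) \<in> frames E"
    unfolding E_def atlas_bundle_def using basis rat by (auto simp: fs_def)
  moreover have "p \<in> U" using v0 det by (simp add: U_def span_in_basic_open[OF hom])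
  ultimately show ?thesis by blast
qed

lemma E_bundle: "vector_bundle r E"
  unfolding E_def by (rule CK.atlas_vector_bundle) (use E_cover in \<open>simp add: E_def\<close>)

lemma E_sectionI:
  assumes "V \<subseteq> proj_space" "\<And>p. p \<in> V \<Longrightarrow> s p \<in> K p"
    and "\<And>l. l < x \<Longrightarrow> rational (cone V) 0 (\<lambda>v. s (vec.span {v}) l)"
  shows "regular_section E V s"
  unfolding E_def by (rule CK.atlas_regular_sectionI[OF assms])

lemma E_sectionD:
  assumes "regular_section E V s" "V \<subseteq> proj_space" "l < x"
  shows "rational (cone V) 0 (\<lambda>v. s (vec.span {v}) l)"
  by (rule CK.atlas_regular_sectionD[OF _ assms(1)[unfolded E_def] assms(2,3)]) (use E_cover in \<open>simp add: E_def\<close>)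

lemma E_frame_open: "(U, fs) \<in> frames E \<Longrightarrow> U \<subseteq> proj_space"
  using zariski_open_in_subset[OF vector_bundleD(2)[OF E_bundle]] by (simp add: base_E)

definition incl :: "('k ^ 'n) set \<Rightarrow> (nat \<Rightarrow> 'k) \<Rightarrow> nat \<times> ('k ^ 'n) \<Rightarrow> 'k" where
  "incl p e = (\<lambda>(l, v). if l < x \<and> v \<in> p - {0} then e l else 0)"

text \<open>Matrix and argument are evaluated at the same representative; \<open>M\<close>
  contributes degree 1 and \<open>y\<close> degree 0, so the result lies in the fibre of
  O(1)^c.\<close>

definition app :: "('k ^ 'n) set \<Rightarrow> (nat \<times> ('k ^ 'n) \<Rightarrow> 'k) \<Rightarrow> nat \<times> ('k ^ 'n) \<Rightarrow> 'k" where
  "app p y = (\<lambda>(k, v). if k < c \<and> v \<in> p - {0} then mv x (M v) (\<lambda>l. y (l, v)) k else 0)"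

lemma scale_in_point: "p \<in> proj_space \<Longrightarrow> v \<in> p - {0} \<Longrightarrow> a \<noteq> 0 \<Longrightarrow> a *s v \<in> p - {0}"
  by (auto elim!: proj_space_obtain intro: vec.span_scale)

lemma incl_fibre: "p \<in> proj_space \<Longrightarrow> incl p e \<in> fibre (twist_sum proj_space (replicate x 0)) p"
  using scale_in_point[of p] by (auto simp: fibre_twist_sum fibre_twist incl_def)

lemma app_fibre:
  assumes p: "p \<in> proj_space" and y: "y \<in> fibre (twist_sum proj_space (replicate x 0)) p"
  shows "app p y \<in> fibre (twist_sum proj_space (replicate c 1)) p"
proof -
  have "mv x (M (a *s v)) (\<lambda>l. y (l, a *s v)) k = a * mv x (M v) (\<lambda>l. y (l, v)) k"
    if "k < c" "v \<in> p - {0}" "a \<noteq> 0" for a v k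
  proof -
    have "y (l, a *s v) = y (l, v)" if "l < x" for l
    proof -
      have "(\<lambda>u. y (l, u)) \<in> fibre (twist 0) p" using y that by (simp add: fibre_twist_sum)
      thus ?thesis using \<open>v \<in> p - {0}\<close> \<open>a \<noteq> 0\<close> by (simp add: fibre_twist)
    qed
    hence "mv x (M (a *s v)) (\<lambda>l. y (l, a *s v)) k = mv x (M (a *s v)) (\<lambda>l. y (l, v)) k"
      by (intro mv_cong) auto
    thus ?thesis using mv_M_scale[OF that(1)] by simp
  qed
  thus ?thesis using scale_in_point[OF p] by (auto simp: fibre_twist_sum fibre_twist app_def)
qed

lemma incl_hom: "bundle_hom E (twist_sum proj_space (replicate x 0)) incl"
proof (rule bundle_homI)
  show "base E = base (twist_sum proj_space (replicate x 0))" by (simp add: base_E base_twist_sum)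
  show "incl p e \<in> fibre (twist_sum proj_space (replicate x 0)) p" if "p \<in> base E" for p e
    using incl_fibre that by (simp add: base_E)
  show "incl p (e + f) = incl p e + incl p f" "incl p (fscale a e) = fscale a (incl p e)" for p e f a
    by (auto simp: incl_def fun_eq_iff fscale_apply)
  fix U fs s assume fr: "(U, fs) \<in> frames E" and s: "s \<in> set fs"
  note U = E_frame_open[OF fr]
  note reg = vector_bundleD(6)[OF E_bundle fr s]
  show "regular_section (twist_sum proj_space (replicate x 0)) U (\<lambda>p. incl p (s p))"
    unfolding regular_section_twist_sum[OF subset_refl U]
  proof (intro conjI ballI allI impI)
    show "incl p (s p) \<in> fibre (twist_sum proj_space (replicate x 0)) p" if "p \<in> U" for p
      using incl_fibre that U by blast
    fix l assume "l < length (replicate x (0::int))"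
    hence l: "l < x" by simp
    show "rational (cone U) (replicate x 0 ! l) (\<lambda>v. incl (vec.span {v}) (s (vec.span {v})) (l, v))"
      using l by (simp, intro rational_cong[OF E_sectionD[OF reg U l]])
        (auto simp: incl_def cone_def self_in_span)
  qed
qed

lemma app_hom: "bundle_hom (twist_sum proj_space (replicate x 0)) (twist_sum proj_space (replicate c 1)) app"
proof (rule bundle_homI)
  show "base (twist_sum proj_space (replicate x 0)) = base (twist_sum proj_space (replicate c 1))"
    by (simp add: base_twist_sum)
  show "app p y \<in> fibre (twist_sum proj_space (replicate c 1)) p"
    if "p \<in> base (twist_sum proj_space (replicate x 0))" "y \<in> fibre (twist_sum proj_space (replicate x 0)) p" for p y
    using app_fibre that by (simp add: base_twist_sum)
  show "app p (y + z) = app p y + app p z" "app p (fscale a y) = fscale a (app p y)" for p y z a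
    by (auto simp: app_def fun_eq_iff fscale_apply mv_add mv_scale)
  fix U fs s assume fr: "(U, fs) \<in> frames (twist_sum proj_space (replicate x 0) :: ('k, 'n, nat \<times> ('k ^ 'n)) vbundle)"
    and s: "s \<in> set fs"
  obtain i where U: "U = proj_space \<inter> (\<Inter>j<x. basic_open (\<lambda>v. v $ i j) \<inter> proj_space)" and fs: "fs = twist_frame (replicate x 0) i"
    using fr unfolding frames_twist_sum by (elim rangeE) simp
  obtain j where j: "j < x" "s = (\<lambda>p. slot j (coord_power 0 (i j) p))"
    using s by (auto simp: fs twist_frame_def)
  have UP: "U \<subseteq> proj_space" by (auto simp: U)
  have Uj: "p \<in> basic_open (\<lambda>v. v $ i j)" if "p \<in> U" for p using that j(1) unfolding U by blast
  have s_fibre: "s p \<in> fibre (twist_sum proj_space (replicate x 0)) p" if "p \<in> U" for p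
    unfolding j(2) by (rule slot_fibre) (use j coord_power_fibre[OF Uj[OF that]] in auto)
  show "regular_section (twist_sum proj_space (replicate c 1)) U (\<lambda>p. app p (s p))"
    unfolding regular_section_twist_sum[OF subset_refl UP]
  proof (intro conjI ballI allI impI)
    show "app p (s p) \<in> fibre (twist_sum proj_space (replicate c 1)) p" if "p \<in> U" for p
      using app_fibre s_fibre[OF that] that UP by blast
    fix k assume "k < length (replicate c (1::int))"
    hence k: "k < c" by simp
    have "rational (cone U) 1 (\<lambda>v. M v k j)"
      unfolding rational_def using rat_at_homogeneous[OF M_hom[OF k j(1)]] by simp
    hence "rational (cone U) 1 (\<lambda>v. app (vec.span {v}) (s (vec.span {v})) (k, v))"
    proof (rule rational_cong)
      fix u assume "u \<in> cone U"
      hence u: "u \<noteq> 0" "vec.span {u} \<in> U" by (auto simp: cone_def)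
      have "mv x (M u) (\<lambda>l. s (vec.span {u}) (l, u)) k = mv x (M u) (\<lambda>l. if l = j then 1 else 0) k"
        by (rule mv_cong) (use u self_in_span[of u] in \<open>auto simp: j(2) slot_apply coord_power_def\<close>)
      thus "M u k j = app (vec.span {u}) (s (vec.span {u})) (k, u)"
        using k j(1) u(1) self_in_span[of u] by (simp add: app_def mv_unit)
    qed
    thus "rational (cone U) (replicate c 1 ! k) (\<lambda>v. app (vec.span {v}) (s (vec.span {v})) (k, v))"
      using k by simp
  qed
qed

lemma E_steiner: "steiner_sequence x c E"
proof -
  have "short_exact E (twist_sum proj_space (replicate x 0)) (twist_sum proj_space (replicate c 1)) incl app"
    unfolding short_exact_def base_E fibre_E
  proof (intro conjI ballI incl_hom app_hom)
    fix p :: "('k ^ 'n) set" assume p: "p \<in> proj_space"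
    obtain v where v: "v \<noteq> 0" "p = vec.span {v}" using p by (rule proj_space_obtain)
    have vp: "v \<in> p - {0}" using v self_in_span by auto
    show "inj_on (incl p) (K p)"
    proof (rule inj_onI)
      fix e f assume ef: "e \<in> K p" "f \<in> K p" "incl p e = incl p f"
      have "e l = f l" for l
      proof (cases "l < x")
        case True
        thus ?thesis using fun_cong[OF ef(3), of "(l, v)"] vp by (simp add: incl_def)
      qed (use ef in \<open>simp add: K_def\<close>)
      thus "e = f" by blast
    qed
    have fib: "y (l, u) = y (l, v)" if y: "y \<in> fibre (twist_sum proj_space (replicate x 0)) p" and l: "l < x" and u: "u \<in> p - {0}" for y l u
    proof -
      obtain a where a: "a \<noteq> 0" "v \<noteq> 0" "u = a *s v"
        using u unfolding v(2) by (rule nonzero_in_span_singletonE)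
      have "(\<lambda>u. y (l, u)) \<in> fibre (twist 0) p" using y l by (simp add: fibre_twist_sum)
      thus ?thesis using vp a by (simp add: fibre_twist)
    qed
    show "incl p ` K p = {y \<in> fibre (twist_sum proj_space (replicate x 0)) p. app p y = 0}"
    proof (intro equalityI subsetI)
      fix y assume "y \<in> incl p ` K p"
      then obtain e where e: "e \<in> K p" "y = incl p e" by blast
      have "mv x (M u) (\<lambda>l. y (l, u)) k = 0" if "u \<in> p - {0}" "k < c" for u k
      proof -
        have "mv x (M u) (\<lambda>l. y (l, u)) k = mv x (M u) e k"
          by (rule mv_cong) (use that in \<open>simp add: e(2) incl_def\<close>)
        thus ?thesis using e(1) that by (simp add: K_def)
      qed
      hence "app p y = 0" by (auto simp: app_def fun_eq_iff)
      thus "y \<in> {y \<in> fibre (twist_sum proj_space (replicate x 0)) p. app p y = 0}"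
        using incl_fibre[OF p] e(2) by simp
    next
      fix y assume "y \<in> {y \<in> fibre (twist_sum proj_space (replicate x 0)) p. app p y = 0}"
      hence y: "y \<in> fibre (twist_sum proj_space (replicate x 0)) p" "app p y = 0" by auto
      define e where "e l = (if l < x then y (l, v) else 0)" for l
      have "mv x (M v) e k = 0" if "k < c" for k
      proof -
        have "mv x (M v) e k = mv x (M v) (\<lambda>l. y (l, v)) k" by (rule mv_cong) (simp add: e_def)
        thus ?thesis using fun_cong[OF y(2), of "(k, v)"] that vp by (simp add: app_def)
      qed
      hence "e \<in> K p" by (simp add: v(2) K_span e_def)
      moreover have "y = incl p e"
      proof (rule ext, clarify)
        fix l u
        show "y (l, u) = incl p e (l, u)"
        proof (cases "l < x \<and> u \<in> p - {0}")
          case True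
          thus ?thesis using fib[OF y(1)] by (simp add: incl_def e_def)
        next
          case False
          thus ?thesis using fibre_twist_sum_outside[OF y(1), of l u] by (auto simp: incl_def)
        qed
      qed
      ultimately show "y \<in> incl p ` K p" by blast
    qed
    show "app p ` fibre (twist_sum proj_space (replicate x 0)) p = fibre (twist_sum proj_space (replicate c 1)) p"
    proof (intro equalityI subsetI)
      fix z assume "z \<in> app p ` fibre (twist_sum proj_space (replicate x 0)) p"
      thus "z \<in> fibre (twist_sum proj_space (replicate c 1)) p" using app_fibre[OF p] by blast
    next
      fix z assume z: "z \<in> fibre (twist_sum proj_space (replicate c 1)) p"
      obtain w where w: "\<forall>k<c. mv x (M v) w k = z (k, v)"
        using full_row_rank_surj[OF M_surj[OF v(1)], of "\<lambda>k. z (k, v)"] unfolding mv_def by blast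
      have "app p (incl p w) = z"
      proof (rule ext, clarify)
        fix k u
        show "app p (incl p w) (k, u) = z (k, u)"
        proof (cases "k < c \<and> u \<in> p - {0}")
          case True
          hence "u \<in> vec.span {v} - {0}" by (simp add: v(2))
          then obtain a where a: "a \<noteq> 0" "v \<noteq> 0" "u = a *s v" by (rule nonzero_in_span_singletonE)
          have "(\<lambda>u. z (k, u)) \<in> fibre (twist 1) p" using z True by (simp add: fibre_twist_sum)
          hence zu: "z (k, u) = a * z (k, v)" using vp a by (simp add: fibre_twist)
          have "mv x (M u) (\<lambda>l. incl p w (l, u)) k = mv x (M u) w k"
            by (rule mv_cong) (use True in \<open>simp add: incl_def\<close>)
          also have "\<dots> = a * z (k, v)" using True w by (simp add: a(3) mv_M_scale)
          finally show ?thesis using True zu by (simp add: app_def)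
        next
          case False
          thus ?thesis using fibre_twist_sum_outside[OF z, of k u] by (auto simp: app_def)
        qed
      qed
      thus "z \<in> app p ` fibre (twist_sum proj_space (replicate x 0)) p" using incl_fibre[OF p] by blast
    qed
  qed
  thus ?thesis unfolding steiner_sequence_def twist_sum_replicate by blast
qed

end

section \<open>Coordinates on a line, and the splitting of the kernel bundle\<close>

lemma proj_lines_obtain:
  assumes "L \<in> proj_lines"
  obtains u w :: "'k::field ^ 'n::finite" where "indep2 u w" "L = {p \<in> proj_space. p \<subseteq> vec.span {u, w}}"
proof -
  obtain W :: "('k ^ 'n) set" where W: "L = {p \<in> proj_space. p \<subseteq> W}" "vec.subspace W" "vec.dim W = 2"
    using assms by (auto simp: proj_lines_def)
  obtain B where B: "B \<subseteq> W" "vec.independent B" "W \<subseteq> vec.span B" "card B = 2"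
    using vec.basis_exists[of W] W(3) by metis
  obtain u w where uw: "B = {u, w}" "u \<noteq> w" using B(4) by (auto simp: card_2_iff)
  have "vec.span B = W" using B(1,3) vec.span_minimal[OF B(1) W(2)] by blast
  moreover have "indep2 u w" unfolding indep2_def
  proof (intro allI impI)
    fix a b assume ab: "a *s u + b *s w = 0"
    define g where "g v = (if v = u then a else b)" for v
    have "(\<Sum>v\<in>{u, w}. g v *s v) = 0" using ab uw(2) by (simp add: g_def)
    hence "\<forall>v\<in>{u, w}. g v = 0" using B(2) unfolding uw(1) by (auto simp: vec.dependent_finite)
    thus "a = 0 \<and> b = 0" using uw(2) by (simp add: g_def)
  qed
  ultimately show ?thesis using that W(1) uw(1) by blast
qed

lemma indep2_minor:
  fixes u w :: "'k::field ^ 'n::finite"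
  assumes "indep2 u w"
  shows "\<exists>i j. u $ i * w $ j - u $ j * w $ i \<noteq> 0"
proof (rule ccontr)
  assume "\<not> (\<exists>i j. u $ i * w $ j - u $ j * w $ i \<noteq> 0)"
  hence 0: "u $ i * w $ j = u $ j * w $ i" for i j by simp
  obtain i where i: "u $ i \<noteq> 0" using nonzero_coord[OF indep2_nonzero(1)[OF assms]] by blast
  have "(w $ i) *s u + (- (u $ i)) *s w = 0"
    using 0[of i] by (simp add: Finite_Cartesian_Product.vec_eq_iff mult.commute)
  hence "u $ i = 0" using assms unfolding indep2_def by (metis neg_equal_0_iff_equal)
  thus False using i by simp
qed

text \<open>Cramer's rule for a nonvanishing minor of \<open>u\<close>, \<open>w\<close>. The
  coordinates on the plane are thereby restrictions of linear forms on the whole space, which count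
  as homogeneous functions.\<close>

lemma indep2_coordinates:
  fixes u w :: "'k::field ^ 'n::finite"
  assumes "indep2 u w"
  obtains s t where "homogeneous 1 s" "homogeneous 1 t"
    "\<And>v. v \<in> vec.span {u, w} \<Longrightarrow> v = s v *s u + t v *s w"
proof -
  obtain i j where d: "u $ i * w $ j - u $ j * w $ i \<noteq> 0" using indep2_minor[OF assms] by blast
  define d where "d = u $ i * w $ j - u $ j * w $ i"
  define s where "s v = (w $ j / d) * v $ i + (- w $ i / d) * v $ j" for v
  define t where "t v = (u $ i / d) * v $ j + (- u $ j / d) * v $ i" for v
  have "homogeneous 1 s" "homogeneous 1 t" unfolding s_def[abs_def] t_def[abs_def]
    by (intro homogeneous_add homogeneous_scale homogeneous_coord)+
  moreover have "v = s v *s u + t v *s w" if span: "v \<in> vec.span {u, w}" for v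
  proof -
    obtain a b where v: "v = a *s u + b *s w" using span in_span_pair by blast
    have "d * s v = d * a" "d * t v = d * b"
      using d by (simp_all add: s_def t_def v d_def[symmetric] algebra_simps) (simp_all add: d_def algebra_simps)
    hence "s v = a" "t v = b" using d by (auto simp: d_def)
    thus ?thesis using v by simp
  qed
  ultimately show ?thesis using that by blast
qed

lemma frames_direct_sumI:
  assumes "(U, fs) \<in> frames E" "(V, gs) \<in> frames F"
  shows "(U \<inter> V, map (\<lambda>s p. case_sum (s p) (\<lambda>_. 0)) fs @ map (\<lambda>s p. case_sum (\<lambda>_. 0) (s p)) gs)
    \<in> frames (direct_sum E F)"
  unfolding direct_sum_def using assms by auto

lemma coord_frame: "(basic_open (\<lambda>v. v $ i), [coord_power a i]) \<in> frames (twist a)"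
  by (auto simp: twist_def coord_power_def[abs_def])

context steiner_matrix
begin

text \<open>With lifts \<open>A\<^sub>k, B\<^sub>k\<close> of the basis of \<open>U\<^sup>* \<otimes> k\<^sup>c\<close>, where \<open>U\<close> is spanned by \<open>u\<^sub>0, u\<^sub>1\<close>, the bundle is
  trivialised over the line by constant sections and \<open>t A\<^sub>k - s B\<^sub>k\<close> at \<open>s u\<^sub>0 + t u\<^sub>1\<close>.\<close>

lemma E_splits:
  assumes L: "L \<in> proj_lines"
  shows "splits_on E L (replicate (x - 2 * c) 0 @ replicate c (- 1))"
proof -
  obtain u0 u1 :: "'k ^ 'n" where u: "indep2 u0 u1" and L: "L = {p \<in> proj_space. p \<subseteq> vec.span {u0, u1}}"
    using L by (rule proj_lines_obtain)
  have coneL: "cone L = {v. v \<noteq> 0 \<and> v \<in> vec.span {u0, u1}}" unfolding L by (rule cone_line)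
  have LP: "L \<subseteq> proj_space" by (auto simp: L)
  obtain s t where s: "homogeneous 1 s" and t: "homogeneous 1 t"
    and st: "\<And>v. v \<in> vec.span {u0, u1} \<Longrightarrow> v = s v *s u0 + t v *s u1" using u by (rule indep2_coordinates) blast
  have st': "v = s v *s u0 + t v *s u1" "s v \<noteq> 0 \<or> t v \<noteq> 0" if v: "v \<in> cone L" for v
  proof -
    show e: "v = s v *s u0 + t v *s u1" using st v by (simp add: coneL)
    have "v \<noteq> 0" using v by (simp add: coneL)
    show "s v \<noteq> 0 \<or> t v \<noteq> 0"
    proof (rule ccontr)
      assume "\<not> (s v \<noteq> 0 \<or> t v \<noteq> 0)"
      thus False using e \<open>v \<noteq> 0\<close> by simp
    qed
  qed
  have s_scale: "s (b *s v) = b * s v" and t_scale: "t (b *s v) = b * t v" for b v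
    using homogeneous_scaling[OF s, of b v] homogeneous_scaling[OF t, of b v] by simp_all
  \<comment> \<open>\<open>M u0\<close> stacked on \<open>M u1\<close>. By \<open>M_line\<close> its
    \<open>2 * c\<close> rows are independent, which yields pivots \<open>j\<close> and
    \<open>x - 2 * c\<close> free coordinates \<open>q\<close>.\<close>
  define N where "N q l = (if q < c then M u0 q l else M u1 (q - c) l)" for q l
  have mvN: "mv x N w q = (if q < c then mv x (M u0) w q else mv x (M u1) w (q - c))" for w q
    by (simp add: mv_def N_def)
  have "trivial_kernel x (2 * c) (\<lambda>l q. N q l)"
  proof (rule trivial_kernelI)
    fix f q assume f: "\<And>l. l < x \<Longrightarrow> (\<Sum>q<2 * c. N q l * f q) = 0" and q: "q < 2 * c"
    have split: "(\<Sum>j<a + b. g j) = (\<Sum>j<a. g j) + (\<Sum>j<b. g (a + j))" for a b and g :: "nat \<Rightarrow> 'k"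
      by (induction b) (simp_all add: add.assoc)
    have rel: "(\<Sum>k<c. f k * M u0 k l + f (c + k) * M u1 k l) = 0" if "l < x" for l
      using f[OF that] unfolding mult_2 split by (simp add: N_def sum.distrib mult.commute)
    have line: "f k = 0 \<and> f (c + k) = 0" if "k < c" for k
      by (rule M_line[OF u, of f "\<lambda>k. f (c + k)", OF rel that])
    show "f q = 0"
    proof (cases "q < c")
      case False
      thus ?thesis using line[of "q - c"] q by simp
    qed (use line in simp)
  qed
  then obtain j where j: "inj_on j {..<2 * c}" "\<forall>i<2 * c. j i < x" "trivial_kernel (2 * c) (2 * c) (\<lambda>k i. N k (j i))"
    using pivot_columns by blast
  define a where "a = x - 2 * c"
  obtain q where q: "bij_betw q {..<a} ({..<x} - j ` {..<2 * c})"
    using complement_bij[OF j(1,2)] unfolding a_def by blast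
  have qx: "q i < x" "q i \<notin> j ` {..<2 * c}" if "i < a" for i using q that by (auto simp: bij_betw_def)
  \<comment> \<open>A vector is determined by its images under \<open>M u0\<close> and
    \<open>M u1\<close> together with its free coordinates.\<close>
  have uniq: "w l = 0" if w: "\<And>l. l \<ge> x \<Longrightarrow> w l = 0" "\<And>k. k < c \<Longrightarrow> mv x (M u0) w k = 0"
      "\<And>k. k < c \<Longrightarrow> mv x (M u1) w k = 0" "\<And>i. i < a \<Longrightarrow> w (q i) = 0" for w l
  proof (rule pivot_unique[OF j])
    show "mv x N w k = 0" if "k < 2 * c" for k using that w(2,3) by (auto simp: mvN)
    show "w l = 0" if l: "l \<notin> j ` {..<2 * c}" for l
    proof (cases "l < x")
      case True
      hence "l \<in> q ` {..<a}" using q l by (auto simp: bij_betw_def)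
      thus ?thesis using w(4) by auto
    qed (use w(1) in simp)
  qed
  have "\<forall>i\<in>{..<a}. \<exists>w. (\<forall>l\<ge>x. w l = 0) \<and> (\<forall>k<2 * c. mv x N w k = 0) \<and> (\<forall>i'<a. w (q i') = (if i' = i then 1 else 0))"
    using pivot_kernel_vectors[OF j q[unfolded a_def]] by (simp add: a_def)
  from bchoice[OF this] obtain n where n: "\<forall>i\<in>{..<a}. (\<forall>l\<ge>x. n i l = 0) \<and> (\<forall>k<2 * c. mv x N (n i) k = 0) \<and>
      (\<forall>i'<a. n i (q i') = (if i' = i then 1 else 0))" ..
  have n0: "n i l = 0" if "i < a" "l \<ge> x" for i l using n that by blast
  have nM: "mv x (M u0) (n i) k = 0" "mv x (M u1) (n i) k = 0" if "i < a" "k < c" for i k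
  proof -
    have "mv x N (n i) k = 0" "mv x N (n i) (c + k) = 0" using n that by simp_all
    thus "mv x (M u0) (n i) k = 0" "mv x (M u1) (n i) k = 0" using that by (simp_all add: mvN)
  qed
  have nq: "n i (q i') = (if i' = i then 1 else 0)" if "i < a" "i' < a" for i i' using n that by blast
  have lift: "\<exists>w. (\<forall>k<2 * c. mv x N w k = (if k = q then 1 else 0)) \<and> (\<forall>l. l \<notin> j ` {..<2 * c} \<longrightarrow> w l = 0)" for q
    by (rule pivot_solve[OF j])
  \<comment> \<open>For \<open>k < c\<close>, \<open>e k\<close> and \<open>e (c + k)\<close> are
    the two lifts of the comment above. Supported on the pivots, they vanish at the free
    coordinates.\<close>
  define e where "e q = (SOME w. (\<forall>k<2 * c. mv x N w k = (if k = q then 1 else 0)) \<and> (\<forall>l. l \<notin> j ` {..<2 * c} \<longrightarrow> w l = 0))" for q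
  have e: "(\<forall>k<2 * c. mv x N (e q) k = (if k = q then 1 else 0)) \<and> (\<forall>l. l \<notin> j ` {..<2 * c} \<longrightarrow> e q l = 0)" for q
    unfolding e_def by (rule someI_ex[OF lift])
  have eM: "mv x (M u0) (e p) k = (if k = p then 1 else 0)" "mv x (M u1) (e p) k = (if c + k = p then 1 else 0)" if "k < c" for p k
  proof -
    have "mv x N (e p) k = (if k = p then 1 else 0)" "mv x N (e p) (c + k) = (if c + k = p then 1 else 0)"
      using e[of p] that by simp_all
    thus "mv x (M u0) (e p) k = (if k = p then 1 else 0)" "mv x (M u1) (e p) k = (if c + k = p then 1 else 0)"
      using that by (simp_all add: mvN)
  qed
  have e0: "e p l = 0" if "l \<ge> x" for p l
  proof -
    have "l \<notin> j ` {..<2 * c}" using j(2) that by force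
    thus ?thesis using e by blast
  qed
  have eq: "e p (q i) = 0" if "i < a" for p i using e qx(2)[OF that] by blast
  \<comment> \<open>\<open>M u0\<close> sends this to t times, and \<open>M u1\<close> to - s times,
    basis vector \<open>k\<close>. So at v = s u0 + t u1 the contributions s t and - t s cancel, and
    \<open>P v k\<close> lies in the kernel.\<close>
  define P where "P v k = (\<lambda>l. t v * e k l - s v * e (c + k) l)" for v k
  have P0: "P v k l = 0" if "l \<ge> x" for v k l using e0[OF that] by (simp add: P_def)
  have Pq: "P v k (q i) = 0" if "i < a" for v k i using eq[OF that] by (simp add: P_def)
  have PM: "mv x (M u0) (P v k) k' = (if k' = k then t v else 0)" "mv x (M u1) (P v k) k' = (if k' = k then - s v else 0)"
    if "k < c" "k' < c" for v k k'
    using eM[OF that(2), of k] eM[OF that(2), of "c + k"] that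
    by (auto simp: P_def mv_diff mv_scale)
  have P_scale: "P (b *s v) k l = b * P v k l" for b v k l by (simp add: P_def s_scale t_scale algebra_simps)
  define as where "as = replicate a (0::int) @ replicate c (- 1)"
  have len: "length as = a + c" by (simp add: as_def)
  have as: "as ! i = (if i < a then 0 else - 1)" if "i < a + c" for i using that by (simp add: as_def nth_append)
  define col where "col v i = (if i < a then n i else P v (i - a))" for v i
  have col0: "col v i l = 0" if "i < a + c" "l \<ge> x" for v i l using that n0 P0 by (simp add: col_def)
  have colM: "mv x (M v) (col v i) k = 0" if "i < a + c" "k < c" "v \<in> cone L" for v i k
  proof -
    have "mv x (M v) (col v i) k = s v * mv x (M u0) (col v i) k + t v * mv x (M u1) (col v i) k"
      by (subst st'(1)[OF that(3)]) (rule mv_M_comb[OF that(2)])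
    also have "\<dots> = 0"
    proof (cases "i < a")
      case True
      thus ?thesis using nM that(2) by (simp add: col_def)
    next
      case False
      hence "i - a < c" using that(1) by simp
      thus ?thesis using False PM[of "i - a" k v] that(2) by (simp add: col_def)
    qed
    finally show ?thesis .
  qed
  have colq: "(\<Sum>i<a + c. g i * col v i (q i')) = g i'" if "i' < a" for g v i'
  proof -
    have "(\<Sum>i<a + c. g i * col v i (q i')) = (\<Sum>i<a + c. if i = i' then g i' else 0)"
      by (rule sum.cong) (use that nq Pq in \<open>auto simp: col_def\<close>)
    thus ?thesis using that by simp
  qed
  have colu0: "(\<Sum>i<a + c. g i * mv x (M u0) (col v i) k) = t v * g (a + k)"
    and colu1: "(\<Sum>i<a + c. g i * mv x (M u1) (col v i) k) = - s v * g (a + k)" if "k < c" for g v k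
  proof -
    have "(\<Sum>i<a + c. g i * mv x (M u0) (col v i) k) = (\<Sum>i<a + c. if i = a + k then t v * g (a + k) else 0)"
      by (rule sum.cong) (use that nM PM(1)[of _ k v] in \<open>auto simp: col_def\<close>)
    thus "(\<Sum>i<a + c. g i * mv x (M u0) (col v i) k) = t v * g (a + k)" using that by simp
    have "(\<Sum>i<a + c. g i * mv x (M u1) (col v i) k) = (\<Sum>i<a + c. if i = a + k then - s v * g (a + k) else 0)"
      by (rule sum.cong) (use that nM PM(2)[of _ k v] in \<open>auto simp: col_def\<close>)
    thus "(\<Sum>i<a + c. g i * mv x (M u1) (col v i) k) = - s v * g (a + k)" using that by simp
  qed
  have col_scale: "b powi (as ! i) * col (b *s v) i l = col v i l" if "b \<noteq> 0" "i < a + c" for b v i l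
    using that by (simp add: as col_def P_scale)
  define rep where "rep p = (SOME v. v \<in> p - {0 :: 'k ^ 'n})" for p
  have rep: "rep p \<noteq> 0 \<and> vec.span {rep p} = p" if p: "p \<in> proj_space" for p
  proof -
    obtain v where "v \<noteq> 0" "p = vec.span {v}" using p by (rule proj_space_obtain)
    hence "v \<in> p - {0}" using self_in_span by auto
    hence "rep p \<in> p - {0}" unfolding rep_def by (rule someI)
    thus ?thesis using span_eqI[OF p] by auto
  qed
  \<comment> \<open>The degree -1 of the coefficients cancels against the degree 1 of the columns
    \<open>P v k\<close>, so the sum does not depend on the representative.\<close>
  define \<rho> where "\<rho> p f = (\<lambda>l. \<Sum>i<a + c. f (i, rep p) * col (rep p) i l)" for p and f :: "nat \<times> ('k ^ 'n) \<Rightarrow> 'k"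
  have \<rho>_eq: "\<rho> p f = (\<lambda>l. \<Sum>i<a + c. f (i, v) * col v i l)"
    if p: "p \<in> L" and f: "f \<in> fibre (twist_sum L as) p" and v: "v \<in> p - {0}" for p f v
  proof -
    have pp: "p \<in> proj_space" using p LP by blast
    have "v \<in> vec.span {rep p} - {0}" using rep[OF pp] v by simp
    then obtain b where b: "b \<noteq> 0" "rep p \<noteq> 0" "v = b *s rep p" by (rule nonzero_in_span_singletonE)
    have rp: "rep p \<in> p - {0}" using rep[OF pp] self_in_span[of "rep p"] by auto
    have "f (i, v) * col v i l = f (i, rep p) * col (rep p) i l" if "i < a + c" for i l
    proof -
      have "(\<lambda>v. f (i, v)) \<in> fibre (twist (as ! i)) p" using f that len by (simp add: fibre_twist_sum)
      hence "f (i, v) = b powi (as ! i) * f (i, rep p)" using rp b by (simp add: fibre_twist)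
      thus ?thesis using col_scale[OF b(1) that, of "rep p" l] b(3) by (simp add: mult_ac)
    qed
    thus ?thesis by (auto simp: \<rho>_def fun_eq_iff intro!: sum.cong)
  qed
  have rep_cone: "rep p \<in> cone L" "rep p \<in> p - {0}" if "p \<in> L" for p
    using rep[of p] that LP self_in_span[of "rep p"] by (auto simp: cone_def)
  have mv_\<rho>: "mv x N' (\<lambda>l. \<Sum>i<a + c. g i * col v i l) k = (\<Sum>i<a + c. g i * mv x N' (col v i) k)" for N' g v k
    by (rule mv_sum)
  have \<rho>_K: "\<rho> p f \<in> K p" if p: "p \<in> L" for p f
  proof -
    have "\<rho> p f \<in> K (vec.span {rep p})" unfolding K_span \<rho>_def
    proof (intro conjI allI impI)
      show "(\<Sum>i<a + c. f (i, rep p) * col (rep p) i l) = 0" if "l \<ge> x" for l using col0 that by simp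
      show "mv x (M (rep p)) (\<lambda>l. \<Sum>i<a + c. f (i, rep p) * col (rep p) i l) k = 0" if "k < c" for k
        unfolding mv_\<rho> using colM that rep_cone(1)[OF p] by simp
    qed
    thus ?thesis using rep[of p] p LP by auto
  qed
  \<comment> \<open>For \<open>w\<close> in the kernel at \<open>v\<close>, s M(u0) w + t M(u1) w =
    0, so the pair of entries \<open>k\<close> of M(u0) w and M(u1) w is a multiple of (t, - s). The
    factor, the coefficient of \<open>P v k\<close>, is found from whichever of \<open>t v\<close>
    and \<open>s v\<close> is nonzero.\<close>
  define \<eta> where "\<eta> v w k = (if t v \<noteq> 0 then mv x (M u0) w k / t v else - mv x (M u1) w k / s v)" for v w k
  have \<eta>: "mv x (M u0) w k = t v * \<eta> v w k" "mv x (M u1) w k = - s v * \<eta> v w k"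
    if "v \<in> cone L" "w \<in> K (vec.span {v})" "k < c" for v w k
  proof -
    have "mv x (M v) w k = 0" using that by (simp add: K_span)
    hence "mv x (M (s v *s u0 + t v *s u1)) w k = 0" using st'(1)[OF that(1)] by simp
    hence 0: "s v * mv x (M u0) w k + t v * mv x (M u1) w k = 0" by (simp add: mv_M_comb[OF that(3)])
    show "mv x (M u0) w k = t v * \<eta> v w k" "mv x (M u1) w k = - s v * \<eta> v w k"
    proof (atomize (full), cases "t v = 0")
      case True
      hence "s v \<noteq> 0" using st'(2)[OF that(1)] by simp
      thus "mv x (M u0) w k = t v * \<eta> v w k \<and> mv x (M u1) w k = - s v * \<eta> v w k"
        using 0 True by (simp add: \<eta>_def)
    next
      case False
      have "mv x (M u1) w k * t v = - s v * mv x (M u0) w k" using 0 by (simp add: eq_neg_iff_add_eq_0 algebra_simps)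
      thus "mv x (M u0) w k = t v * \<eta> v w k \<and> mv x (M u1) w k = - s v * \<eta> v w k"
        using False by (simp add: \<eta>_def field_simps)
    qed
  qed
  \<comment> \<open>The inverse of \<open>\<rho>\<close>: the columns \<open>P\<close> vanish at the
    free coordinates, so these give the coefficients of the constant sections, and
    \<open>\<eta>\<close> gives the remaining ones.\<close>
  define \<theta> where "\<theta> p w = (\<lambda>(i, v). if i < a + c \<and> v \<in> p - {0} then (if i < a then w (q i) else \<eta> v w (i - a)) else 0)"
    for p :: "('k ^ 'n) set" and w
  have \<eta>_scale: "\<eta> (b *s v) w k = (1 / b) * \<eta> v w k" if "b \<noteq> 0" for b v w k
    using that by (simp add: \<eta>_def s_scale t_scale)
  have \<theta>_fibre: "\<theta> p w \<in> fibre (twist_sum L as) p" if p: "p \<in> L" for p w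
  proof -
    have pp: "p \<in> proj_space" using p LP by blast
    show ?thesis unfolding fibre_twist_sum fibre_twist
    proof (intro CollectI conjI allI impI ballI)
      fix i v b assume "i < length as" "v \<in> p - {0}" "b \<noteq> (0::'k)"
      thus "\<theta> p w (i, b *s v) = b powi (as ! i) * \<theta> p w (i, v)"
        using scale_in_point[OF pp, of v b] by (simp add: \<theta>_def len as \<eta>_scale inverse_eq_divide)
    qed (auto simp: \<theta>_def len)
  qed
  have \<theta>_at: "\<theta> (vec.span {v}) w (i, v) = (if i < a then w (q i) else \<eta> v w (i - a))" if "v \<noteq> 0" "i < a + c" for v w i
    using that self_in_span[of v] by (simp add: \<theta>_def)
  have \<rho>\<theta>: "\<rho> p (\<theta> p w) = w" if p: "p \<in> L" and w: "w \<in> K p" for p w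
  proof -
    define v where "v = rep p"
    have v: "v \<in> cone L" "p = vec.span {v}" "v \<noteq> 0" "v \<in> p - {0}"
      using rep[of p] p LP rep_cone[OF p] by (auto simp: v_def)
    define g where "g i = \<theta> p w (i, v)" for i
    define d where "d l = w l - (\<Sum>i<a + c. g i * col v i l)" for l
    have "d l = 0" for l
    proof (rule uniq)
      show "d l = 0" if "l \<ge> x" for l using that w col0 by (simp add: d_def K_def)
      show "d (q i) = 0" if "i < a" for i
        unfolding d_def colq[OF that] using that v by (simp add: g_def v(2) \<theta>_at)
      have gk: "g (a + k) = \<eta> v w k" if "k < c" for k using that v by (simp add: g_def v(2) \<theta>_at)
      show "mv x (M u0) d k = 0" if "k < c" for k
        unfolding d_def mv_diff mv_\<rho> colu0[OF that] gk[OF that]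
        using \<eta>(1)[OF v(1) w[unfolded v(2)] that] by simp
      show "mv x (M u1) d k = 0" if "k < c" for k
        unfolding d_def mv_diff mv_\<rho> colu1[OF that] gk[OF that]
        using \<eta>(2)[OF v(1) w[unfolded v(2)] that] by simp
    qed
    thus ?thesis by (simp add: \<rho>_def d_def g_def v_def[symmetric] fun_eq_iff)
  qed
  have \<theta>\<rho>: "\<theta> p (\<rho> p f) = f" if p: "p \<in> L" and f: "f \<in> fibre (twist_sum L as) p" for p f
  proof (rule ext, clarify)
    fix i v
    show "\<theta> p (\<rho> p f) (i, v) = f (i, v)"
    proof (cases "i < a + c \<and> v \<in> p - {0}")
      case True
      hence v: "v \<noteq> 0" "p = vec.span {v}" "v \<in> cone L"
        using span_eqI[of p v] p LP by (auto simp: cone_def)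
      have \<rho>v: "\<rho> p f = (\<lambda>l. \<Sum>i<a + c. f (i, v) * col v i l)" using \<rho>_eq[OF p f] True by blast
      show ?thesis
      proof (cases "i < a")
        case i: True
        have "\<rho> p f (q i) = f (i, v)" unfolding \<rho>v by (rule colq[OF i])
        thus ?thesis using v True i by (simp add: \<theta>_def)
      next
        case False
        define k where "k = i - a"
        have k: "k < c" "i = a + k" using False True by (auto simp: k_def)
        have "mv x (M u0) (\<rho> p f) k = t v * f (i, v)" "mv x (M u1) (\<rho> p f) k = - s v * f (i, v)"
          unfolding \<rho>v mv_\<rho> colu0[OF k(1)] colu1[OF k(1)] k(2) by simp_all
        hence "\<eta> v (\<rho> p f) k = f (i, v)" using st'(2)[OF v(3)] by (auto simp: \<eta>_def)
        thus ?thesis using True False by (simp add: \<theta>_def k_def)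
      qed
    next
      case False
      thus ?thesis using fibre_twist_sum_outside[OF f, of i v] by (auto simp: \<theta>_def len)
    qed
  qed
  have baseL: "base (restrict_bundle E L) = L" and fibL: "fibre (restrict_bundle E L) p = K p" for p
    using LP by (auto simp: restrict_bundle_def base_E fibre_E)
  have mv_rat: "rat_at X v 0 (\<lambda>u. mv x N' (h u) k)" if "v \<noteq> 0" "\<And>l. l < x \<Longrightarrow> rat_at X v 0 (\<lambda>u. h u l)" for X v N' h k
    unfolding mv_def by (intro rat_at_sum rat_at_scale that) auto
  have \<theta>_hom: "bundle_hom (restrict_bundle E L) (twist_sum L as) \<theta>"
  proof (rule bundle_homI)
    show "base (restrict_bundle E L) = base (twist_sum L as)" by (simp add: baseL base_twist_sum)
    fix p w assume "p \<in> base (restrict_bundle E L)"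
    hence p: "p \<in> L" by (simp add: baseL)
    show "\<theta> p w \<in> fibre (twist_sum L as) p" by (rule \<theta>_fibre[OF p])
    have \<eta>_scale': "\<eta> v (fscale b w) k = b * \<eta> v w k" for b v k
      by (simp add: \<eta>_def fscale_def mv_scale)
    show "\<theta> p (fscale b w) = fscale b (\<theta> p w)" for b
      by (auto simp: \<theta>_def fun_eq_iff fscale_apply \<eta>_scale')
    fix w'
    have \<eta>_add: "\<eta> v (w + w') k = \<eta> v w k + \<eta> v w' k" for v k
      by (simp add: \<eta>_def plus_fun_def mv_add add_divide_distrib diff_divide_distrib)
    show "\<theta> p (w + w') = \<theta> p w + \<theta> p w'"
      by (auto simp: \<theta>_def fun_eq_iff \<eta>_add)
  next
    fix V fs \<sigma> assume "(V, fs) \<in> frames (restrict_bundle E L)" and \<sigma>: "\<sigma> \<in> set fs"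
    then obtain U where fr: "(U, fs) \<in> frames E" and V: "V = U \<inter> L" by (auto simp: restrict_bundle_def)
    note UP = E_frame_open[OF fr]
    note reg = vector_bundleD(6)[OF E_bundle fr \<sigma>]
    have VL: "V \<subseteq> L" by (auto simp: V)
    have mem: "\<sigma> p \<in> K p" if "p \<in> V" for p using regular_sectionD(1)[OF reg, of p] that by (simp add: V fibre_E)
    have rat: "rat_at (cone V) v 0 (\<lambda>v. \<sigma> (vec.span {v}) l)" if "l < x" "v \<in> cone V" for l v
    proof -
      have "rational (cone V) 0 (\<lambda>v. \<sigma> (vec.span {v}) l)"
        by (rule rational_mono[OF E_sectionD[OF reg UP that(1)]]) (auto simp: V cone_def)
      thus ?thesis using that(2) by (simp add: rational_def)
    qed
    show "regular_section (twist_sum L as) V (\<lambda>p. \<theta> p (\<sigma> p))"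
      unfolding regular_section_twist_sum[OF LP VL]
    proof (intro conjI ballI allI impI)
      show "\<theta> p (\<sigma> p) \<in> fibre (twist_sum L as) p" if "p \<in> V" for p using \<theta>_fibre that VL by blast
      fix i assume "i < length as"
      hence i: "i < a + c" by (simp add: len)
      show "rational (cone V) (as ! i) (\<lambda>v. \<theta> (vec.span {v}) (\<sigma> (vec.span {v})) (i, v))"
        unfolding rational_def
      proof
        fix v assume v: "v \<in> cone V"
        hence v0: "v \<noteq> 0" "v \<in> cone L" using VL by (auto simp: cone_def)
        show "rat_at (cone V) v (as ! i) (\<lambda>v. \<theta> (vec.span {v}) (\<sigma> (vec.span {v})) (i, v))"
        proof (cases "i < a")
          case True
          show ?thesis
            using rat_at_cong[OF rat[OF qx(1)[OF True] v], of "\<lambda>v. \<theta> (vec.span {v}) (\<sigma> (vec.span {v})) (i, v)"] i True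
            by (simp add: as \<theta>_at cone_def)
        next
          case False
          define k where "k = i - a"
          have k: "k < c" using False i by (simp add: k_def)
          have mvr: "rat_at (cone V) v 0 (\<lambda>v. mv x N' (\<sigma> (vec.span {v})) k)" for N'
            by (rule mv_rat[OF v0(1)]) (rule rat[OF _ v])
          have "rat_at (cone V) v (- 1) (\<lambda>v. \<eta> v (\<sigma> (vec.span {v})) k)"
          proof (cases "t v = 0")
            case t0: False
            have tr: "rat_at X v 1 t" for X using rat_at_homogeneous[OF t] by simp
            show ?thesis
            proof (rule rat_at_open[OF t t0])
              have 1: "rat_at (cone V \<inter> {u. t u \<noteq> 0}) v (0 - 1) (\<lambda>v. mv x (M u0) (\<sigma> (vec.span {v})) k / t v)"
                by (intro rat_at_divide rat_at_mono[OF mvr] tr) (use v t0 in auto)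
              show "rat_at (cone V \<inter> {u. t u \<noteq> 0}) v (- 1) (\<lambda>v. \<eta> v (\<sigma> (vec.span {v})) k)"
                by (rule rat_at_cong[OF 1[simplified]]) (simp add: \<eta>_def)
            qed
          next
            \<comment> \<open>Where \<open>t v = 0\<close> the quotient by \<open>s\<close> is used;
              it agrees with \<open>\<eta>\<close> on all of \<open>s \<noteq> 0\<close>, including
              the points where \<open>\<eta>\<close> is defined by the other quotient.\<close>
            case True
            hence s0: "s v \<noteq> 0" using st'(2)[OF v0(2)] by simp
            have sr: "rat_at X v 1 s" for X using rat_at_homogeneous[OF s] by simp
            show ?thesis
            proof (rule rat_at_open[OF s s0])
              have 1: "rat_at (cone V \<inter> {u. s u \<noteq> 0}) v (0 - 1) (\<lambda>v. (- 1) * mv x (M u1) (\<sigma> (vec.span {v})) k / s v)"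
                by (intro rat_at_divide rat_at_scale rat_at_mono[OF mvr] sr) (use v s0 in auto)
              show "rat_at (cone V \<inter> {u. s u \<noteq> 0}) v (- 1) (\<lambda>v. \<eta> v (\<sigma> (vec.span {v})) k)"
              proof (rule rat_at_cong[OF 1[simplified]])
                fix u' assume u': "u' \<in> cone V \<inter> {u. s u \<noteq> 0}"
                hence "u' \<in> cone L" "\<sigma> (vec.span {u'}) \<in> K (vec.span {u'})" using VL mem by (auto simp: cone_def)
                from \<eta>(2)[OF this k] u' show "- (mv x (M u1) (\<sigma> (vec.span {u'})) k / s u') = \<eta> u' (\<sigma> (vec.span {u'})) k"
                  by simp
              qed
            qed
          qed
          hence "rat_at (cone V) v (as ! i) (\<lambda>v. \<eta> v (\<sigma> (vec.span {v})) k)" using i False by (simp add: as)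
          thus ?thesis by (rule rat_at_cong) (use i False in \<open>simp add: \<theta>_at cone_def k_def\<close>)
        qed
      qed
    qed
  qed
  have \<rho>_hom: "bundle_hom (twist_sum L as) (restrict_bundle E L) \<rho>"
  proof (rule bundle_homI)
    show "base (twist_sum L as) = base (restrict_bundle E L)" by (simp add: baseL base_twist_sum)
    fix p f assume "p \<in> base (twist_sum L as)"
    hence p: "p \<in> L" by (simp add: base_twist_sum)
    show "\<rho> p f \<in> fibre (restrict_bundle E L) p" using \<rho>_K[OF p] by (simp add: fibL)
    show "\<rho> p (fscale b f) = fscale b (\<rho> p f)" for b
      by (auto simp: \<rho>_def fun_eq_iff fscale_apply sum_distrib_left mult.assoc)
    show "\<rho> p (f + g) = \<rho> p f + \<rho> p g" for g
      by (auto simp: \<rho>_def fun_eq_iff sum.distrib distrib_right)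
  next
    fix V fs \<sigma> assume "(V, fs) \<in> frames (twist_sum L as)" and \<sigma>: "\<sigma> \<in> set fs"
    then obtain d where V: "V = L \<inter> (\<Inter>j<length as. basic_open (\<lambda>v. v $ d j) \<inter> L)" and fs: "fs = twist_frame as d"
      unfolding frames_twist_sum by (elim rangeE) simp
    obtain i where i: "i < a + c" "\<sigma> = (\<lambda>p. slot i (coord_power (as ! i) (d i) p))"
      using \<sigma> by (auto simp: fs twist_frame_def len)
    have VL: "V \<subseteq> L" by (auto simp: V)
    have "i < length as" using i(1) len by simp
    hence Vi: "p \<in> basic_open (\<lambda>v. v $ d i)" if "p \<in> V" for p using that unfolding V by blast
    have \<sigma>_fibre: "\<sigma> p \<in> fibre (twist_sum L as) p" if "p \<in> V" for p
      unfolding i(2) by (rule slot_fibre) (use i len coord_power_fibre[OF Vi[OF that]] in auto)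
    have "regular_section E V (\<lambda>p. \<rho> p (\<sigma> p))"
    proof (rule E_sectionI)
      show "V \<subseteq> proj_space" using VL LP by blast
      show "\<rho> p (\<sigma> p) \<in> K p" if "p \<in> V" for p using \<rho>_K that VL by blast
      fix l
      show "rational (cone V) 0 (\<lambda>v. \<rho> (vec.span {v}) (\<sigma> (vec.span {v})) l)" unfolding rational_def
      proof
        fix v assume v: "v \<in> cone V"
        hence vi: "v $ d i \<noteq> 0" using Vi[of "vec.span {v}"] by (simp add: cone_def coord_open)
        have "rat_at (cone V) v (- (as ! i)) (\<lambda>v. col v i l)"
        proof (cases "i < a")
          case True
          thus ?thesis using i by (simp add: as col_def rat_at_const)
        next
          case False
          have "homogeneous 1 (\<lambda>v. e (i - a) l * t v + (- e (c + (i - a)) l) * s v)"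
            by (intro homogeneous_add homogeneous_scale s t)
          from rat_at_homogeneous[OF this] show ?thesis
            using i False by (simp add: as col_def P_def mult.commute)
        qed
        from rat_at_mult[OF rat_at_power_int[OF v vi, of "as ! i"] this]
        have "rat_at (cone V) v 0 (\<lambda>v. (v $ d i) powi (as ! i) * col v i l)" by simp
        thus "rat_at (cone V) v 0 (\<lambda>v. \<rho> (vec.span {v}) (\<sigma> (vec.span {v})) l)"
        proof (rule rat_at_cong)
          fix u' assume "u' \<in> cone V"
          hence u': "vec.span {u'} \<in> V" "u' \<in> vec.span {u'} - {0}" using self_in_span by (auto simp: cone_def)
          have "vec.span {u'} \<in> L" using u'(1) VL by (rule subsetD[rotated])
          from \<rho>_eq[OF this \<sigma>_fibre[OF u'(1)] u'(2)]
          have "\<rho> (vec.span {u'}) (\<sigma> (vec.span {u'})) l = (\<Sum>i'<a + c. \<sigma> (vec.span {u'}) (i', u') * col u' i' l)"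
            by (rule fun_cong)
          also have "\<dots> = (\<Sum>i'<a + c. if i' = i then (u' $ d i) powi (as ! i) * col u' i l else 0)"
            by (rule sum.cong) (use u' in \<open>auto simp: i(2) slot_apply coord_power_def\<close>)
          finally show "(u' $ d i) powi (as ! i) * col u' i l = \<rho> (vec.span {u'}) (\<sigma> (vec.span {u'})) l"
            using i(1) by simp
        qed
      qed
    qed
    thus "regular_section (restrict_bundle E L) V (\<lambda>p. \<rho> p (\<sigma> p))" by (simp add: regular_section_restrict[OF VL])
  qed
  have "bundle_iso (restrict_bundle E L) (twist_sum L as)" unfolding bundle_iso_def
    by (intro exI[of _ \<theta>] exI[of _ \<rho>]) (use \<theta>_hom \<rho>_hom \<rho>\<theta> \<theta>\<rho> in \<open>auto simp: baseL fibL\<close>)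
  thus ?thesis unfolding splits_on_iff as_def a_def .
qed

lemma E_type:
  assumes "c \<ge> 1"
  shows "type_uniform_steiner 1 E"
  unfolding type_uniform_steiner_def
proof (intro conjI)
  show "steiner_bundle E" unfolding steiner_bundle_def using E_bundle E_steiner by blast
  show "uniform E" unfolding uniform_def using E_bundle E_splits base_E by blast
  show "\<exists>a. 0 < a 1 \<and> (\<forall>L\<in>proj_lines. splits_on E L (concat (map (\<lambda>i. replicate (a i) (- int i)) [0..<Suc 1])))"
    unfolding type_one_list
    by (rule exI[of _ "\<lambda>i. if i = 0 then x - 2 * c else c"]) (use assms E_splits in auto)
qed simp

text \<open>The section 1 of a summand O becomes a section of \<open>E\<close> with coordinates of
  degree 0, which are constant on each line and so everywhere. The resulting vector lies in all
  kernels and is 0 by \<open>M_const\<close>, although \<open>\<alpha>\<close> maps it back to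
  1.\<close>

lemma E_no_trivial_summand: "\<not> has_trivial_summand E"
proof
  assume "has_trivial_summand E"
  then obtain F :: "('k, 'n, nat) vbundle" and r' where F: "vector_bundle r' F" "base F = proj_space"
    and iso: "bundle_iso E (direct_sum (twist 0) F)" by (auto simp: has_trivial_summand_def)
  define D where "D = direct_sum (twist 0 :: ('k, 'n, 'k ^ 'n) vbundle) F"
  obtain \<alpha> \<beta> where \<alpha>: "bundle_hom E D \<alpha>" and \<beta>: "bundle_hom D E \<beta>"
    and inv: "\<And>p y. p \<in> proj_space \<Longrightarrow> y \<in> fibre D p \<Longrightarrow> \<alpha> p (\<beta> p y) = y"
    using iso unfolding bundle_iso_def D_def base_E by blast
  have baseD: "base D = proj_space" by (simp add: D_def direct_sum_def F(2) twist_def)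
  \<comment> \<open>The section 1 of O. It equals the zeroth power of every coordinate, so it occurs
    in each frame.\<close>
  define one where "one p = case_sum (\<lambda>v :: 'k ^ 'n. if v \<in> p - {0} then 1 else (0::'k)) (\<lambda>_ :: nat. 0)" for p
  define h where "h p = \<beta> p (one p)" for p
  have one_coord: "one p = case_sum (coord_power 0 i p) (\<lambda>_. 0)" for p i
    by (auto simp: one_def coord_power_def fun_eq_iff split: sum.split)
  have one_fibre: "one p \<in> fibre D p" if p: "p \<in> proj_space" for p
  proof -
    obtain v where v: "v \<noteq> 0" "p = vec.span {v}" using p by (rule proj_space_obtain)
    obtain i where i: "v $ i \<noteq> 0" using nonzero_coord[OF v(1)] by blast
    have "coord_power 0 i p \<in> fibre (twist 0) p" by (rule coord_power_fibre) (simp add: v(2) coord_open i)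
    moreover have "(\<lambda>_. 0) \<in> fibre F p"
      using fvec.subspace_0[OF fibre_subspace[OF F(1)], of p] p F(2) by (simp add: zero_fun_def)
    ultimately show ?thesis by (simp add: D_def direct_sum_def one_coord[of p i] case_sum_o_inj)
  qed
  have h_K: "h p \<in> K p" if "p \<in> proj_space" for p
    unfolding h_def using bundle_homD(2)[OF \<beta> _ one_fibre[OF that]] that by (simp add: baseD fibre_E)
  have rat: "rational {v. v \<noteq> 0} 0 (\<lambda>v. h (vec.span {v}) l)" if l: "l < x" for l
    unfolding rational_def
  proof
    fix v :: "'k ^ 'n" assume "v \<in> {v. v \<noteq> 0}"
    hence v: "v \<noteq> 0" by simp
    obtain i where i: "v $ i \<noteq> 0" using nonzero_coord[OF v] by blast
    obtain V gs where V: "(V, gs) \<in> frames F" "vec.span {v} \<in> V"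
      using vector_bundleD(5)[OF F(1)] span_in_proj_space[OF v] F(2) by metis
    have opV: "zariski_open_in proj_space V" using vector_bundleD(2)[OF F(1) V(1)] by (simp add: F(2))
    have VP: "V \<subseteq> proj_space" using zariski_open_in_subset[OF opV] .
    define U where "U = basic_open (\<lambda>v :: 'k ^ 'n. v $ i) \<inter> V"
    have fr: "(U, map (\<lambda>s p. case_sum (s p) (\<lambda>_. 0)) [coord_power 0 i] @ map (\<lambda>s p. case_sum (\<lambda>_. 0) (s p)) gs) \<in> frames D"
      unfolding D_def U_def by (rule frames_direct_sumI[OF coord_frame V(1)])
    have "regular_section E U (\<lambda>p. \<beta> p ((\<lambda>p. case_sum (coord_power 0 i p) (\<lambda>_. 0)) p))"
      by (rule bundle_homD(5)[OF \<beta> fr]) simp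
    hence "regular_section E U h" by (simp add: h_def[abs_def] one_coord[of _ i])
    hence "rational (cone U) 0 (\<lambda>v. h (vec.span {v}) l)" by (rule E_sectionD) (use VP U_def l in auto)
    hence "rat_at (cone U) v 0 (\<lambda>v. h (vec.span {v}) l)"
      using v V(2) i by (simp add: rational_def cone_def U_def coord_open)
    hence "rat_at (cone V \<inter> {u. u $ i \<noteq> 0}) v 0 (\<lambda>v. h (vec.span {v}) l)"
      by (rule rat_at_mono) (auto simp: U_def cone_def coord_open)
    from rat_at_open[OF homogeneous_coord[of i] i this]
    have "rat_at (cone (V \<inter> proj_space)) v 0 (\<lambda>v. h (vec.span {v}) l)" using VP by (simp add: Int_absorb2)
    from rat_at_zariski_open[OF subset_refl opV subset_refl _ this] v V(2)
    have "rat_at (cone proj_space) v 0 (\<lambda>v. h (vec.span {v}) l)" by (simp add: cone_def)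
    thus "rat_at {v. v \<noteq> 0} v 0 (\<lambda>v. h (vec.span {v}) l)" by (simp add: cone_proj_space)
  qed
  have const: "h (vec.span {u}) = h (vec.span {v})" if uv: "u \<noteq> 0" "v \<noteq> 0" for u v :: "'k ^ 'n"
  proof (cases "indep2 u v")
    case True
    show ?thesis
    proof
      fix l
      show "h (vec.span {u}) l = h (vec.span {v}) l"
      proof (cases "l < x")
        case l: True
        show ?thesis
          by (rule rational_line(1)[of "{v. v \<noteq> 0}" 0]) (use rat[OF l] indep2_comb[OF True] in auto)
      next
        case False
        thus ?thesis using h_K[OF span_in_proj_space[OF uv(1)]] h_K[OF span_in_proj_space[OF uv(2)]] by (simp add: K_def)
      qed
    qed
  next
    case False
    then obtain a b where ab: "a *s u + b *s v = 0" "a \<noteq> 0 \<or> b \<noteq> 0" by (auto simp: indep2_def)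
    have b0: "b \<noteq> 0" using ab uv by auto
    have "(1 / b) *s (b *s v) = (1 / b) *s (- (a *s u))" using ab(1) by (simp add: add_eq_0_iff)
    hence v: "v = (- a / b) *s u" using b0 by (simp add: Finite_Cartesian_Product.vec_eq_iff)
    have "- a / b \<noteq> 0" using v uv(2) by auto
    thus ?thesis using span_scaled[OF _ uv(1), of "- a / b"] v by simp
  qed
  define v0 :: "'k ^ 'n" where "v0 = axis undefined 1"
  have v0: "v0 \<noteq> 0" by (simp add: v0_def axis_eq_0_iff)
  define w where "w = h (vec.span {v0})"
  have "mv x (M v) w k = 0" if "v \<noteq> 0" "k < c" for v k
    using h_K[OF span_in_proj_space[OF that(1)]] const[OF that(1) v0] that(2) by (simp add: w_def K_span)
  hence "w l = 0" if "l < x" for l using M_const that by blast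
  moreover have "w l = 0" if "l \<ge> x" for l
    using h_K[OF span_in_proj_space[OF v0]] that by (simp add: w_def K_def)
  ultimately have w0: "w = 0" by (auto simp: fun_eq_iff) (meson not_le)
  define p0 where "p0 = vec.span {v0}"
  have p0: "p0 \<in> proj_space" using span_in_proj_space[OF v0] by (simp add: p0_def)
  have "\<alpha> p0 (fscale 0 0) = fscale 0 (\<alpha> p0 0)"
    by (rule bundle_homD(4)[OF \<alpha>]) (use p0 fvec.subspace_0[OF K_subspace] in \<open>auto simp: base_E fibre_E\<close>)
  hence "\<alpha> p0 0 = 0" by simp
  moreover have "\<alpha> p0 (h p0) = one p0" unfolding h_def by (rule inv[OF p0 one_fibre[OF p0]])
  ultimately have "one p0 = 0" using w0 by (simp add: w_def p0_def)
  hence "one p0 (Inl v0) = 0" by simp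
  thus False using v0 self_in_span[of v0] by (simp add: one_def p0_def)
qed

end

section \<open>The first Chern class of a kernel bundle\<close>

context steiner_matrix
begin

definition entry :: "(nat \<Rightarrow> 'k) list \<Rightarrow> (nat \<Rightarrow> nat \<Rightarrow> 'k) \<Rightarrow> nat \<Rightarrow> nat \<Rightarrow> 'k" where
  "entry xs m q l = (if q < r then (xs ! q) l else m (q - r) l)"

text \<open>Vectors of a fibre of \<open>E\<close> above lifts of the basis of k^c: the determinant
  realises the isomorphism of det E tensor O(c) with det O^x. Lifts have degree -1 in the base
  vector, so the determinant has degree -c.\<close>

definition rows :: "(nat \<Rightarrow> 'k) list \<Rightarrow> (nat \<Rightarrow> nat \<Rightarrow> 'k) \<Rightarrow> 'k mat" where
  "rows xs m = Matrix.mat x x (\<lambda>(q, l). entry xs m q l)"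

lemma rows_carrier: "rows xs m \<in> carrier_mat x x"
  by (simp add: rows_def)

lemma det_rows: "Determinant.det (rows xs m) =
    (\<Sum>p\<in>{p. p permutes {0..<x}}. signof p * (\<Prod>q = 0..<x. entry xs m q (p q)))"
proof -
  have "Determinant.det (rows xs m) =
      (\<Sum>p\<in>{p. p permutes {0..<x}}. signof p * (\<Prod>q = 0..<x. rows xs m $$ (q, p q)))"
    by (rule det_def'[OF rows_carrier])
  also have "\<dots> = (\<Sum>p\<in>{p. p permutes {0..<x}}. signof p * (\<Prod>q = 0..<x. entry xs m q (p q)))"
  proof (intro sum.cong prod.cong arg_cong2[where f = "(*)"] refl)
    fix p q assume "p \<in> {p. p permutes {0..<x}}" "q \<in> {0..<x}"
    hence "q < x" "p q < x" using permutes_in_image[of p "{0..<x}" q] by auto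
    thus "rows xs m $$ (q, p q) = entry xs m q (p q)" by (simp add: rows_def)
  qed
  finally show ?thesis .
qed

text \<open>Isolates in the Leibniz sum the factor from row \<open>j\<close>, in which
  multilinearity is evident.\<close>

lemma det_rows_update:
  assumes "j < r" "length xs = r"
  shows "Determinant.det (rows (xs[j := y]) m) =
    (\<Sum>p\<in>{p. p permutes {0..<x}}. signof p * (y (p j) * (\<Prod>q\<in>{0..<x} - {j}. entry xs m q (p q))))"
  unfolding det_rows
proof (intro sum.cong arg_cong2[where f = "(*)"] refl)
  fix p
  have "(\<Prod>q = 0..<x. entry (xs[j := y]) m q (p q)) =
      entry (xs[j := y]) m j (p j) * (\<Prod>q\<in>{0..<x} - {j}. entry (xs[j := y]) m q (p q))"
    by (rule prod.remove) (use assms xr in auto)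
  also have "\<dots> = y (p j) * (\<Prod>q\<in>{0..<x} - {j}. entry xs m q (p q))"
    using assms by (intro arg_cong2[where f = "(*)"] prod.cong) (auto simp: entry_def)
  finally show "(\<Prod>q = 0..<x. entry (xs[j := y]) m q (p q)) = y (p j) * (\<Prod>q\<in>{0..<x} - {j}. entry xs m q (p q))" .
qed

lemma alternating_det:
  "alternating_on r V (\<lambda>xs. fscale (Determinant.det (rows xs m)) d)"
  unfolding alternating_on_def
proof (intro allI impI conjI ballI)
  fix xs j assume xs: "length xs = r \<and> set xs \<subseteq> V" and j: "j < r"
  have len: "length xs = r" using xs by simp
  note upd = det_rows_update[OF j len] det_rows_update[OF j len, of "xs ! j", unfolded list_update_id]
  show "fscale (Determinant.det (rows (xs[j := xs ! j + y]) m)) d =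
      fscale (Determinant.det (rows xs m)) d + fscale (Determinant.det (rows (xs[j := y]) m)) d" for y
  proof -
    have "Determinant.det (rows (xs[j := xs ! j + y]) m) =
        Determinant.det (rows xs m) + Determinant.det (rows (xs[j := y]) m)"
      unfolding upd by (simp add: algebra_simps sum.distrib)
    thus ?thesis by (simp add: fun_eq_iff fscale_apply distrib_right)
  qed
  show "fscale (Determinant.det (rows (xs[j := fscale a (xs ! j)]) m)) d =
      fscale a (fscale (Determinant.det (rows xs m)) d)" for a
  proof -
    have "Determinant.det (rows (xs[j := fscale a (xs ! j)]) m) = a * Determinant.det (rows xs m)"
      unfolding upd by (simp add: fscale_apply sum_distrib_left mult_ac)
    thus ?thesis by (simp add: fun_eq_iff fscale_apply)
  qed
next
  fix xs i j assume xs: "length xs = r \<and> set xs \<subseteq> V" and ij: "i < j \<and> j < r \<and> xs ! i = xs ! j"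
  have "Determinant.det (rows xs m) = 0"
  proof (rule det_identical_rows[OF rows_carrier, of i j])
    show "i \<noteq> j" "i < x" "j < x" using ij xr by auto
    thus "row (rows xs m) i = row (rows xs m) j"
      using ij by (intro eq_vecI) (auto simp: rows_def entry_def)
  qed
  thus "fscale (Determinant.det (rows xs m)) d = 0" by simp
qed

definition lifts :: "'k ^ 'n \<Rightarrow> (nat \<Rightarrow> nat \<Rightarrow> 'k) \<Rightarrow> bool" where
  "lifts v m \<longleftrightarrow> (\<forall>k<c. \<forall>k'<c. mv x (M v) (m k) k' = (if k' = k then 1 else 0))"

lemma lifts_exist: "v \<noteq> 0 \<Longrightarrow> \<exists>m. lifts v m"
proof -
  assume v: "v \<noteq> 0"
  have "\<forall>k\<in>{..<c}. \<exists>w. \<forall>k'<c. mv x (M v) w k' = (if k' = k then 1 else 0)"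
  proof
    fix k
    show "\<exists>w. \<forall>k'<c. mv x (M v) w k' = (if k' = k then 1 else 0)"
      using full_row_rank_surj[OF M_surj[OF v], of "\<lambda>k'. if k' = k then 1 else 0"] unfolding mv_def by blast
  qed
  from bchoice[OF this] obtain m where "\<forall>k\<in>{..<c}. \<forall>k'<c. mv x (M v) (m k) k' = (if k' = k then 1 else 0)" ..
  thus ?thesis by (intro exI[of _ m]) (simp add: lifts_def)
qed

lemma sum_split: "(\<Sum>q<x. g q) = (\<Sum>q<r. g q) + (\<Sum>k<c. g (r + k))" for g :: "nat \<Rightarrow> 'k"
proof -
  have "(\<Sum>q<r + b. g q) = (\<Sum>q<r. g q) + (\<Sum>k<b. g (r + k))" for b
    by (induction b) (simp_all add: add.assoc)
  thus ?thesis by (simp add: xr)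
qed

text \<open>Changing the lifts adds combinations of the first \<open>r\<close> rows to the other rows.\<close>

lemma det_rows_lifts:
  assumes bs: "is_basis (K (vec.span {v})) xs" "length xs = r" and m: "lifts v m" "lifts v m'"
  shows "Determinant.det (rows xs m') = Determinant.det (rows xs m)"
proof -
  have "\<forall>k\<in>{..<c}. \<exists>t. \<forall>l<x. m' k l = (\<Sum>q<r. t q * (xs ! q) l) + m k l"
  proof
    fix k assume k: "k \<in> {..<c}"
    define d where "d l = (if l < x then m' k l - m k l else 0)" for l
    have "mv x (M v) d k' = 0" if "k' < c" for k'
    proof -
      have "mv x (M v) d k' = mv x (M v) (\<lambda>l. m' k l - m k l) k'" by (rule mv_cong) (simp add: d_def)
      thus ?thesis using m k that by (simp add: mv_diff lifts_def)
    qed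
    hence "d \<in> K (vec.span {v})" by (simp add: K_span d_def)
    then obtain t where t: "d = (\<Sum>q<r. fscale (t q) (xs ! q))" using is_basis_sum[OF bs(1)] bs(2) by auto
    have "m' k l = (\<Sum>q<r. t q * (xs ! q) l) + m k l" if "l < x" for l
      using fun_cong[OF t, of l] that by (simp add: d_def sum_fun_apply fscale_apply algebra_simps)
    thus "\<exists>t. \<forall>l<x. m' k l = (\<Sum>q<r. t q * (xs ! q) l) + m k l" by blast
  qed
  from bchoice[OF this] obtain t where t: "\<forall>k\<in>{..<c}. \<forall>l<x. m' k l = (\<Sum>q<r. t k q * (xs ! q) l) + m k l" ..
  define T where "T = Matrix.mat x x (\<lambda>(q, q'). if q = q' then 1 else if r \<le> q \<and> q' < r then t (q - r) q' else 0)"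
  have T: "T \<in> carrier_mat x x" by (simp add: T_def)
  have "Determinant.det T = prod_list (diag_mat T)"
    by (rule det_lower_triangular[OF _ T]) (auto simp: T_def)
  also have "diag_mat T = map (\<lambda>_. 1) [0..<x]" unfolding diag_mat_def by (intro map_cong) (auto simp: T_def)
  also have "prod_list (map (\<lambda>_. 1) [0..<x]) = (1 :: 'k)" by (induction x) auto
  finally have det_T: "Determinant.det T = 1" .
  have "rows xs m' = T * rows xs m"
  proof (rule eq_matI)
    fix q l assume "q < dim_row (T * rows xs m)" "l < dim_col (T * rows xs m)"
    hence ql: "q < x" "l < x" by (auto simp: T_def rows_def)
    have "(T * rows xs m) $$ (q, l) = (\<Sum>q'<x. T $$ (q, q') * rows xs m $$ (q', l))"
      using ql T rows_carrier[of xs m] by (simp add: scalar_prod_def atLeast0LessThan)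
    also have "\<dots> = (\<Sum>q'<x. (if q = q' then 1 else if r \<le> q \<and> q' < r then t (q - r) q' else 0) * entry xs m q' l)"
      by (rule sum.cong) (use ql in \<open>auto simp: T_def rows_def\<close>)
    also have "\<dots> = entry xs m' q l"
    proof (cases "q < r")
      case True
      hence "(\<Sum>q'<x. (if q = q' then 1 else if r \<le> q \<and> q' < r then t (q - r) q' else 0) * entry xs m q' l) =
          (\<Sum>q'<x. if q' = q then entry xs m q l else 0)" by (intro sum.cong) auto
      thus ?thesis using ql True by (simp add: entry_def)
    next
      case False
      define k where "k = q - r"
      have k: "k < c" "q = r + k" using False ql xr by (auto simp: k_def)
      have "(\<Sum>q'<r. (if q = q' then 1 else if r \<le> q \<and> q' < r then t (q - r) q' else 0) * entry xs m q' l) =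
          (\<Sum>q'<r. t k q' * (xs ! q') l)"
        by (rule sum.cong) (use False in \<open>auto simp: entry_def k_def\<close>)
      moreover have "(\<Sum>k'<c. (if q = r + k' then 1 else if r \<le> q \<and> r + k' < r then t (q - r) (r + k') else 0) * entry xs m (r + k') l) =
          (\<Sum>k'<c. if k' = k then m k l else 0)"
        by (rule sum.cong) (use k in \<open>auto simp: entry_def\<close>)
      ultimately show ?thesis unfolding sum_split using t ql k by (simp add: entry_def)
    qed
    finally show "rows xs m' $$ (q, l) = (T * rows xs m) $$ (q, l)" using ql by (simp add: rows_def)
  qed (simp_all add: T_def rows_def)
  thus ?thesis using det_mult[OF T rows_carrier, of xs m] det_T by simp
qed

lemma det_rows_scale: "Determinant.det (rows xs (\<lambda>k l. b * m k l)) = b ^ c * Determinant.det (rows xs m)"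
proof -
  have "(\<Prod>q = 0..<x. entry xs (\<lambda>k l. b * m k l) q (p q)) = b ^ c * (\<Prod>q = 0..<x. entry xs m q (p q))" for p
  proof -
    have "(\<Prod>q = 0..<x. entry xs (\<lambda>k l. b * m k l) q (p q)) =
        (\<Prod>q = 0..<x. (if q < r then 1 else b) * entry xs m q (p q))"
      by (rule prod.cong) (auto simp: entry_def)
    also have "\<dots> = (\<Prod>q = 0..<x. if q < r then 1 else b) * (\<Prod>q = 0..<x. entry xs m q (p q))"
      by (rule prod.distrib)
    also have "(\<Prod>q = 0..<x. if q < r then 1 else b) = b ^ c"
    proof -
      have "(\<Prod>q = 0..<x. if q < r then 1 else b) = (\<Prod>q\<in>{r..<x}. b)"
        by (rule prod.mono_neutral_cong_right) auto
      thus ?thesis by (simp add: xr)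
    qed
    finally show ?thesis .
  qed
  thus ?thesis by (simp add: det_rows sum_distrib_left mult_ac)
qed

lemma lifts_scale: "lifts v m \<Longrightarrow> b \<noteq> 0 \<Longrightarrow> lifts (b *s v) (\<lambda>k l. (1 / b) * m k l)"
  unfolding lifts_def
proof (intro allI impI)
  fix k k' assume m: "\<forall>k<c. \<forall>k'<c. mv x (M v) (m k) k' = (if k' = k then 1 else 0)" and b: "b \<noteq> 0"
    and k: "k < c" "k' < c"
  have "mv x (M (b *s v)) (\<lambda>l. (1 / b) * m k l) k' = (1 / b) * (b * mv x (M v) (m k) k')"
    by (simp only: mv_scale mv_M_scale[OF k(2)])
  thus "mv x (M (b *s v)) (\<lambda>l. (1 / b) * m k l) k' = (if k' = k then 1 else 0)" using m b k by simp
qed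

text \<open>In a relation among the rows, applying M(v) kills the kernel vectors and isolates the
  coefficients of the lifts, which therefore vanish; the rest is a relation in a basis.\<close>

lemma det_rows_nonzero:
  assumes bs: "is_basis (K (vec.span {v})) xs" "length xs = r" and m: "lifts v m"
  shows "Determinant.det (rows xs m) \<noteq> 0"
proof
  assume "Determinant.det (rows xs m) = 0"
  hence "Determinant.det (transpose_mat (rows xs m)) = 0" using det_transpose[OF rows_carrier] by simp
  then obtain u where u: "u \<in> carrier_vec x" "u \<noteq> 0\<^sub>v x" "transpose_mat (rows xs m) *\<^sub>v u = 0\<^sub>v x"
    using det_0_iff_vec_prod_zero_field[of "transpose_mat (rows xs m)" x] rows_carrier[of xs m] by auto
  define a where "a q = vec_index u q" for q
  have rel: "(\<Sum>q<x. a q * entry xs m q l) = 0" if "l < x" for l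
  proof -
    have "vec_index (transpose_mat (rows xs m) *\<^sub>v u) l = (\<Sum>q<x. rows xs m $$ (q, l) * a q)"
      using that u(1) rows_carrier[of xs m] by (simp add: scalar_prod_def atLeast0LessThan a_def)
    also have "\<dots> = (\<Sum>q<x. a q * entry xs m q l)"
      by (rule sum.cong) (use that in \<open>auto simp: rows_def\<close>)
    finally show ?thesis using u(3) that by simp
  qed
  have mem: "xs ! q \<in> K (vec.span {v})" if "q < r" for q
    using bs that fvec.span_base[of "xs ! q" "set xs"] by (auto simp: is_basis_def)
  have ar: "a (r + k) = 0" if k: "k < c" for k
  proof -
    have "0 = mv x (M v) (\<lambda>l. \<Sum>q<x. a q * entry xs m q l) k"
      using rel by (simp add: mv_def)
    also have "\<dots> = (\<Sum>q<x. a q * mv x (M v) (entry xs m q) k)" by (rule mv_sum)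
    also have "\<dots> = (\<Sum>q<r. a q * mv x (M v) (xs ! q) k) + (\<Sum>k'<c. a (r + k') * mv x (M v) (m k') k)"
      unfolding sum_split by (simp add: entry_def[abs_def])
    also have "(\<Sum>q<r. a q * mv x (M v) (xs ! q) k) = 0" using mem k by (simp add: K_span)
    also have "(\<Sum>k'<c. a (r + k') * mv x (M v) (m k') k) = (\<Sum>k'<c. if k' = k then a (r + k) else 0)"
      by (rule sum.cong) (use m k in \<open>auto simp: lifts_def\<close>)
    finally show ?thesis using k by simp
  qed
  have "(\<Sum>q<r. fscale (a q) (xs ! q)) = 0"
  proof
    fix l
    show "(\<Sum>q<r. fscale (a q) (xs ! q)) l = 0 l"
    proof (cases "l < x")
      case True
      thus ?thesis using rel[OF True] ar unfolding sum_split by (simp add: entry_def sum_fun_apply fscale_apply)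
    next
      case False
      thus ?thesis using mem by (simp add: K_span sum_fun_apply fscale_apply)
    qed
  qed
  hence "a q = 0" if "q < r" for q using is_basis_independent[OF bs(1), of a q] bs(2) that by simp
  hence "a q = 0" if "q < x" for q using ar[of "q - r"] that xr by (cases "q < r") auto
  hence "u = 0\<^sub>v x" using u(1) by (intro eq_vecI) (auto simp: a_def)
  thus False using u(2) by simp
qed

lemma E_c1: "has_c1 E (- int c)"
proof -
  define rep where "rep p = (SOME v. v \<in> p - {0 :: 'k ^ 'n})" for p
  have rep: "rep p \<noteq> 0 \<and> vec.span {rep p} = p" if p: "p \<in> proj_space" for p
  proof -
    obtain v where "v \<noteq> 0" "p = vec.span {v}" using p by (rule proj_space_obtain)
    hence "v \<in> p - {0}" using self_in_span by auto
    hence "rep p \<in> p - {0}" unfolding rep_def by (rule someI)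
    thus ?thesis using span_eqI[OF p] by auto
  qed
  \<comment> \<open>Lifts chosen point by point without regard to regularity. By
    \<open>\<omega>_at\<close> the value does not depend on them, so regularity may be checked with
    better lifts.\<close>
  define lf where "lf p = (SOME m. lifts (rep p) m)" for p
  have lf: "lifts (rep p) (lf p)" if "p \<in> proj_space" for p
    unfolding lf_def by (rule someI_ex[OF lifts_exist]) (use rep[OF that] in blast)
  define \<omega> where "\<omega> p xs = fscale (Determinant.det (rows xs (lf p))) (unit_at (- int c) (rep p))" for p xs
  \<comment> \<open>Passing from \<open>rep p\<close> to \<open>b *s rep p\<close> scales the lifts
    by \<open>1 / b\<close> and the determinant by \<open>(1 / b) ^ c\<close>, exactly as the unit
    vector of O(-c) scales.\<close>
  have \<omega>_at: "\<omega> (vec.span {v}) xs v = Determinant.det (rows xs m)"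
    if v: "v \<noteq> 0" and bs: "is_basis (K (vec.span {v})) xs" "length xs = r" and m: "lifts v m" for v xs m
  proof -
    define p where "p = vec.span {v}"
    have p: "p \<in> proj_space" using span_in_proj_space[OF v] by (simp add: p_def)
    have "v \<in> vec.span {rep p} - {0}" using rep[OF p] v self_in_span[of v] by (simp add: p_def)
    then obtain b where b: "b \<noteq> 0" "rep p \<noteq> 0" "v = b *s rep p" by (rule nonzero_in_span_singletonE)
    have "lifts v (\<lambda>k l. (1 / b) * lf p k l)" unfolding b(3) by (rule lifts_scale[OF lf[OF p] b(1)])
    from det_rows_lifts[OF bs this m]
    have "Determinant.det (rows xs m) = (1 / b) ^ c * Determinant.det (rows xs (lf p))"
      by (simp only: det_rows_scale)
    moreover have "unit_at (- int c) (rep p) v = (1 / b) ^ c"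
      unfolding b(3) unit_at_scaled[OF b(2,1)] by (simp add: power_int_minus power_one_over inverse_eq_divide)
    ultimately show ?thesis by (simp add: \<omega>_def p_def[symmetric] fscale_apply)
  qed
  have alt: "alternating_on r (fibre E p) (\<omega> p)" for p
    unfolding \<omega>_def by (rule alternating_det)
  have frame: "regular_section (twist (- int c)) U (\<lambda>p. \<omega> p (map (\<lambda>s. s p) fs)) \<and>
      (\<forall>p\<in>U. \<omega> p (map (\<lambda>s. s p) fs) \<noteq> 0)" if fr: "(U, fs) \<in> frames E" for U fs
  proof -
    note UP = E_frame_open[OF fr]
    have len: "length fs = r" by (rule vector_bundleD(3)[OF E_bundle fr])
    have basis: "is_basis (K p) (map (\<lambda>s. s p) fs)" if "p \<in> U" for p
      using vector_bundleD(4)[OF E_bundle fr that] by (simp add: fibre_E)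
    have "\<omega> p (map (\<lambda>s. s p) fs) \<noteq> 0" if p: "p \<in> U" for p
    proof -
      obtain v where v: "v \<noteq> 0" "p = vec.span {v}" using p UP by (blast elim: proj_space_obtain)
      obtain m where m: "lifts v m" using lifts_exist[OF v(1)] by blast
      have bs: "is_basis (K (vec.span {v})) (map (\<lambda>s. s p) fs)" using basis[OF p] v(2) by simp
      have "\<omega> (vec.span {v}) (map (\<lambda>s. s p) fs) v \<noteq> 0"
        using \<omega>_at[OF v(1) bs _ m] det_rows_nonzero[OF bs _ m] len by simp
      thus ?thesis using v(2) by auto
    qed
    moreover have "regular_section (twist (- int c)) U (\<lambda>p. \<omega> p (map (\<lambda>s. s p) fs))"
    proof (rule twist_regular_section[OF UP])
      show "\<omega> p (map (\<lambda>s. s p) fs) \<in> fibre (twist (- int c)) p" if "p \<in> U" for p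
      proof -
        have "unit_at (- int c) (rep p) \<in> fibre (twist (- int c)) (vec.span {rep p})" by (rule unit_at_fibre)
        hence "unit_at (- int c) (rep p) \<in> fibre (twist (- int c)) p" using rep[of p] that UP by auto
        thus ?thesis unfolding \<omega>_def by (rule fvec.subspace_scale[OF fibre_twist_subspace])
      qed
      show "rational (cone U) (- int c) (\<lambda>v. \<omega> (vec.span {v}) (map (\<lambda>s. s (vec.span {v})) fs) v)"
        unfolding rational_def
      proof
        fix v0 assume v0: "v0 \<in> cone U"
        hence v0n: "v0 \<noteq> 0" by (simp add: cone_def)
        obtain j where j: "inj_on j {..<c}" "\<forall>i<c. j i < x" "pivot_det c (M v0) j \<noteq> 0"
          using pivots[OF v0n] by blast
        note hom = pivot_open[OF j(2)]
        define X where "X = cone U \<inter> {v. pivot_det c (M v) j \<noteq> 0}"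
        have v0X: "v0 \<in> X" using v0 j(3) by (simp add: X_def)
        have piv: "trivial_kernel c c (\<lambda>k i. M v k (j i))" if "v \<in> X" for v
          using that by (simp add: X_def pivot_det_trivial_kernel)
        have ex: "\<exists>w. (\<forall>k'<c. mv x (M v) w k' = (if k' = k then 1 else 0)) \<and> (\<forall>l. l \<notin> j ` {..<c} \<longrightarrow> w l = 0)"
          if "v \<in> X" for v k by (rule pivot_solve[OF j(1,2) piv[OF that]])
        \<comment> \<open>Lifts supported on the pivot columns solve a square system with
          coefficients of degree 1 and constant right side, so they are rational of degree -1 near
          \<open>v0\<close>.\<close>
        define m where "m v k = (SOME w. (\<forall>k'<c. mv x (M v) w k' = (if k' = k then 1 else 0)) \<and>
          (\<forall>l. l \<notin> j ` {..<c} \<longrightarrow> w l = 0))" for v k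
        have m: "(\<forall>k'<c. mv x (M v) (m v k) k' = (if k' = k then 1 else 0)) \<and> (\<forall>l. l \<notin> j ` {..<c} \<longrightarrow> m v k l = 0)"
          if "v \<in> X" for v k unfolding m_def by (rule someI_ex[OF ex[OF that]])
        have m_rat: "rat_at X v0 (- 1) (\<lambda>v. m v k l)" if k: "k < c" for k l
        proof (cases "l \<in> j ` {..<c}")
          case False
          show ?thesis by (rule rat_at_cong[OF rat_at_0[OF v0n]]) (use m False in auto)
        next
          case True
          then obtain i where i: "i < c" "l = j i" by auto
          have "rat_at X v0 (- 1) (\<lambda>v. m v k (j i))"
          proof (rule rat_at_solve[where x = c and r = c and \<beta> = 1 and B = "\<lambda>k i v. M v k (j i)"
                and W = "\<lambda>k' v. if k' = k then 1 else 0" and a = "\<lambda>i v. m v k (j i)"])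
            show "rat_at X v0 1 (\<lambda>v. M v k (j i))" if "k < c" "i < c" for k i
              using rat_at_homogeneous[OF M_hom, of k "j i" X v0] that j(2) by simp
            show "rat_at X v0 (- 1 + 1) (\<lambda>v. if k' = k then 1 else 0)" for k'
              by (cases "k' = k") (simp_all add: rat_at_const)
            show "(\<Sum>i<c. M u k' (j i) * m u k (j i)) = (if k' = k then 1 else 0)" if "u \<in> X" "k' < c" for u k'
              using m[OF that(1), of k] that(2) mv_support[OF j(1,2), of "m u k" "M u" k'] by auto
            show "trivial_kernel c c (\<lambda>k i. M v0 k (j i))" by (rule piv[OF v0X])
          qed (use v0X v0n i in auto)
          thus ?thesis by (simp add: i(2))
        qed
        have "rat_at X v0 (- int c) (\<lambda>v. Determinant.det (rows (map (\<lambda>s. s (vec.span {v})) fs) (m v)))"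
          unfolding det_rows
        proof (intro rat_at_sum[OF v0n] rat_at_scale)
          fix p assume p: "p \<in> {p. p permutes {0..<x}}"
          \<comment> \<open>Rows from the frame have degree 0, and each of the \<open>c\<close>
            lifts contributes degree -1.\<close>
          have "rat_at X v0 (\<Sum>q = 0..<x. if q < r then 0 else - 1)
             (\<lambda>v. \<Prod>q = 0..<x. entry (map (\<lambda>s. s (vec.span {v})) fs) (m v) q (p q))"
          proof (rule rat_at_prod)
            fix q assume q: "q \<in> {0..<x}"
            hence pq: "p q < x" using p permutes_in_image[of p "{0..<x}" q] by auto
            show "rat_at X v0 (if q < r then 0 else - 1) (\<lambda>v. entry (map (\<lambda>s. s (vec.span {v})) fs) (m v) q (p q))"
            proof (cases "q < r")
              case True
              have "regular_section E U (fs ! q)" using vector_bundleD(6)[OF E_bundle fr] True len by simp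
              from E_sectionD[OF this UP pq] have "rat_at (cone U) v0 0 (\<lambda>v. (fs ! q) (vec.span {v}) (p q))"
                using v0 by (simp add: rational_def)
              hence "rat_at X v0 0 (\<lambda>v. (fs ! q) (vec.span {v}) (p q))" by (rule rat_at_mono) (simp add: X_def)
              thus ?thesis using True len by (simp add: entry_def)
            next
              case False
              thus ?thesis using m_rat[of "q - r" "p q"] q xr by (simp add: entry_def)
            qed
          qed simp
          moreover have "(\<Sum>q = 0..<x. if q < r then 0 else - 1 :: int) = - int c"
          proof -
            have "(\<Sum>q = 0..<x. if q < r then 0 else - 1 :: int) = (\<Sum>q\<in>{r..<x}. - 1)"
              by (rule sum.mono_neutral_cong_right) auto
            thus ?thesis by (simp add: xr)
          qed
          ultimately show "rat_at X v0 (- int c) (\<lambda>v. \<Prod>q = 0..<x. entry (map (\<lambda>s. s (vec.span {v})) fs) (m v) q (p q))"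
            by simp
        qed
        hence "rat_at X v0 (- int c) (\<lambda>v. \<omega> (vec.span {v}) (map (\<lambda>s. s (vec.span {v})) fs) v)"
        proof (rule rat_at_cong)
          fix v assume v: "v \<in> X"
          hence "v \<noteq> 0" "vec.span {v} \<in> U" by (auto simp: X_def cone_def)
          moreover have "lifts v (m v)" using m[OF v] by (simp add: lifts_def)
          ultimately show "Determinant.det (rows (map (\<lambda>s. s (vec.span {v})) fs) (m v)) =
              \<omega> (vec.span {v}) (map (\<lambda>s. s (vec.span {v})) fs) v"
            using \<omega>_at[OF _ basis, of v] len by simp
        qed
        thus "rat_at (cone U) v0 (- int c) (\<lambda>v. \<omega> (vec.span {v}) (map (\<lambda>s. s (vec.span {v})) fs) v)"
          unfolding X_def by (rule rat_at_open[OF hom j(3)])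
      qed
    qed
    ultimately show ?thesis by blast
  qed
  show ?thesis unfolding has_c1_def
  proof (intro exI conjI ballI)
    show "vector_bundle r E" by (rule E_bundle)
    show "base E = proj_space" by (rule base_E)
    show "alternating_on r (fibre E p) (\<omega> p)" for p by (rule alt)
    fix Ufs assume "Ufs \<in> frames E"
    thus "case Ufs of (U, fs) \<Rightarrow> regular_section (twist (- int c)) U (\<lambda>p. \<omega> p (map (\<lambda>s. s p) fs)) \<and>
      (\<forall>p\<in>U. \<omega> p (map (\<lambda>s. s p) fs) \<noteq> 0)"
      using frame by (cases Ufs) simp
  qed
qed

end

section \<open>A Toeplitz example in every rank\<close>

text \<open>The columns are the linear forms in the coordinates of a triple \<open>(w\<^sub>1, w\<^sub>2, w\<^sub>3)\<close> of vectors of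
  length \<open>c\<close>, stored in the entries \<open>k\<close>, \<open>c + k\<close>, \<open>2c + k\<close>. The last entries of \<open>w\<^sub>3\<close> do not exist and are
  eliminated by \<open>w\<^sub>3(k) = - w\<^sub>1(k - 2) - w\<^sub>2(k - 1)\<close>: the annihilator consists of the Toeplitz
  matrices whose nonzero elements all have rank \<open>3\<close>.\<close>

definition toeplitz :: "nat \<Rightarrow> nat \<Rightarrow> 'k::field ^ 3 \<Rightarrow> nat \<Rightarrow> nat \<Rightarrow> 'k" where
  "toeplitz c x v k l = v $ 1 * (if l = k then 1 else 0) + v $ 2 * (if l = c + k then 1 else 0) +
     v $ 3 * (if 2 * c + k < x then (if l = 2 * c + k then 1 else 0)
              else - ((if l = k - 2 then 1 else 0) + (if l = c + k - 1 then 1 else 0)))"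

lemma toeplitz_homogeneous: "homogeneous 1 (\<lambda>v. toeplitz c x v k l)"
proof -
  have "homogeneous 1 (\<lambda>v :: 'a ^ 3. v $ 1 * a1 + v $ 2 * a2 + v $ 3 * a3)" for a1 a2 a3
    unfolding mult.commute[of "_ $ _"] by (intro homogeneous_add homogeneous_scale homogeneous_coord)
  thus ?thesis unfolding toeplitz_def .
qed

text \<open>The truncated subtractions in \<open>toeplitz\<close> do no harm: they occur only for
  \<open>x \<le> 2 * c + k\<close>, which by assumption means \<open>k \<ge> 2\<close>.\<close>

lemma left_toeplitz:
  assumes c: "2 * c + 2 \<le> x" and l: "l < x"
  shows "(\<Sum>k<c. f k * toeplitz c x v k l) =
    (if l < c then v $ 1 * f l - (if l + 2 < c \<and> x \<le> 2 * c + (l + 2) then v $ 3 * f (l + 2) else 0)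
     else if l < 2 * c then v $ 2 * f (l - c) -
       (if l - c + 1 < c \<and> x \<le> 2 * c + (l - c + 1) then v $ 3 * f (l - c + 1) else 0)
     else v $ 3 * (if l - 2 * c < c then f (l - 2 * c) else 0))"
proof -
  define d where "d P = (if P then 1 else (0::'a))" for P
  have sum1: "(\<Sum>k<c. f k * d (l = k)) = (if l < c then f l else 0)"
    by (simp add: d_def if_distrib[of "\<lambda>t. _ * t"] cong: if_cong)
  have sumat: "(\<Sum>k<c. f k * d (Q k)) = (if k0 < c then f k0 else 0)" if "\<And>k. k < c \<Longrightarrow> Q k \<longleftrightarrow> k = k0" for Q k0
  proof -
    have "(\<Sum>k<c. f k * d (Q k)) = (\<Sum>k<c. if k = k0 then f k0 else 0)"
      by (rule sum.cong) (use that in \<open>auto simp: d_def\<close>)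
    thus ?thesis by simp
  qed
  have sum0: "(\<Sum>k<c. f k * d (Q k)) = 0" if "\<And>k. k < c \<Longrightarrow> \<not> Q k" for Q
    using that by (simp add: d_def)
  have T: "toeplitz c x v k l = v $ 1 * d (l = k) + v $ 2 * d (l = c + k) + v $ 3 * d (2 * c + k < x \<and> l = 2 * c + k)
      - v $ 3 * d (x \<le> 2 * c + k \<and> l = k - 2) - v $ 3 * d (x \<le> 2 * c + k \<and> l = c + k - 1)" for k
    by (simp add: toeplitz_def d_def not_less[symmetric])
  have "(\<Sum>k<c. f k * toeplitz c x v k l) = v $ 1 * (\<Sum>k<c. f k * d (l = k)) + v $ 2 * (\<Sum>k<c. f k * d (l = c + k)) +
     v $ 3 * (\<Sum>k<c. f k * d (2 * c + k < x \<and> l = 2 * c + k)) - v $ 3 * (\<Sum>k<c. f k * d (x \<le> 2 * c + k \<and> l = k - 2)) -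
     v $ 3 * (\<Sum>k<c. f k * d (x \<le> 2 * c + k \<and> l = c + k - 1))"
    unfolding T by (simp add: algebra_simps sum.distrib sum_subtractf sum_distrib_left)
  also have "(\<Sum>k<c. f k * d (l = k)) = (if l < c then f l else 0)" by (rule sum1)
  also have "(\<Sum>k<c. f k * d (l = c + k)) = (if c \<le> l \<and> l < 2 * c then f (l - c) else 0)"
  proof (cases "c \<le> l")
    case True
    thus ?thesis by (subst sumat[of _ "l - c"]) auto
  qed (subst sum0, auto)
  also have "(\<Sum>k<c. f k * d (2 * c + k < x \<and> l = 2 * c + k)) = (if 2 * c \<le> l \<and> l - 2 * c < c then f (l - 2 * c) else 0)"
  proof (cases "2 * c \<le> l")
    case True
    thus ?thesis using l by (subst sumat[of _ "l - 2 * c"]) auto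
  qed (subst sum0, auto)
  also have "(\<Sum>k<c. f k * d (x \<le> 2 * c + k \<and> l = k - 2)) = (if l + 2 < c \<and> x \<le> 2 * c + (l + 2) then f (l + 2) else 0)"
  proof (cases "x \<le> 2 * c + (l + 2)")
    case True
    thus ?thesis using c by (subst sumat[of _ "l + 2"]) auto
  qed (subst sum0, auto)
  also have "(\<Sum>k<c. f k * d (x \<le> 2 * c + k \<and> l = c + k - 1)) =
      (if c \<le> l \<and> l - c + 1 < c \<and> x \<le> 2 * c + (l - c + 1) then f (l - c + 1) else 0)"
  proof (cases "c \<le> l \<and> x \<le> 2 * c + (l - c + 1)")
    case True
    thus ?thesis using c by (subst sumat[of _ "l - c + 1"]) auto
  qed (subst sum0, use c in auto)
  finally show ?thesis by (auto simp: algebra_simps)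
qed

text \<open>An annihilator of rank at most two is a Toeplitz matrix whose rows are shifts of one
  sequence \<zeta>, and the normal vector of the plane of \<open>u0\<close>, \<open>u1\<close> gives
  a recurrence of order at most two for \<zeta>. The bound \<open>2 * c + 2 \<le> x\<close> provides
  its two initial zeros, so \<zeta> = 0.\<close>

lemma toeplitz_line:
  fixes u0 u1 :: "'k::field ^ 3"
  assumes x: "2 * c + 2 \<le> x" "x \<le> 3 * c" and u: "indep2 u0 u1"
    and rel: "\<And>l. l < x \<Longrightarrow> (\<Sum>k<c. f0 k * toeplitz c x u0 k l + f1 k * toeplitz c x u1 k l) = 0"
    and k: "k < c"
  shows "f0 k = 0 \<and> f1 k = 0"
proof -
  define z where "z i k = u0 $ i * f0 k + u1 $ i * f1 k" for i k
  \<comment> \<open>Extension by zero beyond \<open>c\<close> makes the shift relations hold without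
    boundary cases.\<close>
  define \<zeta> where "\<zeta> k = (if k < c then z 3 k else 0)" for k
  have rel': "(\<Sum>k<c. f0 k * toeplitz c x u0 k l) + (\<Sum>k<c. f1 k * toeplitz c x u1 k l) = 0" if "l < x" for l
    using rel[OF that] by (simp add: sum.distrib)
  have \<zeta>0: "\<zeta> k = 0" if "2 * c + k < x" for k
  proof (cases "k < c")
    case True
    have s: "2 * c + k - 2 * c = k" by simp
    show ?thesis using rel'[OF that] that True unfolding left_toeplitz[OF x(1) that] s
      by (simp add: \<zeta>_def z_def algebra_simps)
  qed (simp add: \<zeta>_def)
  have z1: "z 1 k = \<zeta> (k + 2)" if k: "k < c" for k
  proof -
    have kx: "k < x" using k x(1) by simp
    show ?thesis
    proof (cases "k + 2 < c \<and> x \<le> 2 * c + (k + 2)")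
      case True
      thus ?thesis using rel'[OF kx] k unfolding left_toeplitz[OF x(1) kx] by (simp add: \<zeta>_def z_def algebra_simps)
    next
      case False
      hence "\<zeta> (k + 2) = 0" using \<zeta>0[of "k + 2"] by (auto simp: \<zeta>_def)
      moreover have "z 1 k = 0" using rel'[OF kx] k False unfolding left_toeplitz[OF x(1) kx] by (auto simp: z_def)
      ultimately show ?thesis by simp
    qed
  qed
  have z2: "z 2 k = \<zeta> (k + 1)" if k: "k < c" for k
  proof -
    have kx: "c + k < x" using k x(1) by simp
    show ?thesis
    proof (cases "k + 1 < c \<and> x \<le> 2 * c + (k + 1)")
      case True
      thus ?thesis using rel'[OF kx] k unfolding left_toeplitz[OF x(1) kx] by (simp add: \<zeta>_def z_def algebra_simps)
    next
      case False
      hence "\<zeta> (k + 1) = 0" using \<zeta>0[of "k + 1"] by (auto simp: \<zeta>_def)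
      moreover have "z 2 k = 0" using rel'[OF kx] k False unfolding left_toeplitz[OF x(1) kx] by (auto simp: z_def)
      ultimately show ?thesis by simp
    qed
  qed
  \<comment> \<open>The cross product of \<open>u0\<close> and \<open>u1\<close>, orthogonal to both
    and nonzero by independence.\<close>
  define n1 n2 n3 where "n1 = u0 $ 2 * u1 $ 3 - u0 $ 3 * u1 $ 2" and "n2 = u0 $ 3 * u1 $ 1 - u0 $ 1 * u1 $ 3"
    and "n3 = u0 $ 1 * u1 $ 2 - u0 $ 2 * u1 $ 1"
  have n: "n1 \<noteq> 0 \<or> n2 \<noteq> 0 \<or> n3 \<noteq> 0"
  proof (rule ccontr)
    assume "\<not> (n1 \<noteq> 0 \<or> n2 \<noteq> 0 \<or> n3 \<noteq> 0)"
    hence "\<forall>i j. u0 $ i * u1 $ j - u0 $ j * u1 $ i = 0"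
      by (auto simp: forall_3 n1_def n2_def n3_def mult.commute)
    thus False using indep2_minor[OF u] by blast
  qed
  have rec: "n1 * \<zeta> (k + 2) + n2 * \<zeta> (k + 1) + n3 * \<zeta> k = 0" for k
  proof (cases "k < c")
    case True
    have "n1 * z 1 k + n2 * z 2 k + n3 * z 3 k = 0"
      by (simp add: z_def n1_def n2_def n3_def algebra_simps)
    thus ?thesis using z1[OF True] z2[OF True] True by (simp add: \<zeta>_def)
  qed (simp add: \<zeta>_def)
  have start: "\<zeta> 0 = 0" "\<zeta> 1 = 0" using \<zeta>0[of 0] \<zeta>0[of 1] x(1) by auto
  have \<zeta>: "\<zeta> k = 0" for k
  proof -
    \<comment> \<open>According to its leading coefficient the recurrence has order two, one or
      zero.\<close>
    consider "n1 \<noteq> 0" | "n1 = 0" "n2 \<noteq> 0" | "n1 = 0" "n2 = 0" "n3 \<noteq> 0" using n by blast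
    thus ?thesis
    proof cases
      case 1
      have "\<zeta> k = 0 \<and> \<zeta> (k + 1) = 0"
      proof (induction k)
        case (Suc k)
        thus ?case using rec[of k] 1 by simp
      qed (use start in simp)
      thus ?thesis ..
    next
      case 2
      show ?thesis
      proof (induction k)
        case (Suc k)
        thus ?case using rec[of k] 2 by simp
      qed (use start in simp)
    next
      case 3
      thus ?thesis using rec[of k] by simp
    qed
  qed
  have "z i k = 0" for i
    using z1[OF k] z2[OF k] \<zeta> \<zeta>[of k, unfolded \<zeta>_def] k exhaust_3[of i] by auto
  hence "f0 k *s u0 + f1 k *s u1 = 0"
    by (simp add: Finite_Cartesian_Product.vec_eq_iff z_def mult.commute)
  thus ?thesis using u by (simp add: indep2_def)
qed

lemma indep2_partner:
  fixes v :: "'k::field ^ 3"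
  assumes "v \<noteq> 0"
  shows "\<exists>w. indep2 v w"
proof -
  obtain i where i: "v $ i \<noteq> 0" using nonzero_coord[OF assms] by blast
  obtain j :: 3 where j: "j \<noteq> i" by (metis one_neq_zero)
  have "indep2 v (axis j 1)" unfolding indep2_def
  proof (intro allI impI)
    fix a b assume ab: "a *s v + b *s axis j 1 = 0"
    have "a * v $ i = 0" using arg_cong[OF ab, of "\<lambda>v. v $ i"] j by (simp add: axis_def)
    hence a: "a = 0" using i by simp
    have "b = 0" using arg_cong[OF ab, of "\<lambda>v. v $ j"] a by (simp add: axis_def)
    thus "a = 0 \<and> b = 0" using a by simp
  qed
  thus ?thesis by blast
qed

lemma toeplitz_steiner_matrix:
  assumes x: "2 * c + 2 \<le> x" "x \<le> 3 * c" "x = r + c"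
  shows "steiner_matrix (toeplitz c x :: 'k::{alg_closed_field, field_char_0} ^ 3 \<Rightarrow> _) x c r"
proof
  show "homogeneous 1 (\<lambda>v :: 'k ^ 3. toeplitz c x v k l)" for k l by (rule toeplitz_homogeneous)
  show "toeplitz c x (u + v) k l = toeplitz c x u k l + toeplitz c x v k l" for u v :: "'k ^ 3" and k l
    by (simp add: toeplitz_def algebra_simps)
  show line: "f0 k = 0 \<and> f1 k = 0" if "indep2 u0 u1"
    "\<And>l. l < x \<Longrightarrow> (\<Sum>k<c. f0 k * toeplitz c x u0 k l + f1 k * toeplitz c x u1 k l) = 0" "k < c"
    for u0 u1 :: "'k ^ 3" and f0 f1 k
    by (rule toeplitz_line[OF x(1,2) that])
  show "trivial_kernel x c (\<lambda>l k. toeplitz c x v k l)" if v: "v \<noteq> 0" for v :: "'k ^ 3"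
  proof (rule trivial_kernelI)
    fix f k assume f: "\<And>l. l < x \<Longrightarrow> (\<Sum>k<c. toeplitz c x v k l * f k) = 0" and k: "k < c"
    obtain w where w: "indep2 v w" using indep2_partner[OF v] by blast
    \<comment> \<open>Surjectivity at \<open>v\<close> is the line condition with second functional
      0, on any line through \<open>v\<close>.\<close>
    have "f k = 0 \<and> (0 :: 'k) = 0"
      by (rule line[OF w _ k, of f "\<lambda>_. 0"]) (use f in \<open>simp add: mult.commute\<close>)
    thus "f k = 0" ..
  qed
  show "w l = 0" if w: "\<And>v k. v \<noteq> 0 \<Longrightarrow> k < c \<Longrightarrow> mv x (toeplitz c x (v :: 'k ^ 3)) w k = 0" and l: "l < x" for w l
  proof -
    \<comment> \<open>At the coordinate vectors of k^3 each column index below \<open>x\<close>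
      occurs in a row without other nonzero entries, so \<open>w\<close> vanishes entry by
      entry.\<close>
    have ax: "axis i (1 :: 'k) \<noteq> 0" for i :: 3 by (simp add: axis_eq_0_iff)
    have delta: "(\<Sum>l<x. (if l = q then 1 else 0) * w l) = w q" if "q < x" for q
      using that by (simp add: if_distrib[of "\<lambda>t. t * _"] cong: if_cong)
    have 1: "w k = 0" if k: "k < c" for k
    proof -
      have "toeplitz c x (axis 1 (1 :: 'k)) k l = (if l = k then 1 else 0)" for l
        by (simp add: toeplitz_def axis_def)
      thus ?thesis using w[OF ax[of 1] k] delta[of k] k x(1) by (simp add: mv_def)
    qed
    have 2: "w (c + k) = 0" if k: "k < c" for k
    proof -
      have "toeplitz c x (axis 2 (1 :: 'k)) k l = (if l = c + k then 1 else 0)" for l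
        by (simp add: toeplitz_def axis_def)
      thus ?thesis using w[OF ax[of 2] k] delta[of "c + k"] k x(1) by (simp add: mv_def)
    qed
    have 3: "w (2 * c + k) = 0" if k: "2 * c + k < x" for k
    proof -
      have kc: "k < c" using k x(2) by simp
      have "toeplitz c x (axis 3 (1 :: 'k)) k l = (if l = 2 * c + k then 1 else 0)" for l
        using k by (simp add: toeplitz_def axis_def)
      thus ?thesis using w[OF ax[of 3] kc] delta[OF k] by (simp add: mv_def)
    qed
    consider "l < c" | "c \<le> l" "l < 2 * c" | "2 * c \<le> l" by linarith
    thus ?thesis
    proof cases
      case 2 thus ?thesis using \<open>\<And>k. k < c \<Longrightarrow> w (c + k) = 0\<close>[of "l - c"] by simp
    next
      case 3 thus ?thesis using \<open>\<And>k. 2 * c + k < x \<Longrightarrow> w (2 * c + k) = 0\<close>[of "l - 2 * c"] l by simp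
    qed (use 1 in simp)
  qed
qed (rule x(3))

lemma uniform_steiner_bundle_exists:
  assumes "c + 2 \<le> r" "r \<le> 2 * c"
  shows "\<exists>E :: ('k::{alg_closed_field, field_char_0}, 3, nat) vbundle.
    vector_bundle r E \<and> type_uniform_steiner 1 E \<and> \<not> has_trivial_summand E \<and>
    steiner_sequence (r + c) c E \<and> has_c1 E (- int c)"
proof -
  interpret steiner_matrix "toeplitz c (r + c) :: 'k ^ 3 \<Rightarrow> _" "r + c" c r
    by (rule toeplitz_steiner_matrix) (use assms in auto)
  have "type_uniform_steiner 1 E" by (rule E_type) (use assms in simp)
  thus ?thesis using E_bundle E_no_trivial_summand E_steiner E_c1 by blast
qed

theorem theorem10:
  fixes c :: nat
  assumes "c \<ge> 2"
  shows
    "(\<forall>(E :: ('k::{alg_closed_field, field_char_0}, 3, 'i) vbundle) r.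
        vector_bundle r E \<and> type_uniform_steiner 1 E \<and> \<not> has_trivial_summand E \<and>
        steiner_sequence (r + c) c E
        \<longrightarrow> c + 2 \<le> r \<and> r \<le> 2 * c) \<and>
     (\<forall>r\<in>{c + 2, 2 * c}. \<exists>E :: ('k, 3, nat) vbundle.
        vector_bundle r E \<and> type_uniform_steiner 1 E \<and> \<not> has_trivial_summand E \<and>
        steiner_sequence (r + c) c E) \<and>
     (\<forall>r\<in>{c + 2..2 * c}. \<exists>E :: ('k, 3, nat) vbundle.
        vector_bundle r E \<and> type_uniform_steiner 1 E \<and> has_c1 E (- int c))"
proof (intro conjI allI impI ballI)
  fix E :: "('k, 3, 'i) vbundle" and r
  assume E: "vector_bundle r E \<and> type_uniform_steiner 1 E \<and> \<not> has_trivial_summand E \<and>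
        steiner_sequence (r + c) c E"
  show "c + 2 \<le> r" using steiner_rank_lower_bound[of c r E "r + c"] E assms by simp
  show "r \<le> 2 * c" using steiner_rank_upper_bound[of r E "r + c" c] E by simp
next
  fix r assume "r \<in> {c + 2, 2 * c}"
  hence "c + 2 \<le> r" "r \<le> 2 * c" using assms by auto
  thus "\<exists>E :: ('k, 3, nat) vbundle. vector_bundle r E \<and> type_uniform_steiner 1 E \<and> \<not> has_trivial_summand E \<and>
        steiner_sequence (r + c) c E"
    using uniform_steiner_bundle_exists by blast
next
  fix r assume "r \<in> {c + 2..2 * c}"
  thus "\<exists>E :: ('k, 3, nat) vbundle. vector_bundle r E \<and> type_uniform_steiner 1 E \<and> has_c1 E (- int c)"
    using uniform_steiner_bundle_exists[of c r] by auto
qed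

end
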